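(* Let $m,n\in\mathbb{Z}$. For every level $(m,n)$ Okamoto oscillator there is a ratio of two particular solutions which belongs to the family $F_3^n$. Conversely, if $n\in\mathbb{Z}$ and $f$ belongs to $F_3^n$, then $-\frac12\mathcal{S}(f)(x)$ is (the potential of) a level $(m,n)$ Okamoto oscillator for some $m\in\mathbb{Z}$.
   Context: Schwarzian derivative: $\mathcal{S}(f)=\frac{f'''}{f'}-\frac32\left(\frac{f''}{f'}\right)^2$. Let $\zeta=e^{\frac{2\pi i}{3}}$. For $a,b\in\mathbb{C}$, $\theta=(\theta_0,\theta_\infty)$, consider $\widetilde\psi''(x)=V_{10}(x;a,b,\theta)\widetilde\psi(x)$ with $$V_{10}(x)=x^{10}+2\sqrt3ax^7+3\left(a^2+2(1-\theta_\infty)\right)x^4-3\sqrt3\left[b+\left(2\theta_\infty-\tfrac12\right)a\right]x+\left(2+9\left(\theta_0^2-\tfrac14\right)\right)x^{-2}.$$ (It arises from $\psi''(\lambda)=V(\lambda;a,b,\theta)\psi(\lambda)$, $V=\lambda^2+2a\lambda+a^2+2(1-\theta_\infty)-[b+(2\theta_\infty-\frac12)a]\lambda^{-1}+(\theta_0^2-\frac14)\lambda^{-2}$, via $\widetilde\psi(x)=x^{-1}\psi(\frac{1}{3}\sqrt3x^3)$.) Stokes sectors $\Omega_k^{10}=\{|\arg x-\frac{k\pi}{6}|<\frac{\pi}{12}\}$. Stokes multipliers: with $G(x)=\frac16x^6+\frac{a}{\sqrt3}x^3$, let $\widetilde\psi_k$, $k\in\mathbb{Z}$, be the solution on the universal cover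 of $\mathbb{C}^*$ subdominant in the sector $|\arg x-\frac{k\pi}6|<\frac\pi{12}$, normalised by $\widetilde\psi_k\sim c_{\mathrm{odd}}\,x^{\frac12-3\theta_\infty}e^{G(x)}$ for $k$ odd and $\widetilde\psi_k\sim c_{\mathrm{even}}\,x^{3\theta_\infty-\frac{11}{2}}e^{-G(x)}$ for $k$ even, with nonzero constants $c_{\mathrm{odd}},c_{\mathrm{even}}$ independent of $k$; then $\widetilde\psi_{k+1}=\widetilde\psi_{k-1}+s_k\widetilde\psi_k$ defines $s_k$. For $\theta_\infty\in\frac12\mathbb{Z}$ one has $s_{k+12}=s_k$, and the products $s_ks_{k+1}$ do not depend on $c_{\mathrm{odd}},c_{\mathrm{even}}$. For $m,n\in\mathbb{Z}$, the oscillator (or its potential $V_{10}$) with $\theta_0=\frac12n-\frac16$ and $\theta_\infty=\frac12(2m+n+1)$ is called a level $(m,n)$ Okamoto oscillator if $1+s_ks_{k+1}=0$ for all $k\in\mathbb{Z}_{12}$. Family $F_3^n$, $n\in\mathbb{Z}$: meromorphic functions $f:\mathbb{C}\to\mathbb{P}^1$ having 13 singularities, namely 12 transcendental singularities (asymptotic values) and 1 critical point, such that - $-\frac12\mathcal{S}(f)(x)=x^{10}+\mathcal{O}(x^9)$ as $x\to\infty$; - the critical point lies at $x=0$, has multiplicity $|3n-1|-1$ (i.e. $f$ has local degree $|3n-1|$ at $0$; for $n=0$ this means that $f$ has no genuine critical point), and $f(0)=0$ if $n\ge1$, $f(0)=\infty$ otherwise; - the asymptotic values $w_k$ of $f$ in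 the sectors $\Omega_k^{10}$, $k=0,\dots,11$, are $w_k=1,\zeta^{-1},\zeta$ for $k\equiv0,1,2\pmod3$ respectively; - $f(\zeta x)=\zeta^{-1}f(x)$. *)

theory Defs
  imports "HOL-Complex_Analysis.Complex_Analysis" "HOL-Library.Landau_Symbols"
begin

definition zeta3 :: complex where
  "zeta3 = exp (2 * of_real pi * \<i> / 3)"

text \<open>
  Functions on the universal cover of the punctured plane are written in the logarithmic
  coordinate \<open>t\<close>, where \<open>x = exp t\<close>: the modulus of \<open>x\<close> is \<open>exp (Re t)\<close>, its
  argument is \<open>Im t\<close>, and a power of \<open>x\<close> with exponent \<open>p\<close> is \<open>exp (p * t)\<close>.
\<close>

definition cover_deriv :: "(complex \<Rightarrow> complex) \<Rightarrow> complex \<Rightarrow> complex" where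
  "cover_deriv \<phi> t = deriv \<phi> t / exp t"  \<comment> \<open>\<open>d/dx\<close>\<close>

definition oscillator_solution :: "(complex \<Rightarrow> complex) \<Rightarrow> (complex \<Rightarrow> complex) \<Rightarrow> bool" where
  "oscillator_solution V \<phi> \<longleftrightarrow>
     \<phi> holomorphic_on UNIV \<and> (\<forall>t. cover_deriv (cover_deriv \<phi>) t = V (exp t) * \<phi> t)"

text \<open>
  \<open>x\<close> tends to infinity with \<open>\<bar>arg x - k * pi / 6\<bar> \<le> \<delta>\<close>. Asymptotics in an open Stokes sector
  are understood, as usual, to be uniform on each closed subsector, i.e. to hold
  for every \<open>\<delta> < pi / 12\<close>.
\<close>

definition sector_at_infinity :: "int \<Rightarrow> real \<Rightarrow> complex filter" where
  "sector_at_infinity k \<delta> =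
     inf (filtercomap Re at_top) (principal {t. \<bar>Im t - of_int k * pi / 6\<bar> \<le> \<delta>})"

definition V10 :: "complex \<Rightarrow> complex \<Rightarrow> complex \<Rightarrow> complex \<Rightarrow> complex \<Rightarrow> complex" where
  "V10 a b \<theta>0 \<theta>inf x =
     x ^ 10 + 2 * of_real (sqrt 3) * a * x ^ 7 + 3 * (a\<^sup>2 + 2 * (1 - \<theta>inf)) * x ^ 4
     - 3 * of_real (sqrt 3) * (b + (2 * \<theta>inf - 1 / 2) * a) * x
     + (2 + 9 * (\<theta>0\<^sup>2 - 1 / 4)) / x\<^sup>2"

definition stokes_G :: "complex \<Rightarrow> complex \<Rightarrow> complex" where
  "stokes_G a x = x ^ 6 / 6 + a / of_real (sqrt 3) * x ^ 3"

definition normalised_subdominant ::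
  "complex \<Rightarrow> complex \<Rightarrow> complex \<Rightarrow> complex \<Rightarrow> complex \<Rightarrow> complex \<Rightarrow> int \<Rightarrow> (complex \<Rightarrow> complex) \<Rightarrow> bool"
where
  "normalised_subdominant a b \<theta>0 \<theta>inf codd ceven k \<phi> \<longleftrightarrow>
     oscillator_solution (V10 a b \<theta>0 \<theta>inf) \<phi> \<and>
     (\<forall>\<delta>\<in>{0<..<pi / 12}. \<phi> \<sim>[sector_at_infinity k \<delta>]
        (\<lambda>t. if odd k then codd * exp ((1 / 2 - 3 * \<theta>inf) * t) * exp (stokes_G a (exp t))
             else ceven * exp ((3 * \<theta>inf - 11 / 2) * t) * exp (- stokes_G a (exp t))))"

text \<open>
  For given nonzero \<open>codd\<close> and \<open>ceven\<close> the normalised subdominant solutions exist and are unique, so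
  exactly one sequence \<open>s\<close> satisfies this predicate.
\<close>

definition stokes_multipliers ::
  "complex \<Rightarrow> complex \<Rightarrow> complex \<Rightarrow> complex \<Rightarrow> complex \<Rightarrow> complex \<Rightarrow> (int \<Rightarrow> complex) \<Rightarrow> bool"
where
  "stokes_multipliers a b \<theta>0 \<theta>inf codd ceven s \<longleftrightarrow>
     (\<exists>\<psi>. (\<forall>k. normalised_subdominant a b \<theta>0 \<theta>inf codd ceven k (\<psi> k)) \<and>
          (\<forall>k t. \<psi> (k + 1) t = \<psi> (k - 1) t + s k * \<psi> k t))"

definition okamoto_theta0 :: "int \<Rightarrow> complex" where
  "okamoto_theta0 n = of_int n / 2 - 1 / 6"

definition okamoto_theta_inf :: "int \<Rightarrow> int \<Rightarrow> complex" where
  "okamoto_theta_inf m n = of_int (2 * m + n + 1) / 2"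

abbreviation okamoto_potential :: "int \<Rightarrow> int \<Rightarrow> complex \<Rightarrow> complex \<Rightarrow> complex \<Rightarrow> complex" where
  "okamoto_potential m n a b \<equiv> V10 a b (okamoto_theta0 n) (okamoto_theta_inf m n)"

text \<open>
  The products \<open>s k * s (k + 1)\<close> do not depend on the choice of \<open>codd\<close> and \<open>ceven\<close>.
  Since \<open>okamoto_theta_inf m n\<close> is a half-integer, \<open>s\<close> has period 12, so \<open>k\<close> ranging over all
  integers is the same as \<open>k\<close> ranging over the residues modulo 12.
\<close>

definition okamoto_oscillator :: "int \<Rightarrow> int \<Rightarrow> complex \<Rightarrow> complex \<Rightarrow> bool" where
  "okamoto_oscillator m n a b \<longleftrightarrow>
     (\<exists>codd ceven s. codd \<noteq> 0 \<and> ceven \<noteq> 0 \<and>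
        stokes_multipliers a b (okamoto_theta0 n) (okamoto_theta_inf m n) codd ceven s \<and>
        (\<forall>k. 1 + s k * s (k + 1) = 0))"

text \<open>
  The Schwarzian derivative as a meromorphic function: \<open>remove_sings\<close> supplies the value at the simple
  poles of \<open>f\<close>, where the formula is meaningless but its singularity is removable.
\<close>

definition schwarzian :: "(complex \<Rightarrow> complex) \<Rightarrow> complex \<Rightarrow> complex" where
  "schwarzian f = remove_sings
     (\<lambda>x. (deriv ^^ 3) f x / deriv f x - 3 / 2 * ((deriv ^^ 2) f x / deriv f x)\<^sup>2)"

text \<open>
  A meromorphic function from the plane to the Riemann sphere is a function \<open>f\<close> with
  \<open>f nicely_meromorphic_on UNIV\<close>; its poles are the points where it takes the value infinity
  (and the conventional value of \<open>f\<close> there is \<open>0\<close>). Points of the sphere are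
  written \<open>Some w\<close>, and \<open>None\<close> is infinity.
\<close>

definition sphere_value :: "(complex \<Rightarrow> complex) \<Rightarrow> complex \<Rightarrow> complex option" where
  "sphere_value f z = (if is_pole f z then None else Some (f z))"

fun sphere_disc :: "complex option \<Rightarrow> real \<Rightarrow> complex option set" where
  "sphere_disc (Some w) r = Some ` ball w r"
| "sphere_disc None r = - (Some ` cball 0 (1 / r))"

definition local_degree :: "(complex \<Rightarrow> complex) \<Rightarrow> complex \<Rightarrow> nat" where
  "local_degree f z =
     (if is_pole f z then nat (- zorder f z) else nat (zorder (\<lambda>x. f x - f z) z))"

text \<open>
  Iversen's definition of the transcendental singularities of the inverse of \<open>f\<close>: a
  singularity over \<open>w\<close> is a nested choice, for each radius \<open>r\<close>, of a component of the preimage of the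
  disc of radius \<open>r\<close> about \<open>w\<close>, such that the intersection of these components is empty.
  Any fundamental system of discs on the sphere yields the same singularities.
\<close>

definition transcendental_singularities ::
  "(complex \<Rightarrow> complex) \<Rightarrow> (complex option \<times> (real \<Rightarrow> complex set)) set"
where
  "transcendental_singularities f =
     {(w, U). U \<in> (\<Pi>\<^sub>E r\<in>{0<..}. components {z. sphere_value f z \<in> sphere_disc w r}) \<and>
              (\<forall>r s. 0 < r \<longrightarrow> r \<le> s \<longrightarrow> U r \<subseteq> U s) \<and>
              (\<Inter>r\<in>{0<..}. U r) = {}}"

definition asymptotic_value_in_sector :: "(complex \<Rightarrow> complex) \<Rightarrow> int \<Rightarrow> complex \<Rightarrow> bool" where
  "asymptotic_value_in_sector f k w \<longleftrightarrow>
     (\<forall>\<delta>\<in>{0<..<pi / 12}. ((\<lambda>t. f (exp t)) \<longlongrightarrow> w) (sector_at_infinity k \<delta>))"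

text \<open>
  For \<open>n = 0\<close> the local degree at \<open>0\<close> is \<open>1\<close>, so that \<open>f\<close> has no critical point at all.
\<close>

definition family_F3 :: "int \<Rightarrow> (complex \<Rightarrow> complex) set" where
  "family_F3 n = {f. f nicely_meromorphic_on UNIV \<and>
     finite (transcendental_singularities f) \<and> card (transcendental_singularities f) = 12 \<and>
     (\<forall>z. z \<noteq> 0 \<longrightarrow> local_degree f z = 1) \<and>
     (\<lambda>x. - (1 / 2) * schwarzian f x - x ^ 10) \<in> O[at_infinity](\<lambda>x. x ^ 9) \<and>
     local_degree f 0 = nat \<bar>3 * n - 1\<bar> \<and>
     sphere_value f 0 = (if n \<ge> 1 then Some 0 else None) \<and>
     (\<forall>k\<in>{0..11}. asymptotic_value_in_sector f k
        (if k mod 3 = 0 then 1 else if k mod 3 = 1 then inverse zeta3 else zeta3)) \<and>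
     (\<forall>x. f (zeta3 * x) = inverse zeta3 * f x)}"

text \<open>
  The quotient of two solutions need not be known to be single-valued a priori, hence the
  comparison on the universal cover. It covers the poles of \<open>f\<close> as well: there \<open>f\<close> and
  division by zero both have the value \<open>0\<close>.
\<close>

definition solution_ratio :: "(complex \<Rightarrow> complex) \<Rightarrow> (complex \<Rightarrow> complex) \<Rightarrow> bool" where
  "solution_ratio V f \<longleftrightarrow>
     (\<exists>\<phi>1 \<phi>2. oscillator_solution V \<phi>1 \<and> oscillator_solution V \<phi>2 \<and>
        (\<forall>t. f (exp t) = \<phi>1 t / \<phi>2 t))"

end

theory Submission
  imports Defs
begin

text \<open>
  The functions of the family are the quotients of two solutions of the equation, and their behaviour at
  infinity is read off from the subdominant solutions \<open>\<psi> k\<close> of the Stokes sectors, whose existence and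
  asymptotics are established in \<open>wkb_solution\<close> by integration from points tending to infinity.

  \<^emph>\<open>Asymptotic values.\<close> A quotient \<open>y1 / y2\<close> of independent solutions tends, in the sector with index \<open>k\<close>, to
  the value \<open>w k\<close> for which \<open>y1 - w k * y2\<close> is a multiple of \<open>\<psi> k\<close>, because every other solution is exponentially
  larger than \<open>\<psi> k\<close> (\<open>quotient_tendsto_in_sector\<close>). So the asymptotic values amount to the lines spanned by
  the \<open>\<psi> k\<close>. Elimination of \<open>\<psi> (k + 1)\<close> from two consecutive Stokes relations shows that \<open>1 + s k * s (k + 1) = 0\<close> says
  that \<open>\<psi> (k + 2)\<close> is proportional to \<open>\<psi> (k - 1)\<close> (\<open>stokes_condition_iff\<close>): the sequence \<open>w\<close> has period three.

  \<^emph>\<open>From an oscillator to the family.\<close> The exponents at the origin are \<open>3 n / 2\<close> and \<open>1 - 3 n / 2\<close>, and since the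
  equation is invariant under the rotation by \<open>zeta3\<close>, the Frobenius series proceed in powers of \<open>x\<^sup>3\<close>, which excludes
  logarithms (\<open>okamoto_frobenius_basis\<close>). The quotient \<open>f\<close> of the two Frobenius solutions is \<open>x\<close> to the power
  \<open>3 n - 1\<close> times a function of \<open>x\<^sup>3\<close>; this gives single-valuedness, the symmetry of \<open>f\<close>, and the local degree at the origin.
  The rotation moves the sector with index \<open>k\<close> to the one with index \<open>k + 4\<close>, which because of the period three has the
  asymptotic value \<open>w (k + 1)\<close>; hence \<open>w\<close> is a geometric progression with ratio \<open>1 / zeta3\<close>, and a
  constant factor makes \<open>w 0 = 1\<close>. The Schwarzian derivative of \<open>f\<close> is \<open>- 2\<close> times the potential.

  It remains to see that \<open>f\<close> has exactly twelve transcendental singularities. Each Stokes sector contributes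
  one (\<open>tract_singularity\<close>). Conversely, a singularity whose components avoid the sectors would lie in a
  thin wedge around one of the rays between them. There the quotient of the two neighbouring subdominant
  solutions is the exponential of a nearly linear function of \<open>x\<^sup>6\<close> (\<open>log_quotient_nearly_linear\<close>), so that
  the components can be described explicitly enough to rule this out (\<open>singularity_not_in_boundary_wedge\<close>).

  \<^emph>\<open>From the family to an oscillator.\<close> Away from the origin \<open>f\<close> is locally injective, so its Schwarzian derivative is
  finite there; at the origin it has at most a double pole, determined by the local degree. By the growth
  condition and Liouville's theorem it is a polynomial up to this pole, and the symmetry of \<open>f\<close> leaves the powers
  that occur in \<open>V10\<close> (\<open>F3_schwarzian\<close>). The local solutions \<open>f' powr (- 1 / 2)\<close> and \<open>f * f' powr (- 1 / 2)\<close> extend to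
  the whole cover and represent \<open>f\<close> as a quotient (\<open>F3_quotient_representation\<close>). The prescribed asymptotic
  values have period three, which is the condition on the Stokes multipliers. Under this condition the monodromy
  of \<open>\<psi> 2\<close> is multiplication by \<open>- exp (- 2 pi \<i> \<theta>)\<close> (\<open>subdominant_monodromy\<close>), while the exponents at
  the origin multiply every solution by \<open>(- 1) ^ n\<close> in a full turn; comparison shows that \<open>\<theta>\<close> is one of the values
  \<open>okamoto_theta_inf m n\<close>.
\<close>

section \<open>Solutions on the universal cover\<close>

lemma cover_deriv_holomorphic [simp]:
  "\<phi> holomorphic_on UNIV \<Longrightarrow> cover_deriv \<phi> holomorphic_on UNIV"
  unfolding cover_deriv_def[abs_def] by (auto intro!: holomorphic_intros)

lemma has_field_derivative_cover:
  assumes "\<phi> holomorphic_on UNIV"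
  shows "(\<phi> has_field_derivative exp t * cover_deriv \<phi> t) (at t)"
  using holomorphic_derivI[OF assms open_UNIV UNIV_I] by (simp add: cover_deriv_def)

lemma cover_derivI:
  assumes "(\<phi> has_field_derivative exp t * d) (at t)"
  shows "cover_deriv \<phi> t = d"
  using DERIV_imp_deriv[OF assms] by (simp add: cover_deriv_def)

lemma solution_holomorphic: "oscillator_solution V \<phi> \<Longrightarrow> \<phi> holomorphic_on UNIV"
  by (simp add: oscillator_solution_def)

lemma solution_DERIV:
  "oscillator_solution V \<phi> \<Longrightarrow> (\<phi> has_field_derivative exp t * cover_deriv \<phi> t) (at t)"
  by (simp add: has_field_derivative_cover solution_holomorphic)

lemma solution_DERIV2:
  assumes "oscillator_solution V \<phi>"
  shows "(cover_deriv \<phi> has_field_derivative exp t * (V (exp t) * \<phi> t)) (at t)"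
  using has_field_derivative_cover[of "cover_deriv \<phi>" t] assms
  by (simp add: oscillator_solution_def)

lemma solutionI:
  assumes "\<And>t. (\<phi> has_field_derivative exp t * \<phi>' t) (at t)"
    and "\<And>t. (\<phi>' has_field_derivative exp t * (V (exp t) * \<phi> t)) (at t)"
  shows "oscillator_solution V \<phi>" "cover_deriv \<phi> = \<phi>'"
proof -
  show *: "cover_deriv \<phi> = \<phi>'"
    using assms(1) cover_derivI by blast
  have "\<phi> holomorphic_on UNIV"
    using assms(1) holomorphic_on_open open_UNIV by blast
  then show "oscillator_solution V \<phi>"
    using cover_derivI[OF assms(2)] by (simp add: oscillator_solution_def *)
qed

lemma solution_lincomb:
  assumes "oscillator_solution V \<phi>" "oscillator_solution V \<eta>"
  shows "oscillator_solution V (\<lambda>t. c * \<phi> t + d * \<eta> t)"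
    and "cover_deriv (\<lambda>t. c * \<phi> t + d * \<eta> t) = (\<lambda>t. c * cover_deriv \<phi> t + d * cover_deriv \<eta> t)"
  by (rule solutionI[where \<phi>' = "\<lambda>t. c * cover_deriv \<phi> t + d * cover_deriv \<eta> t"];
      auto intro!: derivative_eq_intros solution_DERIV[OF assms(1)] solution_DERIV[OF assms(2)]
        solution_DERIV2[OF assms(1)] solution_DERIV2[OF assms(2)] simp: algebra_simps)+

lemma solution_cmult:
  assumes "oscillator_solution V \<phi>"
  shows "oscillator_solution V (\<lambda>t. c * \<phi> t)"
    and "cover_deriv (\<lambda>t. c * \<phi> t) = (\<lambda>t. c * cover_deriv \<phi> t)"
  using solution_lincomb[OF assms assms, of c 0] by simp_all

definition wronskian :: "(complex \<Rightarrow> complex) \<Rightarrow> (complex \<Rightarrow> complex) \<Rightarrow> complex \<Rightarrow> complex" where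
  "wronskian \<phi> \<eta> t = \<phi> t * cover_deriv \<eta> t - cover_deriv \<phi> t * \<eta> t"

lemma wronskian_const:
  assumes "oscillator_solution V \<phi>" "oscillator_solution V \<eta>"
  shows "wronskian \<phi> \<eta> t = wronskian \<phi> \<eta> 0"
proof -
  have "(wronskian \<phi> \<eta> has_field_derivative 0) (at t)" for t
    unfolding wronskian_def[abs_def]
    by (auto intro!: derivative_eq_intros solution_DERIV[OF assms(1)] solution_DERIV[OF assms(2)]
        solution_DERIV2[OF assms(1)] solution_DERIV2[OF assms(2)] simp: algebra_simps)
  then obtain c where "\<And>t. wronskian \<phi> \<eta> t = c"
    using has_field_derivative_zero_constant[of UNIV "wronskian \<phi> \<eta>"] by auto
  then show ?thesis by simp
qed

lemma wronskian_lincomb_left: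
  assumes "oscillator_solution V \<phi>" "oscillator_solution V \<eta>"
  shows "wronskian (\<lambda>t. c * \<phi> t + d * \<eta> t) \<psi> t = c * wronskian \<phi> \<psi> t + d * wronskian \<eta> \<psi> t"
  by (simp add: wronskian_def solution_lincomb[OF assms] algebra_simps)

lemma wronskian_swap: "wronskian \<eta> \<phi> t = - wronskian \<phi> \<eta> t"
  by (simp add: wronskian_def)

text \<open>
  The Wronskian pairing with a basis gives the coordinates of a solution: this is Cramer's rule at
  every point of the cover.
\<close>

lemma solution_coordinates:
  assumes sol: "oscillator_solution V \<phi>" "oscillator_solution V \<eta>" "oscillator_solution V u"
    and w: "wronskian \<phi> \<eta> 0 \<noteq> 0"
  shows "u t = (wronskian u \<eta> 0 / wronskian \<phi> \<eta> 0) * \<phi> t - (wronskian u \<phi> 0 / wronskian \<phi> \<eta> 0) * \<eta> t"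
proof -
  have "wronskian u \<eta> t * \<phi> t - wronskian u \<phi> t * \<eta> t = wronskian \<phi> \<eta> t * u t"
    by (simp add: wronskian_def algebra_simps)
  then have "wronskian u \<eta> 0 * \<phi> t - wronskian u \<phi> 0 * \<eta> t = wronskian \<phi> \<eta> 0 * u t"
    using wronskian_const[OF sol(3,2)] wronskian_const[OF sol(3,1)] wronskian_const[OF sol(1,2)]
    by metis
  then show ?thesis using w by (simp add: field_simps)
qed

lemma solution_dependent:
  assumes sol: "oscillator_solution V \<phi>" "oscillator_solution V \<eta>" "oscillator_solution V u"
    and w: "wronskian \<phi> \<eta> 0 \<noteq> 0" and u: "wronskian u \<phi> 0 = 0"
  shows "\<exists>c. \<forall>t. u t = c * \<phi> t"
  using solution_coordinates[OF sol w] u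
  by (intro exI[of _ "wronskian u \<eta> 0 / wronskian \<phi> \<eta> 0"]) simp

lemma wronskian_cmult [simp]:
  assumes "oscillator_solution V \<phi>"
  shows "wronskian (\<lambda>t. c * \<phi> t) \<psi> t = c * wronskian \<phi> \<psi> t"
        "wronskian \<psi> (\<lambda>t. c * \<phi> t) t = c * wronskian \<psi> \<phi> t"
  by (simp_all add: wronskian_def solution_cmult[OF assms] algebra_simps)

lemma wronskian_self [simp]: "wronskian \<phi> \<phi> t = 0"
  by (simp add: wronskian_def)

text \<open>
  The space of solutions is two-dimensional as soon as it contains two independent solutions, so
  some solution has any prescribed value and slope.
\<close>

lemma solution_initial_value:
  assumes sol: "oscillator_solution V \<phi>" "oscillator_solution V \<eta>"
    and w: "wronskian \<phi> \<eta> 0 \<noteq> 0"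
  shows "\<exists>u. oscillator_solution V u \<and> u t0 = v \<and> cover_deriv u t0 = v'"
proof -
  define D where "D = wronskian \<phi> \<eta> t0"
  have D: "D \<noteq> 0" using w wronskian_const[OF sol, of t0] by (simp add: D_def)
  define c d where "c = (v * cover_deriv \<eta> t0 - v' * \<eta> t0) / D"
    and "d = (v' * \<phi> t0 - v * cover_deriv \<phi> t0) / D"
  have "c * \<phi> t0 + d * \<eta> t0 = v"
    using D unfolding c_def d_def
    by (simp add: divide_simps) (simp add: D_def wronskian_def algebra_simps)
  moreover have "c * cover_deriv \<phi> t0 + d * cover_deriv \<eta> t0 = v'"
    using D unfolding c_def d_def
    by (simp add: divide_simps) (simp add: D_def wronskian_def algebra_simps)
  ultimately show ?thesis
    using solution_lincomb[OF sol, of c d] D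
    by (intro exI[of _ "\<lambda>t. c * \<phi> t + d * \<eta> t"]) simp
qed

section \<open>Solutions at the regular singular point\<close>

text \<open>
  Coefficients of the Frobenius series in powers of \<open>x\<^sup>3\<close>, with \<open>q i\<close> the indicial factor at step \<open>i\<close>. Only
  every third power of \<open>x\<close> occurs, because the potential has the corresponding symmetry.
\<close>

fun frobenius_coeff ::
  "complex \<Rightarrow> complex \<Rightarrow> complex \<Rightarrow> (nat \<Rightarrow> complex) \<Rightarrow> nat \<Rightarrow> complex" where
  "frobenius_coeff v1 v2 v3 q i = (if i = 0 then 1 else
     (v1 * frobenius_coeff v1 v2 v3 q (i - 1)
      + (if i < 2 then 0 else v2 * frobenius_coeff v1 v2 v3 q (i - 2))
      + (if i < 3 then 0 else v3 * frobenius_coeff v1 v2 v3 q (i - 3))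
      + (if i < 4 then 0 else frobenius_coeff v1 v2 v3 q (i - 4))) / q i)"

declare frobenius_coeff.simps [simp del]

text \<open>
  Once \<open>\<bar>q i\<bar>\<close> is at least the sum of the four weights of the recursion, the weighted coefficient is at most
  the maximum of its four predecessors. Since this happens for every \<open>B\<close>, the series is entire.
\<close>

lemma frobenius_coeff_bounded:
  assumes q: "\<And>i. i > 0 \<Longrightarrow> q i \<noteq> 0" and qinf: "filterlim q at_infinity sequentially"
    and B: "B > 0"
  shows "\<exists>C. \<forall>i. norm (frobenius_coeff v1 v2 v3 q i) * B ^ i \<le> C"
proof -
  define c where "c = frobenius_coeff v1 v2 v3 q"
  define S where "S = norm v1 * B + norm v2 * B^2 + norm v3 * B^3 + B^4"
  have "eventually (\<lambda>i. norm (q i) \<ge> S) sequentially"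
    using filterlim_at_infinity_imp_norm_at_top[OF qinf] by (simp add: filterlim_at_top)
  then obtain i0 where i0: "\<And>i. i \<ge> i0 \<Longrightarrow> norm (q i) \<ge> S"
    by (auto simp: eventually_sequentially)
  define C where "C = (\<Sum>i\<le>i0. norm (c i) * B ^ i)"
  have "C \<ge> 0" unfolding C_def using B by (intro sum_nonneg) auto
  have "norm (c i) * B ^ i \<le> C" for i
  proof (induction i rule: less_induct)
    case (less i)
    show ?case
    proof (cases "i \<le> i0")
      case True
      then show ?thesis unfolding C_def using B by (intro member_le_sum) auto
    next
      case False
      then have i: "i > 0" "norm (q i) \<ge> S" "norm (q i) > 0" using i0 q by auto
      have step: "norm (if i < j then 0 else v * c (i - j)) * B ^ i \<le> norm v * B ^ j * C"
        if "j > 0" for j v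
      proof (cases "i < j")
        case True
        then show ?thesis using \<open>C \<ge> 0\<close> B by simp
      next
        case False
        then have "norm v * B ^ j * (norm (c (i - j)) * B ^ (i - j)) \<le> norm v * B ^ j * C"
          using B that i by (intro mult_left_mono less.IH) auto
        moreover have "B ^ i = B ^ j * B ^ (i - j)" using False by (simp flip: power_add)
        ultimately show ?thesis using False by (simp add: norm_mult mult_ac)
      qed
      have "norm (c i) * norm (q i) = norm ((if i < 1 then 0 else v1 * c (i - 1))
         + (if i < 2 then 0 else v2 * c (i - 2)) + (if i < 3 then 0 else v3 * c (i - 3))
         + (if i < 4 then 0 else 1 * c (i - 4)))"
        using i unfolding c_def by (subst frobenius_coeff.simps) (simp add: norm_divide)
      also have "\<dots> \<le> norm (if i < 1 then 0 else v1 * c (i - 1))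
         + norm (if i < 2 then 0 else v2 * c (i - 2)) + norm (if i < 3 then 0 else v3 * c (i - 3))
         + norm (if i < 4 then 0 else 1 * c (i - 4))"
        by (intro norm_triangle_le add_mono order_refl)
      finally have "norm (c i) * norm (q i) * B ^ i \<le> (norm (if i < 1 then 0 else v1 * c (i - 1))
         + norm (if i < 2 then 0 else v2 * c (i - 2)) + norm (if i < 3 then 0 else v3 * c (i - 3))
         + norm (if i < 4 then 0 else 1 * c (i - 4))) * B ^ i"
        using B by (intro mult_right_mono) auto
      also have "\<dots> \<le> norm v1 * B ^ 1 * C + norm v2 * B^2 * C + norm v3 * B^3 * C
         + norm (1::complex) * B^4 * C"
        unfolding distrib_right by (intro add_mono step) auto
      also have "\<dots> = S * C" by (simp add: S_def algebra_simps)
      also have "\<dots> \<le> norm (q i) * C" using i \<open>C \<ge> 0\<close> by (intro mult_right_mono) auto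
      finally show ?thesis using i by (simp add: mult_ac)
    qed
  qed
  then show ?thesis unfolding c_def by blast
qed

lemma frobenius_conv_radius:
  assumes q: "\<And>i. i > 0 \<Longrightarrow> q i \<noteq> 0" and qinf: "filterlim q at_infinity sequentially"
  shows "fps_conv_radius (Abs_fps (frobenius_coeff v1 v2 v3 q)) = \<infinity>"
proof (rule ccontr)
  define R where "R = fps_conv_radius (Abs_fps (frobenius_coeff v1 v2 v3 q))"
  assume "fps_conv_radius (Abs_fps (frobenius_coeff v1 v2 v3 q)) \<noteq> \<infinity>"
  then have "R \<noteq> \<infinity>" by (simp add: R_def)
  moreover have "R \<ge> 0" by (simp add: R_def fps_conv_radius_def conv_radius_nonneg)
  ultimately obtain r where r: "R = ereal r" "r \<ge> 0" by (cases R) auto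
  define B where "B = 2 * (r + 1)"
  have B: "B > 0" using r by (simp add: B_def)
  obtain C where C: "\<And>i. norm (frobenius_coeff v1 v2 v3 q i) * B ^ i \<le> C"
    using frobenius_coeff_bounded[OF q qinf B] by blast
  have "summable (\<lambda>i. frobenius_coeff v1 v2 v3 q i * of_real (r + 1) ^ i)"
  proof (rule summable_comparison_test')
    show "summable (\<lambda>i. C * (1 / 2) ^ i)" by (intro summable_mult summable_geometric) auto
    show "norm (frobenius_coeff v1 v2 v3 q i * of_real (r + 1) ^ i) \<le> C * (1 / 2) ^ i" for i
    proof -
      have "norm (frobenius_coeff v1 v2 v3 q i * of_real (r + 1) ^ i)
         = (norm (frobenius_coeff v1 v2 v3 q i) * B ^ i) * (1 / 2) ^ i"
      proof -
        have "norm (of_real (r + 1) :: complex) = B * (1/2)"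
          using r by (simp add: B_def del: of_real_add)
        then show ?thesis by (simp only: norm_mult norm_power power_mult_distrib mult_ac)
      qed
      also have "\<dots> \<le> C * (1 / 2) ^ i" by (intro mult_right_mono C) auto
      finally show ?thesis .
    qed
  qed
  then have "conv_radius (frobenius_coeff v1 v2 v3 q) \<ge> norm (of_real (r + 1) :: complex)"
    by (rule conv_radius_geI)
  then have "ereal (r + 1) \<le> R"
    using r by (simp add: R_def fps_conv_radius_def del: of_real_add)
  then show False using r by simp
qed

text \<open>
  Since \<open>x\<^sup>2 V(x)\<close> is a polynomial in \<open>u = x\<^sup>3\<close>, the substitution \<open>x powr \<rho> * h(u)\<close> is compatible with the
  equation: the factor \<open>h\<close> satisfies \<open>9 u h'' + (9 + 3 (2 \<rho> - 1)) h' = (v1 + v2 u + v3 u\<^sup>2 + u\<^sup>3) h\<close>,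
  and the indicial factor at step \<open>i\<close> is \<open>3 i (3 i + 2 \<rho> - 1)\<close>.
\<close>

lemma frobenius_solution:
  assumes V: "\<And>t. exp t ^ 2 * V (exp t) =
      \<rho> * (\<rho> - 1) + v1 * exp t ^ 3 + v2 * exp t ^ 6 + v3 * exp t ^ 9 + exp t ^ 12"
    and nonres: "\<And>i::nat. i > 0 \<Longrightarrow> 3 * of_nat i + 2 * \<rho> - 1 \<noteq> 0"
  obtains h h' where "h holomorphic_on UNIV" "h' holomorphic_on UNIV" "h 0 = 1"
    "oscillator_solution V (\<lambda>t. exp (\<rho> * t) * h (exp t ^ 3))"
    "\<And>t. cover_deriv (\<lambda>t. exp (\<rho> * t) * h (exp t ^ 3)) t =
       exp ((\<rho> - 1) * t) * (\<rho> * h (exp t ^ 3) + 3 * exp t ^ 3 * h' (exp t ^ 3))"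
proof -
  define q where "q = (\<lambda>i::nat. 3 * of_nat i * (3 * of_nat i + 2 * \<rho> - 1))"
  have q: "q i \<noteq> 0" if "i > 0" for i using nonres[OF that] that by (simp add: q_def)
  have "filterlim (\<lambda>i::nat. of_nat i :: complex) at_infinity sequentially"
    by (rule tendsto_of_nat)
  then have inf: "filterlim (\<lambda>i::nat. 3 * of_nat i :: complex) at_infinity sequentially"
    by (intro tendsto_mult_filterlim_at_infinity[OF tendsto_const]) auto
  have "filterlim (\<lambda>i::nat. (2 * \<rho> - 1) + 3 * of_nat i) at_infinity sequentially"
    by (rule tendsto_add_filterlim_at_infinity[OF tendsto_const inf])
  then have "filterlim (\<lambda>i::nat. 3 * of_nat i * ((2 * \<rho> - 1) + 3 * of_nat i)) at_infinity sequentially"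
    by (rule filterlim_at_infinity_times[OF inf])
  then have qinf: "filterlim q at_infinity sequentially"
    by (simp add: q_def[abs_def] algebra_simps)
  define D where "D = Abs_fps (frobenius_coeff v1 v2 v3 q)"
  have rad: "fps_conv_radius D = \<infinity>" unfolding D_def by (rule frobenius_conv_radius[OF q qinf])
  have rad': "fps_conv_radius (fps_deriv D) = \<infinity>"
    using fps_conv_radius_deriv[of D] rad by simp
  have rad'': "fps_conv_radius (fps_deriv (fps_deriv D)) = \<infinity>"
    using fps_conv_radius_deriv[of "fps_deriv D"] rad' by simp
  define h h' h'' where "h = eval_fps D" and "h' = eval_fps (fps_deriv D)"
    and "h'' = eval_fps (fps_deriv (fps_deriv D))"
  have dh: "(h has_field_derivative h' u) (at u)" for u
    unfolding h_def h'_def by (rule has_field_derivative_eval_fps) (simp add: rad)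
  have dh': "(h' has_field_derivative h'' u) (at u)" for u
    unfolding h'_def h''_def by (rule has_field_derivative_eval_fps) (simp add: rad')
  have fps: "fps_const 9 * (fps_X * fps_deriv (fps_deriv D)) + fps_const (9 + 3 * (2 * \<rho> - 1)) * fps_deriv D
     = fps_const v1 * D + fps_const v2 * (fps_X * D) + fps_const v3 * (fps_X * (fps_X * D))
       + fps_X * (fps_X * (fps_X * D))"
  proof (rule fps_ext)
    fix i
    have "of_nat (i + 1) * (3 * (3 * of_nat (i + 1) + 2 * \<rho> - 1)) * D $ (i + 1) = q (i + 1) * D $ (i + 1)"
      by (simp only: q_def mult_ac)
    also have "\<dots> = v1 * D $ i + (if i < 1 then 0 else v2 * D $ (i - 1)) +
       (if i < 2 then 0 else v3 * D $ (i - 2)) + (if i < 3 then 0 else D $ (i - 3))"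
      using q[of "i + 1"] unfolding D_def
      by (simp add: frobenius_coeff.simps[of v1 v2 v3 q "Suc i"])
    finally have eq: "of_nat (i + 1) * (3 * (3 * of_nat (i + 1) + 2 * \<rho> - 1)) * D $ (i + 1) =
       v1 * D $ i + (if i < 1 then 0 else v2 * D $ (i - 1)) +
       (if i < 2 then 0 else v3 * D $ (i - 2)) + (if i < 3 then 0 else D $ (i - 3))" .
    have "(fps_const 9 * (fps_X * fps_deriv (fps_deriv D)) + fps_const (9 + 3 * (2 * \<rho> - 1)) * fps_deriv D) $ i
      = of_nat (i + 1) * (3 * (3 * of_nat (i + 1) + 2 * \<rho> - 1)) * D $ (i + 1)"
      by (cases i) (simp_all add: algebra_simps)
    also note eq
    also have "v1 * D $ i + (if i < 1 then 0 else v2 * D $ (i - 1)) +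
       (if i < 2 then 0 else v3 * D $ (i - 2)) + (if i < 3 then 0 else D $ (i - 3)) =
       (fps_const v1 * D + fps_const v2 * (fps_X * D) + fps_const v3 * (fps_X * (fps_X * D))
       + fps_X * (fps_X * (fps_X * D))) $ i"
      by (auto simp: numeral_eq_Suc)
    finally show "(fps_const 9 * (fps_X * fps_deriv (fps_deriv D)) + fps_const (9 + 3 * (2 * \<rho> - 1)) * fps_deriv D) $ i = \<dots>" .
  qed
  have inf_mult: "fps_conv_radius (A * B) = \<infinity>" if "fps_conv_radius A = \<infinity>" "fps_conv_radius B = \<infinity>"
    for A B :: "complex fps"
    using fps_conv_radius_mult[of A B] that by simp
  have inf_add: "fps_conv_radius (A + B) = \<infinity>" if "fps_conv_radius A = \<infinity>" "fps_conv_radius B = \<infinity>"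
    for A B :: "complex fps"
    using fps_conv_radius_add[of A B] that by simp
  have ode: "9 * (u * h'' u) + (9 + 3 * (2 * \<rho> - 1)) * h' u =
     v1 * h u + v2 * (u * h u) + v3 * (u * (u * h u)) + u * (u * (u * h u))" for u
  proof -
    have "eval_fps (fps_const 9 * (fps_X * fps_deriv (fps_deriv D)) + fps_const (9 + 3 * (2 * \<rho> - 1)) * fps_deriv D) u
      = eval_fps (fps_const v1 * D + fps_const v2 * (fps_X * D) + fps_const v3 * (fps_X * (fps_X * D))
       + fps_X * (fps_X * (fps_X * D))) u"
      by (simp only: fps)
    then show ?thesis
      by (simp add: eval_fps_add eval_fps_mult inf_mult inf_add rad rad' rad'' h_def h'_def h''_def
          del: fps_mult_fps_X_commute)
  qed
  define \<phi> where "\<phi> = (\<lambda>t. exp (\<rho> * t) * h (exp t ^ 3))"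
  define \<phi>' where "\<phi>' = (\<lambda>t. exp ((\<rho> - 1) * t) * (\<rho> * h (exp t ^ 3) + 3 * exp t ^ 3 * h' (exp t ^ 3)))"
  have e: "exp (\<rho> * t) = exp t * exp ((\<rho> - 1) * t)" for t
    by (simp add: exp_add[symmetric] algebra_simps)
  have d1: "(\<phi> has_field_derivative exp t * \<phi>' t) (at t)" for t
    unfolding \<phi>_def \<phi>'_def
    by (auto intro!: derivative_eq_intros DERIV_chain2[OF dh] simp: e power3_eq_cube algebra_simps)
       
  have d2: "(\<phi>' has_field_derivative exp t * (V (exp t) * \<phi> t)) (at t)" for t
  proof -
    define u where "u = exp t ^ 3"
    have u: "exp t ^ 6 = u^2" "exp t ^ 9 = u ^ 3" "exp t ^ 12 = u ^ 4"
      by (simp_all add: u_def power_mult[symmetric])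
    have "exp t * (V (exp t) * \<phi> t) = exp ((\<rho> - 1) * t) * (exp t ^ 2 * V (exp t)) * h u"
      by (simp add: \<phi>_def e u_def power2_eq_square)
    also have "\<dots> = exp ((\<rho> - 1) * t) * (\<rho> * (\<rho> - 1) * h u +
        u * (v1 * h u + v2 * (u * h u) + v3 * (u * (u * h u)) + u * (u * (u * h u))))"
      unfolding V u u_def[symmetric] by (simp add: algebra_simps eval_nat_numeral)
    also have "\<dots> = (\<rho> - 1) * exp ((\<rho> - 1) * t) * (\<rho> * h u + 3 * u * h' u) + exp ((\<rho> - 1) * t) *
       (\<rho> * (h' u * (3 * u)) + (3 * (3 * u) * h' u + 3 * u * (h'' u * (3 * u))))"
      unfolding ode[symmetric] by (simp add: algebra_simps)
    finally have "exp t * (V (exp t) * \<phi> t) = \<dots>" .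
    moreover have "((\<lambda>t. exp t ^ 3) has_field_derivative 3 * u) (at t)"
      unfolding u_def by (auto intro!: derivative_eq_intros simp: power3_eq_cube power2_eq_square)
    note du = this
    have "(\<phi>' has_field_derivative (\<rho> - 1) * exp ((\<rho> - 1) * t) * (\<rho> * h u + 3 * u * h' u) + exp ((\<rho> - 1) * t) *
       (\<rho> * (h' u * (3 * u)) + (3 * (3 * u) * h' u + 3 * u * (h'' u * (3 * u))))) (at t)"
      unfolding \<phi>'_def
      by (rule derivative_eq_intros DERIV_chain2[OF dh, OF du] DERIV_chain2[OF dh', OF du] du refl)+
         (simp add: u_def algebra_simps)
    ultimately show ?thesis by simp
  qed
  show ?thesis
  proof (rule that[of h h'])
    show "h holomorphic_on UNIV" "h' holomorphic_on UNIV"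
      using dh dh' holomorphic_on_open open_UNIV by blast+
    show "h 0 = 1"
      by (simp add: h_def eval_fps_at_0 D_def frobenius_coeff.simps)
    show "oscillator_solution V (\<lambda>t. exp (\<rho> * t) * h (exp t ^ 3))"
      using solutionI(1)[OF d1 d2] by (simp add: \<phi>_def)
    show "cover_deriv (\<lambda>t. exp (\<rho> * t) * h (exp t ^ 3)) t =
       exp ((\<rho> - 1) * t) * (\<rho> * h (exp t ^ 3) + 3 * exp t ^ 3 * h' (exp t ^ 3))" for t
      using fun_cong[OF solutionI(2)[OF d1 d2], of t] by (simp add: \<phi>_def \<phi>'_def)
  qed
qed

text \<open>
  These are the indicial factors at the two exponents, divided by \<open>3 i\<close>: \<open>3 n - 1\<close> is not divisible by three, so none of them vanishes.
\<close>

lemma frobenius_nonresonant: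
  fixes n :: int and i :: nat
  shows "3 * of_nat i + of_int (3 * n - 1) \<noteq> (0::complex)"
    and "3 * of_nat i - of_int (3 * n - 1) \<noteq> (0::complex)"
proof -
  have "3 * int i + (3 * n - 1) \<noteq> 0" "3 * int i - (3 * n - 1) \<noteq> 0" by presburger+
  then have "of_int (3 * int i + (3 * n - 1)) \<noteq> (0::complex)"
    "of_int (3 * int i - (3 * n - 1)) \<noteq> (0::complex)"
    by (simp_all only: of_int_eq_0_iff not_False_eq_True)
  then show "3 * of_nat i + of_int (3 * n - 1) \<noteq> (0::complex)"
    "3 * of_nat i - of_int (3 * n - 1) \<noteq> (0::complex)" by simp_all
qed

text \<open>
  For these values of \<open>\<theta>\<^sub>0\<close> the exponents at the origin are \<open>3 n / 2\<close> and \<open>1 - 3 n / 2\<close>. They differ by the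
  integer \<open>3 n - 1\<close>, but no logarithm appears because the series proceed in powers of \<open>x\<^sup>3\<close>.
\<close>

lemma okamoto_frobenius_basis:
  fixes n :: int and a b \<theta> :: complex
  defines "V \<equiv> V10 a b (okamoto_theta0 n) \<theta>"
  obtains hp hm where "hp holomorphic_on UNIV" "hm holomorphic_on UNIV" "hp 0 = 1" "hm 0 = 1"
    "oscillator_solution V (\<lambda>t. exp (of_int (3 * n) / 2 * t) * hp (exp t ^ 3))"
    "oscillator_solution V (\<lambda>t. exp ((1 - of_int (3 * n) / 2) * t) * hm (exp t ^ 3))"
    "wronskian (\<lambda>t. exp (of_int (3 * n) / 2 * t) * hp (exp t ^ 3))
       (\<lambda>t. exp ((1 - of_int (3 * n) / 2) * t) * hm (exp t ^ 3)) 0 \<noteq> 0"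
proof -
  define \<rho>1 \<rho>2 :: complex where "\<rho>1 = of_int (3 * n) / 2" and "\<rho>2 = 1 - of_int (3 * n) / 2"
  define v1 v2 v3 where "v1 = - 3 * of_real (sqrt 3) * (b + (2 * \<theta> - 1 / 2) * a)"
    and "v2 = 3 * (a\<^sup>2 + 2 * (1 - \<theta>))" and "v3 = 2 * of_real (sqrt 3) * a"
  have V: "exp t ^ 2 * V (exp t) =
      \<rho> * (\<rho> - 1) + v1 * exp t ^ 3 + v2 * exp t ^ 6 + v3 * exp t ^ 9 + exp t ^ 12"
    if "\<rho> * (\<rho> - 1) = 2 + 9 * ((okamoto_theta0 n)\<^sup>2 - 1 / 4)" for \<rho> t
  proof -
    have "exp t \<noteq> (0::complex)" by simp
    then show ?thesis unfolding that V_def V10_def v1_def v2_def v3_def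
      by (simp add: divide_simps eval_nat_numeral) (simp add: algebra_simps)
  qed
  have r: "\<rho>1 * (\<rho>1 - 1) = 2 + 9 * ((okamoto_theta0 n)\<^sup>2 - 1 / 4)"
    "\<rho>2 * (\<rho>2 - 1) = 2 + 9 * ((okamoto_theta0 n)\<^sup>2 - 1 / 4)"
    by (simp_all add: \<rho>1_def \<rho>2_def okamoto_theta0_def power2_eq_square field_simps)
  have n1: "3 * of_nat i + 2 * \<rho>1 - 1 \<noteq> 0" and n2: "3 * of_nat i + 2 * \<rho>2 - 1 \<noteq> 0" for i :: nat
    using frobenius_nonresonant[of i n] by (simp_all add: \<rho>1_def \<rho>2_def algebra_simps)
  obtain hp hp' where hp: "hp holomorphic_on UNIV" "hp' holomorphic_on UNIV" "hp 0 = 1"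
    "oscillator_solution V (\<lambda>t. exp (\<rho>1 * t) * hp (exp t ^ 3))"
    "\<And>t. cover_deriv (\<lambda>t. exp (\<rho>1 * t) * hp (exp t ^ 3)) t =
       exp ((\<rho>1 - 1) * t) * (\<rho>1 * hp (exp t ^ 3) + 3 * exp t ^ 3 * hp' (exp t ^ 3))"
    by (rule frobenius_solution[OF V[OF r(1)] n1]) blast
  obtain hm hm' where hm: "hm holomorphic_on UNIV" "hm' holomorphic_on UNIV" "hm 0 = 1"
    "oscillator_solution V (\<lambda>t. exp (\<rho>2 * t) * hm (exp t ^ 3))"
    "\<And>t. cover_deriv (\<lambda>t. exp (\<rho>2 * t) * hm (exp t ^ 3)) t =
       exp ((\<rho>2 - 1) * t) * (\<rho>2 * hm (exp t ^ 3) + 3 * exp t ^ 3 * hm' (exp t ^ 3))"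
    by (rule frobenius_solution[OF V[OF r(2)] n2]) blast
  define W where "W = wronskian (\<lambda>t. exp (\<rho>1 * t) * hp (exp t ^ 3)) (\<lambda>t. exp (\<rho>2 * t) * hm (exp t ^ 3))"
  define K where "K = (\<lambda>u. hp u * (\<rho>2 * hm u + 3 * u * hm' u) - (\<rho>1 * hp u + 3 * u * hp' u) * hm u)"
  have WK: "W t = K (exp t ^ 3)" for t
  proof -
    have "exp (\<rho>1 * t) * exp ((\<rho>2 - 1) * t) = 1" "exp ((\<rho>1 - 1) * t) * exp (\<rho>2 * t) = 1"
      by (simp_all add: exp_add[symmetric] \<rho>1_def \<rho>2_def algebra_simps)
    note e = this
    have "W t = (exp (\<rho>1 * t) * exp ((\<rho>2 - 1) * t)) * (hp (exp t ^ 3) * (\<rho>2 * hm (exp t ^ 3) + 3 * exp t ^ 3 * hm' (exp t ^ 3)))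
      - (exp ((\<rho>1 - 1) * t) * exp (\<rho>2 * t)) * ((\<rho>1 * hp (exp t ^ 3) + 3 * exp t ^ 3 * hp' (exp t ^ 3)) * hm (exp t ^ 3))"
      unfolding W_def wronskian_def hp(5) hm(5) by (simp only: mult_ac)
    then show ?thesis by (simp only: e K_def mult_1_left)
  qed
  have Kc: "K u = W 0" if "u \<noteq> 0" for u
  proof -
    have "exp (Ln u / 3) ^ 3 = u" using that by (simp flip: exp_of_nat_mult)
    then have "K u = W (Ln u / 3)" by (simp add: WK)
    also have "\<dots> = W 0" unfolding W_def by (rule wronskian_const[OF hp(4) hm(4)])
    finally show ?thesis .
  qed
  have "isCont K 0"
  proof -
    have "K holomorphic_on UNIV" unfolding K_def using hp(1,2) hm(1,2) by (intro holomorphic_intros)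
    then show ?thesis
      using continuous_on_eq_continuous_at[OF open_UNIV] holomorphic_on_imp_continuous_on by blast
  qed
  then have "K \<midarrow>0\<rightarrow> K 0" by (simp add: isCont_def)
  moreover have "K \<midarrow>0\<rightarrow> W 0"
    by (rule tendsto_eventually) (auto simp: eventually_at_filter Kc)
  ultimately have "W 0 = K 0" using LIM_unique by blast
  also have "\<dots> = \<rho>2 - \<rho>1" by (simp add: K_def hp hm)
  also have "\<dots> \<noteq> 0"
    using frobenius_nonresonant(2)[of 0 n] by (auto simp: \<rho>1_def \<rho>2_def field_simps)
  finally have "W 0 \<noteq> 0" .
  then show ?thesis
    using that[of hp hm] hp hm unfolding \<rho>1_def \<rho>2_def W_def by blast
qed

section \<open>Asymptotics of a subdominant solution\<close>

text \<open>The formal solution that decays in the sector with index \<open>k\<close>.\<close>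

definition wkb_sign :: "int \<Rightarrow> complex" where
  "wkb_sign k = (if odd k then 1 else - 1)"

definition wkb_exponent :: "complex \<Rightarrow> int \<Rightarrow> complex" where
  "wkb_exponent \<theta> k = (if odd k then 1 / 2 - 3 * \<theta> else 3 * \<theta> - 11 / 2)"

definition wkb_log :: "complex \<Rightarrow> complex \<Rightarrow> int \<Rightarrow> complex \<Rightarrow> complex" where
  "wkb_log a \<theta> k t = wkb_exponent \<theta> k * t + wkb_sign k * stokes_G a (exp t)"

definition wkb :: "complex \<Rightarrow> complex \<Rightarrow> int \<Rightarrow> complex \<Rightarrow> complex" where
  "wkb a \<theta> k t = exp (wkb_log a \<theta> k t)"

definition wkb_slope :: "complex \<Rightarrow> complex \<Rightarrow> int \<Rightarrow> complex \<Rightarrow> complex" where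
  "wkb_slope a \<theta> k t = wkb_exponent \<theta> k / exp t
     + wkb_sign k * (exp t ^ 5 + of_real (sqrt 3) * a * exp t ^ 2)"

definition wkb_slope' :: "complex \<Rightarrow> complex \<Rightarrow> int \<Rightarrow> complex \<Rightarrow> complex" where
  "wkb_slope' a \<theta> k t = - wkb_exponent \<theta> k / exp t ^ 2
     + wkb_sign k * (5 * exp t ^ 4 + 2 * of_real (sqrt 3) * a * exp t)"

lemma wkb_nonzero [simp]: "wkb a \<theta> k t \<noteq> 0" by (simp add: wkb_def)

lemma wkb_log_DERIV: "(wkb_log a \<theta> k has_field_derivative exp t * wkb_slope a \<theta> k t) (at t)"
proof -
  have "complex_of_real (sqrt 3) * complex_of_real (sqrt 3) = 3"
    by (simp flip: of_real_mult)
  then have s: "3 / complex_of_real (sqrt 3) = of_real (sqrt 3)"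
    by (simp add: divide_eq_eq)
  have "(stokes_G a has_field_derivative (x ^ 5 + of_real (sqrt 3) * a * x ^ 2)) (at x)" for x
  proof -
    have "(stokes_G a has_field_derivative (x ^ 5 + (3 / of_real (sqrt 3)) * a * x ^ 2)) (at x)"
      unfolding stokes_G_def[abs_def] by (auto intro!: derivative_eq_intros)
    then show ?thesis unfolding s .
  qed
  note G = this
  show ?thesis
    unfolding wkb_log_def[abs_def] wkb_slope_def
    by (auto intro!: derivative_eq_intros DERIV_chain2[OF G] simp: algebra_simps)
qed

lemma wkb_DERIV: "(wkb a \<theta> k has_field_derivative exp t * wkb_slope a \<theta> k t * wkb a \<theta> k t) (at t)"
  unfolding wkb_def[abs_def] by (auto intro!: derivative_eq_intros wkb_log_DERIV)

lemma wkb_slope_DERIV: "(wkb_slope a \<theta> k has_field_derivative exp t * wkb_slope' a \<theta> k t) (at t)"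
  unfolding wkb_slope_def[abs_def] wkb_slope'_def
  by (auto intro!: derivative_eq_intros simp: field_simps eval_nat_numeral)

text \<open>
  The potential with formal solution \<open>wkb\<close> agrees with \<open>V10\<close> up to terms of order \<open>x\<close>. The exponent of
  the power in front of the exponential is the one that cancels the terms of order \<open>x\<^sup>4\<close>.
\<close>

definition wkb_residual :: "complex \<Rightarrow> complex \<Rightarrow> complex \<Rightarrow> complex \<Rightarrow> int \<Rightarrow> complex \<Rightarrow> complex" where
  "wkb_residual a b \<theta>0 \<theta> k t =
     V10 a b \<theta>0 \<theta> (exp t) - (wkb_slope a \<theta> k t)\<^sup>2 - wkb_slope' a \<theta> k t"

lemma wkb_residual_bound:
  "\<exists>C>0. \<forall>t. Re t \<ge> 0 \<longrightarrow> norm (wkb_residual a b \<theta>0 \<theta> k t) \<le> C * norm (exp t)"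
proof -
  define \<sigma> p where "\<sigma> = wkb_sign k" and "p = wkb_exponent \<theta> k"
  define S :: complex where "S = of_real (sqrt 3)"
  have S: "S * S = 3" by (simp add: S_def flip: of_real_mult)
  have \<sigma>: "\<sigma> * \<sigma> = 1" by (simp add: \<sigma>_def wkb_sign_def)
  have \<sigma>p: "\<sigma> * (2 * p + 5) = 6 * (1 - \<theta>)"
    by (simp add: \<sigma>_def p_def wkb_sign_def wkb_exponent_def algebra_simps)
  define c1 c2 where "c1 = - 3 * S * (b + (2 * \<theta> - 1 / 2) * a) - \<sigma> * (2 * S * a) - 2 * p * \<sigma> * S * a"
    and "c2 = 2 + 9 * (\<theta>0\<^sup>2 - 1 / 4) + p - p\<^sup>2"
  have res: "wkb_residual a b \<theta>0 \<theta> k t = c1 * x + c2 / x\<^sup>2" if "x = exp t" for x t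
  proof -
    have x: "x \<noteq> 0" using that by simp
    have "(p / x + \<sigma> * (x ^ 5 + S * a * x ^ 2))\<^sup>2 = p\<^sup>2 / x\<^sup>2 + 2 * \<sigma> * p * (x ^ 4 + S * a * x)
       + (\<sigma> * \<sigma>) * (x ^ 10 + 2 * S * a * x ^ 7 + (S * S) * a\<^sup>2 * x ^ 4)"
      using x by (simp add: field_simps eval_nat_numeral)
    also have "\<dots> = p\<^sup>2 / x\<^sup>2 + 2 * \<sigma> * p * (x ^ 4 + S * a * x) + (x ^ 10 + 2 * S * a * x ^ 7 + 3 * a\<^sup>2 * x ^ 4)"
      by (simp add: \<sigma> S)
    finally have sq: "(p / x + \<sigma> * (x ^ 5 + S * a * x ^ 2))\<^sup>2 = \<dots>" .
    have "wkb_residual a b \<theta>0 \<theta> k t = c1 * x + c2 / x\<^sup>2 + (6 * (1 - \<theta>) - \<sigma> * (2 * p + 5)) * x ^ 4"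
      unfolding wkb_residual_def V10_def wkb_slope_def wkb_slope'_def that[symmetric]
        \<sigma>_def[symmetric] p_def[symmetric] S_def[symmetric] sq c1_def c2_def
      by (simp add: algebra_simps diff_divide_distrib add_divide_distrib)
    then show ?thesis by (simp add: \<sigma>p)
  qed
  have "norm (wkb_residual a b \<theta>0 \<theta> k t) \<le> (norm c1 + norm c2 + 1) * norm (exp t)" if "Re t \<ge> 0" for t
  proof -
    have x: "norm (exp t) \<ge> 1" using that by simp
    have "norm (c2 / exp t ^ 2) \<le> norm c2 / 1"
      unfolding norm_divide norm_power by (intro divide_left_mono) (use x in auto)
    also have "\<dots> \<le> norm c2 * norm (exp t)" using mult_left_mono[OF x, of "norm c2"] by simp
    finally have "norm (c1 * exp t + c2 / exp t ^ 2) \<le> norm c1 * norm (exp t) + norm c2 * norm (exp t)"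
      by (intro norm_triangle_le add_mono) (auto simp: norm_mult)
    moreover have "(norm c1 + norm c2 + 1) * norm (exp t) =
        norm c1 * norm (exp t) + norm c2 * norm (exp t) + norm (exp t)"
      by (simp only: distrib_right mult_1_left)
    ultimately show ?thesis unfolding res[OF refl] using x by linarith
  qed
  then show ?thesis by (intro exI[of _ "norm c1 + norm c2 + 1"]) (auto intro: add_nonneg_pos)
qed

text \<open>
  The quotient \<open>u / wkb\<close> and the defect \<open>u' - wkb_slope * u\<close> satisfy a system of first order in which the
  quotient acts on the defect only through the small residual.
\<close>

lemma wkb_quotient_DERIV:
  assumes "oscillator_solution V u"
  shows "((\<lambda>t. u t / wkb a \<theta> k t) has_field_derivative
     exp t * ((cover_deriv u t - wkb_slope a \<theta> k t * u t) / wkb a \<theta> k t)) (at t)"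
  by (auto intro!: derivative_eq_intros solution_DERIV[OF assms] wkb_DERIV simp: field_simps)

lemma wkb_defect_DERIV:
  assumes "oscillator_solution (V10 a b \<theta>0 \<theta>) u"
  shows "((\<lambda>t. wkb a \<theta> k t * (cover_deriv u t - wkb_slope a \<theta> k t * u t)) has_field_derivative
     exp t * (wkb a \<theta> k t * wkb_residual a b \<theta>0 \<theta> k t * u t)) (at t)"
  unfolding wkb_residual_def
  by (rule derivative_eq_intros solution_DERIV[OF assms] solution_DERIV2[OF assms] wkb_DERIV
      wkb_slope_DERIV refl)+ (simp add: algebra_simps power2_eq_square)

text \<open>
  This is the form in which integrals of exponentially growing functions are estimated: such an integral is
  at most a constant multiple of the exponential at the end point.
\<close>

lemma dominated_variation:
  fixes Z L :: "real \<Rightarrow> complex" and K :: real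
  assumes "\<alpha> \<le> \<beta>"
    and Z: "\<And>s. s \<in> {\<alpha>..\<beta>} \<Longrightarrow> (Z has_vector_derivative Z' s) (at s)"
    and L: "\<And>s. s \<in> {\<alpha>..\<beta>} \<Longrightarrow> (L has_vector_derivative L' s) (at s)"
    and le: "\<And>s. s \<in> {\<alpha>..\<beta>} \<Longrightarrow> norm (Z' s) \<le> K * (Re (L' s) * exp (Re (L s)))"
  shows "norm (Z \<beta> - Z \<alpha>) \<le> K * exp (Re (L \<beta>)) - K * exp (Re (L \<alpha>))"
proof (cases "\<alpha> = \<beta>")
  case False
  have d: "((\<lambda>s. K * exp (Re (L s))) has_vector_derivative K * (Re (L' s) * exp (Re (L s)))) (at s)"
    if "s \<in> {\<alpha>..\<beta>}" for s
  proof -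
    have h: "((\<lambda>s. Re (L s)) has_real_derivative Re (L' s)) (at s)"
      using bounded_linear.has_vector_derivative[OF bounded_linear_Re L[OF that]]
      by (simp add: has_real_derivative_iff_has_vector_derivative)
    then have "((\<lambda>s. K * exp (Re (L s))) has_real_derivative K * (Re (L' s) * exp (Re (L s)))) (at s)"
      using DERIV_cmult[OF DERIV_fun_exp[OF h], of K]
      by (simp add: mult_ac)
    then show ?thesis by (simp add: has_real_derivative_iff_has_vector_derivative)
  qed
  show ?thesis
  proof (rule differentiable_bound_general)
    show "\<alpha> < \<beta>" using False assms(1) by simp
    show "continuous_on {\<alpha>..\<beta>} Z"
      by (intro continuous_at_imp_continuous_on ballI has_vector_derivative_continuous[OF Z])
    show "continuous_on {\<alpha>..\<beta>} (\<lambda>s. K * exp (Re (L s)))"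
      by (intro continuous_at_imp_continuous_on ballI has_vector_derivative_continuous[OF d])
    fix s assume "\<alpha> < s" "s < \<beta>"
    then have s: "s \<in> {\<alpha>..\<beta>}" by simp
    show "(Z has_vector_derivative Z' s) (at s)" by (rule Z[OF s])
    show "((\<lambda>s. K * exp (Re (L s))) has_vector_derivative K * (Re (L' s) * exp (Re (L s)))) (at s)"
      by (rule d[OF s])
    show "norm (Z' s) \<le> K * (Re (L' s) * exp (Re (L s)))" by (rule le[OF s])
  qed
qed auto

text \<open>
  The coordinate \<open>y\<close> turns the central ray of the sector with index \<open>k\<close> into the positive real axis.
\<close>

definition sector_log :: "int \<Rightarrow> complex \<Rightarrow> complex" where
  "sector_log k y = Ln y + \<i> * of_real (of_int k * pi / 6)"

definition sector_rot :: "int \<Rightarrow> complex" where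
  "sector_rot k = exp (\<i> * of_real (of_int k * pi / 6))"

lemma norm_sector_rot [simp]: "norm (sector_rot k) = 1"
  by (simp add: sector_rot_def)

lemma exp_sector_log: "y \<noteq> 0 \<Longrightarrow> exp (sector_log k y) = sector_rot k * y"
  by (simp add: sector_log_def sector_rot_def exp_add)

lemma exp_i_pi_int: "exp (\<i> * of_real (of_int k * pi)) = (if even k then 1 else - 1)"
proof (cases "even k")
  case True
  then obtain j where "k = 2 * j" by blast
  then show ?thesis using exp_plus_2pin[of 0 j] by (simp add: mult_ac)
next
  case False
  then obtain j where "k = 2 * j + 1" using oddE by blast
  then show ?thesis using exp_plus_2pin[of "of_real pi * \<i>" j] by (simp add: algebra_simps)
qed

lemma sector_rot_power6: "sector_rot k ^ 6 = - wkb_sign k"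
proof -
  have "sector_rot k ^ 6 = exp (\<i> * of_real (of_int k * pi))"
    by (simp add: sector_rot_def flip: exp_of_nat_mult)
  then show ?thesis by (simp only: exp_i_pi_int) (simp add: wkb_sign_def)
qed

lemma wkb_sign_square [simp]: "wkb_sign k * wkb_sign k = 1" "norm (wkb_sign k) = 1"
  by (auto simp: wkb_sign_def)

lemma cone_norm_le:
  assumes "\<bar>Im y\<bar> \<le> 3 / 10 * Re y"
  shows "norm y \<le> 21 / 20 * Re y"
proof -
  have r: "Re y \<ge> 0" using assms abs_ge_zero[of "Im y"] by linarith
  have "(Im y)\<^sup>2 \<le> (3 / 10 * Re y)\<^sup>2" using assms by (rule abs_le_square_iff[THEN iffD1, OF order_trans]) (use r in auto)
  then have "(Im y)\<^sup>2 \<le> 9 / 100 * (Re y)\<^sup>2" by (simp add: power_mult_distrib power_divide)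
  moreover have "(21 / 20 * Re y)\<^sup>2 = 441 / 400 * (Re y)\<^sup>2" by (simp add: power_mult_distrib power_divide)
  ultimately have "(Re y)\<^sup>2 + (Im y)\<^sup>2 \<le> (21 / 20 * Re y)\<^sup>2"
    using zero_le_power2[of "Re y"] by linarith
  then show ?thesis unfolding cmod_def using r by (intro real_le_lsqrt) auto
qed

text \<open>
  The slope \<open>3 / 10\<close> is less than \<open>tan (pi / 10)\<close>, so the fifth power stays in the right half-plane, with room for
  a small change \<open>d\<close> of direction. In \<open>wkb_growth_rate\<close> the other terms of the slope are of lower order.
\<close>

lemma cone_Re_power5:
  assumes y: "\<bar>Im y\<bar> \<le> 3 / 10 * Re y" and d: "norm (d - 1) \<le> 3 / 100"
  shows "Re (d * y ^ 5) \<ge> 1 / 10 * Re y ^ 5"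
proof -
  define r q where "r = Re y" and "q = Im y"
  have r: "r \<ge> 0" using y abs_ge_zero[of "Im y"] unfolding r_def by linarith
  have y5: "Re (y ^ 5) = r ^ 5 - 10 * r ^ 3 * q\<^sup>2 + 5 * r * q ^ 4"
    by (simp add: r_def q_def eval_nat_numeral algebra_simps)
  have q2: "q\<^sup>2 \<le> 9 / 100 * r\<^sup>2"
    using power_mono[OF y abs_ge_zero, of 2] by (simp add: r_def q_def power2_eq_square)
  have "(10 * r ^ 3) * (r\<^sup>2 * (9 / 100) - q\<^sup>2) - (5 * r) * ((9 / 100 * r\<^sup>2 - q\<^sup>2) * (9 / 100 * r\<^sup>2 + q\<^sup>2)) \<ge> 0"
  proof -
    have "(9 / 100 * r\<^sup>2 - q\<^sup>2) * (9 / 100 * r\<^sup>2 + q\<^sup>2) \<le> (9 / 100 * r\<^sup>2 - q\<^sup>2) * (2 * r\<^sup>2)"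
      using q2 zero_le_power2[of r] by (intro mult_left_mono; linarith)
    then have "(5 * r) * ((9 / 100 * r\<^sup>2 - q\<^sup>2) * (9 / 100 * r\<^sup>2 + q\<^sup>2)) \<le> (5 * r) * ((9 / 100 * r\<^sup>2 - q\<^sup>2) * (2 * r\<^sup>2))"
      by (rule mult_left_mono) (use r in simp)
    then show ?thesis by (simp add: algebra_simps eval_nat_numeral)
  qed
  then have "Re (y ^ 5) \<ge> 14 / 100 * r ^ 5"
    unfolding y5 using zero_le_power[OF r, of 5] by (simp add: algebra_simps eval_nat_numeral)
  moreover have "\<bar>Re ((d - 1) * y ^ 5)\<bar> \<le> 3 / 100 * (21 / 20 * r) ^ 5"
  proof -
    have "\<bar>Re ((d - 1) * y ^ 5)\<bar> \<le> norm (d - 1) * norm y ^ 5"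
      using abs_Re_le_cmod[of "(d - 1) * y ^ 5"] by (simp add: norm_mult norm_power)
    also have "\<dots> \<le> 3 / 100 * (21 / 20 * r) ^ 5"
      unfolding r_def by (intro mult_mono power_mono d cone_norm_le y) auto
    finally show ?thesis .
  qed
  moreover have "Re (d * y ^ 5) = Re (y ^ 5) + Re ((d - 1) * y ^ 5)" by (simp add: algebra_simps)
  moreover have "3 / 100 * (21 / 20 * r) ^ 5 \<le> 4 / 100 * r ^ 5"
    using zero_le_power[OF r, of 5] by (simp add: power_mult_distrib power_divide)
  ultimately show ?thesis unfolding r_def by linarith
qed

text \<open>
  Moving towards the origin inside the cone, the modulus of the decaying formal solution grows at the
  rate \<open>\<bar>y\<bar>\<^sup>5\<close>; the cone may be wider than the Stokes sector because \<open>Re (y\<^sup>5) > 0\<close> for \<open>\<bar>arg y\<bar> < pi / 10\<close>.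
\<close>

lemma wkb_growth_rate:
  "\<exists>R\<ge>1. \<forall>y d. Re y \<ge> R \<longrightarrow> \<bar>Im y\<bar> \<le> 3 / 10 * Re y \<longrightarrow> norm d = 1 \<longrightarrow> norm (d - 1) \<le> 3 / 100 \<longrightarrow>
     Re (- 2 * d * sector_rot k * wkb_slope a \<theta> k (sector_log k y)) \<ge> 1 / 10 * Re y ^ 5"
proof -
  define p where "p = wkb_exponent \<theta> k"
  define C where "C = norm p + 4 * norm a"
  show ?thesis
  proof (intro exI[of _ "max 1 (20 * C)"] conjI allI impI)
    fix y d :: complex
    assume y: "max 1 (20 * C) \<le> Re y" "\<bar>Im y\<bar> \<le> 3 / 10 * Re y"
      and d: "norm d = 1" "norm (d - 1) \<le> 3 / 100"
    define r where "r = Re y"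
    have r: "r \<ge> 1" "r \<ge> 20 * C" using y by (auto simp: r_def)
    have y0: "y \<noteq> 0" using r by (auto simp: r_def)
    have yr: "norm y \<ge> r" using abs_Re_le_cmod[of y] r by (simp add: r_def)
    define e where "e = p / y + wkb_sign k * (of_real (sqrt 3) * a * (sector_rot k ^ 3 * y ^ 2))"
    have "sector_rot k * wkb_slope a \<theta> k (sector_log k y) =
        p / y + wkb_sign k * (sector_rot k ^ 6 * y ^ 5 + of_real (sqrt 3) * a * (sector_rot k ^ 3 * y ^ 2))"
      unfolding wkb_slope_def exp_sector_log[OF y0] p_def
      by (simp add: sector_rot_def field_simps power_mult_distrib eval_nat_numeral)
    also have "\<dots> = e + wkb_sign k * sector_rot k ^ 6 * y ^ 5"
      by (simp add: e_def algebra_simps)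
    also have "\<dots> = e - y ^ 5" by (simp add: sector_rot_power6)
    finally have "sector_rot k * wkb_slope a \<theta> k (sector_log k y) = e - y ^ 5" .
    then have "- 2 * d * (sector_rot k * wkb_slope a \<theta> k (sector_log k y)) = - 2 * d * (e - y ^ 5)"
      by (simp only:)
    then have eq: "- 2 * d * sector_rot k * wkb_slope a \<theta> k (sector_log k y) = 2 * (d * y ^ 5) - 2 * (d * e)"
      by (simp only: mult.assoc right_diff_distrib) (simp add: mult_ac)
    have "norm e \<le> norm p / norm y + sqrt 3 * norm a * norm y ^ 2"
      unfolding e_def by (rule norm_triangle_le) (simp add: norm_mult norm_divide norm_power)
    also have "\<dots> \<le> norm p * r\<^sup>2 + 2 * norm a * (2 * r\<^sup>2)"
    proof (intro add_mono mult_mono)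
      have "norm p / norm y \<le> norm p / 1" using yr r by (intro divide_left_mono) auto
      also have "\<dots> \<le> norm p * r\<^sup>2" using r by (simp add: mult_le_cancel_left1)
      finally show "norm p / norm y \<le> norm p * r\<^sup>2" .
      show "sqrt 3 \<le> 2" by (rule real_le_lsqrt) auto
      have "norm y ^ 2 \<le> (21 / 20 * r) ^ 2"
        using cone_norm_le[OF y(2)] by (intro power_mono) (auto simp: r_def)
      also have "\<dots> \<le> 2 * r\<^sup>2" by (simp add: power_mult_distrib power_divide)
      finally show "norm y ^ 2 \<le> 2 * r\<^sup>2" .
    qed auto
    also have "\<dots> = C * r\<^sup>2" by (simp add: C_def algebra_simps)
    finally have e: "norm e \<le> C * r\<^sup>2" .
    have "20 * (C * r\<^sup>2) \<le> r * r\<^sup>2" using mult_right_mono[OF r(2), of "r\<^sup>2"] by simp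
    also have "\<dots> = r ^ 3" by (simp add: power2_eq_square power3_eq_cube)
    also have "\<dots> \<le> r ^ 5" by (rule power_increasing) (use r in auto)
    finally have "2 * norm e \<le> 1 / 10 * r ^ 5" using e by linarith
    moreover have "Re (2 * (d * e)) \<le> 2 * norm e"
      using abs_Re_le_cmod[of "d * e"] d by (simp add: norm_mult)
    moreover have "Re (2 * (d * y ^ 5)) \<ge> 2 / 10 * r ^ 5"
      using cone_Re_power5[OF y(2) d(2)] by (simp add: r_def)
    ultimately show "1 / 10 * Re y ^ 5 \<le> Re (- 2 * d * sector_rot k * wkb_slope a \<theta> k (sector_log k y))"
      unfolding eq r_def minus_complex.simps(1) by linarith
  qed simp
qed

lemma sector_log_path_DERIV:
  assumes "Re (N - of_real s * d) > 0"
  shows "((\<lambda>s. sector_log k (N - of_real s * d)) has_vector_derivative - d / (N - of_real s * d)) (at s)"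
proof -
  have np: "N - of_real s * d \<notin> \<real>\<^sub>\<le>\<^sub>0" using assms complex_nonpos_Reals_iff by force
  have lin: "((\<lambda>s. N - of_real s * d) has_vector_derivative - d) (at s)"
    by (rule has_vector_derivative_eq_rhs[OF has_vector_derivative_diff[OF has_vector_derivative_const
          has_vector_derivative_mult_left[OF has_vector_derivative_of_real[OF DERIV_ident]]]]) simp
  have "((\<lambda>s. Ln (N - of_real s * d)) has_vector_derivative - d * inverse (N - of_real s * d)) (at s)"
    using field_vector_diff_chain_at[OF lin has_field_derivative_Ln[OF np]] by (simp add: o_def)
  from has_vector_derivative_add[OF this has_vector_derivative_const[of "\<i> * of_real (of_int k * pi / 6)"]]
  show ?thesis by (simp only: sector_log_def divide_inverse[of "- d"] add_0_right)
qed

text \<open>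
  A solution with the same initial data as the decaying formal solution at a point \<open>N\<close> stays close to
  it along segments from \<open>N\<close> towards the origin: both the defect and the quotient are controlled by
  their values at \<open>N\<close>, since all exponential factors are at most \<open>1\<close> in this direction. The bounds do not
  depend on \<open>N\<close>.
\<close>

lemma wkb_segment_estimate:
  "\<exists>R\<ge>1. \<exists>K\<ge>0. \<forall>u N d T. oscillator_solution (V10 a b \<theta>0 \<theta>) u \<longrightarrow> norm d = 1 \<longrightarrow> norm (d - 1) \<le> 3 / 100 \<longrightarrow>
     T \<ge> 0 \<longrightarrow> (\<forall>s\<in>{0..T}. Re (N - of_real s * d) \<ge> R \<and> \<bar>Im (N - of_real s * d)\<bar> \<le> 3 / 10 * Re (N - of_real s * d)) \<longrightarrow>
     u (sector_log k N) = wkb a \<theta> k (sector_log k N) \<longrightarrow>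
     cover_deriv u (sector_log k N) = wkb_slope a \<theta> k (sector_log k N) * u (sector_log k N) \<longrightarrow>
     (let y = N - of_real T * d; t = sector_log k y in
       norm (u t / wkb a \<theta> k t - 1) \<le> K / Re y ^ 3 \<and>
       norm ((cover_deriv u t - wkb_slope a \<theta> k t * u t) / wkb a \<theta> k t) \<le> K / Re y ^ 4)"
proof -
  obtain C where C: "C > 0" "\<And>t. Re t \<ge> 0 \<Longrightarrow> norm (wkb_residual a b \<theta>0 \<theta> k t) \<le> C * norm (exp t)"
    using wkb_residual_bound[of a b \<theta>0 \<theta> k] by blast
  obtain R0 where R0: "R0 \<ge> 1" "\<And>y d. Re y \<ge> R0 \<Longrightarrow> \<bar>Im y\<bar> \<le> 3 / 10 * Re y \<Longrightarrow> norm d = 1 \<Longrightarrow>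
     norm (d - 1) \<le> 3 / 100 \<Longrightarrow>
     Re (- 2 * d * sector_rot k * wkb_slope a \<theta> k (sector_log k y)) \<ge> 1 / 10 * Re y ^ 5"
    using wkb_growth_rate[of k a \<theta>] by blast
  define R where "R = max R0 (11 * C)"
  have R: "R \<ge> 1" "R \<ge> R0" "R \<ge> 11 * C" using R0 by (auto simp: R_def)
  show ?thesis
  proof (rule exI[of _ R], rule conjI, rule R(1), rule exI[of _ "21 * C"], intro conjI allI impI)
    fix u N d and T :: real
    assume sol: "oscillator_solution (V10 a b \<theta>0 \<theta>) u" and d: "norm d = 1" "norm (d - 1) \<le> 3 / 100"
      and T: "T \<ge> 0"
      and cone: "\<forall>s\<in>{0..T}. Re (N - of_real s * d) \<ge> R \<and> \<bar>Im (N - of_real s * d)\<bar> \<le> 3 / 10 * Re (N - of_real s * d)"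
      and init: "u (sector_log k N) = wkb a \<theta> k (sector_log k N)"
        "cover_deriv u (sector_log k N) = wkb_slope a \<theta> k (sector_log k N) * u (sector_log k N)"
    define y where "y = (\<lambda>s::real. N - of_real s * d)"
    define t where "t = (\<lambda>s. sector_log k (y s))"
    define r where "r = (\<lambda>s. Re (y s))"
    have Red: "Re d \<ge> 97 / 100" using abs_Re_le_cmod[of "d - 1"] d by simp
    have y: "r s \<ge> R" "\<bar>Im (y s)\<bar> \<le> 3 / 10 * r s" "r s > 0" "y s \<noteq> 0" if "s \<in> {0..T}" for s
      using cone that R by (fastforce simp: y_def r_def)+
    have rdec: "r s \<le> r s'" if "s' \<le> s" for s s'
      using mult_right_mono[OF that, of "Re d"] Red by (simp add: r_def y_def)
    have expt: "exp (t s) = sector_rot k * y s" if "s \<in> {0..T}" for s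
      using y[OF that] by (simp add: t_def exp_sector_log)
    have nexpt: "norm (exp (t s)) \<le> 21 / 20 * r s" "Re (t s) \<ge> 0" if "s \<in> {0..T}" for s
    proof -
      show "norm (exp (t s)) \<le> 21 / 20 * r s"
        unfolding expt[OF that] using cone_norm_le[of "y s"] y(2)[OF that] by (simp add: norm_mult r_def)
      have "norm (exp (t s)) \<ge> r s"
        unfolding expt[OF that] using abs_Re_le_cmod[of "y s"] by (simp add: norm_mult r_def)
      then have "norm (exp (t s)) \<ge> 1" using y(1)[OF that] R by linarith
      then show "Re (t s) \<ge> 0" by simp
    qed
    have dt: "(t has_vector_derivative - d / y s) (at s)" if "s \<in> {0..T}" for s
      unfolding t_def y_def by (rule sector_log_path_DERIV) (use y(3)[OF that] in \<open>simp add: y_def r_def\<close>)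
    have chain: "((\<lambda>s. g (t s)) has_vector_derivative - d * sector_rot k * g') (at s)"
      if "s \<in> {0..T}" "(g has_field_derivative exp (t s) * g') (at (t s))" for g g' s
    proof -
      have "((\<lambda>s. g (t s)) has_vector_derivative (- d / y s) * (exp (t s) * g')) (at s)"
        using field_vector_diff_chain_at[OF dt[OF that(1)] that(2)] by (simp add: o_def)
      then show ?thesis using y(4)[OF that(1)] by (simp add: expt[OF that(1)] mult.assoc)
    qed
    define v P where "v = (\<lambda>s. u (t s) / wkb a \<theta> k (t s))"
      and "P = (\<lambda>s. (cover_deriv u (t s) - wkb_slope a \<theta> k (t s) * u (t s)) / wkb a \<theta> k (t s))"
    have dv: "(v has_vector_derivative - d * sector_rot k * P s) (at s)" if "s \<in> {0..T}" for s
      unfolding v_def P_def by (rule chain[OF that wkb_quotient_DERIV[OF sol]])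
    have "continuous_on {0..T} (\<lambda>s. norm (v s))"
      by (intro continuous_on_norm continuous_at_imp_continuous_on ballI has_vector_derivative_continuous[OF dv])
    then obtain s0 where s0: "s0 \<in> {0..T}" "\<And>s. s \<in> {0..T} \<Longrightarrow> norm (v s) \<le> norm (v s0)"
      using continuous_attains_sup[of "{0..T}" "\<lambda>s. norm (v s)"] T by auto
    define M where "M = norm (v s0)"
    have M: "norm (v s) \<le> M" if "s \<in> {0..T}" for s using s0 that by (simp add: M_def)
    have M0: "M \<ge> 0" by (simp add: M_def)
    have v0: "v 0 = 1" using init by (simp add: v_def t_def y_def)
    have P: "norm (P s) \<le> 21 / 2 * C * M / r s ^ 4" if s: "s \<in> {0..T}" for s
    proof -
      define K where "K = 21 / 2 * C * M / r s ^ 4"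
      \<comment> \<open>the defect, multiplied by \<open>wkb\<close>, starts at zero and is integrated against the growth of \<open>wkb\<^sup>2\<close>\<close>
      define Z where "Z = (\<lambda>s. wkb a \<theta> k (t s) * (cover_deriv u (t s) - wkb_slope a \<theta> k (t s) * u (t s)))"
      have K: "K \<ge> 0" using C(1) M0 by (simp add: K_def)
      have "norm (Z s - Z 0) \<le> K * exp (Re (2 * wkb_log a \<theta> k (t s))) - K * exp (Re (2 * wkb_log a \<theta> k (t 0)))"
      proof (rule dominated_variation)
        fix x assume x: "x \<in> {0..s}"
        then have xT: "x \<in> {0..T}" using s by auto
        show "(Z has_vector_derivative - d * sector_rot k *
            (wkb a \<theta> k (t x) * wkb_residual a b \<theta>0 \<theta> k (t x) * u (t x))) (at x)"
          unfolding Z_def by (rule chain[OF xT wkb_defect_DERIV[OF sol]])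
        show "((\<lambda>s. 2 * wkb_log a \<theta> k (t s)) has_vector_derivative - 2 * d * sector_rot k * wkb_slope a \<theta> k (t x)) (at x)"
          using chain[OF xT DERIV_cmult[OF wkb_log_DERIV, of 2, unfolded mult.left_commute[of 2]]]
          by (simp add: mult_ac)
        have e: "exp (Re (2 * wkb_log a \<theta> k (t x))) = norm (wkb a \<theta> k (t x)) ^ 2"
          by (simp add: wkb_def norm_exp_eq_Re flip: exp_of_nat_mult)
        have "norm (- d * sector_rot k * (wkb a \<theta> k (t x) * wkb_residual a b \<theta>0 \<theta> k (t x) * u (t x)))
           = norm (wkb_residual a b \<theta>0 \<theta> k (t x)) * norm (v x) * norm (wkb a \<theta> k (t x)) ^ 2"
          by (simp add: norm_mult d v_def norm_divide power2_eq_square)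
        also have "\<dots> \<le> (C * (21 / 20 * r x) * M) * norm (wkb a \<theta> k (t x)) ^ 2"
        proof (intro mult_right_mono mult_mono M xT)
          have "norm (wkb_residual a b \<theta>0 \<theta> k (t x)) \<le> C * norm (exp (t x))"
            by (rule C) (rule nexpt[OF xT])
          also have "\<dots> \<le> C * (21 / 20 * r x)" using nexpt[OF xT] C(1) by (intro mult_left_mono) auto
          finally show "norm (wkb_residual a b \<theta>0 \<theta> k (t x)) \<le> C * (21 / 20 * r x)" .
        qed (use C(1) y(3)[OF xT] in auto)
        also have "C * (21 / 20 * r x) * M \<le> K * (1 / 10 * r x ^ 5)"
        proof -
          have "r s ^ 4 \<le> r x ^ 4" using rdec[of x s] x y(3)[OF s] by (intro power_mono) auto
          then have "C * (21 / 20 * r x) * M * r s ^ 4 \<le> C * (21 / 20 * r x) * M * r x ^ 4"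
            using C(1) M0 y(3)[OF xT] by (intro mult_left_mono) auto
          then show ?thesis using y(3)[OF s] unfolding K_def
            by (simp add: field_simps eval_nat_numeral)
        qed
        also have "K * (1 / 10 * r x ^ 5) \<le> K * Re (- 2 * d * sector_rot k * wkb_slope a \<theta> k (t x))"
          unfolding t_def r_def
          by (intro mult_left_mono R0(2) d K) (use y[OF xT] R in \<open>auto simp: r_def\<close>)
        finally show "norm (- d * sector_rot k * (wkb a \<theta> k (t x) * wkb_residual a b \<theta>0 \<theta> k (t x) * u (t x)))
          \<le> K * (Re (- 2 * d * sector_rot k * wkb_slope a \<theta> k (t x)) * exp (Re (2 * wkb_log a \<theta> k (t x))))"
          unfolding e by (simp add: mult_ac mult_right_mono)
      qed (use s in auto)
      moreover have "Z 0 = 0" using init by (simp add: Z_def t_def y_def)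
      moreover have "K * exp (Re (2 * wkb_log a \<theta> k (t 0))) \<ge> 0" using K by simp
      moreover have "exp (Re (2 * wkb_log a \<theta> k (t s))) = norm (wkb a \<theta> k (t s)) ^ 2"
        by (simp add: wkb_def norm_exp_eq_Re flip: exp_of_nat_mult)
      ultimately have "norm (Z s) \<le> K * norm (wkb a \<theta> k (t s)) ^ 2" by simp
      moreover have "P s = Z s / wkb a \<theta> k (t s) ^ 2" by (simp add: P_def Z_def power2_eq_square)
      ultimately show ?thesis unfolding K_def[symmetric]
        by (simp add: norm_divide norm_power divide_le_eq)
    qed
    have v1: "norm (v s - 1) \<le> 21 / 4 * C * M / r s ^ 3" if s: "s \<in> {0..T}" for s
    proof (cases "s = 0")
      case True
      then show ?thesis using v0 C M0 y(3)[OF s] by simp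
    next
      case False
      have "norm (v s - v 0) \<le> 21 / 4 * C * M / r s ^ 3 - 21 / 4 * C * M / r 0 ^ 3"
      proof (rule differentiable_bound_general)
        show "0 < s" using False s by simp
        show "continuous_on {0..s} v"
          by (intro continuous_at_imp_continuous_on ballI has_vector_derivative_continuous[OF dv]) (use s in auto)
        have dr: "((\<lambda>x. 21 / 4 * C * M / r x ^ 3) has_real_derivative 63 / 4 * C * M * Re d / r x ^ 4) (at x)"
          if "x \<in> {0..s}" for x
        proof -
          have r0: "r x \<noteq> 0" using y(3)[of x] that s by auto
          have r1: "(r has_real_derivative - Re d) (at x)"
            unfolding r_def y_def by (auto intro!: derivative_eq_intros)
          have "((\<lambda>x. 21 / 4 * C * M / r x ^ 3) has_real_derivative
              (0 * r x ^ 3 - 21 / 4 * C * M * (3 * (- Re d * r x ^ 2))) / (r x ^ 3 * r x ^ 3)) (at x)"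
            by (rule DERIV_divide DERIV_const derivative_eq_intros r1 refl | use r0 in simp)+
          then show ?thesis using r0 by (simp add: divide_simps eval_nat_numeral mult_ac)
        qed
        show "continuous_on {0..s} (\<lambda>x. 21 / 4 * C * M / r x ^ 3)"
          by (intro continuous_at_imp_continuous_on ballI DERIV_isCont[OF dr])
        fix x assume x: "0 < x" "x < s"
        then have xT: "x \<in> {0..T}" using s by auto
        show "(v has_vector_derivative - d * sector_rot k * P x) (at x)" by (rule dv[OF xT])
        show "((\<lambda>x. 21 / 4 * C * M / r x ^ 3) has_vector_derivative 63 / 4 * C * M * Re d / r x ^ 4) (at x)"
          using dr[of x] x by (simp add: has_real_derivative_iff_has_vector_derivative)
        have "norm (- d * sector_rot k * P x) = norm (P x)" by (simp add: norm_mult d)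
        also have "\<dots> \<le> 21 / 2 * C * M / r x ^ 4" by (rule P[OF xT])
        also have "\<dots> \<le> 63 / 4 * C * M * Re d / r x ^ 4"
        proof (rule divide_right_mono)
          have "(C * M) * (21 / 2) \<le> (C * M) * (63 / 4 * Re d)"
            using Red C(1) M0 by (intro mult_left_mono) auto
          then show "21 / 2 * C * M \<le> 63 / 4 * C * M * Re d" by (simp add: mult_ac)
        qed (use y(3)[OF xT] in auto)
        finally show "norm (- d * sector_rot k * P x) \<le> 63 / 4 * C * M * Re d / r x ^ 4" .
      qed
      moreover have "21 / 4 * C * M / r 0 ^ 3 \<ge> 0" using C(1) M0 y(3)[of 0] T by simp
      ultimately show ?thesis using v0 by simp
    qed
    \<comment> \<open>the bound for \<open>v - 1\<close> involves the maximum \<open>M\<close> of \<open>v\<close> itself; for \<open>R \<ge> 11 C\<close> it can be absorbed\<close>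
    have "M \<le> 2"
    proof -
      have "21 / 4 * C \<le> 1 / 2 * r s0" using R y(1)[OF s0(1)] C(1) by linarith
      also have "r s0 \<le> r s0 ^ 3" using y(1)[OF s0(1)] R by (intro self_le_power) auto
      finally have "21 / 4 * C * M \<le> 1 / 2 * r s0 ^ 3 * M" using M0 by (intro mult_right_mono) auto
      then have "21 / 4 * C * M / r s0 ^ 3 \<le> M / 2"
        using y(3)[OF s0(1)] by (simp add: divide_le_eq mult_ac)
      moreover have "M \<le> 1 + norm (v s0 - 1)"
        unfolding M_def using norm_triangle_ineq[of 1 "v s0 - 1"] by simp
      ultimately show ?thesis using v1[OF s0(1)] by linarith
    qed
    have "T \<in> {0..T}" using T by simp
    note TT = this
    have "C * M \<le> C * 2" using \<open>M \<le> 2\<close> C(1) by (intro mult_left_mono) auto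
    then have CM: "21 / 4 * C * M \<le> 21 * C" "21 / 2 * C * M \<le> 21 * C" using C(1) by simp_all
    have "norm (v T - 1) \<le> 21 * C / r T ^ 3"
      by (rule order_trans[OF v1[OF TT] divide_right_mono[OF CM(1)]]) (use y(3)[OF TT] in simp)
    moreover have "norm (P T) \<le> 21 * C / r T ^ 4"
      by (rule order_trans[OF P[OF TT] divide_right_mono[OF CM(2)]]) (use y(3)[OF TT] in simp)
    ultimately show "let y = N - of_real T * d; t = sector_log k y in
       norm (u t / wkb a \<theta> k t - 1) \<le> 21 * C / Re y ^ 3 \<and>
       norm ((cover_deriv u t - wkb_slope a \<theta> k t * u t) / wkb a \<theta> k t) \<le> 21 * C / Re y ^ 4"
      by (simp add: Let_def v_def P_def t_def r_def y_def)
  qed (use C(1) in simp)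
qed

text \<open>
  The subdominant solutions are constructed as linear combinations of two given independent solutions. The
  Frobenius solutions at the origin provide such a basis.
\<close>

locale solution_basis =
  fixes a b \<theta>0 \<theta> :: complex and \<phi>1 \<phi>2 :: "complex \<Rightarrow> complex"
  assumes basis_solution: "oscillator_solution (V10 a b \<theta>0 \<theta>) \<phi>1" "oscillator_solution (V10 a b \<theta>0 \<theta>) \<phi>2"
    and basis_wronskian: "wronskian \<phi>1 \<phi>2 0 \<noteq> 0"
begin

abbreviation sol :: "(complex \<Rightarrow> complex) \<Rightarrow> bool" where
  "sol \<equiv> oscillator_solution (V10 a b \<theta>0 \<theta>)"

text \<open>
  The subdominant solution is a limit of solutions that agree with the formal solution to first order
  at points \<open>N\<close> tending to infinity. The limit exists along a subsequence because the coordinates of these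
  solutions with respect to a basis are bounded, and it inherits the uniform estimates.
\<close>

lemma wkb_solution_cone:
  "\<exists>u R K. sol u \<and> R \<ge> 1 \<and> K \<ge> 0 \<and> (\<forall>y. Re y \<ge> R \<longrightarrow> \<bar>Im y\<bar> \<le> 3 / 10 * Re y \<longrightarrow>
     norm (u (sector_log k y) / wkb a \<theta> k (sector_log k y) - 1) \<le> K / Re y ^ 3 \<and>
     norm ((cover_deriv u (sector_log k y) - wkb_slope a \<theta> k (sector_log k y) * u (sector_log k y))
       / wkb a \<theta> k (sector_log k y)) \<le> K / Re y ^ 4)"
proof -
  from wkb_segment_estimate[of a b \<theta>0 \<theta> k] obtain R K where R: "R \<ge> 1" and K: "K \<ge> 0"
    and est: "\<And>u N d T. sol u \<Longrightarrow> norm d = 1 \<Longrightarrow> norm (d - 1) \<le> 3 / 100 \<Longrightarrow> T \<ge> 0 \<Longrightarrow>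
     (\<forall>s\<in>{0..T}. Re (N - of_real s * d) \<ge> R \<and> \<bar>Im (N - of_real s * d)\<bar> \<le> 3 / 10 * Re (N - of_real s * d)) \<Longrightarrow>
     u (sector_log k N) = wkb a \<theta> k (sector_log k N) \<Longrightarrow>
     cover_deriv u (sector_log k N) = wkb_slope a \<theta> k (sector_log k N) * u (sector_log k N) \<Longrightarrow>
     (let y = N - of_real T * d; t = sector_log k y in
       norm (u t / wkb a \<theta> k t - 1) \<le> K / Re y ^ 3 \<and>
       norm ((cover_deriv u t - wkb_slope a \<theta> k t * u t) / wkb a \<theta> k t) \<le> K / Re y ^ 4)"
    by blast
  define N where "N = (\<lambda>j::nat. 100 * (R + 1) + real j)"
  have "\<exists>u. sol u \<and> u t0 = wkb a \<theta> k t0 \<and> cover_deriv u t0 = wkb_slope a \<theta> k t0 * wkb a \<theta> k t0" for t0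
    by (rule solution_initial_value[OF basis_solution basis_wronskian])
  then have "\<forall>j. \<exists>u. sol u \<and> u (sector_log k (N j)) = wkb a \<theta> k (sector_log k (N j)) \<and>
     cover_deriv u (sector_log k (N j)) = wkb_slope a \<theta> k (sector_log k (N j)) * wkb a \<theta> k (sector_log k (N j))"
    by blast
  then obtain u where u: "\<And>j. sol (u j)"
    "\<And>j. u j (sector_log k (N j)) = wkb a \<theta> k (sector_log k (N j))"
    "\<And>j. cover_deriv (u j) (sector_log k (N j)) = wkb_slope a \<theta> k (sector_log k (N j)) * wkb a \<theta> k (sector_log k (N j))"
    by metis
  have bound: "norm (u j (sector_log k y) / wkb a \<theta> k (sector_log k y) - 1) \<le> K / Re y ^ 3 \<and>
     norm ((cover_deriv (u j) (sector_log k y) - wkb_slope a \<theta> k (sector_log k y) * u j (sector_log k y))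
       / wkb a \<theta> k (sector_log k y)) \<le> K / Re y ^ 4"
    if y: "Re y \<ge> R" "\<bar>Im y\<bar> \<le> 3 / 10 * Re y" and N: "N j \<ge> 100 * norm y" for y j
  proof -
    define M where "M = complex_of_real (N j)"
    define T where "T = norm (M - y)"
    \<comment> \<open>the segment from \<open>N j\<close> to \<open>y\<close> is almost parallel to the real axis when \<open>N j\<close> is large compared with \<open>y\<close>\<close>
    define d where "d = (M - y) / of_real T"
    have ny: "norm y \<ge> 1" using abs_Re_le_cmod[of y] y R by linarith
    have nM: "norm M = N j" using N ny unfolding M_def norm_of_real by linarith
    have T: "T \<ge> 99 * norm y"
      using norm_triangle_ineq2[of M y] N nM unfolding T_def by linarith
    have T0: "T > 0" using T ny by linarith
    have Td: "of_real T * d = M - y" using T0 by (simp add: d_def)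
    have d1: "norm d = 1" using T0 by (simp add: d_def norm_divide T_def)
    have "norm (of_real T * (d - 1)) = norm ((M - of_real T) - y)"
      unfolding right_diff_distrib Td by (simp add: algebra_simps)
    also have "\<dots> \<le> norm (M - of_real T) + norm y" by (rule norm_triangle_ineq4)
    also have "norm (M - of_real T) = \<bar>N j - T\<bar>"
      unfolding M_def by (simp only: of_real_diff[symmetric] norm_of_real)
    also have "\<bar>N j - T\<bar> \<le> norm y"
      using norm_triangle_ineq3[of M "M - y"] unfolding T_def nM by simp
    finally have "T * norm (d - 1) \<le> 2 * norm y" using T0 by (simp add: norm_mult)
    also have "\<dots> \<le> T * (3 / 100)" using T ny by linarith
    finally have d2: "norm (d - 1) \<le> 3 / 100" using T0 by simp
    have cone: "\<forall>s\<in>{0..T}. Re (M - of_real s * d) \<ge> R \<and> \<bar>Im (M - of_real s * d)\<bar> \<le> 3 / 10 * Re (M - of_real s * d)"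
    proof
      fix s assume s: "s \<in> {0..T}"
      define l where "l = s / T"
      have l: "0 \<le> l" "l \<le> 1" using s T0 by (auto simp: l_def)
      have "of_real s * d = of_real l * (M - y)" using T0 by (simp add: d_def l_def)
      then have e: "M - of_real s * d = of_real (1 - l) * M + of_real l * y" by (simp add: algebra_simps)
      have re: "Re (M - of_real s * d) = (1 - l) * N j + l * Re y" unfolding e by (simp add: M_def)
      have im: "Im (M - of_real s * d) = l * Im y" unfolding e by (simp add: M_def)
      have NR: "N j \<ge> R" using R by (simp add: N_def)
      have "(1 - l) * R + l * R \<le> (1 - l) * N j + l * Re y"
        using l NR y by (intro add_mono mult_left_mono) auto
      then have 1: "R \<le> (1 - l) * N j + l * Re y" by (simp add: algebra_simps)
      have "l * \<bar>Im y\<bar> \<le> l * (3 / 10 * Re y)" using l y by (intro mult_left_mono) auto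
      moreover have "(1 - l) * N j \<ge> 0" using l NR R by simp
      ultimately have "l * \<bar>Im y\<bar> \<le> 3 / 10 * ((1 - l) * N j + l * Re y)" by (simp add: algebra_simps)
      then show "Re (M - of_real s * d) \<ge> R \<and> \<bar>Im (M - of_real s * d)\<bar> \<le> 3 / 10 * Re (M - of_real s * d)"
        unfolding re im using 1 l by (simp add: abs_mult)
    qed
    have "M - of_real T * d = y" using Td by simp
    then show ?thesis
      using est[OF u(1) d1 d2 less_imp_le[OF T0] cone, of j] u(2,3)[of j] by (simp add: Let_def M_def)
  qed
  define A B where "A = (\<lambda>j. wronskian (u j) \<phi>2 0 / wronskian \<phi>1 \<phi>2 0)"
    and "B = (\<lambda>j. - (wronskian (u j) \<phi>1 0 / wronskian \<phi>1 \<phi>2 0))"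
  have AB: "u j = (\<lambda>t. A j * \<phi>1 t + B j * \<phi>2 t)" for j
    using solution_coordinates[OF basis_solution u(1)[of j] basis_wronskian]
    by (simp add: fun_eq_iff A_def B_def)
  have "\<exists>C. \<forall>j. norm (A j, B j) \<le> C"
  proof -
    \<comment> \<open>the coordinates are bounded because the solutions and their derivatives are bounded at one point\<close>
    define y where "y = complex_of_real (R + 1)"
    define t where "t = sector_log k y"
    define E where "E = norm (wkb a \<theta> k t)"
    have E: "E > 0" by (simp add: E_def)
    have ry: "Re y = R + 1" "Im y = 0" "norm y = R + 1" using R by (simp_all add: y_def del: of_real_add)
    have Kp: "K / Re y ^ 3 \<le> K" "K / Re y ^ 4 \<le> K"
      unfolding ry using R K divide_left_mono[of 1 _ K] by (auto simp: one_le_power)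
    define C1 C2 where "C1 = (1 + K) * E" and "C2 = norm (wkb_slope a \<theta> k t) * C1 + K * E"
    have b: "norm (u j t) \<le> C1" "norm (cover_deriv (u j) t) \<le> C2" for j
    proof -
      have N: "N j \<ge> 100 * norm y" by (simp add: ry N_def)
      have "\<bar>Im y\<bar> \<le> 3 / 10 * Re y" "Re y \<ge> R" using ry R by auto
      note bd = bound[OF this(2,1) N, folded t_def]
      have "norm (u j t / wkb a \<theta> k t) \<le> norm (u j t / wkb a \<theta> k t - 1) + 1"
        using norm_triangle_ineq[of "u j t / wkb a \<theta> k t - 1" 1] by simp
      also have "\<dots> \<le> 1 + K" using bd Kp by linarith
      finally show b1: "norm (u j t) \<le> C1" using E by (simp add: norm_divide E_def C1_def divide_le_eq)
      have "norm ((cover_deriv (u j) t - wkb_slope a \<theta> k t * u j t) / wkb a \<theta> k t) \<le> K"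
        using bd Kp by linarith
      then have "norm (cover_deriv (u j) t - wkb_slope a \<theta> k t * u j t) \<le> K * E"
        using E by (simp add: norm_divide E_def divide_le_eq)
      moreover have "norm (cover_deriv (u j) t) \<le> norm (wkb_slope a \<theta> k t * u j t) +
          norm (cover_deriv (u j) t - wkb_slope a \<theta> k t * u j t)"
        using norm_triangle_ineq[of "wkb_slope a \<theta> k t * u j t" "cover_deriv (u j) t - wkb_slope a \<theta> k t * u j t"]
        by simp
      moreover have "norm (wkb_slope a \<theta> k t * u j t) \<le> norm (wkb_slope a \<theta> k t) * C1"
        unfolding norm_mult by (intro mult_left_mono b1) auto
      ultimately show "norm (cover_deriv (u j) t) \<le> C2" by (simp add: C2_def)
    qed
    have wb: "norm (wronskian (u j) \<phi> 0) \<le> C1 * norm (cover_deriv \<phi> t) + C2 * norm (\<phi> t)"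
      if "sol \<phi>" for \<phi> j
    proof -
      have "norm (wronskian (u j) \<phi> t) \<le> norm (u j t) * norm (cover_deriv \<phi> t) + norm (cover_deriv (u j) t) * norm (\<phi> t)"
        unfolding wronskian_def by (metis norm_mult norm_triangle_ineq4)
      also have "\<dots> \<le> C1 * norm (cover_deriv \<phi> t) + C2 * norm (\<phi> t)"
        by (intro add_mono mult_right_mono b) auto
      finally show ?thesis using wronskian_const[OF u(1) that, of j t] by simp
    qed
    define C where "C = (C1 * norm (cover_deriv \<phi>2 t) + C2 * norm (\<phi>2 t)) / norm (wronskian \<phi>1 \<phi>2 0)
      + (C1 * norm (cover_deriv \<phi>1 t) + C2 * norm (\<phi>1 t)) / norm (wronskian \<phi>1 \<phi>2 0)"
    have "norm (A j) + norm (B j) \<le> C" for j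
      unfolding A_def B_def C_def norm_minus_cancel norm_divide
      by (intro add_mono divide_right_mono wb basis_solution) auto
    then show ?thesis using norm_Pair_le order_trans by blast
  qed
  then have "bounded (range (\<lambda>j. (A j, B j)))" by (auto simp: bounded_iff)
  from bounded_imp_convergent_subsequence[OF this] obtain l r
    where r: "strict_mono r" and lim: "((\<lambda>j. (A j, B j)) \<circ> r) \<longlonglongrightarrow> l" by blast
  have limA: "(\<lambda>i. A (r i)) \<longlonglongrightarrow> fst l" and limB: "(\<lambda>i. B (r i)) \<longlonglongrightarrow> snd l"
    using tendsto_fst[OF lim] tendsto_snd[OF lim] by (simp_all add: o_def)
  define v where "v = (\<lambda>t. fst l * \<phi>1 t + snd l * \<phi>2 t)"
  have solv: "sol v" unfolding v_def by (rule solution_lincomb[OF basis_solution])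
  have limu: "(\<lambda>i. u (r i) t) \<longlonglongrightarrow> v t" for t
    unfolding AB v_def by (intro tendsto_intros limA limB)
  have limu': "(\<lambda>i. cover_deriv (u (r i)) t) \<longlonglongrightarrow> cover_deriv v t" for t
    unfolding AB v_def solution_lincomb(2)[OF basis_solution] by (intro tendsto_intros limA limB)
  have "norm (v (sector_log k y) / wkb a \<theta> k (sector_log k y) - 1) \<le> K / Re y ^ 3 \<and>
     norm ((cover_deriv v (sector_log k y) - wkb_slope a \<theta> k (sector_log k y) * v (sector_log k y))
       / wkb a \<theta> k (sector_log k y)) \<le> K / Re y ^ 4" if y: "Re y \<ge> R" "\<bar>Im y\<bar> \<le> 3 / 10 * Re y" for y
  proof -
    have ev: "eventually (\<lambda>i. N (r i) \<ge> 100 * norm y) sequentially"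
    proof -
      obtain i0 :: nat where i0: "real i0 \<ge> 100 * norm y" using real_arch_simple by blast
      have "N (r i) \<ge> 100 * norm y" if "i \<ge> i0" for i
      proof -
        have "real (r i) \<ge> real i0" using seq_suble[OF r, of i] that by linarith
        then show ?thesis using i0 R by (simp add: N_def)
      qed
      then show ?thesis by (auto simp: eventually_sequentially)
    qed
    show ?thesis
    proof
      show "norm (v (sector_log k y) / wkb a \<theta> k (sector_log k y) - 1) \<le> K / Re y ^ 3"
        by (rule tendsto_upperbound[of "\<lambda>i. norm (u (r i) (sector_log k y) / wkb a \<theta> k (sector_log k y) - 1)" _ sequentially])
          (auto intro!: tendsto_intros limu eventually_mono[OF ev] dest: bound[OF y])
      show "norm ((cover_deriv v (sector_log k y) - wkb_slope a \<theta> k (sector_log k y) * v (sector_log k y))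
         / wkb a \<theta> k (sector_log k y)) \<le> K / Re y ^ 4"
        by (rule tendsto_upperbound[of "\<lambda>i. norm ((cover_deriv (u (r i)) (sector_log k y)
              - wkb_slope a \<theta> k (sector_log k y) * u (r i) (sector_log k y)) / wkb a \<theta> k (sector_log k y))" _ sequentially])
          (auto intro!: tendsto_intros limu limu' eventually_mono[OF ev] dest: bound[OF y])
    qed
  qed
  then show ?thesis using solv R K by blast
qed

end

text \<open>
  Any half-opening between \<open>pi / 12\<close> and \<open>pi / 10\<close> would serve; this one is the half-opening of the cone with
  slope \<open>3 / 10\<close>.
\<close>

definition wide_angle :: real where
  "wide_angle = arctan (3 / 10)"

lemma wide_angle_bounds: "pi / 12 < wide_angle" "wide_angle < pi / 6"
proof -
  have "arctan (3 / 10) + arctan (3 / 10) = arctan (60 / 91)"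
    by (subst arctan_add) auto
  moreover have "arctan (60 / 91) + arctan (3 / 10) = arctan ((60 / 91 + 3 / 10) / (1 - 60 / 91 * (3 / 10)))"
    by (subst arctan_add) auto
  moreover have "\<dots> > arctan 1" by (subst arctan_less_iff) (simp add: field_simps)
  ultimately show "pi / 12 < wide_angle" by (simp add: wide_angle_def arctan_one)
  have "arctan (3 / 10) < arctan 1 / 2 + arctan 1 / 6"
  proof -
    have "arctan (60 / 91) < arctan 1" by (subst arctan_less_iff) simp
    then show ?thesis
      using \<open>arctan (3 / 10) + arctan (3 / 10) = arctan (60 / 91)\<close> zero_less_arctan_iff[of 1]
      by linarith
  qed
  then show "wide_angle < pi / 6" by (simp add: wide_angle_def arctan_one)
qed

text \<open>
  It is essential that the asymptotics hold beyond the Stokes sector of half-opening \<open>pi / 12\<close>, across both of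
  its boundary rays: neighbouring subdominant solutions can then be compared on the ray between them.
\<close>

lemma (in solution_basis) wkb_solution:
  "\<exists>u B K. sol u \<and> K \<ge> 0 \<and> B \<ge> 0 \<and> (\<forall>t. Re t \<ge> B \<longrightarrow> \<bar>Im t - of_int k * pi / 6\<bar> \<le> wide_angle \<longrightarrow>
     norm (u t / wkb a \<theta> k t - 1) \<le> K * exp (- (3 * Re t)) \<and>
     norm ((cover_deriv u t - wkb_slope a \<theta> k t * u t) / wkb a \<theta> k t) \<le> K * exp (- (4 * Re t)))"
proof -
  from wkb_solution_cone[of k] obtain u R K where sol: "sol u" and R: "R \<ge> 1" and K: "K \<ge> 0"
    and est: "\<And>y. Re y \<ge> R \<Longrightarrow> \<bar>Im y\<bar> \<le> 3 / 10 * Re y \<Longrightarrow>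
     norm (u (sector_log k y) / wkb a \<theta> k (sector_log k y) - 1) \<le> K / Re y ^ 3 \<and>
     norm ((cover_deriv u (sector_log k y) - wkb_slope a \<theta> k (sector_log k y) * u (sector_log k y))
       / wkb a \<theta> k (sector_log k y)) \<le> K / Re y ^ 4" by blast
  have "norm (u t / wkb a \<theta> k t - 1) \<le> (2 * K) * exp (- (3 * Re t)) \<and>
     norm ((cover_deriv u t - wkb_slope a \<theta> k t * u t) / wkb a \<theta> k t) \<le> (2 * K) * exp (- (4 * Re t))"
    if t: "Re t \<ge> ln (21 / 20 * R)" "\<bar>Im t - of_int k * pi / 6\<bar> \<le> wide_angle" for t
  proof -
    define s where "s = t - \<i> * of_real (of_int k * pi / 6)"
    define y where "y = exp s"
    have ims: "\<bar>Im s\<bar> \<le> wide_angle" "Re s = Re t" using t(2) by (simp_all add: s_def)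
    then have ims2: "\<bar>Im s\<bar> < pi / 6" using wide_angle_bounds by linarith
    have "sector_log k y = t"
    proof -
      have "Ln y = s" unfolding y_def using ims2 pi_gt_zero by (intro Ln_exp) linarith+
      then show ?thesis by (simp add: sector_log_def s_def)
    qed
    have c: "cos (Im s) > 0" using ims2 by (intro cos_gt_zero_pi) linarith+
    have y: "Re y = exp (Re t) * cos (Im s)" "Im y = exp (Re t) * sin (Im s)"
      using ims by (simp_all add: y_def Re_exp Im_exp)
    have "\<bar>tan (Im s)\<bar> \<le> 3 / 10"
    proof -
      have "tan \<bar>Im s\<bar> \<le> tan wide_angle"
        by (rule tan_mono_le) (use ims wide_angle_bounds pi_gt_zero in \<open>auto\<close>)
      moreover have "tan wide_angle = 3 / 10" by (simp add: wide_angle_def tan_arctan)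
      moreover have "\<bar>tan (Im s)\<bar> = tan \<bar>Im s\<bar>"
      proof -
        have "tan \<bar>Im s\<bar> \<ge> 0"
          using ims2 pi_gt_zero by (cases "Im s = 0") (auto intro!: less_imp_le[OF tan_gt_zero])
        then show ?thesis by (auto simp: abs_if)
      qed
      ultimately show ?thesis by simp
    qed
    then have cone: "\<bar>Im y\<bar> \<le> 3 / 10 * Re y"
      unfolding y using c by (simp add: tan_def abs_mult divide_le_eq mult_left_mono mult.left_commute)
    have ny: "norm y = exp (Re t)" by (simp add: y_def ims)
    have "exp (Re t) \<ge> exp (ln (21 / 20 * R))" using t(1) by (simp only: exp_le_cancel_iff)
    then have "exp (Re t) \<ge> 21 / 20 * R" using R by simp
    moreover have low: "exp (Re t) \<le> 21 / 20 * Re y" using cone_norm_le[OF cone] by (simp add: ny)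
    ultimately have yR: "Re y \<ge> R" by linarith
    then have y0: "Re y > 0" using R by linarith
    have pw: "K / Re y ^ n \<le> (2 * K) * exp (- (real n * Re t))" if "(21 / 20 :: real) ^ n \<le> 2" for n
    proof -
      have "exp (real n * Re t) = exp (Re t) ^ n" by (simp add: exp_of_nat_mult)
      also have "\<dots> \<le> (21 / 20 * Re y) ^ n" using low by (intro power_mono) auto
      also have "\<dots> = (21 / 20) ^ n * Re y ^ n" by (rule power_mult_distrib)
      also have "\<dots> \<le> 2 * Re y ^ n" using that y0 by (intro mult_right_mono) auto
      finally have "K * exp (real n * Re t) \<le> K * (2 * Re y ^ n)" using K by (intro mult_left_mono) auto
      then show ?thesis using y0 by (simp add: exp_minus field_simps)
    qed
    show ?thesis
      using est[OF yR cone] pw[of 3] pw[of 4] unfolding \<open>sector_log k y = t\<close>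
      by (auto simp: power_divide)
  qed
  moreover have "ln (21 / 20 * R) \<ge> 0" using R by simp
  ultimately show ?thesis using sol K by (intro exI[of _ u] exI[of _ "ln (21 / 20 * R)"] exI[of _ "2 * K"]) auto
qed

section \<open>Dominance in Stokes sectors\<close>

lemma eventually_sector:
  "eventually P (sector_at_infinity k \<delta>) \<longleftrightarrow>
     (\<exists>B. \<forall>t. Re t \<ge> B \<longrightarrow> \<bar>Im t - of_int k * pi / 6\<bar> \<le> \<delta> \<longrightarrow> P t)"
  unfolding sector_at_infinity_def eventually_inf_principal
    eventually_filtercomap_at_top_linorder by auto

lemma sector_at_infinity_nontrivial:
  assumes "\<delta> \<ge> 0" shows "sector_at_infinity k \<delta> \<noteq> bot"
proof -
  have "\<not> eventually (\<lambda>_. False) (sector_at_infinity k \<delta>)"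
  proof
    assume "eventually (\<lambda>_. False) (sector_at_infinity k \<delta>)"
    then obtain B where "\<And>t. Re t \<ge> B \<Longrightarrow> \<bar>Im t - of_int k * pi / 6\<bar> \<le> \<delta> \<Longrightarrow> False"
      by (auto simp: eventually_sector)
    from this[of "Complex B (of_int k * pi / 6)"] show False using assms by simp
  qed
  then show ?thesis by (auto simp: trivial_limit_def)
qed

lemma sector_at_infinity_mono: "\<delta> \<le> \<delta>' \<Longrightarrow> sector_at_infinity k \<delta> \<le> sector_at_infinity k \<delta>'"
  unfolding sector_at_infinity_def by (intro inf_mono order_refl) auto

lemma exp_decay_in_sector:
  assumes "c > 0"
  shows "((\<lambda>t. exp (- (c * Re t))) \<longlongrightarrow> 0) (sector_at_infinity k \<delta>)"
proof -
  have "filterlim Re at_top (sector_at_infinity k \<delta>)"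
    unfolding sector_at_infinity_def by (rule filterlim_mono[OF filterlim_filtercomap order_refl inf_le1])
  then have "filterlim (\<lambda>t. c * Re t) at_top (sector_at_infinity k \<delta>)"
    using assms by (intro filterlim_tendsto_pos_mult_at_top[OF tendsto_const])
  then have "filterlim (\<lambda>t. - (c * Re t)) at_bot (sector_at_infinity k \<delta>)"
    by (simp add: filterlim_uminus_at_bot)
  then show ?thesis by (rule filterlim_compose[OF exp_at_bot])
qed

lemma exp_neg_tendsto_0_sector:
  assumes "c > 0"
  shows "((\<lambda>t. exp (- (of_real c * t))) \<longlongrightarrow> 0) (sector_at_infinity k \<delta>)"
  by (rule tendsto_norm_zero_cancel) (use exp_decay_in_sector[OF assms] in simp)

lemma wkb_sign_exp: "- wkb_sign k * exp (6 * t) = exp (6 * (t - \<i> * of_real (of_int k * pi / 6)))"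
proof -
  have "exp (6 * (t - \<i> * of_real (of_int k * pi / 6))) = exp (6 * t) / exp (\<i> * of_real (of_int k * pi))"
    by (simp add: exp_diff[symmetric] algebra_simps)
  then show ?thesis by (simp only: exp_i_pi_int) (simp add: wkb_sign_def)
qed

text \<open>
  A solution that is independent of the subdominant one is exponentially larger in the sector. With
  \<open>g = u / \<psi>\<close>, the derivative of \<open>g\<close> is a constant multiple of \<open>1 / \<psi>\<^sup>2\<close>, hence asymptotically the derivative of
  \<open>C exp \<Lambda>\<close> with \<open>\<Lambda> = - 2 log \<psi> - 5 log x\<close>; integration along rays shows that the difference is
  negligible against \<open>exp (Re \<Lambda>)\<close>, which tends to infinity.
\<close>

lemma dominant_over_subdominant:
  assumes sol: "oscillator_solution V \<psi>" "oscillator_solution V u"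
    and \<delta>: "0 \<le> \<delta>" "\<delta> < pi / 12"
    and lim: "((\<lambda>t. \<psi> t / wkb a \<theta> k t) \<longlongrightarrow> c) (sector_at_infinity k \<delta>)" and c: "c \<noteq> 0"
    and wr: "wronskian u \<psi> 0 \<noteq> 0"
  shows "filterlim (\<lambda>t. u t / \<psi> t) at_infinity (sector_at_infinity k \<delta>)"
proof -
  let ?F = "sector_at_infinity k \<delta>"
  define w \<sigma> p where "w = wronskian u \<psi> 0" and "\<sigma> = wkb_sign k" and "p = wkb_exponent \<theta> k"
  define S :: complex where "S = of_real (sqrt 3) * a"
  define C where "C = \<sigma> * w / (2 * c\<^sup>2)"
  have \<sigma>: "\<sigma> * \<sigma> = 1" "norm \<sigma> = 1" by (simp_all add: \<sigma>_def)
  have C: "C \<noteq> 0" using \<sigma>(1) wr c by (auto simp: C_def w_def)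
  have C\<sigma>: "2 * (C * \<sigma>) = w / c\<^sup>2" using \<sigma>(1) by (simp add: C_def mult_ac)
  define \<Lambda> where "\<Lambda> = (\<lambda>t. - 2 * wkb_log a \<theta> k t - 5 * t)"
  define \<Lambda>' where "\<Lambda>' = (\<lambda>t. 2 * (- \<sigma> * exp (6 * t)) - 2 * \<sigma> * S * exp (3 * t) - (2 * p + 5))"
  have slope: "exp t * wkb_slope a \<theta> k t = p + \<sigma> * (exp (6 * t) + S * exp (3 * t))" for t
    unfolding wkb_slope_def p_def \<sigma>_def S_def exp_of_nat_mult[of 5 t, symmetric] exp_of_nat_mult[of 2 t, symmetric]
    by (simp add: algebra_simps flip: exp_add)
  have d\<Lambda>: "(\<Lambda> has_field_derivative \<Lambda>' t) (at t)" for t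
    unfolding \<Lambda>_def \<Lambda>'_def
    by (rule derivative_eq_intros wkb_log_DERIV refl)+ (simp add: slope algebra_simps)
  define g where "g = (\<lambda>t. u t / \<psi> t)"
  define v where "v = (\<lambda>t. \<psi> t / wkb a \<theta> k t)"
  define \<eta> where "\<eta> = (\<lambda>t. w / c\<^sup>2 - w / (v t)\<^sup>2 + C * (2 * \<sigma> * S * exp (- (3 * t)) + (2 * p + 5) * exp (- (6 * t))))"
  define h where "h = (\<lambda>t. g t - C * exp (\<Lambda> t))"
  have dh: "(h has_field_derivative exp (\<Lambda> t) * exp (6 * t) * \<eta> t) (at t)" if "\<psi> t \<noteq> 0" for t
  proof -
    have dg: "(g has_field_derivative exp t * (- w) / (\<psi> t)\<^sup>2) (at t)"
    proof -
      have "u t * cover_deriv \<psi> t - cover_deriv u t * \<psi> t = w"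
        using wronskian_const[OF sol(2,1), of t] by (simp add: w_def wronskian_def)
      then have "exp t * (- w) = exp t * cover_deriv u t * \<psi> t - u t * (exp t * cover_deriv \<psi> t)"
        by (simp add: algebra_simps flip: \<open>_ = w\<close>)
      then show ?thesis unfolding g_def power2_eq_square
        using DERIV_divide[OF solution_DERIV[OF sol(2)] solution_DERIV[OF sol(1)] that] by simp
    qed
    have "((\<lambda>t. C * exp (\<Lambda> t)) has_field_derivative C * (exp (\<Lambda> t) * \<Lambda>' t)) (at t)"
      by (auto intro!: derivative_eq_intros d\<Lambda>)
    note DERIV_diff[OF dg this]
    moreover have "exp t * (- w) / (\<psi> t)\<^sup>2 - C * (exp (\<Lambda> t) * \<Lambda>' t) = exp (\<Lambda> t) * exp (6 * t) * \<eta> t"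
    proof -
      have "exp (\<Lambda> t) * exp (6 * t) = exp t / (wkb a \<theta> k t)\<^sup>2"
        by (simp add: \<Lambda>_def wkb_def power2_eq_square exp_diff exp_add[symmetric])
          (simp add: exp_add[symmetric] exp_diff[symmetric] field_simps)
      moreover have "exp t * (- w) / (\<psi> t)\<^sup>2 = exp t / (wkb a \<theta> k t)\<^sup>2 * (- w / (v t)\<^sup>2)"
        by (simp add: v_def power_divide)
      ultimately have 1: "exp t * (- w) / (\<psi> t)\<^sup>2 = exp (\<Lambda> t) * exp (6 * t) * (- w / (v t)\<^sup>2)"
        by (simp only:)
      have L: "\<Lambda>' t = exp (6 * t) * (- 2 * \<sigma> - 2 * \<sigma> * S * exp (- (3 * t)) - (2 * p + 5) * exp (- (6 * t)))"
        unfolding \<Lambda>'_def by (simp add: algebra_simps flip: exp_add)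
      show ?thesis unfolding 1 \<eta>_def C\<sigma>[symmetric] L by (simp add: algebra_simps)
    qed
    ultimately show ?thesis unfolding h_def by simp
  qed
  define \<kappa> where "\<kappa> = cos (6 * \<delta>)"
  have \<kappa>: "\<kappa> > 0" unfolding \<kappa>_def using \<delta> by (intro cos_gt_zero_pi) auto
  have "(\<eta> \<longlongrightarrow> w / c\<^sup>2 - w / c\<^sup>2 + C * (2 * \<sigma> * S * 0 + (2 * p + 5) * 0)) ?F"
    unfolding \<eta>_def v_def
    using exp_neg_tendsto_0_sector[of 3 k \<delta>] exp_neg_tendsto_0_sector[of 6 k \<delta>]
    by (intro tendsto_intros lim) (use c in auto)
  then have \<eta>0: "(\<eta> \<longlongrightarrow> 0) ?F" by simp
  define K where "K = norm C / 2"
  have K: "K > 0" using C by (simp add: K_def)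
  have ev1: "eventually (\<lambda>t. norm (\<eta> t) < K * \<kappa>) ?F"
    using tendstoD[OF \<eta>0, of "K * \<kappa>"] K \<kappa> by (simp add: dist_norm)
  have e0: "((\<lambda>t. 2 * \<sigma> * S * exp (- (3 * t)) + (2 * p + 5) * exp (- (6 * t))) \<longlongrightarrow> 2 * \<sigma> * S * 0 + (2 * p + 5) * 0) ?F"
    using exp_neg_tendsto_0_sector[of 3 k \<delta>] exp_neg_tendsto_0_sector[of 6 k \<delta>]
    by (intro tendsto_intros) auto
  have ev2: "eventually (\<lambda>t. norm (2 * \<sigma> * S * exp (- (3 * t)) + (2 * p + 5) * exp (- (6 * t))) < \<kappa>) ?F"
    using tendstoD[OF e0 \<kappa>] by (simp add: dist_norm)
  have ev3: "eventually (\<lambda>t. \<psi> t \<noteq> 0) ?F"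
    using tendsto_imp_eventually_ne[OF lim c] by eventually_elim auto
  obtain B where B: "\<And>t. Re t \<ge> B \<Longrightarrow> \<bar>Im t - of_int k * pi / 6\<bar> \<le> \<delta> \<Longrightarrow>
      norm (\<eta> t) < K * \<kappa> \<and> norm (2 * \<sigma> * S * exp (- (3 * t)) + (2 * p + 5) * exp (- (6 * t))) < \<kappa> \<and> \<psi> t \<noteq> 0"
    using eventually_conj[OF ev1 eventually_conj[OF ev2 ev3]] by (auto simp: eventually_sector)
  \<comment> \<open>all quantities are bounded on the left edge; the integration proceeds from there along horizontal rays\<close>
  define \<tau>0 where "\<tau>0 = max B 0"
  have Re\<Lambda>': "Re (\<Lambda>' t) \<ge> \<kappa> * norm (exp (6 * t))"
    if t: "Re t \<ge> \<tau>0" "\<bar>Im t - of_int k * pi / 6\<bar> \<le> \<delta>" for t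
  proof -
    have "\<Lambda>' t = 2 * (- \<sigma> * exp (6 * t)) - exp (6 * t) * (2 * \<sigma> * S * exp (- (3 * t)) + (2 * p + 5) * exp (- (6 * t)))"
      unfolding \<Lambda>'_def by (simp add: algebra_simps flip: exp_add)
    moreover have "Re (- \<sigma> * exp (6 * t)) \<ge> \<kappa> * norm (exp (6 * t))"
    proof -
      have "\<bar>6 * (Im t - of_int k * pi / 6)\<bar> \<le> 6 * \<delta>" using t by simp
      then have "cos (6 * \<delta>) \<le> cos \<bar>6 * (Im t - of_int k * pi / 6)\<bar>"
        using \<delta> by (intro cos_monotone_0_pi_le) auto
      then have "cos (6 * (Im t - of_int k * pi / 6)) \<ge> \<kappa>" by (simp add: \<kappa>_def)
      then show ?thesis unfolding \<sigma>_def wkb_sign_exp Re_exp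
        by (simp add: mult_left_mono mult.commute)
    qed
    moreover have "Re (exp (6 * t) * (2 * \<sigma> * S * exp (- (3 * t)) + (2 * p + 5) * exp (- (6 * t)))) \<le> norm (exp (6 * t)) * \<kappa>"
    proof -
      have "norm (2 * \<sigma> * S * exp (- (3 * t)) + (2 * p + 5) * exp (- (6 * t))) \<le> \<kappa>"
        using B[OF _ t(2)] t(1) by (simp add: \<tau>0_def less_imp_le)
      then have "norm (exp (6 * t) * (2 * \<sigma> * S * exp (- (3 * t)) + (2 * p + 5) * exp (- (6 * t)))) \<le> norm (exp (6 * t)) * \<kappa>"
        unfolding norm_mult by (intro mult_left_mono) auto
      then show ?thesis using complex_Re_le_cmod order_trans by blast
    qed
    moreover have "Re (2 * (- \<sigma> * exp (6 * t))) = 2 * Re (- \<sigma> * exp (6 * t))" by simp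
    ultimately show ?thesis by (simp only: minus_complex.simps) (simp only: mult.commute; linarith)
  qed
  define Q where "Q = (\<lambda>\<alpha>. Complex \<tau>0 \<alpha>) ` {of_int k * pi / 6 - \<delta>..of_int k * pi / 6 + \<delta>}"
  have Qc: "compact Q"
    unfolding Q_def Complex_eq by (intro compact_continuous_image continuous_intros) auto
  have Qne: "Q \<noteq> {}" using \<delta> by (auto simp: Q_def)
  have Qin: "Re t = \<tau>0" "\<bar>Im t - of_int k * pi / 6\<bar> \<le> \<delta>" if "t \<in> Q" for t
    using that by (auto simp: Q_def abs_le_iff)
  have "continuous_on Q (\<lambda>t. norm (h t))"
    using Qin B by (intro continuous_on_norm continuous_at_imp_continuous_on ballI DERIV_isCont[OF dh])
      (auto simp: \<tau>0_def)
  then obtain H where H: "\<And>t. t \<in> Q \<Longrightarrow> norm (h t) \<le> H"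
    using continuous_attains_sup[OF Qc Qne, of "\<lambda>t. norm (h t)"] by blast
  have "continuous_on Q (\<lambda>t. Re (\<Lambda> t))"
    by (intro continuous_on_Re continuous_at_imp_continuous_on ballI DERIV_isCont[OF d\<Lambda>])
  then obtain L where L: "\<And>t. t \<in> Q \<Longrightarrow> L \<le> Re (\<Lambda> t)"
    using continuous_attains_inf[OF Qc Qne, of "\<lambda>t. Re (\<Lambda> t)"] by blast
  have low: "norm (g t) \<ge> K * exp (L + \<kappa> * (Re t - \<tau>0)) - H"
    if t: "Re t \<ge> \<tau>0" "\<bar>Im t - of_int k * pi / 6\<bar> \<le> \<delta>" for t
  proof -
    define q where "q = (\<lambda>s::real. Complex s (Im t))"
    have q: "q s = of_real s + \<i> * of_real (Im t)" for s by (simp add: q_def Complex_eq)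
    have qin: "Re (q s) \<ge> \<tau>0" "\<bar>Im (q s) - of_int k * pi / 6\<bar> \<le> \<delta>" if "s \<in> {\<tau>0..Re t}" for s
      using that t by (auto simp: q_def)
    have dq: "(q has_vector_derivative 1) (at s)" for s
      unfolding q[abs_def]
      by (rule has_vector_derivative_eq_rhs[OF has_vector_derivative_add[OF
              has_vector_derivative_of_real[OF DERIV_ident] has_vector_derivative_const]]) simp
    have d1: "((\<lambda>s. h (q s)) has_vector_derivative exp (\<Lambda> (q s)) * exp (6 * q s) * \<eta> (q s)) (at s)"
      if "s \<in> {\<tau>0..Re t}" for s
    proof -
      have "\<psi> (q s) \<noteq> 0" using B[OF _ qin(2)[OF that]] qin(1)[OF that] by (simp add: \<tau>0_def)
      then show ?thesis using field_vector_diff_chain_at[OF dq dh] by (simp add: o_def)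
    qed
    have d2: "((\<lambda>s. \<Lambda> (q s)) has_vector_derivative \<Lambda>' (q s)) (at s)" for s
      using field_vector_diff_chain_at[OF dq d\<Lambda>] by (simp add: o_def)
    have "norm (h (q (Re t)) - h (q \<tau>0)) \<le> K * exp (Re (\<Lambda> (q (Re t)))) - K * exp (Re (\<Lambda> (q \<tau>0)))"
    proof (rule dominated_variation[OF t(1) d1 d2])
      fix s assume s: "s \<in> {\<tau>0..Re t}"
      have "norm (\<eta> (q s)) \<le> K * \<kappa>"
        using B[OF _ qin(2)[OF s]] qin(1)[OF s] by (simp add: \<tau>0_def less_imp_le)
      then have "norm (exp (\<Lambda> (q s)) * exp (6 * q s) * \<eta> (q s)) \<le> norm (exp (\<Lambda> (q s))) * norm (exp (6 * q s)) * (K * \<kappa>)"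
        unfolding norm_mult by (intro mult_left_mono) auto
      also have "\<dots> = K * ((\<kappa> * norm (exp (6 * q s))) * norm (exp (\<Lambda> (q s))))" by simp
      also have "\<dots> \<le> K * (Re (\<Lambda>' (q s)) * norm (exp (\<Lambda> (q s))))"
        using K by (intro mult_left_mono mult_right_mono Re\<Lambda>' qin[OF s]) auto
      finally show "norm (exp (\<Lambda> (q s)) * exp (6 * q s) * \<eta> (q s)) \<le> K * (Re (\<Lambda>' (q s)) * exp (Re (\<Lambda> (q s))))"
        by simp
    qed
    moreover have qt: "q (Re t) = t" by (simp add: q_def)
    moreover have q0: "q \<tau>0 \<in> Q" unfolding Q_def q_def using t by (auto simp: abs_le_iff)
    moreover have "K * exp (Re (\<Lambda> (q \<tau>0))) \<ge> 0" using K by simp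
    ultimately have "norm (h t - h (q \<tau>0)) \<le> K * exp (Re (\<Lambda> t))" by simp
    then have "norm (h t) \<le> K * exp (Re (\<Lambda> t)) + H"
      using H[OF q0] norm_triangle_ineq[of "h t - h (q \<tau>0)" "h (q \<tau>0)"] by simp
    moreover have "norm (C * exp (\<Lambda> t)) \<le> norm (h t) + norm (g t)"
      unfolding h_def using norm_triangle_ineq4[of "g t" "g t - C * exp (\<Lambda> t)"] by simp
    moreover have "norm (C * exp (\<Lambda> t)) = 2 * K * exp (Re (\<Lambda> t))" by (simp add: norm_mult K_def)
    ultimately have 1: "norm (g t) \<ge> K * exp (Re (\<Lambda> t)) - H" by linarith
    have "Re (\<Lambda> t) \<ge> Re (\<Lambda> (q \<tau>0)) + \<kappa> * (Re t - \<tau>0)"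
    proof (cases "Re t = \<tau>0")
      case False
      have "norm (complex_of_real (\<kappa> * Re t) - complex_of_real (\<kappa> * \<tau>0)) \<le> Re (\<Lambda> (q (Re t))) - Re (\<Lambda> (q \<tau>0))"
      proof (rule differentiable_bound_general[where f' = "\<lambda>_. complex_of_real \<kappa>" and \<phi>' = "\<lambda>s. Re (\<Lambda>' (q s))"])
        show "\<tau>0 < Re t" using False t by simp
        have d3: "((\<lambda>s. Re (\<Lambda> (q s))) has_vector_derivative Re (\<Lambda>' (q s))) (at s)" for s
          by (rule bounded_linear.has_vector_derivative[OF bounded_linear_Re d2])
        then show "((\<lambda>s. Re (\<Lambda> (q s))) has_vector_derivative Re (\<Lambda>' (q s))) (at s)" for s .
        show "continuous_on {\<tau>0..Re t} (\<lambda>s. Re (\<Lambda> (q s)))"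
          by (intro continuous_at_imp_continuous_on ballI has_vector_derivative_continuous[OF d3])
        show "continuous_on {\<tau>0..Re t} (\<lambda>s. complex_of_real (\<kappa> * s))" by (intro continuous_intros)
        show "((\<lambda>s. complex_of_real (\<kappa> * s)) has_vector_derivative complex_of_real \<kappa>) (at s)" for s
          by (rule has_vector_derivative_of_real) (auto intro!: derivative_eq_intros)
        fix s assume s: "\<tau>0 < s" "s < Re t"
        then have s': "s \<in> {\<tau>0..Re t}" by simp
        have "s \<ge> 0" using s by (simp add: \<tau>0_def)
        then have "norm (exp (6 * q s)) \<ge> 1" by (simp add: q_def)
        then have "\<kappa> * 1 \<le> \<kappa> * norm (exp (6 * q s))" using \<kappa> by (intro mult_left_mono) auto
        also have "\<dots> \<le> Re (\<Lambda>' (q s))" by (rule Re\<Lambda>'[OF qin[OF s']])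
        finally show "norm (complex_of_real \<kappa>) \<le> Re (\<Lambda>' (q s))" using \<kappa> by simp
      qed
      moreover have "norm (complex_of_real (\<kappa> * Re t) - complex_of_real (\<kappa> * \<tau>0)) = \<kappa> * (Re t - \<tau>0)"
        unfolding of_real_diff[symmetric] norm_of_real using t \<kappa> by (simp add: right_diff_distrib[symmetric])
      ultimately show ?thesis using qt by simp
    qed (use qt in simp)
    then have "Re (\<Lambda> t) \<ge> L + \<kappa> * (Re t - \<tau>0)" using L[OF q0] by linarith
    then have "K * exp (L + \<kappa> * (Re t - \<tau>0)) \<le> K * exp (Re (\<Lambda> t))" using K by simp
    then show ?thesis using 1 by linarith
  qed
  have "filterlim (\<lambda>t. norm (g t)) at_top ?F"
  proof (rule filterlim_at_top_mono)
    show "eventually (\<lambda>t. K * exp (L + \<kappa> * (Re t - \<tau>0)) - H \<le> norm (g t)) ?F"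
      using low by (auto simp: eventually_sector)
    have "filterlim Re at_top ?F"
      unfolding sector_at_infinity_def by (rule filterlim_mono[OF filterlim_filtercomap order_refl inf_le1])
    then have "filterlim (\<lambda>t. \<kappa> * Re t) at_top ?F"
      using \<kappa> by (intro filterlim_tendsto_pos_mult_at_top[OF tendsto_const])
    then have "filterlim (\<lambda>t. (L - \<kappa> * \<tau>0) + \<kappa> * Re t) at_top ?F"
      by (rule filterlim_tendsto_add_at_top[OF tendsto_const])
    then have "filterlim (\<lambda>t. K * exp ((L - \<kappa> * \<tau>0) + \<kappa> * Re t)) at_top ?F"
      by (intro filterlim_tendsto_pos_mult_at_top[OF tendsto_const] K filterlim_compose[OF exp_at_top])
    then have "filterlim (\<lambda>t. - H + K * exp ((L - \<kappa> * \<tau>0) + \<kappa> * Re t)) at_top ?F"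
      by (rule filterlim_tendsto_add_at_top[OF tendsto_const])
    then show "filterlim (\<lambda>t. K * exp (L + \<kappa> * (Re t - \<tau>0)) - H) at_top ?F"
      by (simp add: algebra_simps)
  qed
  then show ?thesis unfolding g_def by (rule filterlim_norm_at_top_imp_at_infinity)
qed

text \<open>
  Hence the quotient of two solutions has an asymptotic value in the sector: up to a multiple of the
  subdominant solution, the numerator is a multiple of the denominator.
\<close>

lemma quotient_tendsto_in_sector:
  assumes sol: "oscillator_solution V \<psi>" "oscillator_solution V y1" "oscillator_solution V y2"
    and \<delta>: "0 \<le> \<delta>" "\<delta> < pi / 12"
    and lim: "((\<lambda>t. \<psi> t / wkb a \<theta> k t) \<longlongrightarrow> c) (sector_at_infinity k \<delta>)" "c \<noteq> 0"
    and w: "wronskian y2 \<psi> 0 \<noteq> 0"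
  shows "((\<lambda>t. y1 t / y2 t) \<longlongrightarrow> wronskian y1 \<psi> 0 / wronskian y2 \<psi> 0) (sector_at_infinity k \<delta>)"
    and "eventually (\<lambda>t. y2 t \<noteq> 0) (sector_at_infinity k \<delta>)"
proof -
  let ?F = "sector_at_infinity k \<delta>"
  define l where "l = wronskian y1 \<psi> 0 / wronskian y2 \<psi> 0"
  have inf: "filterlim (\<lambda>t. y2 t / \<psi> t) at_infinity ?F"
    by (rule dominant_over_subdominant[OF sol(1,3) \<delta> lim w])
  have "((\<lambda>t. inverse (y2 t / \<psi> t)) \<longlongrightarrow> 0) ?F"
    by (rule filterlim_compose[OF tendsto_inverse_0 inf])
  then have 0: "((\<lambda>t. \<psi> t / y2 t) \<longlongrightarrow> 0) ?F" by simp
  show ne: "eventually (\<lambda>t. y2 t \<noteq> 0) ?F"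
    using filterlim_at_infinity_imp_eventually_ne[OF inf, of 0] by eventually_elim auto
  have "wronskian (\<lambda>t. 1 * y1 t + (- l) * y2 t) \<psi> 0 = 0"
    unfolding wronskian_lincomb_left[OF sol(2,3)] using w by (simp add: l_def)
  moreover have "wronskian \<psi> y2 0 \<noteq> 0" using w by (simp add: wronskian_swap[of \<psi> y2])
  ultimately obtain m where "\<And>t. 1 * y1 t + (- l) * y2 t = m * \<psi> t"
    using solution_dependent[OF sol(1,3) solution_lincomb(1)[OF sol(2,3)]] by blast
  then have y1: "y1 t = l * y2 t + m * \<psi> t" for t by (simp add: algebra_simps)
  have "((\<lambda>t. l + m * (\<psi> t / y2 t)) \<longlongrightarrow> l + m * 0) ?F" by (intro tendsto_intros 0)
  moreover have "eventually (\<lambda>t. l + m * (\<psi> t / y2 t) = y1 t / y2 t) ?F"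
    using ne by eventually_elim (simp add: y1 add_divide_distrib)
  ultimately show "((\<lambda>t. y1 t / y2 t) \<longlongrightarrow> wronskian y1 \<psi> 0 / wronskian y2 \<psi> 0) ?F"
    unfolding l_def[symmetric] using Lim_transform_eventually by fastforce
qed

text \<open>
  An independent solution would be dominant, while the quotient has a finite limit.
\<close>

lemma subdominant_unique:
  assumes sol: "oscillator_solution V \<psi>" "oscillator_solution V \<psi>'" "oscillator_solution V \<eta>" "wronskian \<psi> \<eta> 0 \<noteq> 0"
    and \<delta>: "0 \<le> \<delta>" "\<delta> < pi / 12"
    and lim: "((\<lambda>t. \<psi> t / wkb a \<theta> k t) \<longlongrightarrow> c) (sector_at_infinity k \<delta>)" "c \<noteq> 0"
    and lim': "((\<lambda>t. \<psi>' t / wkb a \<theta> k t) \<longlongrightarrow> c') (sector_at_infinity k \<delta>)"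
  shows "\<psi>' t = c' / c * \<psi> t"
proof -
  let ?F = "sector_at_infinity k \<delta>"
  have nt: "?F \<noteq> bot" by (rule sector_at_infinity_nontrivial[OF \<delta>(1)])
  have ne: "eventually (\<lambda>t. \<psi> t / wkb a \<theta> k t \<noteq> 0) ?F" by (rule tendsto_imp_eventually_ne[OF lim])
  have "((\<lambda>t. (\<psi>' t / wkb a \<theta> k t) / (\<psi> t / wkb a \<theta> k t)) \<longlongrightarrow> c' / c) ?F"
    by (intro tendsto_divide lim lim')
  then have q: "((\<lambda>t. \<psi>' t / \<psi> t) \<longlongrightarrow> c' / c) ?F" by simp
  have "wronskian \<psi>' \<psi> 0 = 0"
  proof (rule ccontr)
    assume "wronskian \<psi>' \<psi> 0 \<noteq> 0"
    from dominant_over_subdominant[OF sol(1,2) \<delta> lim this]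
    show False using not_tendsto_and_filterlim_at_infinity[OF nt q] by blast
  qed
  then obtain m where m: "\<And>t. \<psi>' t = m * \<psi> t"
    using solution_dependent[OF sol(1,3,2,4)] by blast
  have "((\<lambda>t. m) \<longlongrightarrow> c' / c) ?F"
    by (rule Lim_transform_eventually[OF q]) (use ne in eventually_elim, auto simp: m)
  then have "m = c' / c" using tendsto_unique[OF nt tendsto_const] by blast
  then show ?thesis using m by simp
qed

section \<open>The subdominant solutions and their Stokes relations\<close>

context solution_basis
begin

definition has_wkb_asymptotics :: "int \<Rightarrow> (complex \<Rightarrow> complex) \<Rightarrow> bool" where
  "has_wkb_asymptotics k u \<longleftrightarrow> (\<exists>B K. \<forall>t. Re t \<ge> B \<longrightarrow> \<bar>Im t - of_int k * pi / 6\<bar> \<le> wide_angle \<longrightarrow>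
       norm (u t / wkb a \<theta> k t - 1) \<le> K * exp (- (3 * Re t)) \<and>
       norm ((cover_deriv u t - wkb_slope a \<theta> k t * u t) / wkb a \<theta> k t) \<le> K * exp (- (4 * Re t)))"

definition subdominant :: "int \<Rightarrow> complex \<Rightarrow> complex" where
  "subdominant k = (SOME u. sol u \<and> has_wkb_asymptotics k u)"

lemma subdominant_exists: "sol (subdominant k) \<and> has_wkb_asymptotics k (subdominant k)"
proof -
  have "\<exists>u. sol u \<and> has_wkb_asymptotics k u"
    using wkb_solution[of k] unfolding has_wkb_asymptotics_def by blast
  then show ?thesis unfolding subdominant_def by (rule someI_ex)
qed

lemma subdominant_solution: "sol (subdominant k)"
  using subdominant_exists by blast

lemma subdominant_tendsto_wide:
  "((\<lambda>t. subdominant k t / wkb a \<theta> k t) \<longlongrightarrow> 1) (sector_at_infinity k wide_angle)"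
proof -
  from subdominant_exists[of k, unfolded has_wkb_asymptotics_def] obtain B K where
    "\<And>t. Re t \<ge> B \<Longrightarrow> \<bar>Im t - of_int k * pi / 6\<bar> \<le> wide_angle \<Longrightarrow>
       norm (subdominant k t / wkb a \<theta> k t - 1) \<le> K * exp (- (3 * Re t))" by blast
  then have "eventually (\<lambda>t. norm (subdominant k t / wkb a \<theta> k t - 1) \<le> K * exp (- (3 * Re t)))
      (sector_at_infinity k wide_angle)" by (auto simp: eventually_sector)
  from Lim_null_comparison[OF this tendsto_mult_right_zero[OF exp_decay_in_sector]]
  have "((\<lambda>t. subdominant k t / wkb a \<theta> k t - 1) \<longlongrightarrow> 0) (sector_at_infinity k wide_angle)"
    by simp
  then show ?thesis by (simp add: LIM_zero_iff)
qed

lemma subdominant_tendsto: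
  assumes "\<delta> \<le> wide_angle"
  shows "((\<lambda>t. subdominant k t / wkb a \<theta> k t) \<longlongrightarrow> 1) (sector_at_infinity k \<delta>)"
  by (rule tendsto_mono[OF sector_at_infinity_mono[OF assms] subdominant_tendsto_wide])

lemma subdominant_eventually_nonzero:
  "eventually (\<lambda>t. subdominant k t \<noteq> 0) (sector_at_infinity k wide_angle)"
  using tendsto_imp_eventually_ne[OF subdominant_tendsto_wide[of k], of 0]
  by (auto elim: eventually_mono)

text \<open>
  The two estimates for a solution and its defect combine to one for the logarithmic derivative.
\<close>

lemma subdominant_log_derivative:
  "((\<lambda>t. cover_deriv (subdominant k) t / subdominant k t - wkb_slope a \<theta> k t) \<longlongrightarrow> 0)
     (sector_at_infinity k wide_angle)"
proof -
  from subdominant_exists[of k, unfolded has_wkb_asymptotics_def] obtain B K where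
    "\<And>t. Re t \<ge> B \<Longrightarrow> \<bar>Im t - of_int k * pi / 6\<bar> \<le> wide_angle \<Longrightarrow>
       norm ((cover_deriv (subdominant k) t - wkb_slope a \<theta> k t * subdominant k t) / wkb a \<theta> k t)
         \<le> K * exp (- (4 * Re t))" by blast
  then have "eventually (\<lambda>t. norm ((cover_deriv (subdominant k) t - wkb_slope a \<theta> k t * subdominant k t) / wkb a \<theta> k t)
         \<le> K * exp (- (4 * Re t))) (sector_at_infinity k wide_angle)" by (auto simp: eventually_sector)
  from Lim_null_comparison[OF this tendsto_mult_right_zero[OF exp_decay_in_sector]]
  have "((\<lambda>t. (cover_deriv (subdominant k) t - wkb_slope a \<theta> k t * subdominant k t) / wkb a \<theta> k t) \<longlongrightarrow> 0)
      (sector_at_infinity k wide_angle)"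
    by simp
  from tendsto_divide[OF this subdominant_tendsto_wide]
  have "((\<lambda>t. (cover_deriv (subdominant k) t - wkb_slope a \<theta> k t * subdominant k t) / wkb a \<theta> k t
      / (subdominant k t / wkb a \<theta> k t)) \<longlongrightarrow> 0) (sector_at_infinity k wide_angle)" by simp
  moreover have "eventually (\<lambda>t. (cover_deriv (subdominant k) t - wkb_slope a \<theta> k t * subdominant k t) / wkb a \<theta> k t
      / (subdominant k t / wkb a \<theta> k t) = cover_deriv (subdominant k) t / subdominant k t - wkb_slope a \<theta> k t)
      (sector_at_infinity k wide_angle)"
    using subdominant_eventually_nonzero[of k] by eventually_elim (simp add: field_simps)
  ultimately show ?thesis by (rule Lim_transform_eventually)
qed

text \<open>
  Both \<open>subdominant k\<close> and \<open>subdominant (k + 1)\<close> are controlled on a thin sector around the ray that separates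
  their Stokes sectors.
\<close>

abbreviation boundary_at_infinity :: "int \<Rightarrow> complex filter" where
  "boundary_at_infinity k \<equiv>
     inf (sector_at_infinity k wide_angle) (sector_at_infinity (k + 1) wide_angle)"

lemma eventually_boundary:
  "eventually P (boundary_at_infinity k) \<longleftrightarrow> (\<exists>B. \<forall>t. Re t \<ge> B \<longrightarrow>
     \<bar>Im t - (of_int k + 1 / 2) * pi / 6\<bar> \<le> wide_angle - pi / 12 \<longrightarrow> P t)" (is "_ \<longleftrightarrow> ?R")
proof
  assume "eventually P (boundary_at_infinity k)"
  then obtain Q R where QR: "eventually Q (sector_at_infinity k wide_angle)"
    "eventually R (sector_at_infinity (k + 1) wide_angle)" "\<And>t. Q t \<and> R t \<longrightarrow> P t"
    by (auto simp: eventually_inf)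
  then obtain B1 B2 where B: "\<And>t. Re t \<ge> B1 \<Longrightarrow> \<bar>Im t - of_int k * pi / 6\<bar> \<le> wide_angle \<Longrightarrow> Q t"
     "\<And>t. Re t \<ge> B2 \<Longrightarrow> \<bar>Im t - of_int (k + 1) * pi / 6\<bar> \<le> wide_angle \<Longrightarrow> R t"
    by (auto simp: eventually_sector)
  show ?R
  proof (intro exI[of _ "max B1 B2"] allI impI)
    fix t assume t: "Re t \<ge> max B1 B2" "\<bar>Im t - (of_int k + 1 / 2) * pi / 6\<bar> \<le> wide_angle - pi / 12"
    have e: "(of_int k + 1 / 2) * pi / 6 = of_int k * pi / 6 + pi / 12"
      "of_int (k + 1) * pi / 6 = of_int k * pi / 6 + pi / 6" by (simp_all add: field_simps)
    have "\<bar>Im t - of_int k * pi / 6\<bar> \<le> wide_angle" "\<bar>Im t - of_int (k + 1) * pi / 6\<bar> \<le> wide_angle"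
      using t(2) pi_gt_zero unfolding e abs_le_iff by linarith+
    then show "P t" using B t(1) QR(3) by auto
  qed
next
  assume ?R
  then obtain B where B: "\<And>t. Re t \<ge> B \<Longrightarrow> \<bar>Im t - (of_int k + 1 / 2) * pi / 6\<bar> \<le> wide_angle - pi / 12 \<Longrightarrow> P t"
    by blast
  have "eventually (\<lambda>t. Re t \<ge> B \<and> \<bar>Im t - of_int k * pi / 6\<bar> \<le> wide_angle) (sector_at_infinity k wide_angle)"
    "eventually (\<lambda>t. \<bar>Im t - of_int (k + 1) * pi / 6\<bar> \<le> wide_angle) (sector_at_infinity (k + 1) wide_angle)"
    by (auto simp: eventually_sector)
  then have "eventually (\<lambda>t. (Re t \<ge> B \<and> \<bar>Im t - of_int k * pi / 6\<bar> \<le> wide_angle) \<and>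
      \<bar>Im t - of_int (k + 1) * pi / 6\<bar> \<le> wide_angle) (boundary_at_infinity k)"
    using filter_leD[OF inf_le1] filter_leD[OF inf_le2] eventually_conj by blast
  then show "eventually P (boundary_at_infinity k)"
  proof eventually_elim
    case (elim t)
    have e: "(of_int k + 1 / 2) * pi / 6 = of_int k * pi / 6 + pi / 12"
      "of_int (k + 1) * pi / 6 = of_int k * pi / 6 + pi / 6" by (simp_all add: field_simps)
    have "\<bar>Im t - (of_int k + 1 / 2) * pi / 6\<bar> \<le> wide_angle - pi / 12"
      using elim unfolding e abs_le_iff by linarith
    then show ?case using B elim by blast
  qed
qed

lemma boundary_nontrivial: "boundary_at_infinity k \<noteq> bot"
proof -
  have "\<not> eventually (\<lambda>_. False) (boundary_at_infinity k)"
  proof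
    assume "eventually (\<lambda>_. False) (boundary_at_infinity k)"
    then obtain B where "\<And>t. Re t \<ge> B \<Longrightarrow> \<bar>Im t - (of_int k + 1 / 2) * pi / 6\<bar> \<le> wide_angle - pi / 12 \<Longrightarrow> False"
      by (auto simp: eventually_boundary)
    from this[of "Complex B ((of_int k + 1 / 2) * pi / 6)"] show False using wide_angle_bounds by simp
  qed
  then show ?thesis by (auto simp: trivial_limit_def)
qed

lemma wkb_sign_Suc: "wkb_sign (k + 1) = - wkb_sign k" "wkb_sign (k - 1) = - wkb_sign k"
  by (simp_all add: wkb_sign_def)

lemma wkb_product: "wkb a \<theta> k t * wkb a \<theta> (k + 1) t = exp (- (5 * t))"
  by (simp add: wkb_def wkb_log_def wkb_sign_Suc exp_add[symmetric])
    (simp add: wkb_exponent_def algebra_simps)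

lemma boundary_log_derivative:
  "((\<lambda>t. exp (- (5 * t)) * (cover_deriv (subdominant k) t / subdominant k t
       - cover_deriv (subdominant (k + 1)) t / subdominant (k + 1) t)) \<longlongrightarrow> 2 * wkb_sign k)
     (boundary_at_infinity k)"
proof -
  let ?F = "boundary_at_infinity k"
  define S :: complex where "S = of_real (sqrt 3) * a"
  define D where "D = (\<lambda>j t. cover_deriv (subdominant j) t / subdominant j t - wkb_slope a \<theta> j t)"
  define q where "q = wkb_exponent \<theta> k - wkb_exponent \<theta> (k + 1)"
  have D: "(D k \<longlongrightarrow> 0) ?F" "(D (k + 1) \<longlongrightarrow> 0) ?F"
    unfolding D_def by (rule tendsto_mono[OF inf_le1 subdominant_log_derivative])
      (rule tendsto_mono[OF inf_le2 subdominant_log_derivative])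
  have E: "((\<lambda>t. exp (- (of_real c * t))) \<longlongrightarrow> 0) ?F" if "c > 0" for c
    by (rule tendsto_mono[OF inf_le1 exp_neg_tendsto_0_sector[OF that]])
  have "((\<lambda>t. q * exp (- (6 * t)) + 2 * wkb_sign k * (1 + S * exp (- (3 * t))) + exp (- (5 * t)) * (D k t - D (k + 1) t))
     \<longlongrightarrow> q * 0 + 2 * wkb_sign k * (1 + S * 0) + 0 * (0 - 0)) ?F"
    using E[of 6] E[of 3] E[of 5] by (intro tendsto_intros D) auto
  moreover have "q * exp (- (6 * t)) + 2 * wkb_sign k * (1 + S * exp (- (3 * t))) + exp (- (5 * t)) * (D k t - D (k + 1) t)
     = exp (- (5 * t)) * (cover_deriv (subdominant k) t / subdominant k t
       - cover_deriv (subdominant (k + 1)) t / subdominant (k + 1) t)" for t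
  proof -
    have p: "exp t ^ 5 = exp (5 * t)" "exp t ^ 2 = exp (2 * t)" by (simp_all add: exp_of_nat_mult[symmetric])
    have "wkb_slope a \<theta> k t - wkb_slope a \<theta> (k + 1) t = q * exp (- t) + 2 * wkb_sign k * (exp (5 * t) + S * exp (2 * t))"
      unfolding wkb_slope_def wkb_sign_Suc q_def S_def p by (simp add: exp_minus field_simps)
    then have "exp (- (5 * t)) * (wkb_slope a \<theta> k t - wkb_slope a \<theta> (k + 1) t) =
        q * exp (- (6 * t)) + 2 * wkb_sign k * (1 + S * exp (- (3 * t)))"
      by (simp add: algebra_simps flip: exp_add)
    moreover have "cover_deriv (subdominant k) t / subdominant k t - cover_deriv (subdominant (k + 1)) t / subdominant (k + 1) t
       = (wkb_slope a \<theta> k t - wkb_slope a \<theta> (k + 1) t) + (D k t - D (k + 1) t)"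
      by (simp add: D_def)
    ultimately show ?thesis by (simp only: distrib_left)
  qed
  ultimately show ?thesis by simp
qed

text \<open>
  The Wronskian is a constant, so it can be computed as a limit along the ray between the two sectors, where
  both solutions have their formal asymptotics. With the normalisation by \<open>wkb\<close> its value depends
  only on the parity of \<open>k\<close>.
\<close>

lemma subdominant_wronskian: "wronskian (subdominant k) (subdominant (k + 1)) 0 = - 2 * wkb_sign k"
proof -
  let ?F = "boundary_at_infinity k"
  define w where "w = wronskian (subdominant k) (subdominant (k + 1)) 0"
  have "((\<lambda>t. - ((subdominant k t / wkb a \<theta> k t) * (subdominant (k + 1) t / wkb a \<theta> (k + 1) t) *
     (exp (- (5 * t)) * (cover_deriv (subdominant k) t / subdominant k t
       - cover_deriv (subdominant (k + 1)) t / subdominant (k + 1) t)))) \<longlongrightarrow> - (1 * 1 * (2 * wkb_sign k))) ?F"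
    by (intro tendsto_intros boundary_log_derivative tendsto_mono[OF inf_le1 subdominant_tendsto_wide]
        tendsto_mono[OF inf_le2 subdominant_tendsto_wide])
  moreover have "eventually (\<lambda>t. - ((subdominant k t / wkb a \<theta> k t) * (subdominant (k + 1) t / wkb a \<theta> (k + 1) t) *
     (exp (- (5 * t)) * (cover_deriv (subdominant k) t / subdominant k t
       - cover_deriv (subdominant (k + 1)) t / subdominant (k + 1) t))) = w) ?F"
    using filter_leD[OF inf_le1 subdominant_eventually_nonzero] filter_leD[OF inf_le2 subdominant_eventually_nonzero]
  proof eventually_elim
    case (elim t)
    have "w = wronskian (subdominant k) (subdominant (k + 1)) t"
      unfolding w_def by (rule wronskian_const[symmetric, OF subdominant_solution subdominant_solution])
    moreover have "- ((P / E) * (Q / E') * (E * E' * (P' / P - Q' / Q))) = P * Q' - P' * Q"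
      if "P \<noteq> 0" "Q \<noteq> 0" "E \<noteq> 0" "E' \<noteq> 0" for P Q P' Q' E E' :: complex
      using that by (simp add: field_simps)
    ultimately show ?case unfolding wkb_product[symmetric, of t k] using elim
      by (simp add: wronskian_def)
  qed
  ultimately have "((\<lambda>t. w) \<longlongrightarrow> - (1 * 1 * (2 * wkb_sign k))) ?F"
    by (rule Lim_transform_eventually)
  then show ?thesis
    using tendsto_unique[OF boundary_nontrivial tendsto_const] unfolding w_def by fastforce
qed

lemma subdominant_independent: "wronskian (subdominant k) (subdominant (k + 1)) 0 \<noteq> 0"
  unfolding subdominant_wronskian by (auto simp: wkb_sign_def)

lemma proportional_subdominant:
  assumes "sol u" "wronskian u (subdominant k) 0 = 0"
  shows "\<exists>c. \<forall>t. u t = c * subdominant k t"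
  by (rule solution_dependent[OF subdominant_solution subdominant_solution assms(1) subdominant_independent assms(2)])

lemma subdominant_nontrivial: "\<not> (\<forall>t. subdominant k t = 0)"
proof
  assume "\<forall>t. subdominant k t = 0"
  then have "subdominant k = (\<lambda>t. 0 * subdominant (k + 1) t)" by auto
  then have "wronskian (subdominant k) (subdominant (k + 1)) 0 = 0"
    using wronskian_cmult(1)[OF subdominant_solution, of 0 "k + 1"] by simp
  then show False using subdominant_independent by blast
qed

lemma proportional_to_subdominant_limit:
  assumes "sol u" "0 \<le> \<delta>" "\<delta> < pi / 12"
    and "((\<lambda>t. u t / wkb a \<theta> k t) \<longlongrightarrow> c) (sector_at_infinity k \<delta>)"
  shows "u t = c * subdominant k t"
proof -
  have "\<delta> \<le> wide_angle" using assms(3) wide_angle_bounds by simp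
  from subdominant_unique[OF subdominant_solution assms(1) subdominant_solution subdominant_independent
      assms(2,3) subdominant_tendsto[OF this] _ assms(4)]
  show ?thesis by simp
qed

text \<open>
  The difference of the two outer solutions is orthogonal, with respect to the Wronskian, to the middle one,
  because neighbouring Wronskians differ by the sign.
\<close>

lemma stokes_relation: "\<exists>s. \<forall>k t. subdominant (k + 1) t = subdominant (k - 1) t + s k * subdominant k t"
proof -
  have "\<exists>s. \<forall>t. subdominant (k + 1) t = subdominant (k - 1) t + s * subdominant k t" for k
  proof -
    define u where "u = (\<lambda>t. 1 * subdominant (k + 1) t + (- 1) * subdominant (k - 1) t)"
    have "wronskian u (subdominant k) 0 = wronskian (subdominant (k + 1)) (subdominant k) 0
        - wronskian (subdominant (k - 1)) (subdominant k) 0"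
      unfolding u_def wronskian_lincomb_left[OF subdominant_solution subdominant_solution] by simp
    also have "\<dots> = 0"
      using subdominant_wronskian[of k] subdominant_wronskian[of "k - 1"]
        wronskian_swap[of "subdominant (k + 1)" "subdominant k" 0]
      by (simp add: wkb_sign_Suc)
    finally obtain c where "\<And>t. u t = c * subdominant k t"
      using proportional_subdominant[of u k] solution_lincomb(1)[OF subdominant_solution subdominant_solution]
      unfolding u_def by blast
    then show ?thesis by (intro exI[of _ c]) (auto simp: u_def algebra_simps)
  qed
  then show ?thesis by metis
qed

lemma normalised_subdominant_iff:
  assumes c: "codd \<noteq> 0" "ceven \<noteq> 0"
  shows "normalised_subdominant a b \<theta>0 \<theta> codd ceven k \<phi> \<longleftrightarrow> sol \<phi> \<and>
     (\<forall>\<delta>\<in>{0<..<pi / 12}. ((\<lambda>t. \<phi> t / wkb a \<theta> k t) \<longlongrightarrow> (if odd k then codd else ceven)) (sector_at_infinity k \<delta>))"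
proof -
  define d where "d = (if odd k then codd else ceven)"
  have d: "d \<noteq> 0" using c by (simp add: d_def)
  have g: "(\<lambda>t. if odd k then codd * exp ((1 / 2 - 3 * \<theta>) * t) * exp (stokes_G a (exp t))
             else ceven * exp ((3 * \<theta> - 11 / 2) * t) * exp (- stokes_G a (exp t))) = (\<lambda>t. d * wkb a \<theta> k t)"
    by (auto simp: d_def wkb_def wkb_log_def wkb_exponent_def wkb_sign_def exp_add exp_diff exp_minus field_simps)
  have "\<phi> \<sim>[F] (\<lambda>t. d * wkb a \<theta> k t) \<longleftrightarrow> ((\<lambda>t. \<phi> t / wkb a \<theta> k t) \<longlongrightarrow> d) F" for F
  proof -
    have "\<phi> \<sim>[F] (\<lambda>t. d * wkb a \<theta> k t) \<longleftrightarrow> ((\<lambda>t. \<phi> t / (d * wkb a \<theta> k t)) \<longlongrightarrow> 1) F"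
      unfolding asymp_equiv_def using d by simp
    also have "\<dots> \<longleftrightarrow> ((\<lambda>t. \<phi> t / wkb a \<theta> k t) \<longlongrightarrow> d) F"
    proof
      assume "((\<lambda>t. \<phi> t / (d * wkb a \<theta> k t)) \<longlongrightarrow> 1) F"
      from tendsto_mult_left[OF this, of d] show "((\<lambda>t. \<phi> t / wkb a \<theta> k t) \<longlongrightarrow> d) F"
        using d by simp
    next
      assume "((\<lambda>t. \<phi> t / wkb a \<theta> k t) \<longlongrightarrow> d) F"
      from tendsto_mult_left[OF this, of "1 / d"] show "((\<lambda>t. \<phi> t / (d * wkb a \<theta> k t)) \<longlongrightarrow> 1) F"
        using d by simp
    qed
    finally show ?thesis .
  qed
  then show ?thesis unfolding normalised_subdominant_def g d_def[symmetric] by simp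
qed

lemma normalised_subdominant_subdominant: "normalised_subdominant a b \<theta>0 \<theta> 1 1 k (subdominant k)"
  using normalised_subdominant_iff[of 1 1 k "subdominant k"] subdominant_solution wide_angle_bounds
  by (auto intro!: subdominant_tendsto)

lemma normalised_subdominant_eq:
  assumes "codd \<noteq> 0" "ceven \<noteq> 0" "normalised_subdominant a b \<theta>0 \<theta> codd ceven k \<phi>"
  shows "\<phi> t = (if odd k then codd else ceven) * subdominant k t"
proof -
  have "pi / 24 \<in> {0<..<pi / 12}" using pi_gt_zero by simp
  then have "sol \<phi>" "((\<lambda>t. \<phi> t / wkb a \<theta> k t) \<longlongrightarrow> (if odd k then codd else ceven)) (sector_at_infinity k (pi / 24))"
    using normalised_subdominant_iff[OF assms(1,2)] assms(3) by blast+
  then show ?thesis using proportional_to_subdominant_limit[of \<phi> "pi / 24"] pi_gt_zero by simp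
qed

text \<open>
  Eliminating \<open>\<psi>\<^sub>k\<^sub>+\<^sub>1\<close> from two consecutive Stokes relations gives
  \<open>\<psi>\<^sub>k\<^sub>+\<^sub>2 = (1 + s\<^sub>k s\<^sub>k\<^sub>+\<^sub>1) \<psi>\<^sub>k + s\<^sub>k\<^sub>+\<^sub>1 \<psi>\<^sub>k\<^sub>-\<^sub>1\<close>, so the condition on the Stokes multipliers says that every third
  subdominant solution is the same up to a factor.
\<close>

lemma stokes_condition_iff:
  assumes "\<And>k t. subdominant (k + 1) t = subdominant (k - 1) t + s k * subdominant k t"
  shows "1 + s k * s (k + 1) = 0 \<longleftrightarrow> (\<exists>c. \<forall>t. subdominant (k + 2) t = c * subdominant (k - 1) t)"
    and "1 + s k * s (k + 1) = 0 \<Longrightarrow> subdominant (k + 2) t = s (k + 1) * subdominant (k - 1) t"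
proof -
  have e: "subdominant (k + 2) t = (1 + s k * s (k + 1)) * subdominant k t + s (k + 1) * subdominant (k - 1) t" for t
    using assms[of k t] assms[of "k + 1" t] by (simp add: algebra_simps)
  show 1: "1 + s k * s (k + 1) = 0 \<Longrightarrow> subdominant (k + 2) t = s (k + 1) * subdominant (k - 1) t" for t
    by (simp add: e)
  show "1 + s k * s (k + 1) = 0 \<longleftrightarrow> (\<exists>c. \<forall>t. subdominant (k + 2) t = c * subdominant (k - 1) t)"
  proof
    assume "\<exists>c. \<forall>t. subdominant (k + 2) t = c * subdominant (k - 1) t"
    then obtain c where c: "\<And>t. subdominant (k + 2) t = c * subdominant (k - 1) t" by blast
    have "(\<lambda>t. (1 + s k * s (k + 1)) * subdominant k t) = (\<lambda>t. (c - s (k + 1)) * subdominant (k - 1) t)"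
      using e c by (auto simp: algebra_simps)
    then have "wronskian (subdominant (k - 1)) (\<lambda>t. (1 + s k * s (k + 1)) * subdominant k t) 0 = 0"
      by (simp add: wronskian_cmult[OF subdominant_solution])
    then show "1 + s k * s (k + 1) = 0"
      using subdominant_independent[of "k - 1"] by (simp add: wronskian_cmult[OF subdominant_solution])
  qed (use 1 in blast)
qed

end

section \<open>Rotation by a third of a turn\<close>

definition third_turn :: complex where
  "third_turn = 2 * of_real pi * \<i> / 3"

lemma exp_third_turn: "exp third_turn = zeta3"
  by (simp add: third_turn_def zeta3_def)

lemma zeta3_cube [simp]: "zeta3 ^ 3 = 1"
proof -
  have "of_nat 3 * (2 * of_real pi * \<i> / 3) = 2 * of_real pi * \<i>" by simp
  then show ?thesis unfolding zeta3_def exp_of_nat_mult[symmetric] by (simp only: exp_two_pi_i)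
qed

lemma zeta3_nonzero [simp]: "zeta3 \<noteq> 0"
  by (simp add: zeta3_def)

lemma zeta3_power_reduce: "zeta3 ^ (3 + j) = zeta3 ^ j"
  by (simp add: power_add)

lemma V10_rotate: "zeta3 ^ 2 * V10 a b \<theta>0 \<theta> (zeta3 * x) = V10 a b \<theta>0 \<theta> x"
proof -
  have z: "zeta3 ^ 12 = 1" "zeta3 ^ 9 = 1" "zeta3 ^ 6 = 1"
    using zeta3_power_reduce[of 9] zeta3_power_reduce[of 6] zeta3_power_reduce[of 3] by simp_all
  have "zeta3\<^sup>2 * (zeta3 * x) ^ 10 = zeta3 ^ 12 * x ^ 10" "zeta3\<^sup>2 * (zeta3 * x) ^ 7 = zeta3 ^ 9 * x ^ 7"
    "zeta3\<^sup>2 * (zeta3 * x) ^ 4 = zeta3 ^ 6 * x ^ 4" "zeta3\<^sup>2 * (zeta3 * x) = zeta3 ^ 3 * x"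
    by (simp_all add: power_mult_distrib eval_nat_numeral)
  note e = this[unfolded z zeta3_cube mult_1_left]
  have "zeta3\<^sup>2 * (c / (zeta3 * x)\<^sup>2) = c / x\<^sup>2" for c by (simp add: power_mult_distrib)
  note e = e this
  have "z * (X + c7 * X7 + c4 * X4 - c1 * X1 + Y) = z * X + c7 * (z * X7) + c4 * (z * X4) - c1 * (z * X1) + z * Y"
    for z X c7 X7 c4 X4 c1 X1 Y :: complex by (simp add: algebra_simps)
  then show ?thesis unfolding V10_def by (simp only: e)
qed

lemma solution_rotate:
  assumes "oscillator_solution (V10 a b \<theta>0 \<theta>) u"
  shows "oscillator_solution (V10 a b \<theta>0 \<theta>) (\<lambda>t. u (t + third_turn))"
    and "cover_deriv (\<lambda>t. u (t + third_turn)) = (\<lambda>t. zeta3 * cover_deriv u (t + third_turn))"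
proof -
  have 1: "((\<lambda>t. u (t + third_turn)) has_field_derivative exp t * (zeta3 * cover_deriv u (t + third_turn))) (at t)" for t
    using DERIV_shift[THEN iffD1, OF solution_DERIV[OF assms, of "t + third_turn"]]
    by (simp add: exp_add exp_third_turn mult_ac)
  have 2: "((\<lambda>t. zeta3 * cover_deriv u (t + third_turn)) has_field_derivative
      exp t * (V10 a b \<theta>0 \<theta> (exp t) * u (t + third_turn))) (at t)" for t
  proof -
    have "((\<lambda>t. zeta3 * cover_deriv u (t + third_turn)) has_field_derivative
      zeta3 * (exp (t + third_turn) * (V10 a b \<theta>0 \<theta> (exp (t + third_turn)) * u (t + third_turn)))) (at t)"
      by (intro DERIV_cmult DERIV_shift[THEN iffD1] solution_DERIV2[OF assms])
    moreover have "zeta3 * (exp (t + third_turn) * (V10 a b \<theta>0 \<theta> (exp (t + third_turn)) * u (t + third_turn)))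
       = exp t * ((zeta3\<^sup>2 * V10 a b \<theta>0 \<theta> (zeta3 * exp t)) * u (t + third_turn))"
      by (simp add: exp_add exp_third_turn power2_eq_square mult_ac)
    ultimately show ?thesis unfolding V10_rotate by simp
  qed
  show "oscillator_solution (V10 a b \<theta>0 \<theta>) (\<lambda>t. u (t + third_turn))"
    "cover_deriv (\<lambda>t. u (t + third_turn)) = (\<lambda>t. zeta3 * cover_deriv u (t + third_turn))"
    by (rule solutionI[OF 1 2])+
qed

lemma wronskian_rotate:
  assumes "oscillator_solution (V10 a b \<theta>0 \<theta>) u" "oscillator_solution (V10 a b \<theta>0 \<theta>) v"
  shows "wronskian (\<lambda>t. u (t + third_turn)) (\<lambda>t. v (t + third_turn)) 0 = zeta3 * wronskian u v 0"
proof -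
  have "wronskian (\<lambda>t. u (t + third_turn)) (\<lambda>t. v (t + third_turn)) 0 = zeta3 * wronskian u v third_turn"
    by (simp add: wronskian_def solution_rotate[OF assms(1)] solution_rotate[OF assms(2)] algebra_simps)
  then show ?thesis using wronskian_const[OF assms] by simp
qed

lemma filterlim_rotate_sector:
  "filterlim (\<lambda>t. t + third_turn) (sector_at_infinity (k + 4) \<delta>) (sector_at_infinity k \<delta>)"
  unfolding filterlim_iff
proof (intro allI impI)
  fix P assume "eventually P (sector_at_infinity (k + 4) \<delta>)"
  then obtain B where B: "\<And>t. Re t \<ge> B \<Longrightarrow> \<bar>Im t - of_int (k + 4) * pi / 6\<bar> \<le> \<delta> \<Longrightarrow> P t"
    by (auto simp: eventually_sector)
  have "P (t + third_turn)" if "Re t \<ge> B" "\<bar>Im t - of_int k * pi / 6\<bar> \<le> \<delta>" for t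
  proof (rule B)
    show "Re (t + third_turn) \<ge> B" using that by (simp add: third_turn_def)
    have "Im (t + third_turn) - of_int (k + 4) * pi / 6 = Im t - of_int k * pi / 6"
      by (simp add: third_turn_def field_simps)
    then show "\<bar>Im (t + third_turn) - of_int (k + 4) * pi / 6\<bar> \<le> \<delta>" using that by simp
  qed
  then show "eventually (\<lambda>t. P (t + third_turn)) (sector_at_infinity k \<delta>)"
    by (auto simp: eventually_sector)
qed

lemma wkb_rotate: "wkb a \<theta> (k + 4) (t + third_turn) = exp (wkb_exponent \<theta> k * third_turn) * wkb a \<theta> k t"
proof -
  have "(zeta3 * x) ^ 3 = x ^ 3" "(zeta3 * x) ^ 6 = x ^ 6" for x
    using zeta3_power_reduce[of 3] by (simp_all add: power_mult_distrib)
  then have "stokes_G a (exp (t + third_turn)) = stokes_G a (exp t)"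
    by (simp add: stokes_G_def exp_add exp_third_turn mult.commute[of _ zeta3])
  moreover have "wkb_sign (k + 4) = wkb_sign k" "wkb_exponent \<theta> (k + 4) = wkb_exponent \<theta> k"
    by (simp_all add: wkb_sign_def wkb_exponent_def)
  ultimately show ?thesis
    by (simp add: wkb_def wkb_log_def exp_add[symmetric] algebra_simps)
qed

context solution_basis
begin

text \<open>
  A third of a turn is four Stokes sectors. The rotated solution is subdominant again, and the normalisation
  by a power of \<open>x\<close> contributes the factor.
\<close>

lemma subdominant_rotate:
  "subdominant (k + 4) (t + third_turn) = exp (wkb_exponent \<theta> k * third_turn) * subdominant k t"
proof -
  let ?F = "sector_at_infinity k 0"
  have "((\<lambda>t. subdominant (k + 4) (t + third_turn) / wkb a \<theta> (k + 4) (t + third_turn)) \<longlongrightarrow> 1) ?F"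
    using wide_angle_bounds pi_gt_zero
    by (intro filterlim_compose[OF subdominant_tendsto filterlim_rotate_sector]) linarith
  from tendsto_mult_left[OF this, of "exp (wkb_exponent \<theta> k * third_turn)"]
  have "((\<lambda>t. subdominant (k + 4) (t + third_turn) / wkb a \<theta> k t) \<longlongrightarrow> exp (wkb_exponent \<theta> k * third_turn)) ?F"
    by (simp add: wkb_rotate)
  from proportional_to_subdominant_limit[OF solution_rotate(1)[OF subdominant_solution] _ _ this]
  show ?thesis by simp
qed

text \<open>
  If every third subdominant solution is the same, rotation by four sectors amounts to a shift of the
  index by one.
\<close>

lemma subdominant_rotate_shift:
  assumes "\<And>k. \<exists>c. \<forall>t. subdominant (k + 3) t = c * subdominant k t"
  shows "\<exists>c. c \<noteq> 0 \<and> (\<forall>t. subdominant (k + 1) (t + third_turn) = c * subdominant k t)"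
proof -
  obtain c where c: "\<And>t. subdominant (k + 4) t = c * subdominant (k + 1) t"
    using assms[of "k + 1"] by (auto simp: add.assoc)
  have "c \<noteq> 0" using subdominant_nontrivial[of "k + 4"] c by auto
  then have "subdominant (k + 1) (t + third_turn) = exp (wkb_exponent \<theta> k * third_turn) / c * subdominant k t" for t
    using subdominant_rotate[of k t] c[of "t + third_turn"] by (simp add: field_simps)
  then show ?thesis using \<open>c \<noteq> 0\<close>
    by (intro exI[of _ "exp (wkb_exponent \<theta> k * third_turn) / c"]) auto
qed

lemma wronskian_rotate_eigen:
  assumes per: "\<And>k. \<exists>c. \<forall>t. subdominant (k + 3) t = c * subdominant k t"
  shows "\<exists>c. c \<noteq> 0 \<and> (\<forall>\<phi> \<mu>. sol \<phi> \<longrightarrow> (\<forall>t. \<phi> (t + third_turn) = \<mu> * \<phi> t) \<longrightarrow>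
      wronskian \<phi> (subdominant (k + 1)) 0 = c * \<mu> * wronskian \<phi> (subdominant k) 0)"
proof -
  obtain c where c: "c \<noteq> 0" "\<And>t. subdominant (k + 1) (t + third_turn) = c * subdominant k t"
    using subdominant_rotate_shift[OF per] by blast
  have "wronskian \<phi> (subdominant (k + 1)) 0 = (c / zeta3) * \<mu> * wronskian \<phi> (subdominant k) 0"
    if "sol \<phi>" "\<forall>t. \<phi> (t + third_turn) = \<mu> * \<phi> t" for \<phi> \<mu>
    using wronskian_rotate[OF that(1) subdominant_solution[of "k + 1"]] that(2) c(2)
    by (simp add: wronskian_cmult[OF that(1)] wronskian_cmult[OF subdominant_solution] field_simps)
  then show ?thesis using c(1) by (intro exI[of _ "c / zeta3"]) auto
qed

text \<open>
  An eigenvector of the rotation that is subdominant in one sector would be subdominant in the next one as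
  well.
\<close>

lemma rotation_eigenvector_not_subdominant:
  assumes per: "\<And>k. \<exists>c. \<forall>t. subdominant (k + 3) t = c * subdominant k t"
    and sol: "sol \<phi>" and eig: "\<And>t. \<phi> (t + third_turn) = \<mu> * \<phi> t"
    and nz: "wronskian \<phi> \<eta> 0 \<noteq> 0" and sol\<eta>: "sol \<eta>"
  shows "wronskian \<phi> (subdominant k) 0 \<noteq> 0"
proof
  assume 0: "wronskian \<phi> (subdominant k) 0 = 0"
  then have "wronskian \<phi> (subdominant (k + 1)) 0 = 0"
    using wronskian_rotate_eigen[OF per, of k] sol eig by auto
  then obtain c d where c: "\<And>t. \<phi> t = c * subdominant k t" and d: "\<And>t. \<phi> t = d * subdominant (k + 1) t"
    using 0 proportional_subdominant[OF sol] by blast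
  have "wronskian \<phi> \<phi> 0 = c * (d * wronskian (subdominant k) (subdominant (k + 1)) 0)"
    unfolding wronskian_cmult[OF subdominant_solution, symmetric]
    by (simp add: c[symmetric] d[symmetric] ext[OF c, symmetric] ext[OF d, symmetric])
  then have "c = 0 \<or> d = 0" using subdominant_independent by simp
  then have "\<phi> = (\<lambda>t. 0 * \<eta> t)" using c d by auto
  then have "wronskian \<phi> \<eta> 0 = 0" using wronskian_cmult(1)[OF sol\<eta>, of 0 \<eta> 0] by simp
  then show False using nz by contradiction
qed

text \<open>
  Three rotations make a full turn. Following \<open>\<psi>\<^sub>2\<close> through them with the Stokes relations gives its
  monodromy in terms of the formal exponents alone: the Stokes multipliers cancel.
\<close>

lemma subdominant_monodromy:
  assumes s: "\<And>k t. subdominant (k + 1) t = subdominant (k - 1) t + s k * subdominant k t"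
    and cond: "\<And>k. 1 + s k * s (k + 1) = 0"
  shows "subdominant 2 (t + 2 * of_real pi * \<i>) = - exp (- (2 * of_real pi * \<i> * \<theta>)) * subdominant 2 t"
proof -
  define e where "e k = exp (wkb_exponent \<theta> k * third_turn)" for k
  have shift: "subdominant (k + 3) t = s (k + 2) * subdominant k t" for k t
    using stokes_condition_iff(2)[OF s cond, of "k + 1" t] by (simp add: add.commute add.assoc)
  have s0: "s k \<noteq> 0" for k using cond[of k] by auto
  have rot: "s (k + 3) * subdominant (k + 1) (t + third_turn) = e k * subdominant k t" for k t
    using subdominant_rotate[of k t] shift[of "k + 1" "t + third_turn"] by (simp add: e_def add.assoc)
  have full: "t + 2 * of_real pi * \<i> = ((t + third_turn) + third_turn) + third_turn"
    by (simp add: third_turn_def)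
  have "(s 4 * (s 3 * s 2)) * subdominant 2 (t + 2 * of_real pi * \<i>)
     = s 3 * s 2 * (e 1 * subdominant 1 ((t + third_turn) + third_turn))"
    unfolding full using rot[of 1 "(t + third_turn) + third_turn"] by (simp add: mult_ac)
  also have "\<dots> = s 2 * e 1 * (e 0 * subdominant 0 (t + third_turn))"
    using rot[of 0 "t + third_turn"] by (simp add: mult_ac)
  also have "\<dots> = e 1 * e 0 * (e (-1) * subdominant (-1) t)"
    using rot[of "-1" t] by (simp add: mult_ac)
  finally have "(s 4 * (s 3 * s 2)) * s 1 * subdominant 2 (t + 2 * of_real pi * \<i>)
      = e 1 * e 0 * e (-1) * (s 1 * subdominant (-1) t)" by (simp add: mult_ac)
  also have "s 1 * subdominant (-1) t = subdominant 2 t" using shift[of "-1" t] by simp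
  also have "(s 4 * (s 3 * s 2)) * s 1 = (s 3 * s 4) * (s 1 * s 2)" by (simp add: mult_ac)
  also have "\<dots> = 1"
  proof -
    have "s 3 * s 4 = -1" "s 1 * s 2 = -1"
      using cond[of 3] cond[of 1] by (simp_all add: eq_neg_iff_add_eq_0 add.commute)
    then show ?thesis by simp
  qed
  also have "e 1 * e 0 * e (-1) = - exp (- (2 * of_real pi * \<i> * \<theta>))"
  proof -
    have c3: "3 * third_turn = 2 * of_real pi * \<i>" by (simp add: third_turn_def)
    have "wkb_exponent \<theta> 1 * third_turn + wkb_exponent \<theta> 0 * third_turn + wkb_exponent \<theta> (-1) * third_turn
        = - (3 / 2) * (3 * third_turn) - \<theta> * (3 * third_turn)"
      by (simp add: wkb_exponent_def algebra_simps)
    also have "\<dots> = (of_real pi * \<i>) + (- (2 * of_real pi * \<i> * \<theta>)) + of_int (-2) * (of_real (2 * pi) * \<i>)"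
      unfolding c3 by (simp add: algebra_simps)
    finally have "e 1 * e 0 * e (-1) = exp ((of_real pi * \<i>) + (- (2 * of_real pi * \<i> * \<theta>)) + of_int (-2) * (of_real (2 * pi) * \<i>))"
      unfolding e_def exp_add[symmetric] by (rule arg_cong)
    also have "\<dots> = exp ((of_real pi * \<i>) + (- (2 * of_real pi * \<i> * \<theta>)))" using exp_plus_2pin[of "(of_real pi * \<i>) + (- (2 * of_real pi * \<i> * \<theta>))" "-2"] by (simp add: mult_ac)
    finally show ?thesis by (simp only: exp_add exp_pi_i') simp
  qed
  finally show ?thesis by simp
qed

text \<open>
  The monodromy of a subdominant solution, computed at infinity, has to be the common factor \<open>(- 1) ^ n\<close> that
  the exponents at the origin prescribe.
\<close>

lemma theta_inf_quantised:
  fixes n :: int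
  assumes s: "\<And>k t. subdominant (k + 1) t = subdominant (k - 1) t + s k * subdominant k t"
    and cond: "\<And>k. 1 + s k * s (k + 1) = 0"
    and mono: "\<And>u t. sol u \<Longrightarrow> u (t + 2 * of_real pi * \<i>) = (if even n then 1 else - 1) * u t"
  shows "\<exists>m. \<theta> = okamoto_theta_inf m n"
proof -
  obtain t where t: "subdominant 2 t \<noteq> 0" using subdominant_nontrivial by blast
  have "(- exp (- (2 * of_real pi * \<i> * \<theta>))) * subdominant 2 t = (if even n then 1 else - 1) * subdominant 2 t"
    by (simp only: subdominant_monodromy[OF s cond, symmetric] mono[OF subdominant_solution])
  then have "- exp (- (2 * of_real pi * \<i> * \<theta>)) = (if even n then 1 else - 1)"
    by (rule mult_right_cancel[OF t, THEN iffD1])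
  then have e: "exp (2 * of_real pi * \<i> * \<theta>) = (if even n then - 1 else 1)"
    by (auto simp: exp_minus field_simps split: if_splits)
  have "exp (of_real pi * \<i> * of_int (n + 1)) = (if even n then - 1 else 1)"
    using exp_i_pi_int[of "n + 1"] by (simp add: mult_ac)
  then have "exp (2 * of_real pi * \<i> * \<theta>) = exp (of_real pi * \<i> * of_int (n + 1))" using e by simp
  then obtain m :: int where "2 * of_real pi * \<i> * \<theta> = of_real pi * \<i> * of_int (n + 1) + (of_int (2 * m) * pi) * \<i>"
    unfolding exp_eq by blast
  then have "(2 * of_real pi * \<i>) * \<theta> = (2 * of_real pi * \<i>) * okamoto_theta_inf m n"
    by (simp add: okamoto_theta_inf_def algebra_simps)
  then show ?thesis by (intro exI[of _ m]) simp
qed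

end

section \<open>Transcendental singularities escape to infinity\<close>

definition disc_preimage :: "(complex \<Rightarrow> complex) \<Rightarrow> complex option \<Rightarrow> real \<Rightarrow> complex set" where
  "disc_preimage f s r = {z. sphere_value f z \<in> sphere_disc s r}"

lemma mem_disc_preimage_Some: "z \<in> disc_preimage f (Some c) r \<longleftrightarrow> \<not> is_pole f z \<and> norm (f z - c) < r"
  by (auto simp: disc_preimage_def sphere_value_def dist_norm norm_minus_commute)

lemma mem_disc_preimage_None: "z \<in> disc_preimage f None r \<longleftrightarrow> is_pole f z \<or> norm (f z) > 1 / r"
  by (auto simp: disc_preimage_def sphere_value_def not_le)

lemma disc_preimage_mono:
  assumes "0 < r" "r \<le> r'"
  shows "disc_preimage f s r \<subseteq> disc_preimage f s r'"
proof (cases s)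
  case None
  have "1 / r' \<le> 1 / r" using assms by (simp add: frac_le)
  then show ?thesis unfolding None by (auto simp: mem_disc_preimage_None)
qed (use assms in \<open>auto simp: mem_disc_preimage_Some\<close>)

lemma disc_preimage_disjoint:
  assumes "s \<noteq> Some c"
  shows "\<exists>r0>0. \<forall>r. 0 < r \<longrightarrow> r \<le> r0 \<longrightarrow> disc_preimage f s r \<inter> disc_preimage f (Some c) r = {}"
proof (cases s)
  case None
  show ?thesis
  proof (intro exI[of _ "1 / (norm c + 1)"] conjI allI impI)
    fix r :: real assume r: "0 < r" "r \<le> 1 / (norm c + 1)"
    have n: "norm c + 1 \<ge> 1" by simp
    have "r * (norm c + 1) \<le> 1" using r n by (simp add: le_divide_eq)
    then have "norm c + 1 \<le> 1 / r" using r by (simp add: le_divide_eq mult.commute)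
    moreover have "r \<le> 1" using r n by (smt (verit) divide_le_eq_1)
    ultimately have "norm (f z) > norm c + 1 \<Longrightarrow> \<not> norm (f z - c) < r" for z
      using norm_triangle_ineq2[of "f z" c] by linarith
    then show "disc_preimage f s r \<inter> disc_preimage f (Some c) r = {}"
      using \<open>norm c + 1 \<le> 1 / r\<close> unfolding None
      by (fastforce simp: mem_disc_preimage_None mem_disc_preimage_Some)
  qed (auto simp: add_nonneg_pos)
next
  case (Some d)
  then have dc: "norm (d - c) > 0" using assms by simp
  show ?thesis
  proof (intro exI[of _ "norm (d - c) / 2"] conjI allI impI)
    fix r :: real assume "0 < r" "r \<le> norm (d - c) / 2"
    then have "norm (f z - d) < r \<Longrightarrow> \<not> norm (f z - c) < r" for z
      using norm_triangle_ineq4[of "f z - c" "f z - d"] by simp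
    then show "disc_preimage f s r \<inter> disc_preimage f (Some c) r = {}"
      unfolding Some by (auto simp: mem_disc_preimage_Some)
  qed (use dc in auto)
qed

lemma nicely_meromorphic_regular_point:
  assumes "f nicely_meromorphic_on UNIV" "\<not> is_pole f z"
  shows "(f \<longlongrightarrow> f z) (nhds z)" "eventually (\<lambda>x. \<not> is_pole f x) (nhds z)"
proof -
  have an: "f analytic_on {z}" by (rule nicely_meromorphic_on_imp_analytic_at[OF assms(1) UNIV_I assms(2)])
  then show "(f \<longlongrightarrow> f z) (nhds z)"
    using analytic_at_imp_isCont isCont_def tendsto_at_iff_tendsto_nhds by blast
  from an obtain S where S: "open S" "z \<in> S" "f holomorphic_on S" by (auto simp: analytic_at)
  then show "eventually (\<lambda>x. \<not> is_pole f x) (nhds z)"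
    unfolding eventually_nhds using not_is_pole_holomorphic[OF S(1) _ S(3)] by blast
qed

lemma eventually_large_at_pole:
  assumes "is_pole f z"
  shows "eventually (\<lambda>x. norm (f x) > B) (at z)"
  using assms unfolding is_pole_def
  by (metis filterlim_at_infinity_imp_norm_at_top filterlim_at_top_dense)

lemma open_disc_preimage:
  assumes f: "f nicely_meromorphic_on UNIV"
  shows "open (disc_preimage f s r)"
proof (subst open_subopen, intro ballI)
  fix z assume z: "z \<in> disc_preimage f s r"
  have "eventually (\<lambda>x. x \<in> disc_preimage f s r) (nhds z)"
  proof (cases "is_pole f z")
    case True
    then have s: "s = None" using z by (cases s) (auto simp: mem_disc_preimage_Some)
    show ?thesis unfolding eventually_nhds_conv_at
      using z eventually_large_at_pole[OF True, of "1 / r"]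
      by (auto simp: s mem_disc_preimage_None elim: eventually_mono)
  next
    case False
    note n = nicely_meromorphic_regular_point[OF f False]
    show ?thesis
    proof (cases s)
      case None
      then have "norm (f z) > 1 / r" using z False by (simp add: mem_disc_preimage_None)
      from order_tendstoD(1)[OF tendsto_norm[OF n(1)] this]
      show ?thesis by eventually_elim (simp add: None mem_disc_preimage_None)
    next
      case (Some c)
      then have "norm (f z - c) < r" using z by (simp add: mem_disc_preimage_Some)
      moreover have "((\<lambda>x. norm (f x - c)) \<longlongrightarrow> norm (f z - c)) (nhds z)" by (intro tendsto_intros n)
      ultimately have "eventually (\<lambda>x. norm (f x - c) < r) (nhds z)" by (metis order_tendstoD(2))
      then show ?thesis using n(2) by eventually_elim (simp add: Some mem_disc_preimage_Some)
    qed
  qed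
  then show "\<exists>T. open T \<and> z \<in> T \<and> T \<subseteq> disc_preimage f s r" by (auto simp: eventually_nhds)
qed

text \<open>
  The sphere is Hausdorff and \<open>f\<close> is continuous into it, so a point that does not lie over the disc has a
  neighbourhood that stays away from a smaller disc.
\<close>

lemma eventually_not_in_disc_preimage:
  assumes f: "f nicely_meromorphic_on UNIV" and r: "r > 0" and z: "z \<notin> disc_preimage f s r"
  shows "\<exists>r'>0. eventually (\<lambda>x. x \<notin> disc_preimage f s r') (nhds z)"
proof (cases s)
  case None
  then have np: "\<not> is_pole f z" using z by (simp add: mem_disc_preimage_None)
  note n = nicely_meromorphic_regular_point[OF f np]
  have "eventually (\<lambda>x. norm (f x) < norm (f z) + 1) (nhds z)"
    by (rule order_tendstoD(2)[OF tendsto_norm[OF n(1)]]) simp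
  then have "eventually (\<lambda>x. x \<notin> disc_preimage f s (1 / (norm (f z) + 1))) (nhds z)"
    using n(2) by eventually_elim (simp add: None mem_disc_preimage_None)
  moreover have "1 / (norm (f z) + 1) > 0" by (simp add: add_nonneg_pos)
  ultimately show ?thesis by blast
next
  case (Some c)
  show ?thesis
  proof (cases "is_pole f z")
    case True
    have "eventually (\<lambda>x. x \<notin> disc_preimage f s 1) (nhds z)"
      unfolding eventually_nhds_conv_at
    proof
      show "z \<notin> disc_preimage f s 1" using True by (simp add: Some mem_disc_preimage_Some)
      show "eventually (\<lambda>x. x \<notin> disc_preimage f s 1) (at z)"
        using eventually_large_at_pole[OF True, of "norm c + 1"]
      proof eventually_elim
        case (elim x)
        then show ?case using norm_triangle_ineq2[of "f x" c] by (simp add: Some mem_disc_preimage_Some)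
      qed
    qed
    then show ?thesis using zero_less_one by blast
  next
    case False
    note n = nicely_meromorphic_regular_point[OF f False]
    have "norm (f z - c) > r / 2" using z False r by (simp add: Some mem_disc_preimage_Some)
    moreover have "((\<lambda>x. norm (f x - c)) \<longlongrightarrow> norm (f z - c)) (nhds z)" by (intro tendsto_intros n)
    ultimately have "eventually (\<lambda>x. norm (f x - c) > r / 2) (nhds z)" by (metis order_tendstoD(1))
    then have "eventually (\<lambda>x. x \<notin> disc_preimage f s (r / 2)) (nhds z)"
      by eventually_elim (simp add: Some mem_disc_preimage_Some)
    then show ?thesis using r by (intro exI[of _ "r / 2"]) simp
  qed
qed

lemma transcendental_singularityD:
  assumes "(s, U) \<in> transcendental_singularities f"
  shows "\<And>r. r > 0 \<Longrightarrow> U r \<in> components (disc_preimage f s r)"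
    and "\<And>r r'. 0 < r \<Longrightarrow> r \<le> r' \<Longrightarrow> U r \<subseteq> U r'"
    and "(\<Inter>r\<in>{0<..}. U r) = {}"
    and "U \<in> extensional {0<..}"
  using assms by (auto simp: transcendental_singularities_def disc_preimage_def PiE_def)

text \<open>
  If the components met a fixed compact set for all radii, their closures would have a common point
  there. At that point the function takes the limiting value, and since it is continuous into the sphere
  the point lies in the interior of every component.
\<close>

lemma transcendental_singularity_escapes:
  assumes f: "f nicely_meromorphic_on UNIV" and U: "(s, U) \<in> transcendental_singularities f"
  shows "\<exists>r0>0. \<forall>r. 0 < r \<longrightarrow> r \<le> r0 \<longrightarrow> U r \<inter> cball 0 R = {}"
proof (rule ccontr)
  note D = transcendental_singularityD[OF U]
  assume contra: "\<not> ?thesis"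
  have meet: "U r \<inter> cball 0 R \<noteq> {}" if r: "r > 0" for r
  proof -
    obtain r' where "0 < r'" "r' \<le> r" "U r' \<inter> cball 0 R \<noteq> {}" using contra r by blast
    then show ?thesis using D(2)[of r' r] by blast
  qed
  define F where "F = (\<lambda>j::nat. closure (U (1 / Suc j)) \<inter> cball 0 R)"
  have "\<Inter>(range F) \<noteq> {}"
  proof (rule compact_nest)
    show "compact (F j)" for j unfolding F_def by (intro closed_Int_compact) auto
    show "F j \<noteq> {}" for j
      unfolding F_def using meet[of "1 / Suc j"] closure_subset[of "U (1 / Suc j)"] by auto
    show "F n \<subseteq> F m" if "m \<le> n" for m n
    proof -
      have "1 / real (Suc n) \<le> 1 / real (Suc m)" using that by (intro divide_left_mono) auto
      then show ?thesis unfolding F_def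
        using closure_mono[OF D(2)[of "1 / Suc n" "1 / Suc m"]] by auto
    qed
  qed
  then obtain z where z: "\<And>j::nat. z \<in> closure (U (1 / Suc j))" unfolding F_def by blast
  have small: "\<exists>j::nat. 1 / Suc j \<le> r" if "r > 0" for r :: real
    using reals_Archimedean[OF that] by (metis inverse_eq_divide less_imp_le)
  have zA: "z \<in> disc_preimage f s r" if r: "r > 0" for r
  proof (rule ccontr)
    assume "z \<notin> disc_preimage f s r"
    from eventually_not_in_disc_preimage[OF f r this] obtain r' S where r': "r' > 0" and S: "open S" "z \<in> S"
      "\<And>x. x \<in> S \<Longrightarrow> x \<notin> disc_preimage f s r'"
      by (auto simp: eventually_nhds)
    obtain j :: nat where j: "1 / Suc j \<le> r'" using small[OF r'] by blast
    have "S \<inter> U (1 / Suc j) \<noteq> {}"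
      using z[of j] S(1,2) by (metis closure_iff_nhds_not_empty inf_commute order_refl)
    moreover have "U (1 / Suc j) \<subseteq> disc_preimage f s r'"
      using in_components_subset[OF D(1)[of "1 / Suc j"]] disc_preimage_mono[of "1 / Suc j" r' f s] j by auto
    ultimately show False using S(3) by blast
  qed
  have "z \<in> U r" if r: "r > 0" for r
  proof -
    define C where "C = connected_component_set (disc_preimage f s r) z"
    have C: "open C" "z \<in> C" "connected C" "C \<subseteq> disc_preimage f s r"
      unfolding C_def using zA[OF r]
      by (auto intro: open_connected_component open_disc_preimage[OF f] simp: connected_component_subset)
    obtain j :: nat where j: "1 / Suc j \<le> r" using small[OF r] by blast
    have "C \<inter> U (1 / Suc j) \<noteq> {}"
      using z[of j] C(1,2) by (metis closure_iff_nhds_not_empty inf_commute order_refl)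
    then have "U r \<inter> C \<noteq> {}" using D(2)[of "1 / Suc j" r] j by auto
    then show ?thesis using components_maximal[OF D(1)[OF r] C(3,4)] C(2) by blast
  qed
  then show False using D(3) by blast
qed

section \<open>Wedges\<close>

definition wedge :: "real \<Rightarrow> real \<Rightarrow> real \<Rightarrow> complex set" where
  "wedge \<beta> \<epsilon> R = {z. R < norm z \<and> cos \<epsilon> * norm z < Re (z * cis (- \<beta>))}"

lemma exp_wedge_coords: "norm (exp t) = exp (Re t)" "Re (exp t * cis (- \<beta>)) = exp (Re t) * cos (Im t - \<beta>)"
  by (simp_all add: Re_exp Im_exp cos_diff algebra_simps)

lemma exp_in_wedge_iff:
  assumes "0 < \<epsilon>" "\<epsilon> \<le> pi" "\<bar>Im t - \<beta>\<bar> \<le> pi"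
  shows "exp t \<in> wedge \<beta> \<epsilon> R \<longleftrightarrow> R < exp (Re t) \<and> \<bar>Im t - \<beta>\<bar> < \<epsilon>"
proof -
  have "cos \<epsilon> < cos (Im t - \<beta>) \<longleftrightarrow> cos \<epsilon> < cos \<bar>Im t - \<beta>\<bar>" by simp
  also have "\<dots> \<longleftrightarrow> \<bar>Im t - \<beta>\<bar> < \<epsilon>" using assms by (intro cos_mono_less_eq) auto
  finally show ?thesis
    unfolding wedge_def mem_Collect_eq exp_wedge_coords by (simp add: mult.commute[of "cos \<epsilon>"])
qed

lemma polar_coordinate:
  assumes "z \<noteq> 0"
  obtains t where "exp t = z" "\<bar>Im t - \<beta>\<bar> \<le> pi"
proof
  define t where "t = Ln (z * cis (- \<beta>)) + \<i> * of_real \<beta>"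
  have "z * cis (- \<beta>) \<noteq> 0" using assms by simp
  then have "exp t = z * cis (- \<beta>) * exp (\<i> * of_real \<beta>)"
    unfolding t_def exp_add by (simp only: exp_Ln not_False_eq_True)
  then show "exp t = z" by (simp add: cis_conv_exp exp_minus)
  show "\<bar>Im t - \<beta>\<bar> \<le> pi"
    using mpi_less_Im_Ln[of "z * cis (- \<beta>)"] Im_Ln_le_pi[of "z * cis (- \<beta>)"] assms by (simp add: t_def)
qed

lemma open_wedge: "open (wedge \<beta> \<epsilon> R)"
  unfolding wedge_def by (intro open_Collect_conj open_Collect_less continuous_intros)

lemma frontier_wedge:
  assumes z: "z \<in> frontier (wedge \<beta> \<epsilon> R)" and R: "R > 0" and \<epsilon>: "0 < \<epsilon>" "\<epsilon> \<le> pi"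
  obtains t where "exp t = z" "\<bar>Im t - \<beta>\<bar> \<le> \<epsilon>" "R \<le> exp (Re t)" "R = exp (Re t) \<or> \<bar>Im t - \<beta>\<bar> = \<epsilon>"
proof -
  have "closed {z. R \<le> norm z \<and> cos \<epsilon> * norm z \<le> Re (z * cis (- \<beta>))}"
    by (intro closed_Collect_conj closed_Collect_le continuous_intros)
  then have "closure (wedge \<beta> \<epsilon> R) \<subseteq> {z. R \<le> norm z \<and> cos \<epsilon> * norm z \<le> Re (z * cis (- \<beta>))}"
    by (intro closure_minimal) (auto simp: wedge_def)
  then have z': "R \<le> norm z" "cos \<epsilon> * norm z \<le> Re (z * cis (- \<beta>))" "z \<notin> wedge \<beta> \<epsilon> R"
    using z open_wedge[of \<beta> \<epsilon> R] by (auto simp: frontier_def interior_open)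
  then have "z \<noteq> 0" using R by auto
  then obtain t where t: "exp t = z" "\<bar>Im t - \<beta>\<bar> \<le> pi" by (rule polar_coordinate)
  have "cos \<epsilon> \<le> cos \<bar>Im t - \<beta>\<bar>"
    using z'(2) unfolding t(1)[symmetric] exp_wedge_coords by (simp add: mult.commute[of "cos \<epsilon>"])
  then have le: "\<bar>Im t - \<beta>\<bar> \<le> \<epsilon>"
    using cos_monotone_0_pi[of \<epsilon> "\<bar>Im t - \<beta>\<bar>"] \<epsilon> t(2) by linarith
  have "R \<le> exp (Re t)" using z'(1) unfolding t(1)[symmetric] by simp
  moreover have "\<not> (R < exp (Re t) \<and> \<bar>Im t - \<beta>\<bar> < \<epsilon>)"
    using z'(3) exp_in_wedge_iff[OF \<epsilon> t(2), of R] t(1) by simp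
  ultimately show ?thesis using that[of t] t(1) le by linarith
qed

text \<open>
  The standard way to confine a component: it suffices that it does not meet the frontier.
\<close>

lemma connected_subset_of_open:
  assumes "connected S" "S \<inter> T \<noteq> {}" "S \<inter> frontier T = {}"
  shows "S \<subseteq> T"
  using connected_Int_frontier[OF assms(1,2)] assms(3) by blast

section \<open>Primitives close to a linear function\<close>

text \<open>
  On a sector around the positive axis, a function with derivative close to \<open>- \<i> / 3\<close> is expanding, and its
  real part is monotone along vertical lines.
\<close>

lemma nearly_linear:
  assumes S: "convex S" and d: "\<And>z. z \<in> S \<Longrightarrow> (H has_field_derivative H' z) (at z)"
    and le: "\<And>z. z \<in> S \<Longrightarrow> norm (H' z + \<i> / 3) \<le> 1 / 12" and xy: "x \<in> S" "y \<in> S"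
  shows "norm (H x - H y) \<ge> norm (x - y) / 4"
    and "y = x + \<i> * of_real s \<Longrightarrow> Re (H y) \<ge> Re (H x) + s / 3 - \<bar>s\<bar> / 12"
proof -
  have "norm ((H x + \<i> / 3 * x) - (H y + \<i> / 3 * y)) \<le> 1 / 12 * norm (x - y)"
    by (rule field_differentiable_bound[OF S _ le])
      (auto intro!: derivative_eq_intros has_field_derivative_at_within[OF d] xy)
  also have "(H x + \<i> / 3 * x) - (H y + \<i> / 3 * y) = (H x - H y) + \<i> / 3 * (x - y)"
    by (simp add: diff_divide_distrib algebra_simps)
  finally have b: "norm ((H x - H y) + \<i> / 3 * (x - y)) \<le> 1 / 12 * norm (x - y)" .
  have "norm (\<i> / 3 * (x - y)) \<le> norm ((H x - H y) + \<i> / 3 * (x - y)) + norm (H x - H y)"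
    using norm_triangle_ineq4[of "(H x - H y) + \<i> / 3 * (x - y)" "H x - H y"] by simp
  then show "norm (H x - H y) \<ge> norm (x - y) / 4"
    using b by (simp add: norm_mult norm_divide)
  assume y: "y = x + \<i> * of_real s"
  have "Re ((H x - H y) + \<i> / 3 * (x - y)) \<le> \<bar>s\<bar> / 12"
    using b complex_Re_le_cmod[of "(H x - H y) + \<i> / 3 * (x - y)"] by (simp add: y norm_mult)
  then show "Re (H y) \<ge> Re (H x) + s / 3 - \<bar>s\<bar> / 12" by (simp add: y)
qed

lemma exp_constant_imp_constant:
  assumes S: "connected S" and N: "continuous_on S N" and c: "\<And>x. x \<in> S \<Longrightarrow> exp (N x) = (c::complex)"
    and xy: "x \<in> S" "y \<in> S"
  shows "N x = N y"
proof -
  have "N constant_on S"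
  proof (rule continuous_discrete_range_constant[OF S N])
    fix x assume x: "x \<in> S"
    have "1 \<le> norm (N y - N x)" if y: "y \<in> S" "N y \<noteq> N x" for y
    proof -
      obtain n :: int where n: "N y = N x + (of_int (2 * n) * pi) * \<i>"
        using c[OF x] c[OF y(1)] exp_eq[of "N y" "N x"] by auto
      then have "n \<noteq> 0" using y(2) by auto
      then have "\<bar>real_of_int n\<bar> \<ge> 1" by linarith
      moreover have "norm (N y - N x) = 2 * \<bar>real_of_int n\<bar> * pi" by (simp add: n norm_mult)
      moreover have "1 * 1 \<le> (2 * \<bar>real_of_int n\<bar>) * pi"
        using calculation(1) pi_gt3 by (intro mult_mono) auto
      ultimately show ?thesis by simp
    qed
    then show "\<exists>e>0. \<forall>y. y \<in> S \<and> N y \<noteq> N x \<longrightarrow> e \<le> norm (N y - N x)" by (intro exI[of _ 1]) auto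
  qed
  then show ?thesis using xy by (auto simp: constant_on_def)
qed

section \<open>Quotients of solutions near a boundary ray\<close>

text \<open>
  The preimage of a small disc around \<open>0\<close> under \<open>(A g + B) / (C g + D)\<close> is a small neighbourhood of the
  zero \<open>- B / A\<close>, on which a logarithm is defined and bounded.
\<close>

lemma moebius_preimage_near:
  fixes A B C D :: complex
  assumes A: "A \<noteq> 0" and B: "B \<noteq> 0"
  shows "\<exists>r0>0. \<forall>r g. 0 < r \<longrightarrow> r \<le> r0 \<longrightarrow> norm (A * g + B) < r * norm (C * g + D) \<longrightarrow> norm (g / (- B / A) - 1) \<le> 1 / 2"
proof -
  define c where "c = - B / A"
  have c: "c \<noteq> 0" using A B by (simp add: c_def)
  have Ac: "A * g + B = A * (g - c)" for g using A by (simp add: c_def algebra_simps)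
  define r1 r2 where "r1 = norm A / (2 * (norm C + 1))" and "r2 = norm A * norm c / (4 * (norm C * norm c + norm D + 1))"
  have p1: "2 * (norm C + 1) > 0" by (simp add: add_nonneg_pos)
  have p2: "4 * (norm C * norm c + norm D + 1) > 0" by (simp add: add_nonneg_pos)
  have pos: "r1 > 0" "r2 > 0" using A c p1 p2 by (simp_all add: r1_def r2_def)
  show ?thesis
  proof (intro exI[of _ "min r1 r2"] conjI allI impI)
    fix r g assume r: "0 < r" "r \<le> min r1 r2" and lt: "norm (A * g + B) < r * norm (C * g + D)"
    have r1: "r * (2 * (norm C + 1)) \<le> norm A" using r p1 by (simp add: r1_def pos_le_divide_eq)
    have r2: "r * (4 * (norm C * norm c + norm D + 1)) \<le> norm A * norm c" using r p2 by (simp add: r2_def pos_le_divide_eq)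
    have "C * g + D = C * (g - c) + (C * c + D)" by (simp add: algebra_simps)
    then have "norm (C * g + D) \<le> norm (C * (g - c)) + norm (C * c + D)" using norm_triangle_ineq by metis
    also have "norm (C * c + D) \<le> norm (C * c) + norm D" by (rule norm_triangle_ineq)
    finally have "norm (C * g + D) \<le> norm C * norm (g - c) + (norm C * norm c + norm D)" by (simp add: norm_mult)
    then have "r * norm (C * g + D) \<le> r * (norm C * norm (g - c) + (norm C * norm c + norm D))"
      using r by (intro mult_left_mono) auto
    also have "\<dots> = (r * norm C) * norm (g - c) + r * (norm C * norm c + norm D)" by (simp add: algebra_simps)
    also have "\<dots> \<le> (norm A / 2) * norm (g - c) + norm A * norm c / 4"
    proof (intro add_mono mult_right_mono)
      show "r * norm C \<le> norm A / 2" using r1 r by (simp add: algebra_simps)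
      show "r * (norm C * norm c + norm D) \<le> norm A * norm c / 4" using r2 r by (simp add: algebra_simps)
    qed simp
    finally have "norm A * norm (g - c) < (norm A / 2) * norm (g - c) + norm A * norm c / 4"
      using lt unfolding Ac norm_mult by linarith
    then have "norm A * norm (g - c) < norm A * (norm c / 2)" by (simp add: algebra_simps)
    then have "norm (g - c) < norm c / 2" using A by simp
    moreover have "g / c - 1 = (g - c) / c" using c by (simp add: diff_divide_distrib)
    ultimately show "norm (g / (- B / A) - 1) \<le> 1 / 2"
      unfolding c_def[symmetric] using c by (simp add: norm_divide divide_le_eq)
  qed (use pos in auto)
qed

text \<open>
  If the zero of the Moebius transformation is \<open>0\<close> itself, the preimages of small discs are nearly round discs
  around \<open>0\<close>. So a decrease of \<open>\<bar>Y\<bar>\<close> keeps the image in a disc of comparable radius.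
\<close>

lemma moebius_preimage_star:
  fixes A C D :: complex
  assumes A: "A \<noteq> 0" and D: "D \<noteq> 0" and R: "R > 0"
  shows "\<exists>r>0. r \<le> R \<and> (\<forall>Y Y'. norm (A * Y) < r * norm (C * Y + D) \<longrightarrow> norm Y' \<le> norm Y \<longrightarrow>
     norm (A * Y') < R * norm (C * Y' + D))"
proof -
  define r where "r = min (R / 8) (norm A / (4 * (norm C + 1)))"
  have p: "4 * (norm C + 1) > 0" by (simp add: add_nonneg_pos)
  have "norm A / (4 * (norm C + 1)) > 0" using A p by simp
  then have r: "r > 0" "r \<le> R / 8" using R unfolding r_def by linarith+
  have rC: "4 * (r * norm C) \<le> norm A"
  proof -
    have "r * (4 * (norm C + 1)) \<le> norm A" using p by (simp add: r_def pos_le_divide_eq[symmetric])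
    then show ?thesis using r by (simp add: algebra_simps)
  qed
  show ?thesis
  proof (intro exI[of _ r] conjI allI impI)
    fix Y Y' :: complex assume Y: "norm (A * Y) < r * norm (C * Y + D)" "norm Y' \<le> norm Y"
    have "norm (C * Y + D) \<le> norm C * norm Y + norm D"
      using norm_triangle_ineq[of "C * Y" D] by (simp add: norm_mult)
    then have "r * norm (C * Y + D) \<le> r * (norm C * norm Y + norm D)" using r by (intro mult_left_mono) auto
    then have "norm A * norm Y < (r * norm C) * norm Y + r * norm D" using Y(1) by (simp add: norm_mult algebra_simps)
    moreover have "4 * (r * norm C) * norm Y \<le> norm A * norm Y" using rC by (intro mult_right_mono) auto
    ultimately have "3 * (norm A * norm Y) < 4 * (r * norm D)" by simp
    moreover have "norm A * norm Y' \<le> norm A * norm Y" using Y(2) by (intro mult_left_mono) auto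
    ultimately have b: "3 * (norm A * norm Y') < 4 * (r * norm D)" by linarith
    have "4 * (r * norm C) * norm Y' \<le> norm A * norm Y'" using rC by (intro mult_right_mono) auto
    then have "3 * (r * (norm C * norm Y')) < r * norm D" using b by simp
    then have "r * (3 * (norm C * norm Y')) < r * norm D" by (simp add: mult_ac)
    then have CY: "3 * (norm C * norm Y') < norm D" using r by simp
    have "norm D \<le> norm (C * Y' + D) + norm C * norm Y'"
      using norm_triangle_ineq4[of "C * Y' + D" "C * Y'"] by (simp add: norm_mult)
    then have "2 * norm D < 3 * norm (C * Y' + D)" using CY by linarith
    then have "R * (2 * norm D) < R * (3 * norm (C * Y' + D))" using R by simp
    moreover have "8 * (r * norm D) \<le> R * norm D" using r by (simp add: mult_right_mono[of "8 * r" R, simplified mult.assoc])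
    moreover have "r * norm D > 0" using r D by simp
    ultimately have "3 * (norm A * norm Y') < 3 * (R * norm (C * Y' + D))" using b by simp
    then show "norm (A * Y') < R * norm (C * Y' + D)" by (simp add: norm_mult)
  qed (use r R in auto)
qed

text \<open>
  The condition \<open>w_wronskian\<close> says that \<open>y1 - w k * y2\<close> is a multiple of the subdominant solution, so that \<open>w k\<close>
  is the asymptotic value of the quotient in the sector with index \<open>k\<close>.
\<close>

locale solution_quotient = solution_basis +
  fixes f y1 y2 :: "complex \<Rightarrow> complex" and w :: "int \<Rightarrow> complex"
  assumes f_meromorphic: "f nicely_meromorphic_on UNIV"
    and y_solution: "sol y1" "sol y2" and y_wronskian: "wronskian y1 y2 0 \<noteq> 0"
    and f_quotient: "\<And>t. f (exp t) = y1 t / y2 t"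
    and f_pole: "\<And>t. is_pole f (exp t) \<longleftrightarrow> y2 t = 0"
    and w_wronskian: "\<And>k. wronskian y1 (subdominant k) 0 = w k * wronskian y2 (subdominant k) 0"
    and w_Suc: "\<And>k. w (k + 1) \<noteq> w k" and w_periodic: "\<And>k. w (k + 12) = w k"
begin

text \<open>
  Numerator and denominator of \<open>f - c\<close>, respectively of \<open>1 / f\<close>, on the cover. In these terms the
  preimages of discs are described without mention of poles.
\<close>

definition num :: "complex option \<Rightarrow> complex \<Rightarrow> complex" where
  "num s = (case s of None \<Rightarrow> y2 | Some c \<Rightarrow> (\<lambda>t. 1 * y1 t + (- c) * y2 t))"

definition den :: "complex option \<Rightarrow> complex \<Rightarrow> complex" where
  "den s = (case s of None \<Rightarrow> y1 | Some c \<Rightarrow> y2)"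

lemma y_no_common_zero: "y2 t = 0 \<Longrightarrow> y1 t \<noteq> 0"
  using wronskian_const[OF y_solution, of t] y_wronskian by (auto simp: wronskian_def)

lemma num_den_solution: "sol (num s)" "sol (den s)"
  by (cases s; simp only: num_def den_def option.case y_solution solution_lincomb(1)[OF y_solution])+

lemma num_den_wronskian: "wronskian (num s) (den s) 0 \<noteq> 0"
proof (cases s)
  case None
  then show ?thesis using y_wronskian wronskian_swap[of y2 y1 0] by (simp add: num_def den_def)
next
  case (Some c)
  have "wronskian (\<lambda>t. 1 * y1 t + (- c) * y2 t) y2 0 = wronskian y1 y2 0"
    unfolding wronskian_lincomb_left[OF y_solution] by simp
  then show ?thesis unfolding Some num_def den_def option.case using y_wronskian by metis
qed

lemma exp_in_disc_preimage_iff: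
  assumes r: "r > 0"
  shows "exp t \<in> disc_preimage f s r \<longleftrightarrow> norm (num s t) < r * norm (den s t)"
proof (cases s)
  case None
  show ?thesis
  proof (cases "y2 t = 0")
    case True
    then show ?thesis using y_no_common_zero[OF True] r f_pole
      by (simp add: None mem_disc_preimage_None num_def den_def)
  next
    case False
    then have "norm (y2 t) > 0" by simp
    then show ?thesis using r f_pole False
      by (simp add: None mem_disc_preimage_None num_def den_def f_quotient norm_divide divide_simps mult.commute)
  qed
next
  case (Some c)
  show ?thesis
  proof (cases "y2 t = 0")
    case True
    then show ?thesis using f_pole by (simp add: Some mem_disc_preimage_Some den_def)
  next
    case False
    then have "norm (y2 t) > 0" by simp
    moreover have "y1 t / y2 t - c = (y1 t - c * y2 t) / y2 t" using False by (simp add: diff_divide_distrib)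
    ultimately show ?thesis using f_pole False
      by (simp add: Some mem_disc_preimage_Some num_def den_def f_quotient norm_divide divide_less_eq)
  qed
qed

lemma y2_not_subdominant: "wronskian y2 (subdominant k) 0 \<noteq> 0"
proof
  assume 0: "wronskian y2 (subdominant k) 0 = 0"
  then have "wronskian y1 (subdominant k) 0 = 0" using w_wronskian by simp
  then obtain c d where c: "\<And>t. y1 t = c * subdominant k t" and d: "\<And>t. y2 t = d * subdominant k t"
    using 0 proportional_subdominant y_solution by metis
  have "y1 = (\<lambda>t. c * subdominant k t)" "y2 = (\<lambda>t. d * subdominant k t)" using c d by auto
  then have "wronskian y1 y2 0 = c * (d * wronskian (subdominant k) (subdominant k) 0)"
    by (simp only: wronskian_cmult[OF subdominant_solution] mult.left_commute)
  then show False using y_wronskian by simp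
qed

lemma quotient_tendsto:
  assumes "0 \<le> \<delta>" "\<delta> < pi / 12"
  shows "((\<lambda>t. y1 t / y2 t) \<longlongrightarrow> w k) (sector_at_infinity k \<delta>)"
    and "eventually (\<lambda>t. y2 t \<noteq> 0) (sector_at_infinity k \<delta>)"
proof -
  have \<delta>: "\<delta> \<le> wide_angle" using assms wide_angle_bounds by linarith
  note q = quotient_tendsto_in_sector[OF subdominant_solution y_solution assms subdominant_tendsto[OF \<delta>]
    one_neq_zero y2_not_subdominant]
  show "((\<lambda>t. y1 t / y2 t) \<longlongrightarrow> w k) (sector_at_infinity k \<delta>)"
    using q(1)[of k] y2_not_subdominant[of k] by (simp add: w_wronskian)
  show "eventually (\<lambda>t. y2 t \<noteq> 0) (sector_at_infinity k \<delta>)" by (rule q(2))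
qed

lemma num_w: "\<exists>c. c \<noteq> 0 \<and> (\<forall>t. num (Some (w k)) t = c * subdominant k t)"
proof -
  have "wronskian (num (Some (w k))) (subdominant k) 0 = 0"
    unfolding num_def option.case wronskian_lincomb_left[OF y_solution] by (simp add: w_wronskian)
  then obtain c where c: "\<And>t. num (Some (w k)) t = c * subdominant k t"
    using proportional_subdominant num_den_solution by blast
  moreover have "c \<noteq> 0"
  proof
    assume "c = 0"
    then have "num (Some (w k)) = (\<lambda>t. 0 * y2 t)" using c by auto
    then have "wronskian (num (Some (w k))) (den (Some (w k))) 0 = 0"
      by (simp only: wronskian_cmult(1)[OF y_solution(2)]) simp
    then show False using num_den_wronskian by blast
  qed
  ultimately show ?thesis by blast
qed

definition far_sector :: "int \<Rightarrow> real \<Rightarrow> real \<Rightarrow> complex set" where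
  "far_sector k \<delta> B = exp ` {t. B \<le> Re t \<and> \<bar>Im t - of_int k * pi / 6\<bar> \<le> \<delta>}"

lemma connected_far_sector: "connected (far_sector k \<delta> B)"
proof -
  have "{t. B \<le> Re t \<and> \<bar>Im t - of_int k * pi / 6\<bar> \<le> \<delta>} =
     {t. Re t \<ge> B} \<inter> ({t. Im t \<ge> of_int k * pi / 6 - \<delta>} \<inter> {t. Im t \<le> of_int k * pi / 6 + \<delta>})" by auto
  then have "convex {t. B \<le> Re t \<and> \<bar>Im t - of_int k * pi / 6\<bar> \<le> \<delta>}"
    by (simp only:) (intro convex_Int convex_halfspace_Re_ge convex_halfspace_Im_ge convex_halfspace_Im_le)
  then show ?thesis unfolding far_sector_def
    by (intro connected_continuous_image convex_connected continuous_intros)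
qed

lemma ray_in_far_sector: "0 \<le> \<delta> \<Longrightarrow> B \<le> B' \<Longrightarrow> exp (Complex B' (of_int k * pi / 6)) \<in> far_sector k \<delta> B"
  by (auto simp: far_sector_def)

lemma far_sector_subset:
  assumes r: "r > 0" and \<delta>: "0 \<le> \<delta>" "\<delta> < pi / 12"
  shows "\<exists>B. \<forall>B'\<ge>B. far_sector k \<delta> B' \<subseteq> disc_preimage f (Some (w k)) r"
proof -
  have "eventually (\<lambda>t. norm (y1 t / y2 t - w k) < r) (sector_at_infinity k \<delta>)"
    using tendstoD[OF quotient_tendsto(1)[OF \<delta>] r] by (simp add: dist_norm)
  from eventually_conj[OF this quotient_tendsto(2)[OF \<delta>]]
  obtain B where B: "\<And>t. Re t \<ge> B \<Longrightarrow> \<bar>Im t - of_int k * pi / 6\<bar> \<le> \<delta> \<Longrightarrow> norm (y1 t / y2 t - w k) < r \<and> y2 t \<noteq> 0"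
    by (auto simp: eventually_sector)
  have "exp t \<in> disc_preimage f (Some (w k)) r" if "Re t \<ge> B" "\<bar>Im t - of_int k * pi / 6\<bar> \<le> \<delta>" for t
    using B[OF that] by (simp add: mem_disc_preimage_Some f_pole f_quotient)
  then show ?thesis by (intro exI[of _ B]) (auto simp: far_sector_def)
qed

lemma exp_shift_period: "exp (t + \<i> * of_real (of_int j * (2 * pi))) = exp t"
  using exp_plus_2pin[of t j] by (simp add: mult_ac)

lemma far_sector_periodic: "far_sector (k + 12 * j) \<delta> B = far_sector k \<delta> B"
proof -
  have sub: "far_sector (k + 12 * j) \<delta> B \<subseteq> far_sector k \<delta> B" for k j
  proof
    fix z assume "z \<in> far_sector (k + 12 * j) \<delta> B"
    then obtain t where t: "z = exp t" "B \<le> Re t" "\<bar>Im t - of_int (k + 12 * j) * pi / 6\<bar> \<le> \<delta>"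
      by (auto simp: far_sector_def)
    have "Im (t + \<i> * of_real (of_int (- j) * (2 * pi))) - of_int k * pi / 6 = Im t - of_int (k + 12 * j) * pi / 6"
      by (simp add: field_simps)
    then show "z \<in> far_sector k \<delta> B" unfolding far_sector_def
      using t exp_shift_period[of t "- j"]
      by (intro image_eqI[of _ _ "t + \<i> * of_real (of_int (- j) * (2 * pi))"]) auto
  qed
  show ?thesis using sub[of k j] sub[of "k + 12 * j" "- j"] by auto
qed

lemma w_periodic': "w (k + 12 * j) = w k"
proof -
  have "w (k + 12 * int i) = w k" for k i
  proof (induction i)
    case (Suc i)
    have "k + 12 * int (Suc i) = (k + 12 * int i) + 12" by simp
    then show ?case using Suc w_periodic[of "k + 12 * int i"] by (simp only:)
  qed simp
  note p = this
  show ?thesis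
  proof (cases "j \<ge> 0")
    case True
    then show ?thesis using p[of k "nat j"] by simp
  next
    case False
    then show ?thesis using p[of "k + 12 * j" "nat (- j)"] by simp
  qed
qed

text \<open>
  In the wide sector the numerator of \<open>f - w k\<close> is a multiple of the subdominant solution, which has no zeros
  far out. In the remaining parts up to the middle rays of the neighbouring sectors, \<open>f\<close> is close to a
  neighbouring asymptotic value, which differs from \<open>w k\<close>.
\<close>

lemma far_value:
  "\<exists>B \<eta>. \<eta> > 0 \<and> (\<forall>t. Re t \<ge> B \<longrightarrow> \<bar>Im t - of_int k * pi / 6\<bar> \<le> pi / 6 \<longrightarrow> num (Some (w k)) t \<noteq> 0 \<and>
     (\<bar>Im t - of_int k * pi / 6\<bar> \<ge> wide_angle \<longrightarrow> \<eta> * norm (den (Some (w k)) t) \<le> norm (num (Some (w k)) t)))"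
proof -
  define \<delta> where "\<delta> = pi / 6 - wide_angle"
  have \<delta>: "0 \<le> \<delta>" "\<delta> < pi / 12" using wide_angle_bounds by (simp_all add: \<delta>_def)
  have side: "\<exists>B \<eta>. \<eta> > 0 \<and> (\<forall>t. Re t \<ge> B \<longrightarrow> \<bar>Im t - of_int j * pi / 6\<bar> \<le> \<delta> \<longrightarrow>
     y2 t \<noteq> 0 \<and> \<eta> * norm (y2 t) \<le> norm (num (Some (w k)) t))" if ne: "w j \<noteq> w k" for j
  proof -
    define \<eta> where "\<eta> = norm (w j - w k) / 2"
    have \<eta>: "\<eta> > 0" using ne by (simp add: \<eta>_def)
    have "eventually (\<lambda>t. norm (y1 t / y2 t - w j) < \<eta>) (sector_at_infinity j \<delta>)"
      using tendstoD[OF quotient_tendsto(1)[OF \<delta>] \<eta>] by (simp add: dist_norm)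
    from eventually_conj[OF this quotient_tendsto(2)[OF \<delta>]]
    obtain B where B: "\<And>t. Re t \<ge> B \<Longrightarrow> \<bar>Im t - of_int j * pi / 6\<bar> \<le> \<delta> \<Longrightarrow> norm (y1 t / y2 t - w j) < \<eta> \<and> y2 t \<noteq> 0"
      by (auto simp: eventually_sector)
    have "\<eta> * norm (y2 t) \<le> norm (num (Some (w k)) t)" if "norm (y1 t / y2 t - w j) < \<eta> \<and> y2 t \<noteq> 0" for t
    proof -
      have "norm (y1 t / y2 t - w k) \<ge> \<eta>"
        using norm_triangle_ineq4[of "y1 t / y2 t - w k" "y1 t / y2 t - w j"] that by (simp add: \<eta>_def)
      then have "\<eta> * norm (y2 t) \<le> norm (y1 t / y2 t - w k) * norm (y2 t)" by (intro mult_right_mono) auto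
      also have "\<dots> = norm (num (Some (w k)) t)"
        using that by (simp add: num_def norm_mult[symmetric] algebra_simps)
      finally show ?thesis .
    qed
    then show ?thesis using B \<eta> by blast
  qed
  obtain B1 \<eta>1 where B1: "\<eta>1 > 0" "\<And>t. Re t \<ge> B1 \<Longrightarrow> \<bar>Im t - of_int (k + 1) * pi / 6\<bar> \<le> \<delta> \<Longrightarrow>
     y2 t \<noteq> 0 \<and> \<eta>1 * norm (y2 t) \<le> norm (num (Some (w k)) t)"
    using side[of "k + 1"] w_Suc by blast
  obtain B2 \<eta>2 where B2: "\<eta>2 > 0" "\<And>t. Re t \<ge> B2 \<Longrightarrow> \<bar>Im t - of_int (k - 1) * pi / 6\<bar> \<le> \<delta> \<Longrightarrow>
     y2 t \<noteq> 0 \<and> \<eta>2 * norm (y2 t) \<le> norm (num (Some (w k)) t)"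
    using side[of "k - 1"] w_Suc[of "k - 1"] by fastforce
  obtain B3 where B3: "\<And>t. Re t \<ge> B3 \<Longrightarrow> \<bar>Im t - of_int k * pi / 6\<bar> \<le> wide_angle \<Longrightarrow> subdominant k t \<noteq> 0"
    using subdominant_eventually_nonzero[of k] by (auto simp: eventually_sector)
  obtain c where c: "c \<noteq> 0" "\<And>t. num (Some (w k)) t = c * subdominant k t" using num_w by blast
  show ?thesis
  proof (rule exI[of _ "max B1 (max B2 B3)"], rule exI[of _ "min \<eta>1 \<eta>2"], intro conjI allI impI)
    fix t assume t: "max B1 (max B2 B3) \<le> Re t" "\<bar>Im t - of_int k * pi / 6\<bar> \<le> pi / 6"
    have out: "min \<eta>1 \<eta>2 * norm (y2 t) \<le> norm (num (Some (w k)) t) \<and> y2 t \<noteq> 0"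
      if "\<bar>Im t - of_int k * pi / 6\<bar> \<ge> wide_angle"
    proof (cases "Im t \<ge> of_int k * pi / 6")
      case True
      have e: "of_int (k + 1) * pi / 6 = of_int k * pi / 6 + pi / 6" by (simp add: field_simps)
      have "\<bar>Im t - of_int (k + 1) * pi / 6\<bar> \<le> \<delta>" unfolding e \<delta>_def using t that True by linarith
      moreover have "min \<eta>1 \<eta>2 * norm (y2 t) \<le> \<eta>1 * norm (y2 t)" by (intro mult_right_mono) auto
      moreover have "Re t \<ge> B1" using t by simp
      ultimately show ?thesis using B1(2)[of t] by (meson order_trans)
    next
      case False
      have e: "of_int (k - 1) * pi / 6 = of_int k * pi / 6 - pi / 6" by (simp add: field_simps)
      have "\<bar>Im t - of_int (k - 1) * pi / 6\<bar> \<le> \<delta>" unfolding e \<delta>_def using t that False by linarith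
      moreover have "min \<eta>1 \<eta>2 * norm (y2 t) \<le> \<eta>2 * norm (y2 t)" by (intro mult_right_mono) auto
      moreover have "Re t \<ge> B2" using t by simp
      ultimately show ?thesis using B2(2)[of t] by (meson order_trans)
    qed
    then show "min \<eta>1 \<eta>2 * norm (den (Some (w k)) t) \<le> norm (num (Some (w k)) t)"
      if "wide_angle \<le> \<bar>Im t - of_int k * pi / 6\<bar>" using that by (simp add: den_def)
    show "num (Some (w k)) t \<noteq> 0"
    proof (cases "\<bar>Im t - of_int k * pi / 6\<bar> \<le> wide_angle")
      case True
      then show ?thesis using B3[of t] t c by simp
    next
      case False
      then have "min \<eta>1 \<eta>2 * norm (y2 t) \<le> norm (num (Some (w k)) t)" "y2 t \<noteq> 0" using out by auto
      moreover have "min \<eta>1 \<eta>2 * norm (y2 t) > 0" using B1(1) B2(1) \<open>y2 t \<noteq> 0\<close> by simp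
      ultimately show ?thesis by auto
    qed
  qed (use B1(1) B2(1) in auto)
qed

section \<open>The tracts over the asymptotic values\<close>

text \<open>
  The component that contains the far part of the middle ray. The base point is an arbitrary point far out on
  this ray; all of them yield the same component.
\<close>

definition tract :: "int \<Rightarrow> real \<Rightarrow> complex set" where
  "tract k r = connected_component_set (disc_preimage f (Some (w k)) r)
     (exp (Complex (SOME B. far_sector k 0 B \<subseteq> disc_preimage f (Some (w k)) r) (of_int k * pi / 6)))"

lemma tract_contains_far_sector:
  assumes r: "r > 0" and \<delta>: "\<delta> \<ge> 0" and sub: "far_sector k \<delta> B \<subseteq> disc_preimage f (Some (w k)) r"
  shows "far_sector k \<delta> B \<subseteq> tract k r" "tract k r \<in> components (disc_preimage f (Some (w k)) r)"
proof -
  define B0 where "B0 = (SOME B. far_sector k 0 B \<subseteq> disc_preimage f (Some (w k)) r)"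
  have "\<exists>B. far_sector k 0 B \<subseteq> disc_preimage f (Some (w k)) r"
    using far_sector_subset[OF r, of 0 k] by auto
  then have B0: "far_sector k 0 B0 \<subseteq> disc_preimage f (Some (w k)) r" unfolding B0_def by (rule someI_ex)
  have tr: "tract k r = connected_component_set (disc_preimage f (Some (w k)) r) (exp (Complex B0 (of_int k * pi / 6)))"
    by (simp add: tract_def B0_def)
  have base: "exp (Complex B0 (of_int k * pi / 6)) \<in> far_sector k 0 B0" by (simp add: ray_in_far_sector)
  show comp: "tract k r \<in> components (disc_preimage f (Some (w k)) r)"
    unfolding tr using base B0 by (intro componentsI) auto
  have "far_sector k 0 B0 \<subseteq> tract k r" unfolding tr
    by (rule connected_component_maximal[OF base connected_far_sector B0])
  then have "exp (Complex (max B B0) (of_int k * pi / 6)) \<in> tract k r"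
    using ray_in_far_sector[of 0 B0 "max B B0" k] by auto
  moreover have "exp (Complex (max B B0) (of_int k * pi / 6)) \<in> far_sector k \<delta> B"
    using ray_in_far_sector[OF \<delta>, of B "max B B0" k] by auto
  ultimately show "far_sector k \<delta> B \<subseteq> tract k r"
    by (intro components_maximal[OF comp connected_far_sector sub]) blast
qed

lemma tract_component:
  assumes "r > 0" shows "tract k r \<in> components (disc_preimage f (Some (w k)) r)"
proof -
  obtain B where "far_sector k 0 B \<subseteq> disc_preimage f (Some (w k)) r"
    using far_sector_subset[OF assms, of 0 k] by auto
  then show ?thesis using tract_contains_far_sector(2)[OF assms order_refl] by blast
qed

lemma tract_mono:
  assumes "0 < r" "r \<le> r'" shows "tract k r \<subseteq> tract k r'"
proof -
  obtain B where B: "far_sector k 0 B \<subseteq> disc_preimage f (Some (w k)) r"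
    using far_sector_subset[OF assms(1), of 0 k] by auto
  have sub: "disc_preimage f (Some (w k)) r \<subseteq> disc_preimage f (Some (w k)) r'"
    by (rule disc_preimage_mono[OF assms])
  have r': "r' > 0" using assms by simp
  have "far_sector k 0 B \<subseteq> tract k r" "far_sector k 0 B \<subseteq> tract k r'"
    using tract_contains_far_sector(1)[of r 0 k B] tract_contains_far_sector(1)[of r' 0 k B] assms B sub by auto
  then have "tract k r' \<inter> tract k r \<noteq> {}" using ray_in_far_sector[of 0 B B k] by auto
  then show ?thesis
    by (intro components_maximal[OF tract_component[OF r']])
      (use in_components_connected[OF tract_component[OF assms(1)]] in_components_subset[OF tract_component[OF assms(1)]] sub in auto)
qed

text \<open>
  For small discs the tract cannot cross the middle rays of the neighbouring sectors, nor an arc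
  joining them far out; so it is confined to a wedge outside any given disc.
\<close>

lemma tract_in_wedge:
  assumes R: "R > 0"
  shows "\<exists>r0>0. \<forall>r. 0 < r \<longrightarrow> r \<le> r0 \<longrightarrow> tract k r \<subseteq> wedge (of_int k * pi / 6) (pi / 6) R"
proof -
  obtain B \<eta> where \<eta>: "\<eta> > 0" and far: "\<And>t. Re t \<ge> B \<Longrightarrow> \<bar>Im t - of_int k * pi / 6\<bar> \<le> pi / 6 \<Longrightarrow>
     num (Some (w k)) t \<noteq> 0 \<and>
     (\<bar>Im t - of_int k * pi / 6\<bar> \<ge> wide_angle \<longrightarrow> \<eta> * norm (den (Some (w k)) t) \<le> norm (num (Some (w k)) t))"
    using far_value[of k] by blast
  define \<tau> where "\<tau> = max B (ln R)"
  define R' where "R' = exp \<tau>"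
  have "exp (ln R) \<le> exp \<tau>" by (simp only: exp_le_cancel_iff) (simp add: \<tau>_def)
  then have R': "R' \<ge> R" "R' > 0" using R by (simp_all add: R'_def)
  define Q where "Q = (\<lambda>\<alpha>. Complex \<tau> \<alpha>) ` {of_int k * pi / 6 - pi / 6..of_int k * pi / 6 + pi / 6}"
  have Qc: "compact Q" unfolding Q_def Complex_eq by (intro compact_continuous_image continuous_intros) auto
  have Qne: "Q \<noteq> {}" using pi_gt_zero by (simp add: Q_def)
  have Qin: "t \<in> Q \<longleftrightarrow> Re t = \<tau> \<and> \<bar>Im t - of_int k * pi / 6\<bar> \<le> pi / 6" for t
  proof -
    have "t \<in> Q \<longleftrightarrow> Re t = \<tau> \<and> of_int k * pi / 6 - pi / 6 \<le> Im t \<and> Im t \<le> of_int k * pi / 6 + pi / 6"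
      by (cases t) (auto simp: Q_def image_iff)
    also have "\<dots> \<longleftrightarrow> Re t = \<tau> \<and> \<bar>Im t - of_int k * pi / 6\<bar> \<le> pi / 6" by linarith
    finally show ?thesis .
  qed
  have cont: "continuous_on Q u" if "sol u" for u
    using solution_holomorphic[OF that] holomorphic_on_imp_continuous_on continuous_on_subset by blast
  obtain t1 where t1: "t1 \<in> Q" "\<And>t. t \<in> Q \<Longrightarrow> norm (num (Some (w k)) t1) \<le> norm (num (Some (w k)) t)"
    using continuous_attains_inf[OF Qc Qne continuous_on_norm[OF cont[OF num_den_solution(1)]]] by blast
  obtain t2 where t2: "t2 \<in> Q" "\<And>t. t \<in> Q \<Longrightarrow> norm (den (Some (w k)) t) \<le> norm (den (Some (w k)) t2)"
    using continuous_attains_sup[OF Qc Qne continuous_on_norm[OF cont[OF num_den_solution(2)]]] by blast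
  define p q where "p = norm (num (Some (w k)) t1)" and "q = norm (den (Some (w k)) t2) + 1"
  have p: "p > 0" using far[of t1] t1(1) by (simp add: p_def Qin \<tau>_def)
  have q: "q > 0" by (simp add: q_def add_nonneg_pos)
  show ?thesis
  proof (intro exI[of _ "min \<eta> (p / q)"] conjI allI impI)
    fix r assume r: "0 < r" "r \<le> min \<eta> (p / q)"
    have rq: "r * q \<le> p" using r q by (simp add: pos_le_divide_eq)
    let ?W = "wedge (of_int k * pi / 6) (pi / 6) R'"
    have avoid: "z \<notin> disc_preimage f (Some (w k)) r" if z: "z \<in> frontier ?W" for z
    proof -
      have "0 < pi / 6" "pi / 6 \<le> pi" using pi_gt_zero by simp_all
      from frontier_wedge[OF z R'(2) this] obtain t where t: "exp t = z" "\<bar>Im t - of_int k * pi / 6\<bar> \<le> pi / 6"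
        "R' \<le> exp (Re t)" "R' = exp (Re t) \<or> \<bar>Im t - of_int k * pi / 6\<bar> = pi / 6" by blast
      have Ret: "Re t \<ge> \<tau>" using t(3) by (simp add: R'_def)
      have "\<not> norm (num (Some (w k)) t) < r * norm (den (Some (w k)) t)"
      proof (cases "R' = exp (Re t)")
        case True
        then have "t \<in> Q" using t by (simp add: R'_def Qin)
        have "r * norm (den (Some (w k)) t) \<le> r * q"
          using t2(2)[OF \<open>t \<in> Q\<close>] r by (intro mult_left_mono) (auto simp: q_def)
        also have "\<dots> \<le> p" by (rule rq)
        also have "p \<le> norm (num (Some (w k)) t)" using t1(2)[OF \<open>t \<in> Q\<close>] by (simp add: p_def)
        finally show ?thesis by simp
      next
        case False
        then have "\<bar>Im t - of_int k * pi / 6\<bar> = pi / 6" using t by blast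
        then have "\<eta> * norm (den (Some (w k)) t) \<le> norm (num (Some (w k)) t)"
          using far[of t] Ret wide_angle_bounds by (simp add: \<tau>_def)
        moreover have "r * norm (den (Some (w k)) t) \<le> \<eta> * norm (den (Some (w k)) t)"
          using r by (intro mult_right_mono) auto
        ultimately show ?thesis by simp
      qed
      then show ?thesis using exp_in_disc_preimage_iff[OF r(1)] t(1) by blast
    qed
    have "tract k r \<subseteq> ?W"
    proof (rule connected_subset_of_open)
      show "connected (tract k r)" by (rule in_components_connected[OF tract_component[OF r(1)]])
      show "tract k r \<inter> frontier ?W = {}"
        using avoid in_components_subset[OF tract_component[OF r(1)]] by blast
      obtain B1 where B1: "far_sector k 0 B1 \<subseteq> disc_preimage f (Some (w k)) r"
        using far_sector_subset[OF r(1), of 0 k] by auto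
      define t where "t = Complex (max B1 (\<tau> + 1)) (of_int k * pi / 6)"
      have "exp t \<in> tract k r"
        using tract_contains_far_sector(1)[OF r(1) order_refl B1] ray_in_far_sector[of 0 B1 "max B1 (\<tau> + 1)" k]
        by (auto simp: t_def)
      moreover have "exp t \<in> ?W"
        using exp_in_wedge_iff[of "pi / 6" t "of_int k * pi / 6" R'] pi_gt_zero by (simp add: t_def R'_def)
      ultimately show "tract k r \<inter> ?W \<noteq> {}" by blast
    qed
    also have "?W \<subseteq> wedge (of_int k * pi / 6) (pi / 6) R" using R' by (auto simp: wedge_def)
    finally show "tract k r \<subseteq> wedge (of_int k * pi / 6) (pi / 6) R" .
  qed (use \<eta> p q in auto)
qed

lemma tract_singularity: "(Some (w k), restrict (tract k) {0<..}) \<in> transcendental_singularities f"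
proof -
  have "(\<Inter>r\<in>{0<..}. tract k r) = {}"
  proof (rule ccontr)
    assume "(\<Inter>r\<in>{0<..}. tract k r) \<noteq> {}"
    then obtain z where z: "\<And>r. r > 0 \<Longrightarrow> z \<in> tract k r" by blast
    obtain r where r: "r > 0" "tract k r \<subseteq> wedge (of_int k * pi / 6) (pi / 6) (norm z + 1)"
      using tract_in_wedge[of "norm z + 1" k] by (auto simp: add_nonneg_pos)
    then show False using z[OF r(1)] by (auto simp: wedge_def)
  qed
  moreover have "\<forall>r s. 0 < r \<longrightarrow> r \<le> s \<longrightarrow> restrict (tract k) {0<..} r \<subseteq> restrict (tract k) {0<..} s"
    using tract_mono by auto
  moreover have "restrict (tract k) {0<..} \<in> (\<Pi>\<^sub>E r\<in>{0<..}. components {z. sphere_value f z \<in> sphere_disc (Some (w k)) r})"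
    using tract_component unfolding disc_preimage_def by auto
  ultimately show ?thesis by (auto simp: transcendental_singularities_def)
qed

text \<open>
  The tracts lie in wedges around the middle rays, so only neighbouring ones could coincide, and these belong
  to different asymptotic values.
\<close>

lemma tract_inj:
  assumes kj: "k \<in> {0..11}" "j \<in> {0..11}" and w: "w k = w j" and tr: "\<And>r. r > 0 \<Longrightarrow> tract k r = tract j r"
  shows "k = j"
proof -
  obtain r1 r2 where r: "r1 > 0" "\<And>r. 0 < r \<Longrightarrow> r \<le> r1 \<Longrightarrow> tract k r \<subseteq> wedge (of_int k * pi / 6) (pi / 6) 1"
    "r2 > 0" "\<And>r. 0 < r \<Longrightarrow> r \<le> r2 \<Longrightarrow> tract j r \<subseteq> wedge (of_int j * pi / 6) (pi / 6) 1"
    using tract_in_wedge[of 1 k] tract_in_wedge[of 1 j] by auto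
  define r where "r = min r1 r2"
  have "r > 0" using r by (simp add: r_def)
  then obtain z where z: "z \<in> tract k r"
    using in_components_nonempty[OF tract_component] by blast
  then have zw: "z \<in> wedge (of_int k * pi / 6) (pi / 6) 1" "z \<in> wedge (of_int j * pi / 6) (pi / 6) 1"
    using r(2)[of r] r(4)[of r] tr[OF \<open>r > 0\<close>] \<open>r > 0\<close> by (auto simp: r_def)
  then have z0: "z \<noteq> 0" by (auto simp: wedge_def)
  have pi: "0 < pi / 6" "pi / 6 \<le> pi" using pi_gt_zero by simp_all
  obtain t where t: "exp t = z" "\<bar>Im t - of_int k * pi / 6\<bar> \<le> pi" using polar_coordinate[OF z0] by metis
  obtain t' where t': "exp t' = z" "\<bar>Im t' - of_int j * pi / 6\<bar> \<le> pi" using polar_coordinate[OF z0] by metis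
  have b: "\<bar>Im t - of_int k * pi / 6\<bar> < pi / 6" "\<bar>Im t' - of_int j * pi / 6\<bar> < pi / 6"
    using zw exp_in_wedge_iff[OF pi t(2), of 1] exp_in_wedge_iff[OF pi t'(2), of 1] t(1) t'(1) by auto
  obtain l :: int where l: "t = t' + (of_int (2 * l) * pi) * \<i>"
    using t(1) t'(1) exp_eq[of t t'] by auto
  have "Im t = Im t' + 2 * of_int l * pi" by (simp add: l)
  then have "\<bar>(of_int k * pi / 6 - of_int j * pi / 6) - 2 * of_int l * pi\<bar> < pi / 3" using b by linarith
  moreover have "(of_int k * pi / 6 - of_int j * pi / 6) - 2 * of_int l * pi = of_int (k - j - 12 * l) * (pi / 6)"
    by (simp add: field_simps)
  ultimately have "\<bar>real_of_int (k - j - 12 * l)\<bar> * (pi / 6) < 2 * (pi / 6)"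
    by (simp only: abs_mult) simp
  then have "\<bar>real_of_int (k - j - 12 * l)\<bar> < 2" using pi by (simp only: mult_less_cancel_right)
  then have "k - j - 12 * l \<in> {-1, 0, 1}" by auto
  moreover have "k - j - 12 * l \<noteq> 1"
  proof
    assume "k - j - 12 * l = 1"
    then have "k = (j + 1) + 12 * l" by simp
    then show False using w w_Suc[of j] w_periodic'[of "j + 1" l] by simp
  qed
  moreover have "k - j - 12 * l \<noteq> -1"
  proof
    assume "k - j - 12 * l = -1"
    then have "j = (k + 1) + 12 * (- l)" by simp
    then show False using w w_Suc[of k] w_periodic'[of "k + 1" "- l"] by simp
  qed
  ultimately have "k - j = 12 * l" by auto
  then show ?thesis using kj unfolding atLeastAtMost_iff by presburger
qed

end

section \<open>No tract lies along a boundary ray\<close>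

definition boundary_angle :: "int \<Rightarrow> real" where
  "boundary_angle k = (of_int k + 1 / 2) * pi / 6"

definition half_width :: real where
  "half_width = wide_angle - pi / 12"

lemma half_width_bounds: "0 < half_width" "half_width < pi / 12"
  using wide_angle_bounds by (simp_all add: half_width_def)

text \<open>
  In the coordinate \<open>\<xi> = (x / e)\<^sup>6\<close>, with \<open>e\<close> on the boundary ray, a thin sector around that ray becomes a cone
  around the positive axis, on which \<open>straight_log\<close> recovers the logarithm of \<open>x\<close>.
\<close>

definition straight :: "int \<Rightarrow> complex \<Rightarrow> complex" where
  "straight k t = exp (6 * (t - \<i> * of_real (boundary_angle k)))"

definition straight_log :: "int \<Rightarrow> complex \<Rightarrow> complex" where
  "straight_log k \<xi> = Ln \<xi> / 6 + \<i> * of_real (boundary_angle k)"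

definition cone :: "real \<Rightarrow> real \<Rightarrow> complex set" where
  "cone m R = {\<xi>. R < Re \<xi> \<and> \<bar>Im \<xi>\<bar> < m * Re \<xi>}"

lemma cone_convex_open: "convex (cone m R)" "open (cone m R)"
proof -
  have e: "cone m R = {\<xi>. Re \<xi> > R} \<inter> ({\<xi>. inner (Complex m (-1)) \<xi> > 0} \<inter> {\<xi>. inner (Complex m 1) \<xi> > 0})"
    by (auto simp: cone_def inner_complex_def abs_less_iff)
  show "convex (cone m R)"
    unfolding e by (intro convex_Int convex_halfspace_Re_gt convex_halfspace_gt)
  show "open (cone m R)"
    unfolding cone_def by (intro open_Collect_conj open_Collect_less continuous_intros)
qed

lemma cone_log_angle:
  assumes "\<xi> \<in> cone (tan (6 * \<epsilon>)) R" "R \<ge> 0" "0 < \<epsilon>" "\<epsilon> < pi / 12"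
  shows "\<bar>Im (straight_log k \<xi>) - boundary_angle k\<bar> < \<epsilon>"
proof -
  have r: "Re \<xi> > 0" using assms by (simp add: cone_def)
  have "Arg \<xi> = arctan (Im \<xi> / Re \<xi>)" by (rule arg_conv_arctan[OF r])
  moreover have "\<xi> \<noteq> 0" using r by auto
  ultimately have "Im (Ln \<xi>) = arctan (Im \<xi> / Re \<xi>)" by (simp add: Arg_def)
  moreover have "\<bar>Im \<xi> / Re \<xi>\<bar> < tan (6 * \<epsilon>)"
    using assms(1) r by (simp add: cone_def divide_less_eq abs_divide)
  then have "\<bar>arctan (Im \<xi> / Re \<xi>)\<bar> < 6 * \<epsilon>"
  proof -
    have "arctan (tan (6 * \<epsilon>)) = 6 * \<epsilon>" using assms pi_gt_zero by (intro arctan_tan) linarith+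
    moreover have "Im \<xi> / Re \<xi> < tan (6 * \<epsilon>)" "- tan (6 * \<epsilon>) < Im \<xi> / Re \<xi>"
      using \<open>\<bar>Im \<xi> / Re \<xi>\<bar> < tan (6 * \<epsilon>)\<close> by linarith+
    ultimately have "arctan (Im \<xi> / Re \<xi>) < 6 * \<epsilon>" "- (6 * \<epsilon>) < arctan (Im \<xi> / Re \<xi>)"
      using arctan_less_iff[of "Im \<xi> / Re \<xi>" "tan (6 * \<epsilon>)"]
        arctan_less_iff[of "- tan (6 * \<epsilon>)" "Im \<xi> / Re \<xi>"]
      by (simp_all only: arctan_minus)
    then show ?thesis by (simp add: abs_less_iff)
  qed
  ultimately show ?thesis by (simp add: straight_log_def)
qed

lemma straight_log_straight:
  assumes "\<bar>Im t - boundary_angle k\<bar> < pi / 6"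
  shows "straight_log k (straight k t) = t"
proof -
  have "Ln (straight k t) = 6 * (t - \<i> * of_real (boundary_angle k))"
  proof -
    have e: "Im (6 * (t - \<i> * of_real (boundary_angle k))) = 6 * (Im t - boundary_angle k)" by simp
    define d where "d = Im t - boundary_angle k"
    have "d < pi / 6" "- d < pi / 6" using assms by (simp_all only: abs_less_iff d_def)
    then have "- pi < 6 * d" "6 * d \<le> pi" by simp_all
    then have "- pi < Im (6 * (t - \<i> * of_real (boundary_angle k)))" "Im (6 * (t - \<i> * of_real (boundary_angle k))) \<le> pi"
      by (simp_all only: e d_def)
    then show ?thesis unfolding straight_def by (rule Ln_exp)
  qed
  then show ?thesis by (simp add: straight_log_def diff_divide_distrib)
qed

lemma straight_in_cone:
  assumes t: "\<bar>Im t - boundary_angle k\<bar> < \<epsilon>" and \<epsilon>: "0 < \<epsilon>" "\<epsilon> < pi / 12"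
    and R: "exp (6 * Re t) * cos (6 * \<epsilon>) > R"
  shows "straight k t \<in> cone (tan (6 * \<epsilon>)) R"
proof -
  define \<alpha> where "\<alpha> = 6 * (Im t - boundary_angle k)"
  have \<alpha>: "\<bar>\<alpha>\<bar> < 6 * \<epsilon>" "6 * \<epsilon> < pi / 2" using t \<epsilon> by (simp_all add: \<alpha>_def)
  have re: "Re (straight k t) = exp (6 * Re t) * cos \<alpha>" and im: "Im (straight k t) = exp (6 * Re t) * sin \<alpha>"
    by (simp_all add: straight_def \<alpha>_def Re_exp Im_exp)
  have c: "cos (6 * \<epsilon>) < cos \<bar>\<alpha>\<bar>" using \<alpha> \<epsilon> by (intro cos_monotone_0_pi) auto
  then have 1: "Re (straight k t) > R" unfolding re using R
    by (metis cos_abs_real exp_gt_zero mult_strict_left_mono order.strict_trans)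
  have c0: "cos \<alpha> > 0" using \<alpha> by (intro cos_gt_zero_pi) linarith+
  have "\<bar>tan \<alpha>\<bar> < tan (6 * \<epsilon>)"
  proof -
    have "tan \<alpha> < tan (6 * \<epsilon>)" "tan (- (6 * \<epsilon>)) < tan \<alpha>"
      using \<alpha> by (intro tan_monotone; linarith)+
    then show ?thesis by (simp add: abs_less_iff)
  qed
  then have "\<bar>sin \<alpha>\<bar> < tan (6 * \<epsilon>) * cos \<alpha>" using c0 by (simp add: tan_def abs_divide divide_less_eq)
  then have "exp (6 * Re t) * \<bar>sin \<alpha>\<bar> < exp (6 * Re t) * (tan (6 * \<epsilon>) * cos \<alpha>)" by (simp only: mult_less_cancel_left_pos exp_gt_zero)
  then show ?thesis using 1 unfolding cone_def mem_Collect_eq re im by (simp add: abs_mult mult_ac)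
qed

context solution_quotient
begin

text \<open>
  On the boundary ray the leading exponential factors of two neighbouring subdominant solutions are oscillatory. The
  logarithm of their quotient is \<open>2 wkb_sign k * x\<^sup>6 / 6\<close> up to lower order, which in the straightened coordinate
  is the linear function \<open>- \<i> \<xi> / 3\<close>.
\<close>

lemma log_quotient_nearly_linear:
  "\<exists>R H H'. R \<ge> 0 \<and> (\<forall>\<xi>\<in>cone (tan (6 * half_width)) R.
     (H has_field_derivative H' \<xi>) (at \<xi>) \<and> norm (H' \<xi> + \<i> / 3) \<le> 1 / 12 \<and>
     subdominant k (straight_log k \<xi>) = exp (H \<xi>) * subdominant (k + 1) (straight_log k \<xi>) \<and>
     subdominant (k + 1) (straight_log k \<xi>) \<noteq> 0)"
proof -
  let ?F = "boundary_at_infinity k"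
  define D where "D t = cover_deriv (subdominant k) t / subdominant k t
     - cover_deriv (subdominant (k + 1)) t / subdominant (k + 1) t" for t
  have "eventually (\<lambda>t. norm (exp (- (5 * t)) * D t - 2 * wkb_sign k) < 1 / 2) ?F"
    using tendstoD[OF boundary_log_derivative[of k], of "1 / 2"] by (simp add: dist_norm D_def)
  moreover have "eventually (\<lambda>t. subdominant k t \<noteq> 0) ?F" "eventually (\<lambda>t. subdominant (k + 1) t \<noteq> 0) ?F"
    using filter_leD[OF inf_le1 subdominant_eventually_nonzero] filter_leD[OF inf_le2 subdominant_eventually_nonzero] by blast+
  ultimately have "eventually (\<lambda>t. norm (exp (- (5 * t)) * D t - 2 * wkb_sign k) < 1 / 2 \<and>
      subdominant k t \<noteq> 0 \<and> subdominant (k + 1) t \<noteq> 0) ?F" by eventually_elim auto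
  then obtain B where B: "\<And>t. Re t \<ge> B \<Longrightarrow> \<bar>Im t - boundary_angle k\<bar> \<le> half_width \<Longrightarrow>
     norm (exp (- (5 * t)) * D t - 2 * wkb_sign k) < 1 / 2 \<and> subdominant k t \<noteq> 0 \<and> subdominant (k + 1) t \<noteq> 0"
    by (auto simp: eventually_boundary boundary_angle_def half_width_def)
  define R where "R = exp (6 * B)"
  have R: "R \<ge> 0" by (simp add: R_def)
  define C where "C = cone (tan (6 * half_width)) R"
  have C: "convex C" "open C" unfolding C_def by (rule cone_convex_open)+
  define T where "T = straight_log k"
  have rC: "Re \<xi> > 0" "\<xi> \<noteq> 0" "\<xi> \<notin> \<real>\<^sub>\<le>\<^sub>0" if "\<xi> \<in> C" for \<xi>
  proof -
    show 1: "Re \<xi> > 0" using that R by (simp add: C_def cone_def)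
    then show "\<xi> \<noteq> 0" "\<xi> \<notin> \<real>\<^sub>\<le>\<^sub>0" using complex_nonpos_Reals_iff by force+
  qed
  have T: "norm (exp (- (5 * T \<xi>)) * D (T \<xi>) - 2 * wkb_sign k) < 1 / 2 \<and> subdominant k (T \<xi>) \<noteq> 0 \<and> subdominant (k + 1) (T \<xi>) \<noteq> 0"
    if "\<xi> \<in> C" for \<xi>
  proof (rule B)
    have "R < norm \<xi>" using that complex_Re_le_cmod[of \<xi>] by (simp add: C_def cone_def)
    then have "6 * B \<le> ln (norm \<xi>)" using rC(2)[OF that] by (simp add: R_def ln_ge_iff)
    then show "Re (T \<xi>) \<ge> B" using rC[OF that] by (simp add: T_def straight_log_def)
    show "\<bar>Im (T \<xi>) - boundary_angle k\<bar> \<le> half_width"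
      unfolding T_def using cone_log_angle[OF that[unfolded C_def] R half_width_bounds] by (simp add: less_imp_le)
  qed
  have dT: "(T has_field_derivative 1 / (6 * \<xi>)) (at \<xi>)" if "\<xi> \<in> C" for \<xi>
  proof -
    have "((\<lambda>\<xi>. Ln \<xi> / 6 + \<i> * of_real (boundary_angle k)) has_field_derivative inverse \<xi> / 6 + 0) (at \<xi>)"
      by (intro DERIV_add DERIV_cdivide has_field_derivative_Ln DERIV_const rC(3)[OF that])
    then show ?thesis unfolding T_def straight_log_def[abs_def] by (simp add: field_simps)
  qed
  have e6: "exp (6 * T \<xi>) = - wkb_sign k * \<i> * \<xi>" if "\<xi> \<in> C" for \<xi>
  proof -
    have b: "6 * (\<i> * of_real (boundary_angle k)) = \<i> * of_real (of_int k * pi) + of_real (pi / 2) * \<i>"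
      by (simp add: boundary_angle_def field_simps)
    have "exp (6 * T \<xi>) = exp (Ln \<xi>) * exp (6 * (\<i> * of_real (boundary_angle k)))"
      by (simp add: T_def straight_log_def exp_add[symmetric] algebra_simps)
    also have "exp (6 * (\<i> * of_real (boundary_angle k))) = - wkb_sign k * \<i>"
      unfolding b exp_add exp_i_pi_int
      using cis_conv_exp[of "pi / 2"] by (simp add: wkb_sign_def mult.commute[of _ \<i>])
    finally show ?thesis using rC[OF that] by simp
  qed
  define g where "g \<xi> = subdominant k (T \<xi>) / subdominant (k + 1) (T \<xi>)" for \<xi>
  define H' where "H' \<xi> = exp (T \<xi>) * D (T \<xi>) / (6 * \<xi>)" for \<xi>
  have dg: "(g has_field_derivative g \<xi> * H' \<xi>) (at \<xi>)" if "\<xi> \<in> C" for \<xi>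
  proof -
    have "((\<lambda>t. subdominant k t / subdominant (k + 1) t) has_field_derivative
        (exp (T \<xi>) * cover_deriv (subdominant k) (T \<xi>) * subdominant (k + 1) (T \<xi>) -
         subdominant k (T \<xi>) * (exp (T \<xi>) * cover_deriv (subdominant (k + 1)) (T \<xi>))) /
        (subdominant (k + 1) (T \<xi>) * subdominant (k + 1) (T \<xi>))) (at (T \<xi>))"
      using DERIV_divide[OF solution_DERIV[OF subdominant_solution] solution_DERIV[OF subdominant_solution]] T[OF that] by blast
    from DERIV_chain2[OF this dT[OF that]] show ?thesis
      unfolding g_def[abs_def] H'_def D_def using T[OF that] rC(2)[OF that]
      by (simp add: divide_simps) (simp add: algebra_simps)
  qed
  have H': "norm (H' \<xi> + \<i> / 3) \<le> 1 / 12" if "\<xi> \<in> C" for \<xi>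
  proof -
    define \<epsilon> where "\<epsilon> = exp (- (5 * T \<xi>)) * D (T \<xi>) - 2 * wkb_sign k"
    have "exp (T \<xi>) = exp (6 * T \<xi>) * exp (- (5 * T \<xi>))" by (simp flip: exp_add)
    then have "H' \<xi> = - wkb_sign k * \<i> * (exp (- (5 * T \<xi>)) * D (T \<xi>)) / 6"
      unfolding H'_def e6[OF that] using rC(2)[OF that] by simp
    also have "exp (- (5 * T \<xi>)) * D (T \<xi>) = \<epsilon> + 2 * wkb_sign k" by (simp add: \<epsilon>_def)
    also have "- wkb_sign k * \<i> * (\<epsilon> + 2 * wkb_sign k) / 6 = - wkb_sign k * \<i> * \<epsilon> / 6 - (wkb_sign k * wkb_sign k) * \<i> / 3"
      by (simp add: field_simps)
    finally have "H' \<xi> + \<i> / 3 = - wkb_sign k * \<i> * \<epsilon> / 6" by simp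
    then have "norm (H' \<xi> + \<i> / 3) = norm \<epsilon> / 6" by (simp add: norm_mult norm_divide)
    then show ?thesis using T[OF that] by (simp add: \<epsilon>_def)
  qed
  have "g holomorphic_on C" using dg C(2) by (auto simp: holomorphic_on_open)
  moreover have "g \<xi> \<noteq> 0" if "\<xi> \<in> C" for \<xi> using T[OF that] by (simp add: g_def)
  ultimately obtain H where H: "H holomorphic_on C" "\<And>\<xi>. \<xi> \<in> C \<Longrightarrow> g \<xi> = exp (H \<xi>)"
    using contractible_imp_holomorphic_log[OF _ convex_imp_contractible[OF C(1)]] by blast
  have dH: "(H has_field_derivative H' \<xi>) (at \<xi>)" if "\<xi> \<in> C" for \<xi>
  proof -
    have d: "(H has_field_derivative deriv H \<xi>) (at \<xi>)" by (rule holomorphic_derivI[OF H(1) C(2) that])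
    have "((\<lambda>\<xi>. exp (H \<xi>)) has_field_derivative exp (H \<xi>) * deriv H \<xi>) (at \<xi>)"
      by (rule DERIV_fun_exp[OF d])
    then have "(g has_field_derivative exp (H \<xi>) * deriv H \<xi>) (at \<xi>)"
      by (rule has_field_derivative_transform_within_open[OF _ C(2) that]) (simp add: H(2))
    then have "exp (H \<xi>) * deriv H \<xi> = g \<xi> * H' \<xi>" using dg[OF that] DERIV_unique by blast
    then have "deriv H \<xi> = H' \<xi>" using H(2)[OF that] by simp
    then show ?thesis using d by simp
  qed
  show ?thesis
  proof (rule exI[of _ R], rule exI[of _ H], rule exI[of _ H'], intro conjI ballI R)
    fix \<xi> assume "\<xi> \<in> cone (tan (6 * half_width)) R"
    then have x: "\<xi> \<in> C" by (simp add: C_def)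
    show "(H has_field_derivative H' \<xi>) (at \<xi>)" by (rule dH[OF x])
    show "norm (H' \<xi> + \<i> / 3) \<le> 1 / 12" by (rule H'[OF x])
    show "subdominant (k + 1) (straight_log k \<xi>) \<noteq> 0" using T[OF x] by (simp add: T_def)
    then show "subdominant k (straight_log k \<xi>) = exp (H \<xi>) * subdominant (k + 1) (straight_log k \<xi>)"
      using H(2)[OF x] by (simp add: g_def T_def field_simps)
  qed
qed

text \<open>
  Suppose a component of the preimage of a small disc lay in a thin wedge around a boundary ray. If the
  centre of the disc is neither of the two neighbouring asymptotic values, the logarithm of the quotient
  of the two subdominant solutions would be bounded on the component, but it tends to infinity. If the
  centre is one of these values, moving vertically in the straightened coordinate towards the respective
  sector keeps \<open>f\<close> in a larger, but still small disc, and leads out of the wedge.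
\<close>

lemma singularity_not_in_boundary_wedge:
  assumes U: "(s, U) \<in> transcendental_singularities f" and r0: "r0 > 0"
  shows "\<not> U r0 \<subseteq> wedge (boundary_angle k) (half_width / 2) 0"
proof
  note S = transcendental_singularityD[OF U]
  define \<epsilon>1 where "\<epsilon>1 = half_width / 2"
  define m where "m = tan (6 * \<epsilon>1)"
  have \<epsilon>1: "0 < \<epsilon>1" "\<epsilon>1 < half_width" "\<epsilon>1 < pi / 12" "\<epsilon>1 \<le> pi"
    using half_width_bounds pi_gt_zero by (auto simp: \<epsilon>1_def)
  have m0: "m > 0" unfolding m_def using \<epsilon>1 half_width_bounds by (intro tan_gt_zero) auto
  have mm: "m < tan (6 * half_width)" unfolding m_def using \<epsilon>1 half_width_bounds pi_gt_zero by (intro tan_monotone) linarith+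
  assume "U r0 \<subseteq> wedge (boundary_angle k) (half_width / 2) 0"
  then have wed: "U r0 \<subseteq> wedge (boundary_angle k) \<epsilon>1 0" by (simp add: \<epsilon>1_def)
  obtain R H H' where R: "R \<ge> 0" and HH: "\<And>\<xi>. \<xi> \<in> cone (tan (6 * half_width)) R \<Longrightarrow>
     (H has_field_derivative H' \<xi>) (at \<xi>) \<and> norm (H' \<xi> + \<i> / 3) \<le> 1 / 12 \<and>
     subdominant k (straight_log k \<xi>) = exp (H \<xi>) * subdominant (k + 1) (straight_log k \<xi>) \<and>
     subdominant (k + 1) (straight_log k \<xi>) \<noteq> 0"
    using log_quotient_nearly_linear[of k] by blast
  define C where "C = cone (tan (6 * half_width)) R"
  define T where "T = straight_log k"
  have dH: "\<And>\<xi>. \<xi> \<in> C \<Longrightarrow> (H has_field_derivative H' \<xi>) (at \<xi>)" and H': "\<And>\<xi>. \<xi> \<in> C \<Longrightarrow> norm (H' \<xi> + \<i> / 3) \<le> 1 / 12"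
    and g: "\<And>\<xi>. \<xi> \<in> C \<Longrightarrow> subdominant k (T \<xi>) = exp (H \<xi>) * subdominant (k + 1) (T \<xi>)"
    and nz: "\<And>\<xi>. \<xi> \<in> C \<Longrightarrow> subdominant (k + 1) (T \<xi>) \<noteq> 0"
    using HH by (simp_all add: C_def T_def)
  have Cc: "convex C" unfolding C_def by (rule cone_convex_open)
  have lin1: "norm (H x - H y) \<ge> norm (x - y) / 4" if "x \<in> C" "y \<in> C" for x y
    by (rule nearly_linear(1)[OF Cc dH H' that])
  have lin2: "Re (H y) \<ge> Re (H x) + l / 3 - \<bar>l\<bar> / 12" if "x \<in> C" "y \<in> C" "y = x + \<i> * of_real l" for x y l
    by (rule nearly_linear(2)[OF Cc dH H' that])
  have c1: "cos (6 * \<epsilon>1) > 0" using \<epsilon>1 by (intro cos_gt_zero_pi) linarith+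
  define M where "M = R / cos (6 * \<epsilon>1) + 1"
  have M: "M \<ge> 1" using R c1 by (simp add: M_def)
  obtain r1 where r1: "r1 > 0" "\<And>r. 0 < r \<Longrightarrow> r \<le> r1 \<Longrightarrow> U r \<inter> cball 0 M = {}"
    using transcendental_singularity_escapes[OF f_meromorphic U, of M] by blast
  define r2 where "r2 = min r0 r1"
  have r2: "r2 > 0" "r2 \<le> r0" "r2 \<le> r1" using r0 r1 by (auto simp: r2_def)
  \<comment> \<open>every point of the component has a straightened coordinate in the smaller cone\<close>
  define X where "X = (\<lambda>z. (z * cis (- boundary_angle k)) ^ 6)"
  have pt: "X z \<in> cone m R \<and> exp (T (X z)) = z" if z: "z \<in> U r2" for z
  proof -
    have zw: "z \<in> wedge (boundary_angle k) \<epsilon>1 0" using z wed S(2)[OF r2(1,2)] by blast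
    then have "z \<noteq> 0" by (auto simp: wedge_def)
    then obtain t where t: "exp t = z" "\<bar>Im t - boundary_angle k\<bar> \<le> pi" by (rule polar_coordinate)
    have im: "\<bar>Im t - boundary_angle k\<bar> < \<epsilon>1" using zw exp_in_wedge_iff[OF \<epsilon>1(1,4) t(2)] t(1) by blast
    have XS: "X z = straight k t"
    proof -
      have "z * cis (- boundary_angle k) = exp (t - \<i> * of_real (boundary_angle k))"
        by (simp add: t(1)[symmetric] cis_conv_exp exp_diff exp_minus field_simps)
      then show ?thesis unfolding X_def straight_def
        by (simp only: exp_of_nat_mult[of 6, symmetric]) simp
    qed
    have "norm z > M" using r1(2)[OF r2(1,3)] z by (auto simp: not_le)
    then have eM: "exp (Re t) > M" using t(1) by auto
    have "exp (6 * Re t) * cos (6 * \<epsilon>1) > R"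
    proof -
      have "exp (Re t) \<le> exp (Re t) ^ 6" by (rule self_le_power) (use eM M in linarith, simp)
      also have "\<dots> = exp (6 * Re t)" by (simp flip: exp_of_nat_mult)
      finally have "R / cos (6 * \<epsilon>1) < exp (6 * Re t)" using eM unfolding M_def by linarith
      then show ?thesis using c1 by (simp add: divide_less_eq)
    qed
    from straight_in_cone[OF im \<epsilon>1(1,3) this]
    have "X z \<in> cone m R" by (simp add: XS m_def)
    moreover have "T (X z) = t" unfolding XS T_def using im \<epsilon>1 pi_gt_zero by (intro straight_log_straight) linarith
    ultimately show ?thesis using t(1) by simp
  qed
  have sub: "cone m R \<subseteq> C"
  proof
    fix \<xi> assume x: "\<xi> \<in> cone m R"
    then have "m * Re \<xi> \<le> tan (6 * half_width) * Re \<xi>" using mm R by (intro mult_right_mono) (auto simp: cone_def)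
    then show "\<xi> \<in> C" using x by (auto simp: C_def cone_def)
  qed
  \<comment> \<open>numerator and denominator in terms of the two neighbouring subdominant solutions\<close>
  have ex: "\<exists>\<alpha> \<beta>. \<forall>t. u t = \<alpha> * subdominant k t + \<beta> * subdominant (k + 1) t" if "sol u" for u
  proof -
    define W where "W = wronskian (subdominant k) (subdominant (k + 1)) 0"
    have "u t = (wronskian u (subdominant (k + 1)) 0 / W) * subdominant k t
        + (- (wronskian u (subdominant k) 0 / W)) * subdominant (k + 1) t" for t
      using solution_coordinates[OF subdominant_solution subdominant_solution that subdominant_independent[of k], of t]
      unfolding W_def by (simp add: algebra_simps)
    then show ?thesis by blast
  qed
  obtain \<alpha> \<beta> where P: "\<And>t. num s t = \<alpha> * subdominant k t + \<beta> * subdominant (k + 1) t"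
    using ex[OF num_den_solution(1)] by blast
  obtain \<gamma> \<delta> where Q: "\<And>t. den s t = \<gamma> * subdominant k t + \<delta> * subdominant (k + 1) t"
    using ex[OF num_den_solution(2)] by blast
  have det: "\<alpha> * \<delta> \<noteq> \<beta> * \<gamma>"
  proof
    assume e: "\<alpha> * \<delta> = \<beta> * \<gamma>"
    have "num s = (\<lambda>t. \<alpha> * subdominant k t + \<beta> * subdominant (k + 1) t)"
      "den s = (\<lambda>t. \<gamma> * subdominant k t + \<delta> * subdominant (k + 1) t)" using P Q by auto
    then have "wronskian (num s) (den s) 0 = (\<alpha> * \<delta> - \<beta> * \<gamma>) * wronskian (subdominant k) (subdominant (k + 1)) 0"
      by (simp only: wronskian_def solution_lincomb(2)[OF subdominant_solution subdominant_solution]) (simp add: algebra_simps)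
    then show False using e num_den_wronskian by simp
  qed
  have mem: "exp (T \<xi>) \<in> disc_preimage f s r \<longleftrightarrow> norm (\<alpha> * exp (H \<xi>) + \<beta>) < r * norm (\<gamma> * exp (H \<xi>) + \<delta>)"
    if x: "\<xi> \<in> C" and r: "r > 0" for \<xi> r
  proof -
    have "num s (T \<xi>) = (\<alpha> * exp (H \<xi>) + \<beta>) * subdominant (k + 1) (T \<xi>)"
      "den s (T \<xi>) = (\<gamma> * exp (H \<xi>) + \<delta>) * subdominant (k + 1) (T \<xi>)"
      unfolding P Q g[OF x] by (simp_all add: algebra_simps)
    then show ?thesis unfolding exp_in_disc_preimage_iff[OF r] using nz[OF x] by (simp add: norm_mult mult.assoc[symmetric])
  qed
  \<comment> \<open>the case of a neighbouring asymptotic value, with \<open>e\<close> pointing away from its sector\<close>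
  have star: False if A: "A \<noteq> 0" "E \<noteq> 0" and e: "e = 1 \<or> e = - 1" and Y: "\<And>\<xi>. norm (Y \<xi>) = exp (e * Re (H \<xi>))"
    and mem': "\<And>\<xi> r. \<xi> \<in> C \<Longrightarrow> r > 0 \<Longrightarrow> exp (T \<xi>) \<in> disc_preimage f s r \<longleftrightarrow> norm (A * Y \<xi>) < r * norm (B * Y \<xi> + E)"
    for A B E :: complex and e :: real and Y
  proof -
    obtain r3 where r3: "r3 > 0" "r3 \<le> r2" and st: "\<And>Y Y'. norm (A * Y) < r3 * norm (B * Y + E) \<Longrightarrow> norm Y' \<le> norm Y \<Longrightarrow>
       norm (A * Y') < r2 * norm (B * Y' + E)"
      using moebius_preimage_star[OF A r2(1), of B] by blast
    obtain z0 where z0: "z0 \<in> U r3" using in_components_nonempty[OF S(1)[OF r3(1)]] by blast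
    then have z02: "z0 \<in> U r2" using S(2)[OF r3] by blast
    define \<xi>0 where "\<xi>0 = X z0"
    have x0: "\<xi>0 \<in> cone m R" "exp (T \<xi>0) = z0" using pt[OF z02] by (auto simp: \<xi>0_def)
    define l where "l = e * Im \<xi>0 + m * Re \<xi>0"
    have R0: "Re \<xi>0 > R" "\<bar>Im \<xi>0\<bar> < m * Re \<xi>0" using x0(1) by (auto simp: cone_def)
    have l: "l > 0" using e R0(2) unfolding l_def abs_less_iff by (elim disjE; simp; linarith)
    define q where "q = (\<lambda>s::real. \<xi>0 - \<i> * of_real (e * s))"
    have qC: "q s \<in> C" if s: "s \<in> {0..l}" for s
    proof -
      have im: "Im (q s) = Im \<xi>0 - e * s" "Re (q s) = Re \<xi>0" by (simp_all add: q_def)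
      have "\<bar>Im \<xi>0 - e * s\<bar> \<le> m * Re \<xi>0"
        using e s R0(2) unfolding l_def abs_less_iff abs_le_iff by (elim disjE; simp; linarith)
      also have "m * Re \<xi>0 < tan (6 * half_width) * Re \<xi>0" using mm R R0(1) by simp
      finally show ?thesis using R0(1) unfolding C_def cone_def mem_Collect_eq im by simp
    qed
    have q0: "q 0 = \<xi>0" by (simp add: q_def)
    have x0C: "\<xi>0 \<in> C" using sub x0(1) by blast
    have dec: "norm (Y (q s)) \<le> norm (Y \<xi>0)" if s: "s \<in> {0..l}" for s
    proof -
      have "e * Re (H (q s)) \<le> e * Re (H \<xi>0)"
      proof (rule disjE[OF e])
        assume e1: "e = 1"
        have "\<xi>0 = q s + \<i> * of_real s" by (simp add: q_def e1)
        from lin2[OF qC[OF s] x0C this] show ?thesis using e1 s by simp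
      next
        assume e1: "e = - 1"
        have "q s = \<xi>0 + \<i> * of_real s" by (simp add: q_def e1)
        from lin2[OF x0C qC[OF s] this] show ?thesis using e1 s by simp
      qed
      then show ?thesis by (simp add: Y)
    qed
    have start: "norm (A * Y \<xi>0) < r3 * norm (B * Y \<xi>0 + E)"
      using z0 in_components_subset[OF S(1)[OF r3(1)]] mem'[OF x0C r3(1)] x0(2) by auto
    define Z where "Z = (\<lambda>s. exp (T (q s))) ` {0..l}"
    have "Z \<subseteq> disc_preimage f s r2"
      using st[OF start dec] mem'[OF qC r2(1)] by (auto simp: Z_def)
    moreover have "connected Z"
    proof -
      have "q s \<notin> \<real>\<^sub>\<le>\<^sub>0" if "s \<in> {0..l}" for s
      proof -
        have "Re (q s) > 0" using R0(1) R by (simp add: q_def)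
        then show ?thesis using complex_nonpos_Reals_iff by force
      qed
      then have "continuous_on {0..l} (\<lambda>s. exp (T (q s)))"
        unfolding T_def straight_log_def q_def by (intro continuous_intros) auto
      then show ?thesis unfolding Z_def by (rule connected_continuous_image) simp
    qed
    moreover have "z0 \<in> Z" unfolding Z_def using l q0 x0(2) by (intro image_eqI[of _ _ 0]) auto
    ultimately have "Z \<subseteq> U r2" using components_maximal[OF S(1)[OF r2(1)], of Z] z02 by blast
    then have "exp (T (q l)) \<in> wedge (boundary_angle k) \<epsilon>1 0"
      using wed S(2)[OF r2(1,2)] l by (force simp: Z_def)
    moreover have "\<bar>Im (T (q l)) - boundary_angle k\<bar> = \<epsilon>1"
    proof -
      have ql: "Im (q l) = - e * m * Re \<xi>0" "Re (q l) = Re \<xi>0"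
        using e by (auto simp: q_def l_def)
      have rp: "Re \<xi>0 > 0" using R0 R by simp
      have "Arg (q l) = arctan (Im (q l) / Re (q l))" by (rule arg_conv_arctan) (use rp ql in simp)
      also have "Im (q l) / Re (q l) = - e * m" using rp ql by simp
      also have "arctan (- e * m) = - e * (6 * \<epsilon>1)"
      proof -
        have am: "arctan m = 6 * \<epsilon>1" unfolding m_def using \<epsilon>1 pi_gt_zero by (intro arctan_tan) linarith+
        show ?thesis using e by (auto simp: am arctan_minus)
      qed
      finally have "Im (Ln (q l)) = - e * (6 * \<epsilon>1)" using rp ql by (auto simp: Arg_def split: if_splits)
      then show ?thesis using e \<epsilon>1 by (auto simp: T_def straight_log_def)
    qed
    ultimately show False using exp_in_wedge_iff[OF \<epsilon>1(1,4), of "T (q l)" "boundary_angle k" 0] \<epsilon>1(4) by simp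
  qed
  consider "\<alpha> = 0" | "\<beta> = 0" | "\<alpha> \<noteq> 0" "\<beta> \<noteq> 0" by blast
  then show False
  proof cases
    case 1
    then have nz2: "\<beta> \<noteq> 0" "\<gamma> \<noteq> 0" using det by auto
    show False
    proof (rule star[OF nz2, of "- 1" "\<lambda>\<xi>. exp (- H \<xi>)" \<delta>])
      fix \<xi> r assume x: "\<xi> \<in> C" and r: "r > (0::real)"
      have "\<delta> * exp (- H \<xi>) + \<gamma> = exp (- H \<xi>) * (\<gamma> * exp (H \<xi>) + \<delta>)"
        by (simp add: exp_minus field_simps)
      then have "norm (\<beta> * exp (- H \<xi>)) < r * norm (\<delta> * exp (- H \<xi>) + \<gamma>) \<longleftrightarrow>
          norm (exp (- H \<xi>)) * norm \<beta> < norm (exp (- H \<xi>)) * (r * norm (\<gamma> * exp (H \<xi>) + \<delta>))"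
        by (simp only: norm_mult mult_ac)
      also have "\<dots> \<longleftrightarrow> norm \<beta> < r * norm (\<gamma> * exp (H \<xi>) + \<delta>)" by (simp only: mult_less_cancel_left_pos zero_less_norm_iff exp_not_eq_zero not_False_eq_True)
      finally show "exp (T \<xi>) \<in> disc_preimage f s r \<longleftrightarrow> norm (\<beta> * exp (- H \<xi>)) < r * norm (\<delta> * exp (- H \<xi>) + \<gamma>)"
        unfolding mem[OF x r] using 1 by simp
    qed auto
  next
    case 2
    then have nz2: "\<alpha> \<noteq> 0" "\<delta> \<noteq> 0" using det by auto
    show False
      by (rule star[OF nz2, of 1 "\<lambda>\<xi>. exp (H \<xi>)" \<gamma>]) (use mem 2 in auto)
  next
    case 3
    define c where "c = - \<beta> / \<alpha>"
    have c: "c \<noteq> 0" using 3 by (simp add: c_def)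
    obtain r3' where r3': "r3' > 0" and near: "\<And>r g. 0 < r \<Longrightarrow> r \<le> r3' \<Longrightarrow>
        norm (\<alpha> * g + \<beta>) < r * norm (\<gamma> * g + \<delta>) \<Longrightarrow> norm (g / c - 1) \<le> 1 / 2"
      using moebius_preimage_near[OF 3, of \<gamma> \<delta>] unfolding c_def by blast
    define r3 where "r3 = min r2 r3'"
    have r3: "r3 > 0" "r3 \<le> r2" "r3 \<le> r3'" using r2 r3' by (auto simp: r3_def)
    define \<Xi> where "\<Xi> = X ` U r3"
    have \<Xi>C: "\<xi> \<in> C" and \<Xi>near: "norm (exp (H \<xi>) / c - 1) \<le> 1 / 2" if "\<xi> \<in> \<Xi>" for \<xi>
    proof -
      obtain z where z: "z \<in> U r3" "\<xi> = X z" using \<open>\<xi> \<in> \<Xi>\<close> by (auto simp: \<Xi>_def)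
      then have z2: "z \<in> U r2" using S(2)[OF r3(1,2)] by blast
      show x: "\<xi> \<in> C" using pt[OF z2] sub z by auto
      have "z \<in> disc_preimage f s r3" using z in_components_subset[OF S(1)[OF r3(1)]] by blast
      then have "norm (\<alpha> * exp (H \<xi>) + \<beta>) < r3 * norm (\<gamma> * exp (H \<xi>) + \<delta>)"
        using mem[OF x r3(1)] pt[OF z2] z by simp
      then show "norm (exp (H \<xi>) / c - 1) \<le> 1 / 2" by (rule near[OF r3(1,3)])
    qed
    have "connected (U r3)" by (rule in_components_connected[OF S(1)[OF r3(1)]])
    then have \<Xi>conn: "connected \<Xi>" unfolding \<Xi>_def X_def
      by (intro connected_continuous_image continuous_intros)
    define N where "N \<xi> = H \<xi> - Ln (exp (H \<xi>) / c)" for \<xi>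
    have hp: "exp (H \<xi>) / c \<notin> \<real>\<^sub>\<le>\<^sub>0" if "\<xi> \<in> \<Xi>" for \<xi>
    proof -
      have "Re (1 - exp (H \<xi>) / c) \<le> 1 / 2"
        using \<Xi>near[OF that] complex_Re_le_cmod[of "1 - exp (H \<xi>) / c"] by (simp add: norm_minus_commute)
      then show ?thesis by (auto simp: complex_nonpos_Reals_iff)
    qed
    have Hc: "continuous_on \<Xi> H"
      using \<Xi>C dH by (intro continuous_at_imp_continuous_on ballI DERIV_isCont) blast
    have Nc: "continuous_on \<Xi> N" unfolding N_def
      using hp c by (intro continuous_intros Hc continuous_on_Ln') auto
    have Nexp: "exp (N \<xi>) = c" for \<xi> using c by (simp add: N_def exp_diff)
    have "bounded (Ln ` cball 1 (1 / 2))"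
    proof (intro compact_imp_bounded compact_continuous_image continuous_on_Ln)
      fix z :: complex assume "z \<in> cball 1 (1 / 2)"
      then have "Re (1 - z) \<le> 1 / 2" using complex_Re_le_cmod[of "1 - z"] by (simp add: dist_norm)
      then show "z \<notin> \<real>\<^sub>\<le>\<^sub>0" by (auto simp: complex_nonpos_Reals_iff)
    qed auto
    then obtain L where L: "\<And>z. z \<in> cball 1 (1 / 2) \<Longrightarrow> norm (Ln z) \<le> L"
      unfolding bounded_iff by blast
    obtain z1 where z1: "z1 \<in> U r3" using in_components_nonempty[OF S(1)[OF r3(1)]] by blast
    then have x1: "X z1 \<in> \<Xi>" by (auto simp: \<Xi>_def)
    have bound: "norm (X z - X z1) \<le> 8 * L" if "z \<in> U r3" for z
    proof -
      have x: "X z \<in> \<Xi>" using that by (auto simp: \<Xi>_def)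
      have "N (X z) = N (X z1)" by (rule exp_constant_imp_constant[OF \<Xi>conn Nc Nexp x x1])
      then have "H (X z) - H (X z1) = Ln (exp (H (X z)) / c) - Ln (exp (H (X z1)) / c)"
        by (simp add: N_def algebra_simps)
      also have "norm \<dots> \<le> L + L"
        using \<Xi>near[OF x] \<Xi>near[OF x1]
        by (intro norm_triangle_le_diff add_mono L) (auto simp: dist_norm norm_minus_commute)
      finally show ?thesis using lin1[OF \<Xi>C[OF x] \<Xi>C[OF x1]] by linarith
    qed
    define K where "K = norm (X z1) + 8 * L + 1"
    have K: "K \<ge> 1" using bound[OF z1] by (simp add: K_def)
    obtain r4' where r4': "r4' > 0" "\<And>r. 0 < r \<Longrightarrow> r \<le> r4' \<Longrightarrow> U r \<inter> cball 0 K = {}"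
      using transcendental_singularity_escapes[OF f_meromorphic U, of K] by blast
    define r4 where "r4 = min r3 r4'"
    have r4: "r4 > 0" "r4 \<le> r3" "r4 \<le> r4'" using r3 r4' by (auto simp: r4_def)
    obtain z where z: "z \<in> U r4" using in_components_nonempty[OF S(1)[OF r4(1)]] by blast
    then have zK: "norm z > K" using r4'(2)[OF r4(1,3)] by (auto simp: not_le)
    then have "norm z \<le> norm z ^ 6" using K by (intro self_le_power) auto
    also have "\<dots> = norm (X z)" by (simp add: X_def norm_power norm_mult)
    also have "\<dots> \<le> norm (X z1) + 8 * L"
      using bound[of z] z S(2)[OF r4(1,2)] norm_triangle_ineq2[of "X z" "X z1"] by force
    finally show False using zK by (simp add: K_def)
  qed
qed

text \<open>
  Hence a component for a small disc has to enter a closed subsector of one of the Stokes sectors, where \<open>f\<close> is close to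
  the asymptotic value, and then contains the far part of that sector.
\<close>

lemma singularity_enters_sector:
  assumes U: "(s, U) \<in> transcendental_singularities f" and r: "r > 0"
  shows "\<exists>k\<in>{0..11}. s = Some (w k) \<and> (\<exists>B. far_sector k (pi / 12 - half_width / 2) B \<subseteq> U r)"
proof -
  note S = transcendental_singularityD[OF U]
  define \<epsilon> where "\<epsilon> = half_width / 2"
  define \<delta> where "\<delta> = pi / 12 - \<epsilon>"
  have \<epsilon>: "0 < \<epsilon>" "\<epsilon> < pi / 12" "\<epsilon> \<le> pi" using half_width_bounds pi_gt_zero by (auto simp: \<epsilon>_def)
  have \<delta>: "0 \<le> \<delta>" "\<delta> < pi / 12" using \<epsilon> by (auto simp: \<delta>_def)
  have "\<forall>k. \<exists>\<rho>>0. s \<noteq> Some (w k) \<longrightarrow>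
     (\<forall>r. 0 < r \<longrightarrow> r \<le> \<rho> \<longrightarrow> disc_preimage f s r \<inter> disc_preimage f (Some (w k)) r = {})"
    using disc_preimage_disjoint[of s _ f] zero_less_one by metis
  then obtain \<rho> where \<rho>: "\<And>k. \<rho> k > 0" "\<And>k r. s \<noteq> Some (w k) \<Longrightarrow> 0 < r \<Longrightarrow> r \<le> \<rho> k \<Longrightarrow>
     disc_preimage f s r \<inter> disc_preimage f (Some (w k)) r = {}" by metis
  define r1 where "r1 = min r (Min (\<rho> ` {0..11}))"
  have r1: "r1 > 0" "r1 \<le> r" using \<rho>(1) r by (auto simp: r1_def)
  have r1\<rho>: "r1 \<le> \<rho> k" if "k \<in> {0..11}" for k
    unfolding r1_def using that by (intro min.coboundedI2 Min_le) auto
  have "\<forall>k. \<exists>B. \<forall>B'\<ge>B. far_sector k \<delta> B' \<subseteq> disc_preimage f (Some (w k)) r1"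
    using far_sector_subset[OF r1(1) \<delta>] by blast
  then obtain B0 where B0: "\<And>k B'. B' \<ge> B0 k \<Longrightarrow> far_sector k \<delta> B' \<subseteq> disc_preimage f (Some (w k)) r1" by metis
  define B where "B = Max (B0 ` {0..11})"
  have B: "far_sector k \<delta> B \<subseteq> disc_preimage f (Some (w k)) r1" if "k \<in> {0..11}" for k
    using that by (intro B0) (auto simp: B_def)
  obtain r2' where r2': "r2' > 0" "\<And>r. 0 < r \<Longrightarrow> r \<le> r2' \<Longrightarrow> U r \<inter> cball 0 (exp B) = {}"
    using transcendental_singularity_escapes[OF f_meromorphic U, of "exp B"] by blast
  define r2 where "r2 = min r1 r2'"
  have r2: "r2 > 0" "r2 \<le> r1" "r2 \<le> r2'" using r1 r2' by (auto simp: r2_def)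
  have far: "norm z > exp B" if "z \<in> U r2" for z using r2'(2)[OF r2(1,3)] that by (auto simp: not_le)
  have reduce: "\<exists>k\<in>{0..11}. far_sector j \<delta> B = far_sector k \<delta> B" for j
  proof -
    have "j = j mod 12 + 12 * (j div 12)" by simp
    then have "far_sector j \<delta> B = far_sector (j mod 12) \<delta> B" using far_sector_periodic[of "j mod 12" "j div 12" \<delta> B] by simp
    moreover have "j mod 12 \<in> {0..11}" by simp
    ultimately show ?thesis by blast
  qed
  have "\<exists>k\<in>{0..11}. U r2 \<inter> far_sector k \<delta> B \<noteq> {}"
  proof (rule ccontr)
    assume "\<not> ?thesis"
    then have no: "U r2 \<inter> far_sector j \<delta> B = {}" for j using reduce[of j] by auto
    obtain z where z: "z \<in> U r2" using in_components_nonempty[OF S(1)[OF r2(1)]] by blast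
    then have "z \<noteq> 0" using far[OF z] exp_gt_zero[of B] by (metis norm_zero order.asym)
    then obtain t where t: "exp t = z" by (metis exp_Ln)
    define k where "k = \<lfloor>Im t * 6 / pi\<rfloor>"
    have ReB: "Re t > B" using far[OF z] t by auto
    have fl: "of_int k \<le> Im t * 6 / pi" "Im t * 6 / pi < of_int k + 1" by (simp_all add: k_def)
    then have kt: "of_int k * pi / 6 \<le> Im t" "Im t < of_int k * pi / 6 + pi / 6"
      using pi_gt_zero by (simp_all add: field_simps)
    have e: "of_int (k + 1) * pi / 6 = of_int k * pi / 6 + pi / 6" "boundary_angle k = of_int k * pi / 6 + pi / 12"
      by (simp_all add: boundary_angle_def field_simps)
    have nk: "z \<notin> far_sector j \<delta> B" for j using no z by blast
    have out: "\<not> \<bar>Im t - of_int j * pi / 6\<bar> \<le> \<delta>" for j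
      using nk[of j] t ReB by (auto simp: far_sector_def)
    have "\<bar>Im t - boundary_angle k\<bar> < \<epsilon>"
      using out[of k] out[of "k + 1"] kt unfolding e \<delta>_def by linarith
    then have zW: "z \<in> wedge (boundary_angle k) \<epsilon> (exp B)"
      using exp_in_wedge_iff[OF \<epsilon>(1,3), of t "boundary_angle k" "exp B"] \<epsilon> t ReB by auto
    have "U r2 \<subseteq> wedge (boundary_angle k) \<epsilon> (exp B)"
    proof (rule connected_subset_of_open)
      show "connected (U r2)" by (rule in_components_connected[OF S(1)[OF r2(1)]])
      show "U r2 \<inter> wedge (boundary_angle k) \<epsilon> (exp B) \<noteq> {}" using z zW by blast
      show "U r2 \<inter> frontier (wedge (boundary_angle k) \<epsilon> (exp B)) = {}"
      proof (rule ccontr)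
        assume "\<not> ?thesis"
        then obtain x where x: "x \<in> U r2" "x \<in> frontier (wedge (boundary_angle k) \<epsilon> (exp B))" by blast
        from frontier_wedge[OF x(2) exp_gt_zero \<epsilon>(1,3)] obtain t' where t': "exp t' = x"
          "exp B \<le> exp (Re t')" "exp B = exp (Re t') \<or> \<bar>Im t' - boundary_angle k\<bar> = \<epsilon>" by blast
        have "exp B \<noteq> exp (Re t')" using far[OF x(1)] t'(1) by auto
        then have "\<bar>Im t' - boundary_angle k\<bar> = \<epsilon>" using t' by blast
        then have "\<bar>Im t' - of_int k * pi / 6\<bar> \<le> \<delta> \<or> \<bar>Im t' - of_int (k + 1) * pi / 6\<bar> \<le> \<delta>"
          using \<epsilon> unfolding e \<delta>_def by linarith
        then have "x \<in> far_sector k \<delta> B \<or> x \<in> far_sector (k + 1) \<delta> B"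
          using t' by (auto simp: far_sector_def)
        then show False using no x(1) by blast
      qed
    qed
    also have "\<dots> \<subseteq> wedge (boundary_angle k) (half_width / 2) 0"
      using exp_gt_zero[of B] by (auto simp: wedge_def \<epsilon>_def intro: order.strict_trans)
    finally show False using singularity_not_in_boundary_wedge[OF U r2(1)] by blast
  qed
  then obtain k where k: "k \<in> {0..11}" "U r2 \<inter> far_sector k \<delta> B \<noteq> {}" by blast
  have Ur1: "U r2 \<subseteq> U r1" "U r1 \<subseteq> U r" using S(2) r2 r1 by blast+
  have "U r1 \<subseteq> disc_preimage f s r1" by (rule in_components_subset[OF S(1)[OF r1(1)]])
  then have "disc_preimage f s r1 \<inter> disc_preimage f (Some (w k)) r1 \<noteq> {}"
    using k B[OF k(1)] Ur1 by blast
  then have s: "s = Some (w k)" using \<rho>(2)[OF _ r1(1) r1\<rho>[OF k(1)]] by blast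
  have "far_sector k \<delta> B \<subseteq> U r1"
    using components_maximal[OF S(1)[OF r1(1)] connected_far_sector] B[OF k(1)] s k(2) Ur1 by blast
  then show ?thesis using k(1) s Ur1 unfolding \<delta>_def \<epsilon>_def by blast
qed

text \<open>
  The sector that the component enters may depend on the radius; by monotonicity one of the twelve sectors
  serves all radii.
\<close>

lemma singularity_is_tract:
  assumes U: "(s, U) \<in> transcendental_singularities f"
  shows "\<exists>k\<in>{0..11}. (s, U) = (Some (w k), restrict (tract k) {0<..})"
proof -
  note S = transcendental_singularityD[OF U]
  let ?\<delta> = "pi / 12 - half_width / 2"
  have "\<exists>k\<in>{0..11}. \<forall>r>0. s = Some (w k) \<and> (\<exists>B. far_sector k ?\<delta> B \<subseteq> U r)"
  proof (rule ccontr)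
    assume "\<not> ?thesis"
    then have "\<forall>k\<in>{0..11}. \<exists>r>0. \<not> (s = Some (w k) \<and> (\<exists>B. far_sector k ?\<delta> B \<subseteq> U r))" by blast
    then obtain \<rho> where \<rho>: "\<And>k. k \<in> {0..11} \<Longrightarrow> \<rho> k > 0 \<and> \<not> (s = Some (w k) \<and> (\<exists>B. far_sector k ?\<delta> B \<subseteq> U (\<rho> k)))"
      by metis
    define r where "r = Min (\<rho> ` {0..11})"
    have r: "r > 0" using \<rho> by (auto simp: r_def)
    obtain k where k: "k \<in> {0..11}" "s = Some (w k)" "\<exists>B. far_sector k ?\<delta> B \<subseteq> U r"
      using singularity_enters_sector[OF U r] by blast
    have "r \<le> \<rho> k" unfolding r_def using k(1) by (intro Min_le) auto
    then have "U r \<subseteq> U (\<rho> k)" by (rule S(2)[OF r])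
    then show False using \<rho>[OF k(1)] k(2,3) by blast
  qed
  then obtain k where k: "k \<in> {0..11}" "\<And>r. r > 0 \<Longrightarrow> s = Some (w k) \<and> (\<exists>B. far_sector k ?\<delta> B \<subseteq> U r)" by blast
  have s: "s = Some (w k)" using k(2)[of 1] by simp
  have \<delta>: "?\<delta> \<ge> 0" using half_width_bounds by simp
  have "U r = tract k r" if r: "r > 0" for r
  proof -
    obtain B where B: "far_sector k ?\<delta> B \<subseteq> U r" using k(2)[OF r] by blast
    then have "far_sector k ?\<delta> B \<subseteq> disc_preimage f (Some (w k)) r"
      using in_components_subset[OF S(1)[OF r]] s by blast
    from tract_contains_far_sector(1)[OF r \<delta> this] B ray_in_far_sector[OF \<delta>, of B B k]
    have "U r \<inter> tract k r \<noteq> {}" by blast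
    then show ?thesis
      using components_eq[OF S(1)[OF r, unfolded s] tract_component[OF r]] by blast
  qed
  moreover have "U r = undefined" if "\<not> r > 0" for r
    using S(4) that by (simp add: extensional_def)
  ultimately have "U = restrict (tract k) {0<..}" by (auto simp: restrict_def fun_eq_iff)
  then show ?thesis using k(1) s by blast
qed

lemma card_transcendental_singularities:
  "finite (transcendental_singularities f)" "card (transcendental_singularities f) = 12"
proof -
  define \<Phi> where "\<Phi> = (\<lambda>k. (Some (w k), restrict (tract k) {0<..}))"
  have eq: "transcendental_singularities f = \<Phi> ` {0..11}"
    using singularity_is_tract tract_singularity unfolding \<Phi>_def by fast
  have "inj_on \<Phi> {0..11}"
  proof (rule inj_onI)
    fix k j :: int assume kj: "k \<in> {0..11}" "j \<in> {0..11}" "\<Phi> k = \<Phi> j"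
    have "tract k r = tract j r" if "r > 0" for r
      using kj(3) that by (auto simp: \<Phi>_def dest: fun_cong[of _ _ r])
    then show "k = j" using tract_inj[OF kj(1,2)] kj(3) by (simp add: \<Phi>_def)
  qed
  then have "card (transcendental_singularities f) = card {0..11::int}" unfolding eq by (rule card_image)
  then show "card (transcendental_singularities f) = 12" by simp
  show "finite (transcendental_singularities f)" unfolding eq by simp
qed

end

section \<open>The Schwarzian derivative of a quotient of solutions\<close>

definition schwarz_expr :: "(complex \<Rightarrow> complex) \<Rightarrow> complex \<Rightarrow> complex" where
  "schwarz_expr f x = (deriv ^^ 3) f x / deriv f x - 3 / 2 * ((deriv ^^ 2) f x / deriv f x)\<^sup>2"

lemma schwarzian_conv: "schwarzian f = remove_sings (schwarz_expr f)"
  by (simp add: schwarzian_def schwarz_expr_def[abs_def])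

lemma higher_derivs_eqI:
  assumes S: "open S" "x \<in> S"
    and d: "\<And>y. y \<in> S \<Longrightarrow> (f has_field_derivative F1 y) (at y)"
      "\<And>y. y \<in> S \<Longrightarrow> (F1 has_field_derivative F2 y) (at y)"
      "\<And>y. y \<in> S \<Longrightarrow> (F2 has_field_derivative F3 y) (at y)"
  shows "deriv f x = F1 x" "(deriv ^^ 2) f x = F2 x" "(deriv ^^ 3) f x = F3 x"
proof -
  have 1: "deriv f y = F1 y" if "y \<in> S" for y using d(1)[OF that] by (rule DERIV_imp_deriv)
  have 2: "deriv (deriv f) y = F2 y" if "y \<in> S" for y
  proof -
    have "(deriv f has_field_derivative F2 y) (at y)"
      by (rule has_field_derivative_transform_within_open[OF d(2)[OF that] S(1) that]) (simp add: 1)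
    then show ?thesis by (rule DERIV_imp_deriv)
  qed
  have 3: "deriv (deriv (deriv f)) y = F3 y" if "y \<in> S" for y
  proof -
    have "(deriv (deriv f) has_field_derivative F3 y) (at y)"
      by (rule has_field_derivative_transform_within_open[OF d(3)[OF that] S(1) that]) (simp add: 2)
    then show ?thesis by (rule DERIV_imp_deriv)
  qed
  show "deriv f x = F1 x" "(deriv ^^ 2) f x = F2 x" "(deriv ^^ 3) f x = F3 x"
    using 1[OF S(2)] 2[OF S(2)] 3[OF S(2)] by (simp_all add: numeral_eq_Suc)
qed

lemma schwarz_expr_eqI:
  assumes "open S" "x \<in> S"
    and "\<And>y. y \<in> S \<Longrightarrow> (f has_field_derivative F1 y) (at y)"
      "\<And>y. y \<in> S \<Longrightarrow> (F1 has_field_derivative F2 y) (at y)"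
      "\<And>y. y \<in> S \<Longrightarrow> (F2 has_field_derivative F3 y) (at y)"
  shows "schwarz_expr f x = F3 x / F1 x - 3 / 2 * (F2 x / F1 x)\<^sup>2"
  using higher_derivs_eqI[OF assms] by (simp add: schwarz_expr_def)

text \<open>Near a point of the punctured plane, solutions on the cover become functions of \<open>x\<close>.\<close>

lemma logarithm_branch:
  fixes t0 :: complex
  obtains L where "L (exp t0) = t0"
    "\<And>x. x \<in> ball (exp t0) (norm (exp t0)) \<Longrightarrow> exp (L x) = x"
    "\<And>x. x \<in> ball (exp t0) (norm (exp t0)) \<Longrightarrow> (L has_field_derivative inverse x) (at x)"
proof -
  define L where "L x = Ln (x / exp t0) + t0" for x :: complex
  have *: "x \<noteq> 0" "x / exp t0 \<notin> \<real>\<^sub>\<le>\<^sub>0" if x: "x \<in> ball (exp t0) (norm (exp t0))" for x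
  proof -
    have "norm (x - exp t0) < norm (exp t0)" using x by (simp add: dist_norm norm_minus_commute)
    moreover have "x / exp t0 - 1 = (x - exp t0) / exp t0" by (simp add: diff_divide_distrib)
    ultimately have "norm (x / exp t0 - 1) < 1" by (simp only: norm_divide) simp
    then have "norm (1 - x / exp t0) < 1" by (simp only: norm_minus_commute)
    then have "Re (1 - x / exp t0) < 1" using complex_Re_le_cmod order.strict_trans1 by blast
    then have "Re (x / exp t0) > 0" by simp
    then show "x / exp t0 \<notin> \<real>\<^sub>\<le>\<^sub>0" by (auto simp only: complex_nonpos_Reals_iff)
    then show "x \<noteq> 0" by auto
  qed
  show ?thesis
  proof (rule that[of L])
  show "L (exp t0) = t0" by (simp add: L_def)
  fix x assume x: "x \<in> ball (exp t0) (norm (exp t0))"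
  show "exp (L x) = x" using *[OF x] by (simp add: L_def exp_add)
  have "((\<lambda>x. Ln (x / exp t0)) has_field_derivative inverse (x / exp t0) * (1 / exp t0)) (at x)"
    by (rule DERIV_chain2[where f = Ln and g = "\<lambda>x. x / exp t0"], rule has_field_derivative_Ln[OF *(2)[OF x]])
      (auto intro!: derivative_eq_intros)
  then have "((\<lambda>x. Ln (x / exp t0)) has_field_derivative inverse x) (at x)"
    using *(1)[OF x] by (simp add: field_simps)
  from DERIV_add[OF this DERIV_const] show "(L has_field_derivative inverse x) (at x)"
    by (simp add: L_def[abs_def])
  qed
qed

lemma branch_solution_DERIV:
  assumes sol: "oscillator_solution V \<phi>" and L: "exp (L x) = x" "(L has_field_derivative inverse x) (at x)"
  shows "((\<lambda>x. \<phi> (L x)) has_field_derivative cover_deriv \<phi> (L x)) (at x)"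
    and "((\<lambda>x. cover_deriv \<phi> (L x)) has_field_derivative V x * \<phi> (L x)) (at x)"
proof -
  have x: "x \<noteq> 0" using L(1) by (metis exp_not_eq_zero)
  show "((\<lambda>x. \<phi> (L x)) has_field_derivative cover_deriv \<phi> (L x)) (at x)"
    using DERIV_chain2[OF solution_DERIV[OF sol] L(2)] x by (simp add: L(1) field_simps)
  show "((\<lambda>x. cover_deriv \<phi> (L x)) has_field_derivative V x * \<phi> (L x)) (at x)"
    using DERIV_chain2[OF solution_DERIV2[OF sol] L(2)] x by (simp add: L(1) field_simps)
qed

text \<open>
  The derivative of the quotient is \<open>- W / \<phi>2\<^sup>2\<close> with the constant Wronskian \<open>W\<close>, and the Schwarzian derivative
  depends only on the logarithmic derivative of this.
\<close>

lemma solution_ratio_regular: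
  assumes sol: "oscillator_solution V \<phi>1" "oscillator_solution V \<phi>2"
    and f: "\<And>t. f (exp t) = \<phi>1 t / \<phi>2 t" and nz: "\<phi>2 t0 \<noteq> 0" and w: "wronskian \<phi>1 \<phi>2 0 \<noteq> 0"
  shows "f analytic_on {exp t0}" "deriv f (exp t0) \<noteq> 0" "schwarz_expr f (exp t0) = - 2 * V (exp t0)"
proof -
  define w where "w = wronskian \<phi>1 \<phi>2 0"
  obtain L where L: "L (exp t0) = t0"
    "\<And>x. x \<in> ball (exp t0) (norm (exp t0)) \<Longrightarrow> exp (L x) = x"
    "\<And>x. x \<in> ball (exp t0) (norm (exp t0)) \<Longrightarrow> (L has_field_derivative inverse x) (at x)"
    by (rule logarithm_branch[of t0]) blast
  define v v' where "v = (\<lambda>x. \<phi>2 (L x))" and "v' = (\<lambda>x. cover_deriv \<phi>2 (L x))"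
  define S where "S = ball (exp t0) (norm (exp t0)) \<inter> v -` (- {0})"
  have dv: "(v has_field_derivative v' x) (at x)" "(v' has_field_derivative V x * v x) (at x)"
    if "x \<in> ball (exp t0) (norm (exp t0))" for x
    unfolding v_def v'_def using branch_solution_DERIV[OF sol(2) L(2,3)] that by blast+
  have S: "open S" unfolding S_def
    by (intro continuous_open_preimage continuous_at_imp_continuous_on ballI DERIV_isCont[OF dv(1)]) auto
  have x0: "exp t0 \<in> S" using nz by (simp add: S_def v_def L(1))
  have Sb: "x \<in> ball (exp t0) (norm (exp t0))" "v x \<noteq> 0" if "x \<in> S" for x using that by (auto simp: S_def)
  have fx: "\<phi>1 (L x) / v x = f x" if "x \<in> S" for x using f[of "L x"] L(2)[OF Sb(1)[OF that]] by (simp add: v_def)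
  define F1 F2 F3 where "F1 = (\<lambda>x. - w / v x ^ 2)" and "F2 = (\<lambda>x. 2 * w * v' x / v x ^ 3)"
    and "F3 = (\<lambda>x. 2 * w * (V x * v x) / v x ^ 3 - 6 * w * v' x ^ 2 / v x ^ 4)"
  have d1: "(f has_field_derivative F1 x) (at x)" if x: "x \<in> S" for x
  proof -
    have "wronskian \<phi>1 \<phi>2 (L x) = w" unfolding w_def by (rule wronskian_const[OF sol])
    then have "cover_deriv \<phi>1 (L x) * v x - \<phi>1 (L x) * v' x = - w"
      unfolding wronskian_def v_def v'_def by (metis minus_diff_eq)
    moreover have "((\<lambda>x. \<phi>1 (L x) / v x) has_field_derivative
        (cover_deriv \<phi>1 (L x) * v x - \<phi>1 (L x) * v' x) / (v x * v x)) (at x)"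
      by (rule DERIV_divide[OF branch_solution_DERIV(1)[OF sol(1) L(2,3)] dv(1)]) (use Sb[OF x] in auto)
    ultimately have "((\<lambda>x. \<phi>1 (L x) / v x) has_field_derivative F1 x) (at x)"
      by (simp add: F1_def power2_eq_square)
    then show ?thesis by (rule has_field_derivative_transform_within_open[OF _ S x]) (simp add: fx)
  qed
  have d2: "(F1 has_field_derivative F2 x) (at x)" if x: "x \<in> S" for x
    unfolding F1_def F2_def using Sb[OF x]
    by (auto intro!: derivative_eq_intros dv(1) simp: field_simps eval_nat_numeral)
  have d3: "(F2 has_field_derivative F3 x) (at x)" if x: "x \<in> S" for x
    unfolding F2_def F3_def using Sb[OF x]
    by (auto intro!: derivative_eq_intros dv simp: field_simps eval_nat_numeral)
  have "f holomorphic_on S" using d1 S by (auto simp: holomorphic_on_open)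
  then show "f analytic_on {exp t0}" using S x0 by (auto simp: analytic_at)
  show "deriv f (exp t0) \<noteq> 0"
    using higher_derivs_eqI(1)[OF S x0 d1 d2 d3] w Sb[OF x0] by (simp add: F1_def w_def)
  show "schwarz_expr f (exp t0) = - 2 * V (exp t0)"
  proof -
    have "schwarz_expr f (exp t0) = F3 (exp t0) / F1 (exp t0) - 3 / 2 * (F2 (exp t0) / F1 (exp t0))\<^sup>2"
      by (rule schwarz_expr_eqI[OF S x0 d1 d2 d3])
    also have "\<dots> = - 2 * V (exp t0)"
      unfolding F1_def F2_def F3_def
      using w Sb[OF x0] by (simp add: w_def[symmetric] field_simps eval_nat_numeral)
    finally show ?thesis .
  qed
qed

lemma zorder_simple_zero:
  assumes "f analytic_on {z}" "f z = 0" "deriv f z \<noteq> 0"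
  shows "zorder f z = 1"
  by (rule zorder_zero_eqI') (use assms in auto)

lemma zorder_of_inverse_simple_zero:
  assumes "(\<lambda>x. inverse (f x)) analytic_on {z}" "f z = 0" "deriv (\<lambda>x. inverse (f x)) z \<noteq> 0" "is_pole f z"
  shows "zorder f z = - 1"
proof -
  have "eventually (\<lambda>x. inverse (f x) \<noteq> 0) (at z)"
    using eventually_large_at_pole[OF assms(4), of 0] by eventually_elim auto
  then have "frequently (\<lambda>x. inverse (f x) \<noteq> 0) (at z)" by (intro eventually_frequently) auto
  from zorder_inverse[OF isolated_singularity_at_analytic[OF assms(1)] not_essential_analytic[OF assms(1)] this]
  have "zorder f z = - zorder (\<lambda>x. inverse (f x)) z" by simp
  then show ?thesis using zorder_simple_zero[OF assms(1)] assms(2,3) by simp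
qed

text \<open>
  At a zero of the denominator the reciprocal is a quotient of the same kind.
\<close>

lemma local_degree_solution_ratio:
  assumes sol: "oscillator_solution V \<phi>1" "oscillator_solution V \<phi>2"
    and f: "\<And>t. f (exp t) = \<phi>1 t / \<phi>2 t" and pole: "is_pole f (exp t0) \<longleftrightarrow> \<phi>2 t0 = 0"
    and w: "wronskian \<phi>1 \<phi>2 0 \<noteq> 0"
  shows "local_degree f (exp t0) = 1"
proof (cases "\<phi>2 t0 = 0")
  case False
  note r = solution_ratio_regular[OF sol f False w]
  have "(\<lambda>x. f x - f (exp t0)) analytic_on {exp t0}" by (intro analytic_intros r(1))
  moreover have "deriv (\<lambda>x. f x - f (exp t0)) (exp t0) = deriv f (exp t0)"
    using analytic_on_imp_differentiable_at[OF r(1)] by simp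
  ultimately have "zorder (\<lambda>x. f x - f (exp t0)) (exp t0) = 1"
    using r(2) by (intro zorder_simple_zero) auto
  then show ?thesis using False pole by (simp add: local_degree_def)
next
  case True
  have w': "wronskian \<phi>2 \<phi>1 0 \<noteq> 0" using w wronskian_swap[of \<phi>2 \<phi>1 0] by simp
  have "wronskian \<phi>1 \<phi>2 t0 \<noteq> 0" using w wronskian_const[OF sol, of t0] by simp
  then have nz: "\<phi>1 t0 \<noteq> 0" using True by (auto simp: wronskian_def)
  have f': "inverse (f (exp t)) = \<phi>2 t / \<phi>1 t" for t by (simp add: f)
  note r = solution_ratio_regular[OF sol(2,1) f' nz w']
  have "zorder f (exp t0) = - 1"
    by (rule zorder_of_inverse_simple_zero[OF r(1) _ r(2)]) (use True pole f in auto)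
  then show ?thesis using True pole by (simp add: local_degree_def)
qed

lemma nicely_meromorphic_isolated:
  assumes "f nicely_meromorphic_on UNIV"
  shows "isolated_singularity_at f z" "not_essential f z" "f meromorphic_on {z}"
proof -
  show m: "f meromorphic_on {z}"
    using assms meromorphic_on_subset unfolding nicely_meromorphic_on_def by blast
  then show "isolated_singularity_at f z" "not_essential f z" by (simp_all add: meromorphic_at_iff)
qed

lemma schwarzian_solution_ratio:
  assumes sol: "oscillator_solution V \<phi>1" "oscillator_solution V \<phi>2"
    and f: "\<And>t. f (exp t) = \<phi>1 t / \<phi>2 t" and pole: "\<And>t. is_pole f (exp t) \<longleftrightarrow> \<phi>2 t = 0"
    and w: "wronskian \<phi>1 \<phi>2 0 \<noteq> 0" and mero: "f nicely_meromorphic_on UNIV"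
    and z: "z \<noteq> 0" and V: "isCont V z"
  shows "schwarzian f z = - 2 * V z"
proof -
  have "eventually (\<lambda>x. \<not> is_pole f x) (at z)"
    by (rule eventually_not_pole[OF nicely_meromorphic_isolated(1)[OF mero]])
  moreover have "eventually (\<lambda>x. x \<noteq> 0) (at z)" using z by (intro tendsto_imp_eventually_ne[OF tendsto_ident_at])
  ultimately have "eventually (\<lambda>x. - 2 * V x = schwarz_expr f x) (at z)"
  proof eventually_elim
    case (elim x)
    then obtain t where t: "exp t = x" by (metis exp_Ln)
    then have "\<phi>2 t \<noteq> 0" using elim pole by auto
    then show ?case using solution_ratio_regular(3)[OF sol f _ w, of t] t by simp
  qed
  moreover have "((\<lambda>x. - 2 * V x) \<longlongrightarrow> - 2 * V z) (at z)" using V by (intro tendsto_intros) (simp add: isCont_def)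
  ultimately have "(schwarz_expr f \<longlongrightarrow> - 2 * V z) (at z)" by (rule Lim_transform_eventually[rotated])
  then show ?thesis unfolding schwarzian_conv by (rule remove_sings_eqI)
qed

section \<open>Quotients of entire functions\<close>

lemma entire_quotient:
  assumes A: "A holomorphic_on UNIV" and B: "B holomorphic_on UNIV"
    and ncz: "\<And>z. B z = 0 \<Longrightarrow> A z \<noteq> 0" and nt: "B \<beta> \<noteq> 0"
  shows "(\<lambda>x. A x / B x) nicely_meromorphic_on UNIV" "is_pole (\<lambda>x. A x / B x) z \<longleftrightarrow> B z = 0"
proof -
  have cA: "isCont A z" and cB: "isCont B z" for z
    using A B continuous_on_eq_continuous_at[OF open_UNIV] holomorphic_on_imp_continuous_on by blast+
  have pole: "is_pole (\<lambda>x. A x / B x) z" if "B z = 0" for z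
  proof (rule is_pole_divide[OF cA _ ncz[OF that]])
    have "eventually (\<lambda>x. B x \<noteq> 0) (at z)"
      using non_zero_neighbour_alt[OF B open_UNIV connected_UNIV UNIV_I UNIV_I nt] by (auto elim: eventually_mono)
    then show "filterlim B (at 0) (at z)" using cB[of z] that by (auto simp: filterlim_at isCont_def)
  qed
  have reg: "isCont (\<lambda>x. A x / B x) z" if "B z \<noteq> 0" for z using cA cB that by (intro continuous_intros) auto
  have "A meromorphic_on UNIV" "B meromorphic_on UNIV"
    using A B by (auto intro!: analytic_on_imp_meromorphic_on simp: analytic_on_open)
  then have m: "(\<lambda>x. A x / B x) meromorphic_on UNIV" by (intro meromorphic_intros)
  show "(\<lambda>x. A x / B x) nicely_meromorphic_on UNIV" unfolding nicely_meromorphic_on_def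
  proof (intro conjI m ballI)
    fix z
    show "is_pole (\<lambda>x. A x / B x) z \<and> A z / B z = 0 \<or> (\<lambda>x. A x / B x) \<midarrow>z\<rightarrow> A z / B z"
      using pole[of z] reg[of z] by (cases "B z = 0") (auto simp: isCont_def)
  qed
  show "is_pole (\<lambda>x. A x / B x) z \<longleftrightarrow> B z = 0"
  proof (cases "B z = 0")
    case False
    have "\<not> is_pole (\<lambda>x. A x / B x) z"
      using reg[OF False] unfolding isCont_def is_pole_def
      using not_tendsto_and_filterlim_at_infinity[OF at_neq_bot] by blast
    then show ?thesis using False by simp
  qed (use pole in auto)
qed

section \<open>The Schwarzian derivative of a locally injective function\<close>

lemma analytic_schwarz_expr:
  assumes "f analytic_on {z}" "deriv f z \<noteq> 0"
  shows "(schwarz_expr f \<longlongrightarrow> schwarz_expr f z) (at z)"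
proof -
  have "(deriv ^^ n) f analytic_on {z}" for n using assms(1) by (rule analytic_higher_deriv)
  note a = this[of 1, simplified] this[of 2] this[of 3]
  have "schwarz_expr f analytic_on {z}"
    unfolding schwarz_expr_def[abs_def] by (intro analytic_intros a) (use assms in auto)
  then show ?thesis using analytic_at_imp_isCont isCont_def by blast
qed

lemma schwarz_expr_inverse:
  assumes g: "g holomorphic_on S" "open S" "x \<in> S" and nz: "\<And>y. y \<in> S \<Longrightarrow> g y \<noteq> 0" and d: "deriv g x \<noteq> 0"
  shows "schwarz_expr (\<lambda>x. inverse (g x)) x = schwarz_expr g x"
proof -
  define g1 g2 g3 where "g1 = deriv g" and "g2 = deriv g1" and "g3 = deriv g2"
  have h: "g1 holomorphic_on S" "g2 holomorphic_on S"
    unfolding g1_def g2_def by (intro holomorphic_deriv g)+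
  have dg: "(g has_field_derivative g1 y) (at y)" "(g1 has_field_derivative g2 y) (at y)"
    "(g2 has_field_derivative g3 y) (at y)" if "y \<in> S" for y
    using holomorphic_derivI[OF g(1,2) that] holomorphic_derivI[OF h(1) g(2) that] holomorphic_derivI[OF h(2) g(2) that]
    by (simp_all add: g1_def g2_def g3_def)
  define F1 F2 F3 where "F1 = (\<lambda>x. - g1 x / g x ^ 2)" and "F2 = (\<lambda>x. - g2 x / g x ^ 2 + 2 * g1 x ^ 2 / g x ^ 3)"
    and "F3 = (\<lambda>x. - g3 x / g x ^ 2 + 6 * g1 x * g2 x / g x ^ 3 - 6 * g1 x ^ 3 / g x ^ 4)"
  have d1: "((\<lambda>x. inverse (g x)) has_field_derivative F1 y) (at y)" if "y \<in> S" for y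
    unfolding F1_def using nz[OF that] dg[OF that]
    by (auto intro!: derivative_eq_intros simp: field_simps eval_nat_numeral)
  have d2: "(F1 has_field_derivative F2 y) (at y)" if "y \<in> S" for y
    unfolding F1_def F2_def using nz[OF that]
    by (auto intro!: derivative_eq_intros dg[OF that] simp: field_simps eval_nat_numeral)
  have d3: "(F2 has_field_derivative F3 y) (at y)" if "y \<in> S" for y
    unfolding F2_def F3_def using nz[OF that]
    by (auto intro!: derivative_eq_intros dg[OF that] simp: field_simps eval_nat_numeral)
  have "schwarz_expr (\<lambda>x. inverse (g x)) x = F3 x / F1 x - 3 / 2 * (F2 x / F1 x)\<^sup>2"
    by (rule schwarz_expr_eqI[OF g(2,3) d1 d2 d3])
  also have "\<dots> = g3 x / g1 x - 3 / 2 * (g2 x / g1 x)\<^sup>2"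
  proof -
    have "a \<noteq> 0 \<Longrightarrow> p \<noteq> 0 \<Longrightarrow>
      (- c / a ^ 2 + 6 * p * q / a ^ 3 - 6 * p ^ 3 / a ^ 4) / (- p / a ^ 2) - 3 / 2 * ((- q / a ^ 2 + 2 * p ^ 2 / a ^ 3) / (- p / a ^ 2))\<^sup>2
      = c / p - 3 / 2 * (q / p)\<^sup>2" for a p q c :: complex
      by (simp add: field_simps eval_nat_numeral)
    then show ?thesis using nz[OF g(3)] d unfolding F1_def F2_def F3_def g1_def by blast
  qed
  also have "\<dots> = schwarz_expr g x" by (simp add: schwarz_expr_def g1_def g2_def g3_def numeral_eq_Suc)
  finally show ?thesis .
qed

lemma deriv_nonzero_of_zorder_1:
  assumes f: "f analytic_on {z}" "f z = 0" and fr: "frequently (\<lambda>x. f x \<noteq> 0) (at z)" and z1: "zorder f z = 1"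
  shows "deriv f z \<noteq> 0"
proof -
  obtain r g where r: "r > 0" "g holomorphic_on cball z r" "g z \<noteq> 0"
    "\<And>x. x \<in> cball z r - {z} \<Longrightarrow> f x = g x * (x - z)"
    using zorder_exist[OF isolated_singularity_at_analytic[OF f(1)] not_essential_analytic[OF f(1)] fr]
    unfolding z1 by auto
  have eq: "f x = g x * (x - z)" if "x \<in> ball z r" for x using r(4)[of x] that f(2) by (cases "x = z") auto
  have "g holomorphic_on ball z r" using r(2) by (rule holomorphic_on_subset) auto
  then have "(g has_field_derivative deriv g z) (at z)" using r(1) by (intro holomorphic_derivI[of g "ball z r"]) auto
  then have "((\<lambda>x. g x * (x - z)) has_field_derivative g z) (at z)"
    by (auto intro!: derivative_eq_intros)
  then have "(f has_field_derivative g z) (at z)"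
    by (rule has_field_derivative_transform_within_open[of _ _ _ "ball z r"]) (use r(1) eq in auto)
  then have "deriv f z = g z" by (rule DERIV_imp_deriv)
  then show ?thesis using r(3) by simp
qed

lemma deriv_nonzero_of_local_degree_1:
  assumes f: "f nicely_meromorphic_on UNIV" and nc: "\<And>c. \<exists>x. f x \<noteq> c" and deg: "local_degree f z = 1"
    and z: "\<not> is_pole f z"
  shows "deriv f z \<noteq> 0"
proof -
  have an: "f analytic_on {z}" by (rule nicely_meromorphic_on_imp_analytic_at[OF f UNIV_I z])
  have "\<forall>\<^sub>\<approx>x\<in>UNIV. f x \<noteq> f z"
    using nicely_meromorphic_imp_constant_or_avoid[OF f open_UNIV connected_UNIV, of "f z"] nc[of "f z"] by auto
  then have "eventually (\<lambda>x. f x - f z \<noteq> 0) (at z)"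
    by (auto simp: eventually_cosparse_open_eq)
  then have fr: "frequently (\<lambda>x. f x - f z \<noteq> 0) (at z)" by (intro eventually_frequently) auto
  have an': "(\<lambda>x. f x - f z) analytic_on {z}" by (intro analytic_intros an)
  have "nat (zorder (\<lambda>x. f x - f z) z) = 1" using deg z by (simp add: local_degree_def)
  then have "zorder (\<lambda>x. f x - f z) z = 1" by linarith
  from deriv_nonzero_of_zorder_1[OF an' _ fr this] have "deriv (\<lambda>x. f x - f z) z \<noteq> 0" by simp
  then show ?thesis using analytic_on_imp_differentiable_at[OF an] by simp
qed

text \<open>
  At a simple pole the Schwarzian derivative coincides with that of the reciprocal, since it is
  invariant under Moebius transformations.
\<close>

lemma schwarz_expr_limit:
  assumes f: "f nicely_meromorphic_on UNIV" and nc: "\<And>c. \<exists>x. f x \<noteq> c" and deg: "local_degree f z = 1"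
  shows "\<exists>l. (schwarz_expr f \<longlongrightarrow> l) (at z)"
proof (cases "is_pole f z")
  case False
  have an: "f analytic_on {z}" by (rule nicely_meromorphic_on_imp_analytic_at[OF f UNIV_I False])
  show ?thesis
    using analytic_schwarz_expr[OF an deriv_nonzero_of_local_degree_1[OF f nc deg False]] by blast
next
  case True
  define g where "g = (\<lambda>x. inverse (f x))"
  have f0: "f z = 0" using f True unfolding nicely_meromorphic_on_def is_pole_def
    by (metis UNIV_I at_neq_bot not_tendsto_and_filterlim_at_infinity)
  have "g \<midarrow>z\<rightarrow> 0" unfolding g_def
    using True filterlim_compose[OF tendsto_inverse_0] by (auto simp: is_pole_def)
  then have "isCont g z" using f0 by (simp add: isCont_def g_def)
  moreover have "g meromorphic_on {z}" unfolding g_def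
    by (intro meromorphic_intros nicely_meromorphic_isolated(3)[OF f])
  ultimately have an: "g analytic_on {z}" by (rule meromorphic_at_isCont_imp_analytic[rotated])
  have ev: "eventually (\<lambda>x. g x \<noteq> 0) (at z)"
    using eventually_large_at_pole[OF True, of 0] by eventually_elim (auto simp: g_def)
  then have fr: "frequently (\<lambda>x. g x \<noteq> 0) (at z)" by (intro eventually_frequently) auto
  have fr': "frequently (\<lambda>x. f x \<noteq> 0) (at z)" using fr by (auto simp: g_def)
  have "nat (- zorder f z) = 1" using deg True by (simp add: local_degree_def)
  then have "zorder f z = - 1" by linarith
  then have "zorder g z = 1"
    using zorder_inverse[OF nicely_meromorphic_isolated(1,2)[OF f] fr'] by (simp add: g_def)
  then have d: "deriv g z \<noteq> 0" using f0 by (intro deriv_nonzero_of_zorder_1[OF an _ fr]) (auto simp: g_def)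
  obtain S where S: "open S" "z \<in> S" "g holomorphic_on S" using an by (auto simp: analytic_at)
  obtain T where T: "open T" "z \<in> T" "\<And>x. x \<in> T \<Longrightarrow> x \<noteq> z \<Longrightarrow> g x \<noteq> 0"
    using ev by (auto simp: eventually_at_topological)
  have "isCont (deriv g) z"
    using analytic_at_imp_isCont analytic_deriv[OF an] by blast
  then have "deriv g \<midarrow>z\<rightarrow> deriv g z" by (simp add: isCont_def)
  then have "eventually (\<lambda>x. deriv g x \<noteq> 0) (at z)" using d by (rule tendsto_imp_eventually_ne)
  moreover have "eventually (\<lambda>x. x \<in> S - {z}) (at z)" by (rule eventually_at_in_open[OF S(1,2)])
  moreover have "eventually (\<lambda>x. x \<in> T - {z}) (at z)" by (rule eventually_at_in_open[OF T(1,2)])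
  ultimately have "eventually (\<lambda>x. schwarz_expr g x = schwarz_expr f x) (at z)"
  proof eventually_elim
    case (elim x)
    have "schwarz_expr (\<lambda>x. inverse (g x)) x = schwarz_expr g x"
    proof (rule schwarz_expr_inverse[where S = "(S \<inter> T) - {z}"])
      show "open (S \<inter> T - {z})" using S(1) T(1) by (intro open_Diff open_Int) auto
      show "g holomorphic_on S \<inter> T - {z}" using S(3) by (rule holomorphic_on_subset) auto
    qed (use elim T in auto)
    then show ?case by (simp add: g_def)
  qed
  moreover have "(schwarz_expr g \<longlongrightarrow> schwarz_expr g z) (at z)" by (rule analytic_schwarz_expr[OF an d])
  ultimately show ?thesis using Lim_transform_eventually by blast
qed

text \<open>
  With \<open>\<eta> = f'' / f'\<close> the Schwarzian derivative is \<open>\<eta>' - \<eta>\<^sup>2 / 2\<close>, and a function of local order \<open>D\<close> has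
  \<open>\<eta> = (D - 1) / x + O(1)\<close>.
\<close>

lemma schwarz_expr_at_branch_point:
  fixes D :: int
  assumes r: "r > 0" and g: "g holomorphic_on ball 0 r" "g 0 \<noteq> 0"
    and f: "\<And>x. x \<in> ball 0 r - {0} \<Longrightarrow> f x = g x * x powi D" and D: "D \<noteq> 0"
  shows "((\<lambda>x. x\<^sup>2 * schwarz_expr f x) \<longlongrightarrow> (1 - of_int D ^ 2) / 2) (at 0)"
proof -
  define u where "u = (\<lambda>x. of_int D * g x + x * deriv g x)"
  have hg': "deriv g holomorphic_on ball 0 r" by (intro holomorphic_deriv g) simp
  have hu: "u holomorphic_on ball 0 r" unfolding u_def by (intro holomorphic_intros g hg')
  have u0: "u 0 \<noteq> 0" using g D by (simp add: u_def)
  have cu: "continuous_on (ball 0 r) u" by (rule holomorphic_on_imp_continuous_on[OF hu])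
  define S where "S = ball 0 r \<inter> u -` (- {0})"
  have S: "open S" unfolding S_def by (rule continuous_open_preimage[OF cu]) auto
  have S0: "0 \<in> S" using r u0 by (simp add: S_def)
  have Sx: "x \<in> ball 0 r" "u x \<noteq> 0" if "x \<in> S" for x using that by (auto simp: S_def)
  define q where "q = (\<lambda>x. deriv u x / u x)"
  have hq: "q holomorphic_on S" unfolding q_def
    by (intro holomorphic_intros holomorphic_on_subset[OF hu] holomorphic_deriv S)
      (use Sx in \<open>auto simp: S_def\<close>)
  define \<eta> where "\<eta> = (\<lambda>x. of_int (D - 1) / x + q x)"
  define \<eta>' where "\<eta>' = (\<lambda>x. - of_int (D - 1) / x ^ 2 + deriv q x)"
  define F1 where "F1 = (\<lambda>x. x powi (D - 1) * u x)"
  have S': "open (S - {0})" using S by auto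
  have du: "(u has_field_derivative q x * u x) (at x)" if "x \<in> S" for x
    using holomorphic_derivI[OF hu open_ball Sx(1)[OF that]] Sx(2)[OF that] by (simp add: q_def)
  have d\<eta>: "(\<eta> has_field_derivative \<eta>' x) (at x)" if "x \<in> S - {0}" for x
  proof -
    have "(q has_field_derivative deriv q x) (at x)" using that by (intro holomorphic_derivI[OF hq S]) auto
    then show ?thesis unfolding \<eta>_def \<eta>'_def using that
      by (auto intro!: derivative_eq_intros simp: power2_eq_square)
  qed
  have d1: "(f has_field_derivative F1 x) (at x)" if x: "x \<in> S - {0}" for x
  proof -
    have x0: "x \<noteq> 0" "x \<in> ball 0 r" using x Sx by auto
    have dg: "(g has_field_derivative deriv g x) (at x)" by (rule holomorphic_derivI[OF g(1) open_ball x0(2)])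
    have "((\<lambda>x. g x * x powi D) has_field_derivative g x * (of_int D * x powi (D - 1) * 1) + deriv g x * x powi D) (at x)"
      using DERIV_mult[OF dg DERIV_power_int[OF DERIV_ident, of D x UNIV]] x0 by (simp add: algebra_simps)
    moreover have "g x * (of_int D * x powi (D - 1) * 1) + deriv g x * x powi D = F1 x"
    proof -
      have "x powi D = x powi (D - 1) * x" using power_int_add_1[of x "D - 1"] x0 by simp
      then show ?thesis by (simp add: F1_def u_def algebra_simps)
    qed
    ultimately have "((\<lambda>x. g x * x powi D) has_field_derivative F1 x) (at x)" by simp
    then show ?thesis
      by (rule has_field_derivative_transform_within_open[OF _ S' x]) (use f Sx in auto)
  qed
  have d2: "(F1 has_field_derivative F1 x * \<eta> x) (at x)" if x: "x \<in> S - {0}" for x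
  proof -
    have x0: "x \<noteq> 0" "x \<in> S" using x by auto
    have "(F1 has_field_derivative x powi (D - 1) * (q x * u x) + of_int (D - 1) * x powi (D - 1 - 1) * 1 * u x) (at x)"
      unfolding F1_def using DERIV_mult[OF DERIV_power_int[OF DERIV_ident, of "D - 1" x UNIV] du[OF x0(2)]] x0
      by (simp add: algebra_simps)
    moreover have "x powi (D - 1) * (q x * u x) + of_int (D - 1) * x powi (D - 1 - 1) * 1 * u x = F1 x * \<eta> x"
    proof -
      have "x powi (D - 1) = x powi (D - 1 - 1) * x" using power_int_add_1[of x "D - 1 - 1"] x0 by simp
      then have "x powi (D - 1 - 1) = x powi (D - 1) / x" using x0 by simp
      then show ?thesis by (simp add: F1_def \<eta>_def field_simps)
    qed
    ultimately show ?thesis by simp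
  qed
  have d3: "((\<lambda>x. F1 x * \<eta> x) has_field_derivative F1 x * (\<eta> x ^ 2 + \<eta>' x)) (at x)" if x: "x \<in> S - {0}" for x
    using DERIV_mult[OF d2[OF x] d\<eta>[OF x]] by (simp add: algebra_simps power2_eq_square)
  have F1nz: "F1 x \<noteq> 0" if "x \<in> S - {0}" for x using that Sx[of x] by (auto simp: F1_def)
  have sch: "x\<^sup>2 * schwarz_expr f x = - of_int (D - 1) + x\<^sup>2 * deriv q x - (of_int (D - 1) + x * q x)\<^sup>2 / 2"
    if x: "x \<in> S - {0}" for x
  proof -
    have x0: "x \<noteq> 0" using x by auto
    have "schwarz_expr f x = F1 x * (\<eta> x ^ 2 + \<eta>' x) / F1 x - 3 / 2 * (F1 x * \<eta> x / F1 x)\<^sup>2"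
      by (rule schwarz_expr_eqI[OF S' x d1 d2 d3])
    also have "\<dots> = \<eta>' x - \<eta> x ^ 2 / 2" using F1nz[OF x] by simp
    finally have "x\<^sup>2 * schwarz_expr f x = x\<^sup>2 * (\<eta>' x - \<eta> x ^ 2 / 2)" by (simp only:)
    then have "x\<^sup>2 * schwarz_expr f x = x\<^sup>2 * \<eta>' x - (x * \<eta> x)\<^sup>2 / 2"
      by (simp add: power_mult_distrib right_diff_distrib)
    moreover have "x * \<eta> x = of_int (D - 1) + x * q x" using x0 by (simp add: \<eta>_def distrib_left)
    moreover have "x\<^sup>2 * \<eta>' x = - of_int (D - 1) + x\<^sup>2 * deriv q x" using x0 by (simp add: \<eta>'_def distrib_left)
    ultimately show ?thesis by simp
  qed
  have "isCont q 0" "isCont (deriv q) 0"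
    using hq holomorphic_deriv[OF hq S] S S0 by (meson continuous_on_eq_continuous_at holomorphic_on_imp_continuous_on)+
  then have "((\<lambda>x. - of_int (D - 1) + x\<^sup>2 * deriv q x - (of_int (D - 1) + x * q x)\<^sup>2 / 2) \<longlongrightarrow>
      - of_int (D - 1) + 0\<^sup>2 * deriv q 0 - (of_int (D - 1) + 0 * q 0)\<^sup>2 / 2) (at 0)"
    unfolding isCont_def by (intro tendsto_intros) auto
  moreover have "- of_int (D - 1) + 0\<^sup>2 * deriv q 0 - (of_int (D - 1) + 0 * q 0)\<^sup>2 / 2 = (1 - of_int D ^ 2) / 2"
    by (simp add: power2_eq_square field_simps)
  ultimately have lim: "((\<lambda>x. - of_int (D - 1) + x\<^sup>2 * deriv q x - (of_int (D - 1) + x * q x)\<^sup>2 / 2) \<longlongrightarrow>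
      (1 - of_int D ^ 2) / 2) (at 0)" by (simp only:)
  have "eventually (\<lambda>x. - of_int (D - 1) + x\<^sup>2 * deriv q x - (of_int (D - 1) + x * q x)\<^sup>2 / 2 = x\<^sup>2 * schwarz_expr f x) (at 0)"
    using eventually_at_in_open[OF S S0] by eventually_elim (simp add: sch)
  with lim show ?thesis by (rule Lim_transform_eventually)
qed

section \<open>From oscillators to the family of functions\<close>

lemma zeta3_powi_mult_3: "zeta3 powi (3 * j) = 1"
  by (simp add: power_int_mult)

lemma zeta3_not_1: "zeta3 \<noteq> 1"
proof
  assume "zeta3 = 1"
  then obtain j :: int where "2 * of_real pi * \<i> / 3 = (of_int (2 * j) * pi) * \<i>"
    unfolding zeta3_def using exp_eq[of "2 * of_real pi * \<i> / 3" 0] by auto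
  then have "Im (2 * of_real pi * \<i> / 3) = Im ((of_int (2 * j) * pi) * \<i>)" by (simp only:)
  then have "pi * 2 = pi * (6 * of_int j)" by simp
  then have "(2::real) = 6 * of_int j" by (simp only: mult_cancel_left) auto
  then have "(2::int) = 6 * j" by (metis of_int_eq_iff of_int_mult of_int_numeral)
  then show False by presburger
qed

lemma zeta3_square: "zeta3 * zeta3 = inverse zeta3"
proof -
  have "zeta3 * zeta3 * zeta3 = 1" using zeta3_cube by (simp add: power3_eq_cube)
  then show ?thesis by (simp add: field_simps)
qed

definition F3_value :: "int \<Rightarrow> complex" where
  "F3_value k = zeta3 powi (- k)"

lemma F3_value_Suc: "F3_value (k + 1) = inverse zeta3 * F3_value k"
  by (simp add: F3_value_def power_int_diff field_simps power_int_minus power_int_add)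

lemma F3_value_nonzero [simp]: "F3_value k \<noteq> 0"
  by (simp add: F3_value_def)

lemma F3_value_Suc_neq: "F3_value (k + 1) \<noteq> F3_value k"
proof
  assume "F3_value (k + 1) = F3_value k"
  then have "inverse zeta3 * F3_value k = 1 * F3_value k" unfolding F3_value_Suc by simp
  then have "inverse zeta3 = 1" unfolding mult_cancel_right by simp
  then show False using zeta3_not_1 by (metis inverse_1 inverse_inverse_eq)
qed

lemma F3_value_add_3: "F3_value (k + 3) = F3_value k"
proof -
  have "F3_value (k + 3) = inverse zeta3 * (inverse zeta3 * (inverse zeta3 * F3_value k))"
    using F3_value_Suc[of k] F3_value_Suc[of "k + 1"] F3_value_Suc[of "k + 2"] by (simp add: add.assoc)
  also have "\<dots> = F3_value k / zeta3 ^ 3" by (simp add: power3_eq_cube field_simps)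
  finally show ?thesis by simp
qed

lemma F3_value_eq:
  "F3_value k = (if k mod 3 = 0 then 1 else if k mod 3 = 1 then inverse zeta3 else zeta3)"
proof -
  have "- k = 3 * (- (k div 3)) + (- (k mod 3))" by (simp add: minus_mod_eq_mult_div[symmetric])
  then have "F3_value k = zeta3 powi (- (k mod 3))"
    unfolding F3_value_def using power_int_add[of zeta3 "3 * (- (k div 3))" "- (k mod 3)"]
    by (simp add: zeta3_powi_mult_3 del: mult_minus_right)
  moreover have "k mod 3 = 0 \<or> k mod 3 = 1 \<or> k mod 3 = 2" by presburger
  moreover have "zeta3 powi (- 2) = zeta3"
    using zeta3_square by (simp add: power_int_minus power2_eq_square)
  ultimately show ?thesis by (auto simp: power_int_minus)
qed

lemma V10_isCont: "x \<noteq> 0 \<Longrightarrow> isCont (V10 a b \<theta>0 \<theta>) x"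
  unfolding V10_def[abs_def] by (intro continuous_intros) auto

lemma V10_leading_term: "(\<lambda>x. V10 a b \<theta>0 \<theta> x - x ^ 10) \<in> O[at_infinity](\<lambda>x. x ^ 9)"
proof (rule bigoI)
  define c7 c4 c1 c0 where "c7 = 2 * of_real (sqrt 3) * a" and "c4 = 3 * (a\<^sup>2 + 2 * (1 - \<theta>))"
    and "c1 = 3 * of_real (sqrt 3) * (b + (2 * \<theta> - 1 / 2) * a)" and "c0 = 2 + 9 * (\<theta>0\<^sup>2 - 1 / 4)"
  have "norm (V10 a b \<theta>0 \<theta> x - x ^ 10) \<le> (norm c7 + norm c4 + norm c1 + norm c0) * norm (x ^ 9)"
    if x: "norm x \<ge> 1" for x
  proof -
    have p: "norm x ^ i \<le> norm x ^ 9" if "i \<le> 9" for i using that x by (intro power_increasing)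
    have "V10 a b \<theta>0 \<theta> x - x ^ 10 = c7 * x ^ 7 + c4 * x ^ 4 - c1 * x ^ 1 + c0 / x\<^sup>2"
      by (simp add: V10_def c7_def c4_def c1_def c0_def)
    also have "norm \<dots> \<le> norm (c7 * x ^ 7) + norm (c4 * x ^ 4) + norm (c1 * x ^ 1) + norm (c0 / x\<^sup>2)"
      by (intro norm_triangle_le norm_triangle_le_diff add_mono order_refl)
    also have "\<dots> \<le> norm c7 * norm x ^ 9 + norm c4 * norm x ^ 9 + norm c1 * norm x ^ 9 + norm c0 * norm x ^ 9"
      unfolding norm_mult norm_power
    proof (intro add_mono mult_left_mono p)
      have "norm (c0 / x\<^sup>2) \<le> norm c0 / 1"
        unfolding norm_divide norm_power using x by (intro divide_left_mono) (auto simp: one_le_power)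
      also have "\<dots> \<le> norm c0 * norm x ^ 9" using x by (simp add: mult_le_cancel_left1 one_le_power)
      finally show "norm (c0 / x\<^sup>2) \<le> norm c0 * norm x ^ 9" .
    qed auto
    finally show ?thesis by (simp add: norm_power algebra_simps)
  qed
  then show "eventually (\<lambda>x. norm (V10 a b \<theta>0 \<theta> x - x ^ 10) \<le> (norm c7 + norm c4 + norm c1 + norm c0) * norm (x ^ 9)) at_infinity"
    by (auto simp: eventually_at_infinity)
qed

text \<open>
  The period of the subdominant solutions does not see the normalisation constants.
\<close>

lemma okamoto_condition_period:
  assumes basis: "solution_basis a b \<theta>0 \<theta> \<phi>1 \<phi>2"
    and c: "codd \<noteq> 0" "ceven \<noteq> 0" and s: "stokes_multipliers a b \<theta>0 \<theta> codd ceven s"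
    and cond: "\<And>k. 1 + s k * s (k + 1) = 0"
  shows "\<exists>d. \<forall>t. solution_basis.subdominant a b \<theta>0 \<theta> (k + 3) t = d * solution_basis.subdominant a b \<theta>0 \<theta> k t"
proof -
  interpret solution_basis a b \<theta>0 \<theta> \<phi>1 \<phi>2 by (rule basis)
  obtain \<psi> where \<psi>: "\<And>k. normalised_subdominant a b \<theta>0 \<theta> codd ceven k (\<psi> k)"
    "\<And>k t. \<psi> (k + 1) t = \<psi> (k - 1) t + s k * \<psi> k t"
    using s unfolding stokes_multipliers_def by blast
  define d where "d k = (if odd k then codd else ceven)" for k :: int
  have d: "d k \<noteq> 0" for k using c by (simp add: d_def)
  have \<psi>d: "\<psi> k t = d k * subdominant k t" for k t
    using normalised_subdominant_eq[OF c \<psi>(1)] by (simp add: d_def)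
  have "\<psi> (k + 3) t = (1 + s (k + 1) * s (k + 2)) * \<psi> (k + 1) t + s (k + 2) * \<psi> k t" for t
    using \<psi>(2)[of "k + 2" t] \<psi>(2)[of "k + 1" t] by (simp add: algebra_simps)
  moreover have "1 + s (k + 1) * s (k + 2) = 0" using cond[of "k + 1"] by (simp add: add.assoc)
  ultimately have "d (k + 3) * subdominant (k + 3) t = s (k + 2) * (d k * subdominant k t)" for t
    by (simp add: \<psi>d)
  then have "subdominant (k + 3) t = (s (k + 2) * d k / d (k + 3)) * subdominant k t" for t
    using d[of "k + 3"] by (simp add: field_simps)
  then show ?thesis by blast
qed

lemma exp_int_third_turn: "exp (of_int (3 * n) * third_turn) = 1"
proof -
  have "of_int (3 * n) * third_turn = 0 + \<i> * (of_int n * (of_real pi * 2))" by (simp add: third_turn_def)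
  then show ?thesis by (simp only: exp_plus_2pin exp_zero)
qed

text \<open>
  The quotient of the two Frobenius solutions at the origin has the required symmetry and local
  behaviour at the origin. The condition on the Stokes multipliers makes its asymptotic values a geometric
  progression with ratio \<open>1 / zeta3\<close>: the rotation by four sectors multiplies \<open>f\<close> by \<open>1 / zeta3\<close>, and the values
  have period three in \<open>k\<close>. A constant factor then makes \<open>w 0 = 1\<close>.
\<close>

theorem okamoto_oscillator_ratio_in_F3:
  assumes osc: "okamoto_oscillator m n a b"
  shows "\<exists>f\<in>family_F3 n. solution_ratio (okamoto_potential m n a b) f"
proof -
  define \<theta>0 \<theta> where "\<theta>0 = okamoto_theta0 n" and "\<theta> = okamoto_theta_inf m n"
  define p1 p2 :: complex where "p1 = of_int (3 * n) / 2" and "p2 = 1 - of_int (3 * n) / 2"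
  obtain hp hm where hol: "hp holomorphic_on UNIV" "hm holomorphic_on UNIV" and h0: "hp 0 = 1" "hm 0 = 1"
    and sol0: "oscillator_solution (V10 a b \<theta>0 \<theta>) (\<lambda>t. exp (p1 * t) * hp (exp t ^ 3))"
    "oscillator_solution (V10 a b \<theta>0 \<theta>) (\<lambda>t. exp (p2 * t) * hm (exp t ^ 3))"
    and wr0: "wronskian (\<lambda>t. exp (p1 * t) * hp (exp t ^ 3)) (\<lambda>t. exp (p2 * t) * hm (exp t ^ 3)) 0 \<noteq> 0"
    unfolding \<theta>0_def p1_def p2_def by (rule okamoto_frobenius_basis[where n = n and a = a and b = b and \<theta> = \<theta>]) blast
  define \<phi>p \<phi>m where "\<phi>p = (\<lambda>t. exp (p1 * t) * hp (exp t ^ 3))" and "\<phi>m = (\<lambda>t. exp (p2 * t) * hm (exp t ^ 3))"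
  note sol0 = sol0[folded \<phi>p_def \<phi>m_def] and wr0 = wr0[folded \<phi>p_def \<phi>m_def]
  have basis: "solution_basis a b \<theta>0 \<theta> \<phi>p \<phi>m" by unfold_locales (use sol0 wr0 in auto)
  interpret solution_basis a b \<theta>0 \<theta> \<phi>p \<phi>m by (rule basis)
  have per: "\<exists>d. \<forall>t. subdominant (k + 3) t = d * subdominant k t" for k
    using osc okamoto_condition_period[OF basis] unfolding okamoto_oscillator_def \<theta>0_def[symmetric] \<theta>_def[symmetric]
    by blast
  define \<mu>p \<mu>m where "\<mu>p = exp (p1 * third_turn)" and "\<mu>m = exp (p2 * third_turn)"
  have rot3: "exp (t + third_turn) ^ 3 = exp t ^ 3" for t
    by (simp add: exp_add exp_third_turn power_mult_distrib)
  have eigp: "\<phi>p (t + third_turn) = \<mu>p * \<phi>p t" and eigm: "\<phi>m (t + third_turn) = \<mu>m * \<phi>m t" for t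
    unfolding \<phi>p_def \<phi>m_def \<mu>p_def \<mu>m_def rot3 by (simp_all add: exp_add[symmetric] algebra_simps)
  have \<mu>: "\<mu>m = zeta3 * \<mu>p"
  proof -
    have "p2 * third_turn + of_int (3 * n) * third_turn = third_turn + p1 * third_turn"
      by (simp add: p1_def p2_def algebra_simps)
    then have "\<mu>m * exp (of_int (3 * n) * third_turn) = zeta3 * \<mu>p"
      unfolding \<mu>m_def \<mu>p_def exp_third_turn[symmetric] exp_add[symmetric] by (rule arg_cong)
    then show ?thesis by (simp only: exp_int_third_turn mult_1_right)
  qed
  have \<mu>0: "\<mu>p \<noteq> 0" by (simp add: \<mu>p_def)
  have wr0': "wronskian \<phi>m \<phi>p 0 \<noteq> 0" using wr0 wronskian_swap[of \<phi>m \<phi>p 0] by simp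
  have wp: "wronskian \<phi>p (subdominant k) 0 \<noteq> 0" and wm: "wronskian \<phi>m (subdominant k) 0 \<noteq> 0" for k
    by (rule rotation_eigenvector_not_subdominant[OF per sol0(1) eigp wr0 sol0(2)])
      (rule rotation_eigenvector_not_subdominant[OF per sol0(2) eigm wr0' sol0(1)])
  define c where "c = wronskian \<phi>m (subdominant 0) 0 / wronskian \<phi>p (subdominant 0) 0"
  have c: "c \<noteq> 0" using wp wm by (simp add: c_def)
  define y1 where "y1 = (\<lambda>t. c * \<phi>p t)"
  have y1: "sol y1" unfolding y1_def by (rule solution_cmult(1)[OF sol0(1)])
  define P where "P k = c * wronskian \<phi>p (subdominant k) 0 - F3_value k * wronskian \<phi>m (subdominant k) 0" for k
  have Pstep: "P (k + 1) = 0 \<longleftrightarrow> P k = 0" for k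
  proof -
    obtain d where d: "d \<noteq> 0" "\<And>\<phi> \<mu>. sol \<phi> \<Longrightarrow> (\<forall>t. \<phi> (t + third_turn) = \<mu> * \<phi> t) \<Longrightarrow>
        wronskian \<phi> (subdominant (k + 1)) 0 = d * \<mu> * wronskian \<phi> (subdominant k) 0"
      using wronskian_rotate_eigen[OF per, of k] by blast
    have "P (k + 1) = d * \<mu>p * P k"
      unfolding P_def F3_value_Suc d(2)[OF sol0(1) allI[OF eigp]] d(2)[OF sol0(2) allI[OF eigm]]
      by (simp add: \<mu> field_simps)
    then show ?thesis using d(1) \<mu>0 by simp
  qed
  have P0: "P k = 0" for k
  proof (induction k rule: int_induct[where k = 0])
    case base
    then show ?case using wp by (simp add: P_def c_def F3_value_def)
  next
    case (step1 i)
    then show ?case using Pstep by blast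
  next
    case (step2 i)
    then show ?case using Pstep[of "i - 1"] by simp
  qed
  \<comment> \<open>one of the two exponents vanishes, according to the sign of \<open>3 n - 1\<close>\<close>
  define N M where "N = nat (3 * n - 1)" and "M = nat (1 - 3 * n)"
  have NM: "int N - int M = 3 * n - 1" by (simp add: N_def M_def)
  define A B where "A = (\<lambda>x. c * x ^ N * hp (x ^ 3))" and "B = (\<lambda>x. x ^ M * hm (x ^ 3))"
  define f where "f = (\<lambda>x. A x / B x)"
  define e where "e = of_nat N - p1"
  have e': "e = of_nat M - p2"
  proof -
    have "(of_int (int N - int M) :: complex) = of_int (3 * n - 1)" using NM by simp
    then show ?thesis by (simp add: e_def p1_def p2_def algebra_simps)
  qed
  have Aexp: "A (exp t) = exp (e * t) * y1 t" and Bexp: "B (exp t) = exp (e * t) * \<phi>m t" for t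
  proof -
    have "exp t ^ N = exp (e * t) * exp (p1 * t)"
      by (simp add: e_def exp_of_nat_mult[symmetric] exp_add[symmetric] algebra_simps)
    then show "A (exp t) = exp (e * t) * y1 t" by (simp add: A_def y1_def \<phi>p_def mult_ac)
    have "exp t ^ M = exp (e * t) * exp (p2 * t)"
      by (simp add: e' exp_of_nat_mult[symmetric] exp_add[symmetric] algebra_simps)
    then show "B (exp t) = exp (e * t) * \<phi>m t" by (simp add: B_def \<phi>m_def mult_ac)
  qed
  have cube_hol: "(\<lambda>x. hp (x ^ 3)) holomorphic_on UNIV" "(\<lambda>x. hm (x ^ 3)) holomorphic_on UNIV"
    using holomorphic_on_compose[of "\<lambda>x. x ^ 3" UNIV hp] holomorphic_on_compose[of "\<lambda>x. x ^ 3" UNIV hm]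
      holomorphic_on_subset[OF hol(1)] holomorphic_on_subset[OF hol(2)]
      holomorphic_on_power[OF holomorphic_on_ident, of 3 UNIV]
    by (auto simp: o_def)
  have AB: "A holomorphic_on UNIV" "B holomorphic_on UNIV"
    unfolding A_def B_def by (intro holomorphic_intros cube_hol)+
  have ywr: "wronskian y1 \<phi>m 0 \<noteq> 0" unfolding y1_def using wr0 c by (simp add: wronskian_cmult[OF sol0(1)])
  have ncz: "A z \<noteq> 0" if "B z = 0" for z
  proof (cases "z = 0")
    case True
    then have "M > 0" using that h0 by (auto simp: B_def)
    then have "N = 0" by (simp add: N_def M_def)
    then show ?thesis using True c h0 by (simp add: A_def)
  next
    case False
    then obtain t where t: "exp t = z" by (metis exp_Ln)
    then have "\<phi>m t = 0" using that Bexp[of t] by simp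
    moreover have "wronskian y1 \<phi>m t \<noteq> 0" using ywr wronskian_const[OF y1 sol0(2), of t] by simp
    ultimately have "y1 t \<noteq> 0" by (auto simp: wronskian_def)
    then show ?thesis using Aexp[of t] t by simp
  qed
  have "\<exists>t. \<phi>m t \<noteq> 0"
  proof (rule ccontr)
    assume "\<not> ?thesis"
    then have "\<phi>m = (\<lambda>t. 0 * \<phi>p t)" by auto
    then have "wronskian \<phi>m \<phi>p 0 = 0" using wronskian_cmult(1)[OF sol0(1), of 0 \<phi>p 0] by simp
    then show False using wr0' by contradiction
  qed
  then obtain \<beta> where \<beta>: "B \<beta> \<noteq> 0" using Bexp by (metis exp_not_eq_zero mult_eq_0_iff)
  note q = entire_quotient[OF AB ncz \<beta>, folded f_def]
  have fexp: "f (exp t) = y1 t / \<phi>m t" for t by (simp add: f_def Aexp Bexp)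
  have fpole: "is_pole f (exp t) \<longleftrightarrow> \<phi>m t = 0" for t using q(2)[of "exp t"] by (simp add: Bexp)
  have w12: "F3_value (k + 12) = F3_value k" for k
    using F3_value_add_3[of k] F3_value_add_3[of "k + 3"] F3_value_add_3[of "k + 6"] F3_value_add_3[of "k + 9"]
    by (simp add: add.assoc)
  interpret solution_quotient a b \<theta>0 \<theta> \<phi>p \<phi>m f y1 \<phi>m F3_value
  proof
    show "wronskian y1 (subdominant k) 0 = F3_value k * wronskian \<phi>m (subdominant k) 0" for k
      unfolding y1_def using P0[of k] by (simp add: wronskian_cmult[OF sol0(1)] P_def)
  qed (use q(1) y1 sol0 ywr fexp fpole F3_value_Suc_neq w12 in auto)
  have schw: "schwarzian f x = - 2 * V10 a b \<theta>0 \<theta> x" if "x \<noteq> 0" for x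
    by (rule schwarzian_solution_ratio[OF y1 sol0(2) fexp fpole ywr q(1) that V10_isCont[OF that]])
  define g where "g = (\<lambda>x. c * hp (x ^ 3) / hm (x ^ 3))"
  define S where "S = (\<lambda>x. hm (x ^ 3)) -` (- {0})"
  have S: "open S" unfolding S_def
    by (intro open_vimage holomorphic_on_imp_continuous_on cube_hol) auto
  have z0: "zorder f 0 = 3 * n - 1"
  proof (rule zorder_eqI[OF S])
    show "0 \<in> S" using h0 by (simp add: S_def)
    show "g holomorphic_on S" unfolding g_def
      by (intro holomorphic_intros holomorphic_on_subset[OF cube_hol(1)] holomorphic_on_subset[OF cube_hol(2)])
        (auto simp: S_def)
    show "g 0 \<noteq> 0" using c h0 by (simp add: g_def)
    fix x assume x: "x \<in> S" "x \<noteq> 0"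
    have "x powi (3 * n - 1) = x ^ N / x ^ M" unfolding NM[symmetric] using x by (simp add: power_int_diff)
    then show "f x = g x * (x - 0) powi (3 * n - 1)" by (simp add: f_def A_def B_def g_def mult_ac)
  qed
  have B0: "B 0 = 0 \<longleftrightarrow> n \<le> 0" using h0 by (auto simp: B_def M_def power_0_left)
  have f0: "f 0 = 0"
  proof (cases "n \<ge> 1")
    case True
    then have "N > 0" by (simp add: N_def)
    then show ?thesis by (simp add: f_def A_def)
  qed (use B0 in \<open>simp add: f_def\<close>)
  have "f \<in> family_F3 n"
    unfolding family_F3_def mem_Collect_eq
  proof (intro conjI allI impI ballI)
    show "f nicely_meromorphic_on UNIV" by (rule q(1))
    show "finite (transcendental_singularities f)" "card (transcendental_singularities f) = 12"
      by (rule card_transcendental_singularities)+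
    show "local_degree f z = 1" if "z \<noteq> 0" for z
    proof -
      have "exp (Ln z) = z" using that by simp
      then obtain t where t: "exp t = z" by blast
      show ?thesis using local_degree_solution_ratio[OF y1 sol0(2) fexp fpole ywr, of t] t by simp
    qed
    have "V10 a b \<theta>0 \<theta> x - x ^ 10 = - (1 / 2) * schwarzian f x - x ^ 10" if "1 \<le> norm x" for x
      using that by (subst schw) auto
    then have "eventually (\<lambda>x. V10 a b \<theta>0 \<theta> x - x ^ 10 = - (1 / 2) * schwarzian f x - x ^ 10) at_infinity"
      unfolding eventually_at_infinity by blast
    then show "(\<lambda>x. - (1 / 2) * schwarzian f x - x ^ 10) \<in> O[at_infinity](\<lambda>x. x ^ 9)"
      by (rule landau_o.big.in_cong[THEN iffD1, OF _ V10_leading_term])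
    show "local_degree f 0 = nat \<bar>3 * n - 1\<bar>"
      using q(2)[of 0] B0 z0 f0 by (auto simp: local_degree_def)
    show "sphere_value f 0 = (if n \<ge> 1 then Some 0 else None)"
      using q(2)[of 0] B0 f0 by (auto simp: sphere_value_def)
    show "asymptotic_value_in_sector f k (if k mod 3 = 0 then 1 else if k mod 3 = 1 then inverse zeta3 else zeta3)"
      if "k \<in> {0..11}" for k
      unfolding F3_value_eq[symmetric] asymptotic_value_in_sector_def
      using quotient_tendsto(1)[of _ k] by (simp add: fexp)
    show "f (zeta3 * x) = inverse zeta3 * f x" for x
    proof -
      have x3: "(zeta3 * x) ^ 3 = x ^ 3" by (simp add: power_mult_distrib)
      have "f (zeta3 * x) = (zeta3 ^ N / zeta3 ^ M) * f x"
        by (simp add: f_def A_def B_def x3 power_mult_distrib mult_ac)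
      also have "zeta3 ^ N / zeta3 ^ M = zeta3 powi (3 * n - 1)"
        unfolding NM[symmetric] by (simp add: power_int_diff)
      also have "\<dots> = inverse zeta3" by (simp add: power_int_diff zeta3_powi_mult_3 inverse_eq_divide)
      finally show ?thesis .
    qed
  qed
  moreover have "solution_ratio (okamoto_potential m n a b) f"
    unfolding solution_ratio_def \<theta>0_def[symmetric] \<theta>_def[symmetric] using y1 sol0(2) fexp by blast
  ultimately show ?thesis by blast
qed

section \<open>The Schwarzian derivative of a member of the family\<close>

text \<open>
  The twelve prescribed values determine the others, because \<open>f (exp t)\<close> has period \<open>2 pi \<i>\<close> and twelve is
  divisible by three.
\<close>

lemma F3_asymptotic_value:
  assumes f: "f \<in> family_F3 n" and \<delta>: "\<delta> \<in> {0<..<pi / 12}"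
  shows "((\<lambda>t. f (exp t)) \<longlongrightarrow> F3_value k) (sector_at_infinity k \<delta>)"
proof -
  define j r where "j = k div 12" and "r = k mod 12"
  have k: "k = r + 12 * j" and r: "r \<in> {0..11}" by (auto simp: j_def r_def)
  have "((\<lambda>t. f (exp t)) \<longlongrightarrow> F3_value r) (sector_at_infinity r \<delta>)"
    using f r \<delta> unfolding family_F3_def asymptotic_value_in_sector_def F3_value_eq[symmetric] by blast
  moreover have "filterlim (\<lambda>t. t + \<i> * (of_int (- j) * (of_real pi * 2))) (sector_at_infinity r \<delta>) (sector_at_infinity k \<delta>)"
    unfolding filterlim_iff
  proof (intro allI impI)
    fix P assume "eventually P (sector_at_infinity r \<delta>)"
    then obtain B where B: "\<And>t. Re t \<ge> B \<Longrightarrow> \<bar>Im t - of_int r * pi / 6\<bar> \<le> \<delta> \<Longrightarrow> P t"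
      by (auto simp: eventually_sector)
    have "P (t + \<i> * (of_int (- j) * (of_real pi * 2)))" if "Re t \<ge> B" "\<bar>Im t - of_int k * pi / 6\<bar> \<le> \<delta>" for t
    proof (rule B)
      have "Im (t + \<i> * (of_int (- j) * (of_real pi * 2))) - of_int r * pi / 6 = Im t - of_int k * pi / 6"
        by (simp add: k field_simps)
      then show "\<bar>Im (t + \<i> * (of_int (- j) * (of_real pi * 2))) - of_int r * pi / 6\<bar> \<le> \<delta>" using that by simp
    qed (use that in simp)
    then show "eventually (\<lambda>t. P (t + \<i> * (of_int (- j) * (of_real pi * 2)))) (sector_at_infinity k \<delta>)"
      by (auto simp: eventually_sector)
  qed
  ultimately have "((\<lambda>t. f (exp (t + \<i> * (of_int (- j) * (of_real pi * 2))))) \<longlongrightarrow> F3_value r) (sector_at_infinity k \<delta>)"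
    by (rule filterlim_compose)
  moreover have "k mod 3 = r mod 3" unfolding k by presburger
  then have "F3_value k = F3_value r" by (simp add: F3_value_eq)
  ultimately show ?thesis by (simp only: exp_plus_2pin)
qed

lemma F3_nonconstant:
  assumes f: "f \<in> family_F3 n"
  shows "\<exists>x. f x \<noteq> c"
proof (rule ccontr)
  assume "\<not> ?thesis"
  then have c: "f x = c" for x by auto
  have \<delta>: "pi / 24 \<in> {0<..<pi / 12}" using pi_gt_zero by simp
  have "F3_value k = c" for k
    using F3_asymptotic_value[OF f \<delta>, of k] sector_at_infinity_nontrivial[of "pi / 24" k] pi_gt_zero
    by (simp add: c tendsto_const_iff)
  then show False using F3_value_Suc_neq[of 0] by simp
qed

lemma F3_order_at_origin:
  assumes f: "f \<in> family_F3 n"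
  shows "zorder f 0 = 3 * n - 1 \<or> zorder f 0 = 1 - 3 * n"
proof (cases "is_pole f 0")
  case True
  then have "nat (- zorder f 0) = nat \<bar>3 * n - 1\<bar>" using f by (simp add: family_F3_def local_degree_def)
  moreover have "\<bar>3 * n - 1\<bar> > 0" by presburger
  ultimately show ?thesis by linarith
next
  case False
  then have "f 0 = 0" using f by (auto simp: family_F3_def sphere_value_def split: if_splits)
  then have "nat (zorder f 0) = nat \<bar>3 * n - 1\<bar>" using f False by (simp add: family_F3_def local_degree_def)
  moreover have "\<bar>3 * n - 1\<bar> > 0" by presburger
  ultimately show ?thesis by linarith
qed

lemma F3_branch_point:
  assumes f: "f \<in> family_F3 n"
  shows "((\<lambda>x. x\<^sup>2 * schwarz_expr f x) \<longlongrightarrow> (1 - (3 * of_int n - 1)\<^sup>2) / 2) (at 0)"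
proof -
  have mero: "f nicely_meromorphic_on UNIV" using f by (simp add: family_F3_def)
  have "\<forall>\<^sub>\<approx>x\<in>UNIV. f x \<noteq> 0"
    using nicely_meromorphic_imp_constant_or_avoid[OF mero open_UNIV connected_UNIV, of 0] F3_nonconstant[OF f, of 0] by auto
  then have "eventually (\<lambda>x. f x \<noteq> 0) (at 0)" by (auto simp: eventually_cosparse_open_eq)
  then have "frequently (\<lambda>x. f x \<noteq> 0) (at 0)" by (intro eventually_frequently) auto
  from zorder_exist[OF nicely_meromorphic_isolated(1,2)[OF mero] this] obtain r where
    r: "r > 0" "zor_poly f 0 holomorphic_on cball 0 r" "zor_poly f 0 0 \<noteq> 0"
      "\<And>x. x \<in> cball 0 r - {0} \<Longrightarrow> f x = zor_poly f 0 x * x powi zorder f 0" by auto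
  have "((\<lambda>x. x\<^sup>2 * schwarz_expr f x) \<longlongrightarrow> (1 - of_int (zorder f 0) ^ 2) / 2) (at 0)"
  proof (rule schwarz_expr_at_branch_point[where g = "zor_poly f 0" and r = r])
    show "zor_poly f 0 holomorphic_on ball 0 r" using r(2) by (rule holomorphic_on_subset) auto
    show "zorder f 0 \<noteq> 0" using F3_order_at_origin[OF f] by presburger
  qed (use r in auto)
  moreover have "(of_int (zorder f 0) :: complex) ^ 2 = (3 * of_int n - 1)\<^sup>2"
    using F3_order_at_origin[OF f] by (auto simp: power2_commute)
  ultimately show ?thesis by simp
qed

text \<open>
  The Schwarzian derivative is invariant under Moebius transformations of the values and transforms like a
  quadratic differential under a change of variable.
\<close>

lemma schwarz_expr_rotate:
  assumes f: "f nicely_meromorphic_on UNIV" and pole: "\<not> is_pole f (zeta3 * x)"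
    and sym: "\<And>x. f (zeta3 * x) = inverse zeta3 * f x"
  shows "zeta3\<^sup>2 * schwarz_expr f (zeta3 * x) = schwarz_expr f x"
proof -
  have an: "f analytic_on {zeta3 * x}" by (rule nicely_meromorphic_on_imp_analytic_at[OF f UNIV_I pole])
  then obtain S where S: "open S" "zeta3 * x \<in> S" "f holomorphic_on S" by (auto simp: analytic_at)
  define T where "T = (\<lambda>x. zeta3 * x) -` S"
  have T: "open T" "x \<in> T" unfolding T_def using S by (auto intro!: open_vimage continuous_intros)
  have d: "((\<lambda>y. c * (deriv ^^ i) f (zeta3 * y)) has_field_derivative c * zeta3 * (deriv ^^ Suc i) f (zeta3 * y)) (at y)"
    if "y \<in> T" for y c i
  proof -
    have "(deriv ^^ i) f holomorphic_on S" by (rule holomorphic_higher_deriv[OF S(3,1)])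
    from holomorphic_derivI[OF this S(1), of "zeta3 * y"] that
    have "((deriv ^^ i) f has_field_derivative (deriv ^^ Suc i) f (zeta3 * y)) (at (zeta3 * y))"
      by (simp add: T_def)
    then have "((\<lambda>y. (deriv ^^ i) f (zeta3 * y)) has_field_derivative (deriv ^^ Suc i) f (zeta3 * y) * zeta3) (at y)"
      by (rule DERIV_chain2) (auto intro!: derivative_eq_intros)
    from DERIV_cmult[OF this, of c] show ?thesis by (simp only: mult_ac)
  qed
  have f': "f = (\<lambda>y. zeta3 * (deriv ^^ 0) f (zeta3 * y))" by (rule ext) (simp add: sym)
  have "schwarz_expr f x = (zeta3 * zeta3 * zeta3 * zeta3 * (deriv ^^ Suc 2) f (zeta3 * x)) / (zeta3 * zeta3 * (deriv ^^ Suc 0) f (zeta3 * x))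
      - 3 / 2 * ((zeta3 * zeta3 * zeta3 * (deriv ^^ Suc 1) f (zeta3 * x)) / (zeta3 * zeta3 * (deriv ^^ Suc 0) f (zeta3 * x)))\<^sup>2"
  proof (rule schwarz_expr_eqI[OF T])
    show "(f has_field_derivative zeta3 * zeta3 * (deriv ^^ Suc 0) f (zeta3 * y)) (at y)" if "y \<in> T" for y
      by (subst f') (rule d[OF that])
    show "((\<lambda>y. zeta3 * zeta3 * (deriv ^^ Suc 0) f (zeta3 * y)) has_field_derivative
        zeta3 * zeta3 * zeta3 * (deriv ^^ Suc 1) f (zeta3 * y)) (at y)" if "y \<in> T" for y
      using d[OF that, of "zeta3 * zeta3" "Suc 0"] by simp
    show "((\<lambda>y. zeta3 * zeta3 * zeta3 * (deriv ^^ Suc 1) f (zeta3 * y)) has_field_derivative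
        zeta3 * zeta3 * zeta3 * zeta3 * (deriv ^^ Suc 2) f (zeta3 * y)) (at y)" if "y \<in> T" for y
      using d[OF that, of "zeta3 * zeta3 * zeta3" "Suc 1"] by (simp add: numeral_2_eq_2)
  qed
  also have "\<dots> = zeta3\<^sup>2 * schwarz_expr f (zeta3 * x)"
  proof -
    have "z * z * z * z * A3 / (z * z * A1) - 3 / 2 * (z * z * z * A2 / (z * z * A1))\<^sup>2
      = z\<^sup>2 * (A3 / A1 - 3 / 2 * (A2 / A1)\<^sup>2)" if "z \<noteq> 0" for z A1 A2 A3 :: complex
      using that by (simp add: power2_eq_square right_diff_distrib mult_ac)
    moreover have "(deriv ^^ Suc 0) f = deriv f" "(deriv ^^ Suc 1) f = (deriv ^^ 2) f" "(deriv ^^ Suc 2) f = (deriv ^^ 3) f"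
      by (simp_all only: Suc_1 eval_nat_numeral funpow.simps o_apply id_apply comp_id)
    ultimately show ?thesis unfolding schwarz_expr_def by (simp only: zeta3_nonzero not_False_eq_True)
  qed
  finally show ?thesis by simp
qed

text \<open>
  By Liouville's theorem the function is a polynomial, and averaging over the rotations by a third of a
  turn removes all powers that are not divisible by three.
\<close>

lemma rotation_invariant_polynomial:
  assumes hol: "\<Phi> holomorphic_on UNIV" and rot: "\<And>x. \<Phi> (zeta3 * x) = \<Phi> x"
    and growth: "\<And>x. R \<le> norm x \<Longrightarrow> norm (\<Phi> x - x ^ 12) \<le> C * norm x ^ 11"
  shows "\<exists>c9 c6 c3. \<forall>x. \<Phi> x = x ^ 12 + c9 * x ^ 9 + c6 * x ^ 6 + c3 * x ^ 3 + \<Phi> 0"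
proof -
  define g where "g = (\<lambda>x. \<Phi> x - x ^ 12)"
  define c where "c k = (deriv ^^ k) g 0 / fact k" for k
  have gh: "g holomorphic_on UNIV" unfolding g_def by (intro holomorphic_intros hol)
  have g: "g x = (\<Sum>k\<le>11. c k * x ^ k)" for x
    unfolding c_def by (rule Liouville_polynomial[OF gh, of R C]) (simp add: growth g_def)
  have z12: "zeta3 ^ (3 * i) = 1" for i by (simp add: power_mult)
  have "(zeta3 * x) ^ 12 = x ^ 12" for x using z12[of 4] by (simp add: power_mult_distrib)
  then have grot: "g (zeta3 * x) = g x" for x by (simp add: g_def rot)
  have cube: "1 + zeta3 + zeta3 * zeta3 = 0"
  proof -
    have "(zeta3 - 1) * (1 + zeta3 + zeta3 * zeta3) = zeta3 ^ 3 - 1" by (simp add: power3_eq_cube algebra_simps)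
    then show ?thesis using zeta3_not_1 by simp
  qed
  define e where "e k = 1 + zeta3 ^ k + zeta3 ^ k * zeta3 ^ k" for k :: nat
  have e3: "e (3 * i) = 3" for i by (simp add: e_def z12)
  have e1: "e (3 * i + 1) = 0" for i using cube by (simp add: e_def power_add z12)
  have e2: "e (3 * i + 2) = 0" for i
  proof -
    have "zeta3 ^ 2 * zeta3 ^ 2 = zeta3"
    proof -
      have "zeta3 ^ 2 * zeta3 ^ 2 = zeta3 ^ 3 * zeta3" by (simp only: power2_eq_square power3_eq_cube mult_ac)
      then show ?thesis by simp
    qed
    moreover have "zeta3 ^ (3 * i + 2) = zeta3 ^ 2" by (simp only: power_add z12 mult_1_left)
    ultimately have "e (3 * i + 2) = 1 + zeta3 * zeta3 + zeta3" by (simp add: e_def) (simp add: power2_eq_square)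
    then show ?thesis using cube by (simp add: add_ac)
  qed
  have e_2: "e 2 = 0" using e2[of 0] by (simp add: numeral_2_eq_2)
  have "\<Phi> x = x ^ 12 + c 9 * x ^ 9 + c 6 * x ^ 6 + c 3 * x ^ 3 + c 0" for x
  proof -
    have "3 * g x = g x + g (zeta3 * x) + g (zeta3 * (zeta3 * x))" by (simp add: grot)
    also have "\<dots> = (\<Sum>k\<le>11. e k * (c k * x ^ k))"
      by (simp add: g sum.distrib[symmetric] e_def power_mult_distrib algebra_simps)
    also have "\<dots> = 3 * (c 9 * x ^ 9 + c 6 * x ^ 6 + c 3 * x ^ 3 + c 0)"
      using e3[of 0] e3[of 1] e3[of 2] e3[of 3] e1[of 0] e1[of 1] e1[of 2] e1[of 3] e_2 e2[of 1] e2[of 2] e2[of 3]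
      by (simp add: atMost_nat_numeral atMost_Suc algebra_simps)
    finally have "g x = c 9 * x ^ 9 + c 6 * x ^ 6 + c 3 * x ^ 3 + c 0"
      unfolding mult_cancel_left by simp
    then show ?thesis by (simp add: g_def algebra_simps)
  qed
  moreover from this[of 0] have "c 0 = \<Phi> 0" by simp
  ultimately show ?thesis by metis
qed

text \<open>
  The Schwarzian derivative is finite away from the origin, because \<open>f\<close> is locally injective there, and it has
  at most a double pole at the origin, whose coefficient is the one of \<open>V10\<close>. Growth and symmetry then leave three
  free coefficients, which are the parameters \<open>a\<close>, \<open>b\<close> and \<open>\<theta>\<close>.
\<close>

lemma F3_schwarzian:
  assumes f: "f \<in> family_F3 n"
  shows "\<exists>a b \<theta>. \<forall>x. x \<noteq> 0 \<longrightarrow> - (1 / 2) * schwarzian f x = V10 a b (okamoto_theta0 n) \<theta> x"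
proof -
  have mero: "f nicely_meromorphic_on UNIV" and deg: "\<And>z. z \<noteq> 0 \<Longrightarrow> local_degree f z = 1"
    and sym: "\<And>x. f (zeta3 * x) = inverse zeta3 * f x"
    and growth: "(\<lambda>x. - (1 / 2) * schwarzian f x - x ^ 10) \<in> O[at_infinity](\<lambda>x. x ^ 9)"
    using f by (simp_all add: family_F3_def)
  define q where "q = (\<lambda>x. - (1 / 2) * (x\<^sup>2 * schwarz_expr f x))"
  define \<Phi> where "\<Phi> = remove_sings q"
  have fm: "f meromorphic_on {z}" for z by (rule nicely_meromorphic_isolated(3)[OF mero])
  have "q meromorphic_on {z}" for z
    unfolding q_def schwarz_expr_def by (intro meromorphic_intros meromorphic_on_higher_deriv fm)
  then have iso: "isolated_singularity_at q z" for z by (simp add: meromorphic_at_iff)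
  have lim: "q \<midarrow>z\<rightarrow> - (1 / 2) * (z\<^sup>2 * schwarzian f z)" if z: "z \<noteq> 0" for z
  proof -
    obtain l where l: "schwarz_expr f \<midarrow>z\<rightarrow> l" using schwarz_expr_limit[OF mero F3_nonconstant[OF f] deg[OF z]] by blast
    then have "schwarzian f z = l" unfolding schwarzian_conv by (rule remove_sings_eqI)
    then show ?thesis unfolding q_def using l by (intro tendsto_intros) auto
  qed
  have lim0: "q \<midarrow>0\<rightarrow> - (1 / 2) * ((1 - (3 * of_int n - 1)\<^sup>2) / 2)"
    unfolding q_def by (intro tendsto_mult_left F3_branch_point[OF f])
  have \<Phi>: "\<Phi> z = - (1 / 2) * (z\<^sup>2 * schwarzian f z)" if "z \<noteq> 0" for z
    unfolding \<Phi>_def by (rule remove_sings_eqI[OF lim[OF that]])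
  have \<Phi>0: "\<Phi> 0 = - (1 / 2) * ((1 - (3 * of_int n - 1)\<^sup>2) / 2)"
    unfolding \<Phi>_def by (rule remove_sings_eqI[OF lim0])
  have lim\<Phi>: "q \<midarrow>z\<rightarrow> \<Phi> z" for z using lim lim0 \<Phi> \<Phi>0 by (cases "z = 0") auto
  have "\<Phi> analytic_on {z}" for z unfolding \<Phi>_def by (rule remove_sings_analytic_at[OF iso lim\<Phi>])
  then have hol: "\<Phi> holomorphic_on UNIV" using analytic_on_analytic_at analytic_imp_holomorphic by blast
  have rot: "\<Phi> (zeta3 * x) = \<Phi> x" for x
  proof -
    have rotlim: "filterlim (\<lambda>y. zeta3 * y) (at (zeta3 * x)) (at x)"
      by (rule filterlim_atI) (auto intro!: tendsto_intros eventually_at_filter[THEN iffD2])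
    have "eventually (\<lambda>y. \<not> is_pole f y) (at (zeta3 * x))"
      by (rule eventually_not_pole[OF nicely_meromorphic_isolated(1)[OF mero]])
    then have "eventually (\<lambda>y. \<not> is_pole f (zeta3 * y)) (at x)"
      by (rule eventually_compose_filterlim[OF _ rotlim])
    then have "eventually (\<lambda>y. q (zeta3 * y) = q y) (at x)"
    proof eventually_elim
      case (elim y)
      show ?case unfolding q_def schwarz_expr_rotate[OF mero elim sym, symmetric]
        by (simp add: power_mult_distrib mult_ac)
    qed
    from Lim_transform_eventually[OF filterlim_compose[OF lim\<Phi> rotlim] this] lim\<Phi>[of x] show ?thesis
      using tendsto_unique[OF at_neq_bot] by blast
  qed
  obtain C where C: "eventually (\<lambda>x. norm (- (1 / 2) * schwarzian f x - x ^ 10) \<le> C * norm (x ^ 9)) at_infinity"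
    using growth by (rule landau_o.bigE)
  then obtain R where R: "\<And>x. R \<le> norm x \<Longrightarrow> norm (- (1 / 2) * schwarzian f x - x ^ 10) \<le> C * norm (x ^ 9)"
    by (auto simp: eventually_at_infinity)
  have "norm (\<Phi> x - x ^ 12) \<le> C * norm x ^ 11" if x: "max R 1 \<le> norm x" for x
  proof -
    have "x \<noteq> 0" using x by auto
    then have "\<Phi> x - x ^ 12 = x\<^sup>2 * (- (1 / 2) * schwarzian f x - x ^ 10)"
      by (simp add: \<Phi> algebra_simps eval_nat_numeral)
    also have "norm \<dots> \<le> norm (x\<^sup>2) * (C * norm (x ^ 9))"
      unfolding norm_mult[of "x\<^sup>2"] using R[of x] x by (intro mult_left_mono) auto
    finally show ?thesis by (simp add: norm_power norm_mult eval_nat_numeral mult_ac)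
  qed
  from rotation_invariant_polynomial[OF hol rot this] obtain c9 c6 c3 where
    c: "\<And>x. \<Phi> x = x ^ 12 + c9 * x ^ 9 + c6 * x ^ 6 + c3 * x ^ 3 + \<Phi> 0" by blast
  define s :: complex where "s = of_real (sqrt 3)"
  have s: "s \<noteq> 0" by (simp add: s_def)
  define a \<theta> b where "a = c9 / (2 * s)" and "\<theta> = 1 - (c6 / 3 - a\<^sup>2) / 2"
    and "b = - c3 / (3 * s) - (2 * \<theta> - 1 / 2) * a"
  have c9: "2 * s * a = c9" using s by (simp add: a_def)
  have c6: "3 * (a\<^sup>2 + 2 * (1 - \<theta>)) = c6" by (simp add: \<theta>_def diff_divide_distrib)
  have c3: "3 * s * (b + (2 * \<theta> - 1 / 2) * a) = - c3" using s by (simp add: b_def)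
  have c0: "2 + 9 * ((okamoto_theta0 n)\<^sup>2 - 1 / 4) = \<Phi> 0"
    by (simp add: \<Phi>0 okamoto_theta0_def power2_eq_square field_simps)
  have "- (1 / 2) * schwarzian f x = V10 a b (okamoto_theta0 n) \<theta> x" if x: "x \<noteq> 0" for x
  proof -
    have "x\<^sup>2 * (- (1 / 2) * schwarzian f x) = x ^ 12 + c9 * x ^ 9 + c6 * x ^ 6 + c3 * x ^ 3 + \<Phi> 0"
      unfolding c[symmetric] by (simp add: \<Phi>[OF x])
    also have "\<dots> = x\<^sup>2 * V10 a b (okamoto_theta0 n) \<theta> x"
      unfolding V10_def s_def[symmetric] c9 c6 c3 c0 using x by (simp add: field_simps eval_nat_numeral)
    finally show ?thesis unfolding mult_cancel_left using x by simp
  qed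
  then show ?thesis by blast
qed

section \<open>From the family of functions to oscillators\<close>

text \<open>
  A locally injective function with Schwarzian derivative \<open>- 2 V\<close> is the quotient of \<open>f \<eta>\<close> and \<open>\<eta>\<close>, where
  \<open>\<eta> = f' powr (- 1/2)\<close>, and both solve the equation with potential \<open>V\<close>.
\<close>

lemma schwarzian_local_solutions:
  assumes hol: "f holomorphic_on ball x0 r" and r: "r > 0"
    and f': "\<And>x. x \<in> ball x0 r \<Longrightarrow> deriv f x \<noteq> 0"
    and schw: "\<And>x. x \<in> ball x0 r \<Longrightarrow> schwarz_expr f x = - 2 * V x"
  obtains \<eta> \<eta>' where "\<And>x. x \<in> ball x0 r \<Longrightarrow> \<eta> x \<noteq> 0"
    "\<And>x. x \<in> ball x0 r \<Longrightarrow> (\<eta> has_field_derivative \<eta>' x) (at x)"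
    "\<And>x. x \<in> ball x0 r \<Longrightarrow> (\<eta>' has_field_derivative V x * \<eta> x) (at x)"
    "\<And>x. x \<in> ball x0 r \<Longrightarrow> ((\<lambda>x. f x * \<eta> x) has_field_derivative deriv f x * \<eta> x + f x * \<eta>' x) (at x)"
    "\<And>x. x \<in> ball x0 r \<Longrightarrow> ((\<lambda>x. deriv f x * \<eta> x + f x * \<eta>' x) has_field_derivative V x * (f x * \<eta> x)) (at x)"
proof -
  let ?B = "ball x0 r"
  define f1 f2 f3 where "f1 = deriv f" and "f2 = deriv f1" and "f3 = deriv f2"
  have h: "f1 holomorphic_on ?B" "f2 holomorphic_on ?B"
    unfolding f1_def f2_def by (intro holomorphic_deriv hol open_ball)+
  have d: "(f has_field_derivative f1 x) (at x)" "(f1 has_field_derivative f2 x) (at x)"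
    "(f2 has_field_derivative f3 x) (at x)" if "x \<in> ?B" for x
    using holomorphic_derivI[OF hol open_ball that] holomorphic_derivI[OF h(1) open_ball that]
      holomorphic_derivI[OF h(2) open_ball that] by (simp_all add: f1_def f2_def f3_def)
  have f1: "f1 x \<noteq> 0" if "x \<in> ?B" for x using f'[OF that] by (simp add: f1_def)
  have S: "f3 x / f1 x - 3 / 2 * (f2 x / f1 x)\<^sup>2 = - 2 * V x" if "x \<in> ?B" for x
    using schw[OF that] by (simp add: schwarz_expr_def f1_def f2_def f3_def numeral_2_eq_2 numeral_3_eq_3)
  have "(\<lambda>x. f2 x / f1 x) holomorphic_on ?B" by (intro holomorphic_intros h f1)
  then obtain M where "\<And>x. x \<in> ?B \<Longrightarrow> (M has_field_derivative f2 x / f1 x) (at x within ?B)"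
    using holomorphic_convex_primitive'[OF convex_ball open_ball] by blast
  then have M: "(M has_field_derivative f2 x / f1 x) (at x)" if "x \<in> ?B" for x
    using that at_within_open[OF that open_ball] by force
  define \<eta> where "\<eta> = (\<lambda>x. exp (- M x / 2))"
  define \<eta>' where "\<eta>' = (\<lambda>x. - (f2 x / f1 x / 2) * \<eta> x)"
  have d1: "(\<eta> has_field_derivative \<eta>' x) (at x)" if "x \<in> ?B" for x
    unfolding \<eta>_def \<eta>'_def by (auto intro!: derivative_eq_intros M[OF that] simp: mult_ac)
  have d2: "(\<eta>' has_field_derivative V x * \<eta> x) (at x)" if x: "x \<in> ?B" for x
  proof -
    have "(\<eta>' has_field_derivative - ((f3 x * f1 x - f2 x * f2 x) / (f1 x * f1 x) / 2) * \<eta> x - f2 x / f1 x / 2 * \<eta>' x) (at x)"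
    proof -
      have "((\<lambda>x. f2 x / f1 x) has_field_derivative (f3 x * f1 x - f2 x * f2 x) / (f1 x * f1 x)) (at x)"
        by (rule DERIV_divide[OF d(3)[OF x] d(2)[OF x] f1[OF x]])
      from DERIV_mult[OF DERIV_minus[OF DERIV_cdivide[OF this, of 2]] d1[OF x]]
      show ?thesis unfolding \<eta>'_def by (simp add: algebra_simps)
    qed
    moreover have "- ((f3 x * f1 x - f2 x * f2 x) / (f1 x * f1 x) / 2) * \<eta> x - f2 x / f1 x / 2 * \<eta>' x
        = - (1 / 2) * (f3 x / f1 x - 3 / 2 * (f2 x / f1 x)\<^sup>2) * \<eta> x"
      using f1[OF x] by (simp add: \<eta>'_def power2_eq_square divide_simps) (simp add: algebra_simps)
    ultimately show ?thesis unfolding S[OF x] by simp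
  qed
  have e1: "((\<lambda>x. f x * \<eta> x) has_field_derivative deriv f x * \<eta> x + f x * \<eta>' x) (at x)" if x: "x \<in> ?B" for x
    unfolding f1_def[symmetric] by (rule derivative_eq_intros d1[OF x] d[OF x] refl)+ simp
  have e2: "((\<lambda>x. deriv f x * \<eta> x + f x * \<eta>' x) has_field_derivative V x * (f x * \<eta> x)) (at x)" if x: "x \<in> ?B" for x
  proof -
    have "((\<lambda>x. f1 x * \<eta> x + f x * \<eta>' x) has_field_derivative
        (f2 x * \<eta> x + f1 x * \<eta>' x) + (f1 x * \<eta>' x + f x * (V x * \<eta> x))) (at x)"
      by (rule derivative_eq_intros d1[OF x] d2[OF x] d[OF x] refl)+ simp
    moreover have "f2 x * \<eta> x + f1 x * \<eta>' x + f1 x * \<eta>' x = 0" using f1[OF x] by (simp add: \<eta>'_def)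
    then have "(f2 x * \<eta> x + f1 x * \<eta>' x) + (f1 x * \<eta>' x + f x * (V x * \<eta> x)) = V x * (f x * \<eta> x)"
      by (simp add: algebra_simps add_eq_0_iff)
    ultimately show ?thesis by (simp only: f1_def)
  qed
  show ?thesis by (rule that[of \<eta> \<eta>']) (use d1 d2 e1 e2 in \<open>auto simp: \<eta>_def\<close>)
qed

text \<open>The Wronskians with a basis of global solutions are constant, so a local solution is a global one.\<close>

lemma local_solution_extends:
  fixes r :: real
  assumes sol: "oscillator_solution V \<phi>1" "oscillator_solution V \<phi>2" and w: "wronskian \<phi>1 \<phi>2 0 \<noteq> 0"
    and r: "0 < r" "r \<le> norm (exp t0)"
    and L: "\<And>x. x \<in> ball (exp t0) r \<Longrightarrow> exp (L x) = x"
      "\<And>x. x \<in> ball (exp t0) r \<Longrightarrow> (L has_field_derivative inverse x) (at x)"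
    and d: "\<And>x. x \<in> ball (exp t0) r \<Longrightarrow> (u has_field_derivative u' x) (at x)"
      "\<And>x. x \<in> ball (exp t0) r \<Longrightarrow> (u' has_field_derivative V x * u x) (at x)"
  obtains y where "oscillator_solution V y" "\<And>x. x \<in> ball (exp t0) r \<Longrightarrow> y (L x) = u x"
proof -
  let ?B = "ball (exp t0) r"
  have const: "\<exists>c. \<forall>x\<in>?B. u x * cover_deriv \<phi> (L x) - u' x * \<phi> (L x) = c" if \<phi>: "oscillator_solution V \<phi>" for \<phi>
  proof (rule has_field_derivative_zero_constant[OF convex_ball])
    fix x assume x: "x \<in> ?B"
    show "((\<lambda>x. u x * cover_deriv \<phi> (L x) - u' x * \<phi> (L x)) has_field_derivative 0) (at x within ?B)"
      by (rule has_field_derivative_at_within)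
        (rule derivative_eq_intros d[OF x] branch_solution_DERIV[OF \<phi> L(1)[OF x] L(2)[OF x]] refl
          | simp add: algebra_simps)+
  qed
  obtain c1 c2 where c: "\<And>x. x \<in> ?B \<Longrightarrow> u x * cover_deriv \<phi>1 (L x) - u' x * \<phi>1 (L x) = c1"
    "\<And>x. x \<in> ?B \<Longrightarrow> u x * cover_deriv \<phi>2 (L x) - u' x * \<phi>2 (L x) = c2"
    using const[OF sol(1)] const[OF sol(2)] by blast
  define W where "W = wronskian \<phi>1 \<phi>2 0"
  show ?thesis
  proof (rule that)
    show "oscillator_solution V (\<lambda>t. (c2 / W) * \<phi>1 t + (- c1 / W) * \<phi>2 t)"
      by (rule solution_lincomb(1)[OF sol])
    fix x assume x: "x \<in> ?B"
    have "u x * wronskian \<phi>1 \<phi>2 (L x) = c2 * \<phi>1 (L x) - c1 * \<phi>2 (L x)"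
      unfolding c[OF x, symmetric] wronskian_def by (simp add: algebra_simps)
    then have "u x * W = c2 * \<phi>1 (L x) - c1 * \<phi>2 (L x)"
      unfolding W_def wronskian_const[OF sol, of "L x"] .
    then show "(c2 / W) * \<phi>1 (L x) + (- c1 / W) * \<phi>2 (L x) = u x"
      using w by (simp add: W_def field_simps)
  qed
qed

text \<open>
  The quotient representation extends from a neighbourhood of one point to all of the cover by the
  identity theorem for meromorphic functions.
\<close>

lemma F3_quotient_representation:
  assumes f: "f \<in> family_F3 n"
    and schw: "\<And>x. x \<noteq> 0 \<Longrightarrow> schwarzian f x = - 2 * V x"
    and sol: "oscillator_solution V \<phi>1" "oscillator_solution V \<phi>2" and w: "wronskian \<phi>1 \<phi>2 0 \<noteq> 0"
  obtains y1 y2 where "oscillator_solution V y1" "oscillator_solution V y2" "wronskian y1 y2 0 \<noteq> 0"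
    "\<And>t. \<not> is_pole f (exp t) \<Longrightarrow> y2 t \<noteq> 0 \<and> f (exp t) = y1 t / y2 t"
proof -
  have mero: "f nicely_meromorphic_on UNIV" and deg: "\<And>z. z \<noteq> 0 \<Longrightarrow> local_degree f z = 1"
    using f by (simp_all add: family_F3_def)
  have an: "f analytic_on {z}" if "\<not> is_pole f z" for z
    by (rule nicely_meromorphic_on_imp_analytic_at[OF mero UNIV_I that])
  have "eventually (\<lambda>x. \<not> is_pole f x) (at 1)"
    by (rule eventually_not_pole[OF nicely_meromorphic_isolated(1)[OF mero]])
  moreover have "eventually (\<lambda>x::complex. x \<noteq> 0) (at 1)" by (rule tendsto_imp_eventually_ne[OF tendsto_ident_at]) simp
  ultimately have "eventually (\<lambda>x. \<not> is_pole f x \<and> x \<noteq> 0) (at 1)" by eventually_elim simp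
  then obtain x0 where x0: "\<not> is_pole f x0" "x0 \<noteq> 0"
    using eventually_happens'[OF at_neq_bot] by blast
  define t0 where "t0 = Ln x0"
  have t0: "exp t0 = x0" using x0 by (simp add: t0_def)
  obtain r1 where r1: "r1 > 0" "f holomorphic_on ball x0 r1"
    using an[OF x0(1)] by (auto simp: analytic_on_def)
  define r where "r = min r1 (norm x0)"
  have r: "0 < r" "r \<le> norm (exp t0)" using r1 x0 by (auto simp: r_def t0)
  have hol: "f holomorphic_on ball x0 r" using r1(2) by (rule holomorphic_on_subset) (auto simp: r_def)
  have B: "f analytic_on {x}" "\<not> is_pole f x" "x \<noteq> 0" if "x \<in> ball x0 r" for x
  proof -
    show *: "f analytic_on {x}" using hol that by (auto simp: analytic_at)
    then show "\<not> is_pole f x" by (rule analytic_at_imp_no_pole)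
    show "x \<noteq> 0" using that by (auto simp: r_def)
  qed
  have d: "deriv f x \<noteq> 0" if "x \<in> ball x0 r" for x
    by (rule deriv_nonzero_of_local_degree_1[OF mero F3_nonconstant[OF f] deg]) (use B[OF that] in auto)
  have s: "schwarz_expr f x = - 2 * V x" if x: "x \<in> ball x0 r" for x
  proof -
    have "schwarzian f x = schwarz_expr f x"
      unfolding schwarzian_conv by (rule remove_sings_eqI[OF analytic_schwarz_expr[OF B(1)[OF x] d[OF x]]])
    then show ?thesis using schw[OF B(3)[OF x]] by simp
  qed
  obtain \<eta> \<eta>' where \<eta>: "\<And>x. x \<in> ball x0 r \<Longrightarrow> \<eta> x \<noteq> 0"
    "\<And>x. x \<in> ball x0 r \<Longrightarrow> (\<eta> has_field_derivative \<eta>' x) (at x)"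
    "\<And>x. x \<in> ball x0 r \<Longrightarrow> (\<eta>' has_field_derivative V x * \<eta> x) (at x)"
    "\<And>x. x \<in> ball x0 r \<Longrightarrow> ((\<lambda>x. f x * \<eta> x) has_field_derivative deriv f x * \<eta> x + f x * \<eta>' x) (at x)"
    "\<And>x. x \<in> ball x0 r \<Longrightarrow> ((\<lambda>x. deriv f x * \<eta> x + f x * \<eta>' x) has_field_derivative V x * (f x * \<eta> x)) (at x)"
    using schwarzian_local_solutions[OF hol r(1) d s] by blast
  obtain L where L: "L (exp t0) = t0"
    "\<And>x. x \<in> ball (exp t0) (norm (exp t0)) \<Longrightarrow> exp (L x) = x"
    "\<And>x. x \<in> ball (exp t0) (norm (exp t0)) \<Longrightarrow> (L has_field_derivative inverse x) (at x)"
    by (rule logarithm_branch[of t0]) blast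
  have L': "exp (L x) = x" "(L has_field_derivative inverse x) (at x)" if "x \<in> ball (exp t0) r" for x
    using L(2,3)[of x] that r(2) by auto
  note \<eta> = \<eta>[folded t0]
  obtain y2 where y2: "oscillator_solution V y2" "\<And>x. x \<in> ball (exp t0) r \<Longrightarrow> y2 (L x) = \<eta> x"
    using local_solution_extends[OF sol w r L' \<eta>(2,3)] by blast
  obtain y1 where y1: "oscillator_solution V y1" "\<And>x. x \<in> ball (exp t0) r \<Longrightarrow> y1 (L x) = f x * \<eta> x"
    using local_solution_extends[OF sol w r L' \<eta>(4,5)] by blast
  have wy: "wronskian y1 y2 0 \<noteq> 0"
  proof
    assume 0: "wronskian y1 y2 0 = 0"
    have x: "exp t0 \<in> ball (exp t0) r" using r by simp
    have eq2: "cover_deriv y2 (L (exp t0)) = \<eta>' (exp t0)"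
      by (rule DERIV_unique[OF has_field_derivative_transform_within_open[OF branch_solution_DERIV(1)[OF y2(1) L'[OF x]] open_ball x y2(2)] \<eta>(2)[OF x]])
    have eq1: "cover_deriv y1 (L (exp t0)) = deriv f (exp t0) * \<eta> (exp t0) + f (exp t0) * \<eta>' (exp t0)"
      by (rule DERIV_unique[OF has_field_derivative_transform_within_open[OF branch_solution_DERIV(1)[OF y1(1) L'[OF x]] open_ball x y1(2)] \<eta>(4)[OF x]])
    have "wronskian y1 y2 (L (exp t0)) = - deriv f (exp t0) * (\<eta> (exp t0))\<^sup>2"
      unfolding wronskian_def eq1 eq2 y1(2)[OF x] y2(2)[OF x] by (simp add: power2_eq_square algebra_simps)
    then show False using 0 wronskian_const[OF y1(1) y2(1), of "L (exp t0)"] d[of x0] \<eta>(1)[OF x] r(1) by (simp add: t0)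
  qed
  define F where "F = (\<lambda>t. f (exp t) * y2 t - y1 t)"
  have Fm: "F meromorphic_on UNIV"
  proof -
    have fm: "f meromorphic_on UNIV" using mero by (simp add: nicely_meromorphic_on_def)
    have "(\<lambda>t. f (exp t)) meromorphic_on UNIV"
      by (rule meromorphic_on_compose[OF fm]) (auto intro!: analytic_intros)
    moreover have "y1 analytic_on UNIV" "y2 analytic_on UNIV"
      using solution_holomorphic y1(1) y2(1) by (auto simp: analytic_on_open)
    ultimately show ?thesis unfolding F_def by (intro meromorphic_intros) (auto intro: analytic_on_imp_meromorphic_on)
  qed
  have F_near: "eventually (\<lambda>t. F t = 0) (at t0)"
  proof -
    have ec: "eventually (\<lambda>t. exp t \<in> ball (exp t0) r) (at t0)"
    proof -
      have "isCont exp t0" by (rule isCont_exp') simp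
      then have "(exp \<longlongrightarrow> exp t0) (at t0)" by (simp add: isCont_def)
      then show ?thesis by (rule topological_tendstoD) (use r in auto)
    qed
    have "(L has_field_derivative inverse (exp t0)) (at (exp t0))" using L'[of "exp t0"] r by simp
    have el: "eventually (\<lambda>t. norm (t - t0) < 1) (at t0)"
      by (auto simp: eventually_at dist_norm intro!: exI[of _ 1])
    have "isCont L (exp t0)" using L'(2)[of "exp t0"] r by (auto intro: DERIV_isCont)
    then have "((\<lambda>t. L (exp t)) \<longlongrightarrow> L (exp t0)) (at t0)"
      by (intro isCont_tendsto_compose[of _ L] tendsto_intros)
    then have "eventually (\<lambda>t. dist (L (exp t)) (L (exp t0)) < 1) (at t0)" by (rule tendstoD) simp
    with ec el show ?thesis
    proof eventually_elim
      case (elim t)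
      \<comment> \<open>two logarithms of the same number at distance less than two coincide\<close>
      have "exp (L (exp t)) = exp t" using L'(1)[OF elim(1)] .
      then obtain k :: int where k: "L (exp t) = t + of_int (2 * k) * pi * \<i>" by (auto simp: exp_eq)
      have "norm (L (exp t) - t) < 2"
        using elim(2,3) norm_triangle_ineq[of "L (exp t) - t0" "t0 - t"] by (simp add: dist_norm L(1) norm_minus_commute)
      moreover have "L (exp t) - t = of_real (of_int (2 * k) * pi) * \<i>" using k by simp
      ultimately have "\<bar>of_int (2 * k) * pi\<bar> < 2" by (simp only: norm_mult norm_of_real norm_ii mult_1_right)
      moreover have "\<bar>of_int (2 * k) * pi\<bar> \<ge> 2" if "k \<noteq> 0"
      proof -
        have "\<bar>of_int k\<bar> \<ge> (1::real)" using that by linarith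
        then have "1 * 1 \<le> \<bar>of_int k\<bar> * pi" using pi_gt3 by (intro mult_mono) auto
        moreover have "\<bar>of_int (2 * k) * pi\<bar> = 2 * (\<bar>of_int k\<bar> * pi)" by (simp add: abs_mult)
        ultimately show ?thesis by linarith
      qed
      ultimately have "k = 0" by force
      then have "L (exp t) = t" using k by simp
      then have "y1 t = f (exp t) * \<eta> (exp t)" "y2 t = \<eta> (exp t)" using y1(2)[OF elim(1)] y2(2)[OF elim(1)] by simp_all
      then show ?case by (simp add: F_def)
    qed
  qed
  have Fz: "eventually (\<lambda>t. F t = 0) (at t)" for t
  proof -
    have "\<not> eventually (\<lambda>t. F t \<noteq> 0) (cosparse UNIV)"
    proof
      assume "eventually (\<lambda>t. F t \<noteq> 0) (cosparse UNIV)"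
      then have "eventually (\<lambda>t. F t \<noteq> 0) (at t0)" by (auto simp: eventually_cosparse_open_eq)
      with F_near have "eventually (\<lambda>t. False) (at t0)" by eventually_elim simp
      then show False by simp
    qed
    then have "eventually (\<lambda>t. F t = 0) (cosparse UNIV)"
      using meromorphic_imp_constant_or_avoid[OF Fm open_UNIV connected_UNIV, of 0] by blast
    then show ?thesis by (auto simp: eventually_cosparse_open_eq)
  qed
  have F0: "f (exp t) * y2 t = y1 t" if t: "\<not> is_pole f (exp t)" for t
  proof -
    have "isCont (\<lambda>t. f (exp t)) t"
      by (rule isCont_o2[where f = exp and g = f, OF isCont_exp analytic_at_imp_isCont[OF an[OF t]]])
    moreover have "isCont y1 t" "isCont y2 t" using solution_DERIV y1(1) y2(1) DERIV_isCont by blast+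
    ultimately have "isCont F t" unfolding F_def by (intro continuous_diff continuous_mult)
    then have "F \<midarrow>t\<rightarrow> F t" by (simp add: isCont_def)
    moreover have "F \<midarrow>t\<rightarrow> 0" by (rule tendsto_eventually[OF Fz])
    ultimately have "F t = 0" using tendsto_unique[OF at_neq_bot] by blast
    then show ?thesis by (simp add: F_def)
  qed
  show ?thesis
  proof (rule that[OF y1(1) y2(1) wy])
    fix t assume t: "\<not> is_pole f (exp t)"
    have "y2 t \<noteq> 0"
    proof
      assume "y2 t = 0"
      then have "wronskian y1 y2 t = 0" using F0[OF t] by (simp add: wronskian_def)
      then show False using wy wronskian_const[OF y1(1) y2(1), of t] by simp
    qed
    then show "y2 t \<noteq> 0 \<and> f (exp t) = y1 t / y2 t" using F0[OF t] by (simp add: field_simps)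
  qed
qed

text \<open>
  The numerator minus the asymptotic value times the denominator is subdominant in the sector. Since
  the asymptotic values have period three, so does the sequence of subdominant solutions up to
  constants, which is the condition on the Stokes multipliers. The exponents at the origin determine the
  monodromy of all solutions, and this fixes \<open>\<theta>\<close> up to an integer.
\<close>

theorem F3_potential_is_okamoto:
  assumes f: "f \<in> family_F3 n"
  shows "\<exists>m a b. okamoto_oscillator m n a b \<and>
    (\<forall>x. x \<noteq> 0 \<longrightarrow> - (1 / 2) * schwarzian f x = okamoto_potential m n a b x)"
proof -
  obtain a b \<theta> where V: "\<And>x. x \<noteq> 0 \<Longrightarrow> - (1 / 2) * schwarzian f x = V10 a b (okamoto_theta0 n) \<theta> x"
    using F3_schwarzian[OF f] by blast
  define \<theta>0 where "\<theta>0 = okamoto_theta0 n"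
  note V = V[folded \<theta>0_def]
  define p1 p2 :: complex where "p1 = of_int (3 * n) / 2" and "p2 = 1 - of_int (3 * n) / 2"
  obtain hp hm where
    sol0: "oscillator_solution (V10 a b \<theta>0 \<theta>) (\<lambda>t. exp (p1 * t) * hp (exp t ^ 3))"
    "oscillator_solution (V10 a b \<theta>0 \<theta>) (\<lambda>t. exp (p2 * t) * hm (exp t ^ 3))"
    and wr0: "wronskian (\<lambda>t. exp (p1 * t) * hp (exp t ^ 3)) (\<lambda>t. exp (p2 * t) * hm (exp t ^ 3)) 0 \<noteq> 0"
    unfolding \<theta>0_def p1_def p2_def by (rule okamoto_frobenius_basis[where n = n and a = a and b = b and \<theta> = \<theta>]) blast
  define \<phi>p \<phi>m where "\<phi>p = (\<lambda>t. exp (p1 * t) * hp (exp t ^ 3))" and "\<phi>m = (\<lambda>t. exp (p2 * t) * hm (exp t ^ 3))"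
  note sol0 = sol0[folded \<phi>p_def \<phi>m_def] and wr0 = wr0[folded \<phi>p_def \<phi>m_def]
  interpret solution_basis a b \<theta>0 \<theta> \<phi>p \<phi>m by unfold_locales (use sol0 wr0 in auto)
  have schw: "schwarzian f x = - 2 * V10 a b \<theta>0 \<theta> x" if "x \<noteq> 0" for x
    unfolding V[OF that, symmetric] by simp
  obtain y1 y2 where y: "sol y1" "sol y2" and wy: "wronskian y1 y2 0 \<noteq> 0"
    and fy: "\<And>t. \<not> is_pole f (exp t) \<Longrightarrow> y2 t \<noteq> 0 \<and> f (exp t) = y1 t / y2 t"
    using F3_quotient_representation[OF f schw sol0 wr0] by metis
  have mero: "f nicely_meromorphic_on UNIV" using f by (simp add: family_F3_def)
  have pole0: "\<not> is_pole f z" if "f z \<noteq> 0" for z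
    using mero that unfolding nicely_meromorphic_on_def is_pole_def
    by (metis UNIV_I at_neq_bot not_tendsto_and_filterlim_at_infinity)
  have lin: "\<exists>c. c \<noteq> 0 \<and> (\<forall>t. y1 t - F3_value k * y2 t = c * subdominant k t)" for k
  proof -
    define \<delta> where "\<delta> = pi / 24"
    have \<delta>: "\<delta> \<in> {0<..<pi / 12}" "0 \<le> \<delta>" "\<delta> < pi / 12" "\<delta> \<le> wide_angle"
      using pi_gt_zero wide_angle_bounds by (auto simp: \<delta>_def)
    let ?F = "sector_at_infinity k \<delta>"
    have nt: "?F \<noteq> bot" by (rule sector_at_infinity_nontrivial[OF \<delta>(2)])
    have fl: "((\<lambda>t. f (exp t)) \<longlongrightarrow> F3_value k) ?F" by (rule F3_asymptotic_value[OF f \<delta>(1)])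
    have "eventually (\<lambda>t. f (exp t) \<noteq> 0) ?F" by (rule tendsto_imp_eventually_ne[OF fl]) simp
    then have "eventually (\<lambda>t. f (exp t) = y1 t / y2 t) ?F" by eventually_elim (use fy pole0 in auto)
    from Lim_transform_eventually[OF fl this] have q: "((\<lambda>t. y1 t / y2 t) \<longlongrightarrow> F3_value k) ?F" .
    have wk: "wronskian y1 (subdominant k) 0 = F3_value k * wronskian y2 (subdominant k) 0"
    proof (cases "wronskian y2 (subdominant k) 0 = 0")
      case False
      from quotient_tendsto_in_sector(1)[OF subdominant_solution y \<delta>(2,3) subdominant_tendsto[OF \<delta>(4)] _ False]
      have "((\<lambda>t. y1 t / y2 t) \<longlongrightarrow> wronskian y1 (subdominant k) 0 / wronskian y2 (subdominant k) 0) ?F" by simp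
      then have "F3_value k = wronskian y1 (subdominant k) 0 / wronskian y2 (subdominant k) 0"
        using q tendsto_unique[OF nt] by blast
      then show ?thesis using False by simp
    next
      case True
      have ne: "wronskian y1 (subdominant k) 0 \<noteq> 0"
      proof
        assume "wronskian y1 (subdominant k) 0 = 0"
        then obtain c d where "\<And>t. y1 t = c * subdominant k t" "\<And>t. y2 t = d * subdominant k t"
          using True proportional_subdominant[OF y(1)] proportional_subdominant[OF y(2)] by blast
        then have e: "y1 = (\<lambda>t. c * subdominant k t)" "y2 = (\<lambda>t. d * subdominant k t)" by auto
        have "wronskian y1 y2 0 = 0" unfolding e by (simp add: wronskian_cmult[OF subdominant_solution])
        then show False using wy by contradiction
      qed
      from quotient_tendsto_in_sector(1)[OF subdominant_solution y(2,1) \<delta>(2,3) subdominant_tendsto[OF \<delta>(4)] _ ne]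
      have "((\<lambda>t. y2 t / y1 t) \<longlongrightarrow> 0) ?F" using True by simp
      moreover have "((\<lambda>t. y2 t / y1 t) \<longlongrightarrow> inverse (F3_value k)) ?F"
        using tendsto_inverse[OF q] by simp
      ultimately have "inverse (F3_value k) = 0" using tendsto_unique[OF nt] by blast
      then show ?thesis by simp
    qed
    have e: "(\<lambda>t. y1 t - F3_value k * y2 t) = (\<lambda>t. 1 * y1 t + (- F3_value k) * y2 t)" by auto
    have "sol (\<lambda>t. y1 t - F3_value k * y2 t)" unfolding e by (rule solution_lincomb(1)[OF y])
    moreover have "wronskian (\<lambda>t. y1 t - F3_value k * y2 t) (subdominant k) 0 = 0"
      unfolding e wronskian_lincomb_left[OF y] by (simp add: wk)
    ultimately obtain c where c: "\<And>t. y1 t - F3_value k * y2 t = c * subdominant k t"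
      using proportional_subdominant by blast
    have "c \<noteq> 0"
    proof
      assume "c = 0"
      then have e: "y1 = (\<lambda>t. F3_value k * y2 t)" using c by auto
      have "wronskian y1 y2 0 = 0" unfolding e by (simp add: wronskian_cmult[OF y(2)])
      then show False using wy by contradiction
    qed
    then show ?thesis using c by blast
  qed
  obtain s where s: "\<And>k t. subdominant (k + 1) t = subdominant (k - 1) t + s k * subdominant k t"
    using stokes_relation by blast
  have cond: "1 + s k * s (k + 1) = 0" for k
  proof -
    have k2: "k - 1 + 3 = k + 2" by simp
    obtain c d where c: "\<And>t. y1 t - F3_value (k - 1) * y2 t = c * subdominant (k - 1) t"
      and d: "d \<noteq> 0" "\<And>t. y1 t - F3_value (k + 2) * y2 t = d * subdominant (k + 2) t"
      using lin[of "k - 1"] lin[of "k + 2"] by blast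
    have "F3_value (k + 2) = F3_value (k - 1)" using F3_value_add_3[of "k - 1"] unfolding k2 .
    then have "d * subdominant (k + 2) t = c * subdominant (k - 1) t" for t using c d(2) by metis
    then have "\<forall>t. subdominant (k + 2) t = (c / d) * subdominant (k - 1) t" using d(1) by (simp add: field_simps)
    then show ?thesis using stokes_condition_iff(1)[of s k, OF s] by blast
  qed
  have full: "exp (t + 2 * of_real pi * \<i>) = exp t" for t :: complex by (simp add: exp_add)
  have n1: "exp (\<i> * (of_int j * of_real pi)) = (if even j then 1 else - 1)" for j :: int
    using exp_i_pi_int[of j] by simp
  have p12: "p1 * (2 * of_real pi * \<i>) = \<i> * (of_int (3 * n) * of_real pi)"
    "p2 * (2 * of_real pi * \<i>) = \<i> * (of_int (2 - 3 * n) * of_real pi)"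
    by (simp_all add: p1_def p2_def algebra_simps)
  have sgn: "exp (p1 * (2 * of_real pi * \<i>)) = (if even n then 1 else - 1)"
    "exp (p2 * (2 * of_real pi * \<i>)) = (if even n then 1 else - 1)"
    unfolding p12 n1 by simp_all
  have mono: "u (t + 2 * of_real pi * \<i>) = (if even n then 1 else - 1) * u t" if u: "sol u" for u t
  proof -
    have "\<phi>p (t + 2 * of_real pi * \<i>) = (if even n then 1 else - 1) * \<phi>p t"
      "\<phi>m (t + 2 * of_real pi * \<i>) = (if even n then 1 else - 1) * \<phi>m t"
      unfolding \<phi>p_def \<phi>m_def full distrib_left exp_add sgn
      by (simp_all add: mult_ac)
    then show ?thesis
      unfolding solution_coordinates[OF sol0 u wr0, of t]
        solution_coordinates[OF sol0 u wr0, of "t + 2 * of_real pi * \<i>"]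
      by (simp add: algebra_simps)
  qed
  obtain m where m: "\<theta> = okamoto_theta_inf m n" using theta_inf_quantised[OF s cond mono] by blast
  have "stokes_multipliers a b \<theta>0 \<theta> 1 1 s"
    unfolding stokes_multipliers_def
    by (rule exI[of _ subdominant]) (use normalised_subdominant_subdominant s in blast)
  then have "okamoto_oscillator m n a b"
    unfolding okamoto_oscillator_def \<theta>0_def[symmetric] m[symmetric] using cond
    by (intro exI[of _ "1::complex"] conjI) auto
  then show ?thesis using V unfolding \<theta>0_def m by blast
qed

theorem theorem3p8:
  shows "(\<forall>m n a b. okamoto_oscillator m n a b \<longrightarrow>
            (\<exists>f \<in> family_F3 n. solution_ratio (okamoto_potential m n a b) f)) \<and>
         (\<forall>n. \<forall>f \<in> family_F3 n. \<exists>m a b. okamoto_oscillator m n a b \<and>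
            (\<forall>x. x \<noteq> 0 \<longrightarrow> - (1 / 2) * schwarzian f x = okamoto_potential m n a b x))"
  using okamoto_oscillator_ratio_in_F3 F3_potential_is_okamoto by blast

end
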